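(* Let $W$ be an $\mathbb{R}^2$-valued process which is either a fractional Brownian motion with Hurst parameter $H\in(0,+\infty)\setminus\mathbb{N}$ or a $\beta$-stable Lévy process with $\beta\in(0,2]$, and let $\alpha\in(\alpha_W,1)$. Let $u$ and $(\kappa_q)_q$ be the velocity field and the noise intensities constructed in the context, with $\delta$ sufficiently small (so that $u\in C^\alpha([0,1]\times\mathbb{T}^2;\mathbb{R}^2)$) and $a_0$ sufficiently small, and let $X^\kappa_t(x)$ be the stochastic flow of $X^\kappa_t=x+\int_0^tu(r,X^\kappa_r)\,\mathrm{d}r+\kappa W_t$. Then, for any continuous $f:\mathbb{T}^2\to\mathbb{R}$ and Lebesgue a.e. $x\in\mathbb{T}^2$, one has $$\lim_{q\to\infty}\mathrm{Var}\big(f(X^{\kappa_q}_1(x))\big)=0.$$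
   Context: $\mathbb{T}^2\cong[0,1]^2/\!\sim$. $\mathrm{Var}(Y)$ denotes the variance of a real random variable $Y\in L^2(\Omega)$. Noise. Fractional Brownian motion: for $H\in(0,1)$ the continuous centered Gaussian process with covariance $\frac12(t^{2H}+s^{2H}-|t-s|^{2H})$; for $H\in(1,\infty)\setminus\mathbb N$, recursively $W^{H+1}_t=\int_0^tW^H_r\,\mathrm dr$; coordinates i.i.d. $\beta$-stable Lévy process: for $\beta\in(0,2)$ the isotropic one with generator $-|\nabla|^\beta=-(-\Delta)^{\beta/2}$, for $\beta=2$ standard Brownian motion. $\alpha_W=\max\{1-\frac1{2H},0\}$ for fBm and $\alpha_W=1-\frac\beta2$ for Lévy. If $u\in C^\alpha([0,1]\times\mathbb{T}^2)$ with $\alpha>\alpha_W$, the SDE is known to admit, for each $\kappa>0$, a unique stochastic flow $X^\kappa_t(x,\omega)$ on the canonical space $(\Omega,\mathcal F,\mathbb P)$. Parameters. Fix $\gamma$ with: $\frac12<\gamma<1$ if $W$ is fBm with $H<\frac12$; $\max\{1-\frac1{4H},\frac12\}<\gamma<1$ if $W$ is fBm with $H\ge\frac12$; $\max\{1-\frac\beta4,\frac12\}<\gamma<1$ if $W$ is $\beta$-stable. Let $\delta\in(0,1/100)$ and $a_0\in(0,1)$, and let $(a_q)_{q\in\mathbb N}$ satisfy $a_q/a_{q+1}\in[a_q^{-\delta},a_q^{-\delta}+4]\cap4\mathbb N$ and $1/a_q\in2\mathbb N$ for all $q\ge0$. Set $\ell_q=a_q^\gamma a_{q+1}^{1-\gamma}$,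 $\kappa_q=a_q^{1/2}a_{q+1}^{1/2}$, $t_0=0$, $t_{q+1}=t_q+\frac{3}{\pi^2(q+1)^2}$ (so $t_q\uparrow\frac12$). $a_0$ is taken small enough that $\sum_{q\ge j}a_q^{\delta(1-\gamma)}<4a_j^{\delta(1-\gamma)}$ for all $j\ge0$ and $10q^4\kappa_q\le\ell_q$ for all $q$. Construction of $u$. Let $\varphi_{q+1}:\mathbb{R}\to\mathbb{R}$ be the continuous, piecewise linear, $2a_q$-periodic function with $\varphi_{q+1}(0)=0$ such that on each interval $(2ia_{q+1},2(i+1)a_{q+1}]\subset(0,a_q]$ ($i\in\mathbb{N}$) its slope is $+1$ on the first half and $-1$ on the second half, and $\varphi_{q+1}(x)=-\varphi_{q+1}(x-a_q)$ for $x\in(a_q,2a_q]$; it is regarded as a $1$-periodic function. Define $v_{q+1,1}(x_1,x_2)=\frac{a_q}{2}(\varphi_{q+1}'(x_2),0)$, $v_{q+1,2}(x_1,x_2)=\frac{a_{q+1}}{2}(0,\varphi_{q+1}'(x_1)+1)$, and the constant field $v_{\mathrm{swap},q}=(a_{q+1},0)$. Split $[t_q,t_{q+1})$ into three consecutive intervals $J_{q,1},J_{q,2},J_{q,3}$ of equal length $\frac{t_{q+1}-t_q}3$ (in increasing order, closed on the left and open on the right). Let $\eta_{q,i}\in C_c^\infty(J_{q,i};[0,\infty))$ with $\int\eta_{q,i}=1$ and $\|\eta_{q,i}\|_{C^k}\le C_k(t_{q+1}-t_q)^{-k-1}$ for all $k\in\mathbb{N}$, with $C_k$ independent of $q$.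 Let $\chi:\mathbb{R}\to[0,1]$ be a standard mollifier and $\chi_\ell(\cdot)=\ell^{-1}\chi(\cdot/\ell)$. For $t\in[t_q,t_{q+1})$ set $u(t,x)=\eta_{q,1}(t)(\chi_{\ell_{q+1}}\star v_{q+1,1})(x_2)$ if $t\in J_{q,1}$, $u(t,x)=\eta_{q,2}(t)(\chi_{\ell_{q+1}}\star v_{q+1,2})(x_1)$ if $t\in J_{q,2}$, and $u(t,x)=0$ if $t\in J_{q,3}$. Set $u(1/2,\cdot)=0$ and, for $t\in(1/2,1]$, $u(t,x)=-u(1-t,x)+\sum_{q\ge0}\eta_{q,3}(1-t)\,v_{\mathrm{swap},q}$. The field $u$ is divergence-free in space and, given $\alpha\in(0,1)$ and $\gamma$, belongs to $C^\alpha([0,1]\times\mathbb T^2;\mathbb R^2)$ for $\delta$ small enough. *)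

theory Defs
  imports "HOL-Probability.Probability"
begin

text \<open>The torus \<open>\<real>\<^sup>2/\<int>\<^sup>2\<close> is represented by its universal cover: functions on the torus are
  \<open>\<int>\<^sup>2\<close>-periodic functions on \<open>real^2\<close>, and torus-valued flows are lifted to the plane.
  All processes are indexed by times in \<open>[0,1]\<close>; values at other times are irrelevant.\<close>

section \<open>Driving noise\<close>

definition centered_gaussian :: "'w measure \<Rightarrow> ('w \<Rightarrow> real) \<Rightarrow> bool" where
  "centered_gaussian M Y \<longleftrightarrow>
     (AE \<omega> in M. Y \<omega> = 0) \<or> (\<exists>\<sigma>>0. distributed M lborel Y (normal_density 0 \<sigma>))"

definition centered_gaussian_process :: "'w measure \<Rightarrow> (real \<Rightarrow> 'w \<Rightarrow> real) \<Rightarrow> bool" where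
  "centered_gaussian_process M B \<longleftrightarrow>
     (\<forall>t\<in>{0..1}. B t \<in> borel_measurable M) \<and>
     (\<forall>S c. finite S \<and> S \<subseteq> {0..1} \<longrightarrow> centered_gaussian M (\<lambda>\<omega>. \<Sum>t\<in>S. c t * B t \<omega>))"

inductive fractional_brownian :: "'w measure \<Rightarrow> real \<Rightarrow> (real \<Rightarrow> 'w \<Rightarrow> real) \<Rightarrow> bool"
  for M :: "'w measure" where
  base: "\<lbrakk> 0 < H; H < 1; centered_gaussian_process M B;
      \<forall>s\<in>{0..1}. \<forall>t\<in>{0..1}.
        (\<integral>\<omega>. B s \<omega> * B t \<omega> \<partial>M) = 1/2 * (t powr (2*H) + s powr (2*H) - \<bar>t - s\<bar> powr (2*H));
      AE \<omega> in M. continuous_on {0..1} (\<lambda>t. B t \<omega>) \<rbrakk>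
    \<Longrightarrow> fractional_brownian M H B"
| step: "\<lbrakk> fractional_brownian M H B; \<forall>t\<in>{0..1}. B' t \<in> borel_measurable M;
      AE \<omega> in M. \<forall>t\<in>{0..1}. B' t \<omega> = integral {0..t} (\<lambda>r. B r \<omega>) \<rbrakk>
    \<Longrightarrow> fractional_brownian M (H + 1) B'"

definition fractional_brownian_plane :: "'w measure \<Rightarrow> real \<Rightarrow> (real \<Rightarrow> 'w \<Rightarrow> real^2) \<Rightarrow> bool" where
  "fractional_brownian_plane M H W \<longleftrightarrow>
     (\<forall>i. fractional_brownian M H (\<lambda>t \<omega>. W t \<omega> $ i)) \<and>
     prob_space.indep_vars M (\<lambda>i. Pi\<^sub>M {0..1} (\<lambda>t. borel))
       (\<lambda>i \<omega>. \<lambda>t\<in>{0..1}. W t \<omega> $ i) (UNIV :: 2 set)"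

definition levy_process :: "'w measure \<Rightarrow> (real \<Rightarrow> 'w \<Rightarrow> real^2) \<Rightarrow> bool" where
  "levy_process M L \<longleftrightarrow>
     (\<forall>t\<in>{0..1}. L t \<in> borel_measurable M) \<and>
     (AE \<omega> in M. L 0 \<omega> = 0) \<and>
     (\<forall>(n::nat) \<tau>. mono_on {..n} \<tau> \<and> \<tau> ` {..n} \<subseteq> {0..1} \<longrightarrow>
        prob_space.indep_vars M (\<lambda>i. borel) (\<lambda>i \<omega>. L (\<tau> (Suc i)) \<omega> - L (\<tau> i) \<omega>) {..<n}) \<and>
     (\<forall>s t. 0 \<le> s \<and> 0 \<le> t \<and> s + t \<le> 1 \<longrightarrow>
        distr M borel (\<lambda>\<omega>. L (s + t) \<omega> - L s \<omega>) = distr M borel (L t)) \<and>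
     (AE \<omega> in M. (\<forall>t\<in>{0..<1}. continuous (at_right t) (\<lambda>s. L s \<omega>)) \<and>
        (\<forall>t\<in>{0<..1}. \<exists>l. ((\<lambda>s. L s \<omega>) \<longlongrightarrow> l) (at_left t)))"

definition fourier_synthesis :: "(real^2 \<Rightarrow> complex) \<Rightarrow> real^2 \<Rightarrow> complex" where
  "fourier_synthesis h x = (\<integral>\<xi>. cis (\<xi> \<bullet> x) * h \<xi> \<partial>lborel)"

text \<open>The operator \<open>|\<nabla>|\<^sup>\<beta>\<close> is the Fourier multiplier with symbol \<open>|\<xi>|\<^sup>\<beta>\<close>: it maps
  \<open>fourier_synthesis h\<close> to \<open>fourier_synthesis (\<lambda>\<xi>. |\<xi>|\<^sup>\<beta> h \<xi>)\<close>. The process has generator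
  \<open>-|\<nabla>|\<^sup>\<beta>\<close> if the uniform derivative at time zero of its transition semigroup
  \<open>g \<mapsto> E g(x + L\<^sub>t)\<close> is \<open>-|\<nabla>|\<^sup>\<beta> g\<close> for all \<open>g\<close> with \<open>h\<close> and \<open>|\<xi>|\<^sup>\<beta> h\<close> integrable
  (in particular for all Schwartz functions).\<close>

definition has_generator_minus_nabla_powr :: "'w measure \<Rightarrow> real \<Rightarrow> (real \<Rightarrow> 'w \<Rightarrow> real^2) \<Rightarrow> bool" where
  "has_generator_minus_nabla_powr M \<beta> L \<longleftrightarrow>
     (\<forall>h. integrable lborel h \<and>
          integrable lborel (\<lambda>\<xi>. complex_of_real (norm \<xi> powr \<beta>) * h \<xi>) \<longrightarrow>
        uniform_limit UNIV
          (\<lambda>t x. ((\<integral>\<omega>. fourier_synthesis h (x + L t \<omega>) \<partial>M) - fourier_synthesis h x) / complex_of_real t)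
          (\<lambda>x. - fourier_synthesis (\<lambda>\<xi>. complex_of_real (norm \<xi> powr \<beta>) * h \<xi>) x)
          (at_right 0))"

definition standard_brownian_plane :: "'w measure \<Rightarrow> (real \<Rightarrow> 'w \<Rightarrow> real^2) \<Rightarrow> bool" where
  "standard_brownian_plane M L \<longleftrightarrow>
     levy_process M L \<and>
     (AE \<omega> in M. continuous_on {0..1} (\<lambda>t. L t \<omega>)) \<and>
     (\<forall>t\<in>{0<..1}.
        prob_space.indep_vars M (\<lambda>i. borel) (\<lambda>i \<omega>. L t \<omega> $ i) (UNIV :: 2 set) \<and>
        (\<forall>i. distributed M lborel (\<lambda>\<omega>. L t \<omega> $ i) (normal_density 0 (sqrt t))))"

definition stable_process :: "'w measure \<Rightarrow> real \<Rightarrow> (real \<Rightarrow> 'w \<Rightarrow> real^2) \<Rightarrow> bool" where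
  "stable_process M \<beta> L \<longleftrightarrow>
     (if \<beta> = 2 then standard_brownian_plane M L
      else levy_process M L \<and> has_generator_minus_nabla_powr M \<beta> L)"

datatype noise = FBM real | Stable real

fun valid_noise :: "noise \<Rightarrow> bool" where
  "valid_noise (FBM H) \<longleftrightarrow> 0 < H \<and> H \<notin> \<nat>"
| "valid_noise (Stable \<beta>) \<longleftrightarrow> 0 < \<beta> \<and> \<beta> \<le> 2"

fun is_noise :: "'w measure \<Rightarrow> noise \<Rightarrow> (real \<Rightarrow> 'w \<Rightarrow> real^2) \<Rightarrow> bool" where
  "is_noise M (FBM H) W \<longleftrightarrow> fractional_brownian_plane M H W"
| "is_noise M (Stable \<beta>) W \<longleftrightarrow> stable_process M \<beta> W"

fun alpha_W :: "noise \<Rightarrow> real" where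
  "alpha_W (FBM H) = max (1 - 1 / (2*H)) 0"
| "alpha_W (Stable \<beta>) = 1 - \<beta>/2"

fun admissible_gamma :: "noise \<Rightarrow> real \<Rightarrow> bool" where
  "admissible_gamma (FBM H) \<gamma> \<longleftrightarrow>
     (if H < 1/2 then 1/2 < \<gamma> \<and> \<gamma> < 1 else max (1 - 1 / (4*H)) (1/2) < \<gamma> \<and> \<gamma> < 1)"
| "admissible_gamma (Stable \<beta>) \<gamma> \<longleftrightarrow> max (1 - \<beta>/4) (1/2) < \<gamma> \<and> \<gamma> < 1"

section \<open>Parameters\<close>

definition ell :: "real \<Rightarrow> (nat \<Rightarrow> real) \<Rightarrow> nat \<Rightarrow> real" where
  "ell \<gamma> a q = a q powr \<gamma> * a (Suc q) powr (1 - \<gamma>)"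

definition kappa :: "(nat \<Rightarrow> real) \<Rightarrow> nat \<Rightarrow> real" where
  "kappa a q = a q powr (1/2) * a (Suc q) powr (1/2)"

definition scale_sequence :: "real \<Rightarrow> real \<Rightarrow> (nat \<Rightarrow> real) \<Rightarrow> bool" where
  "scale_sequence \<delta> \<gamma> a \<longleftrightarrow>
     a 0 < 1 \<and> (\<forall>q. 0 < a q) \<and>
     (\<forall>q. a q / a (Suc q) \<in> {a q powr (-\<delta>) .. a q powr (-\<delta>) + 4}
        \<and> (\<exists>k::nat. a q / a (Suc q) = 4 * real k)) \<and>
     (\<forall>q. \<exists>k::nat. 1 / a q = 2 * real k) \<and>
     summable (\<lambda>q. a q powr (\<delta> * (1 - \<gamma>))) \<and>
     (\<forall>j. (\<Sum>q. a (q + j) powr (\<delta> * (1 - \<gamma>))) < 4 * a j powr (\<delta> * (1 - \<gamma>))) \<and>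
     (\<forall>q. 10 * real q ^ 4 * kappa a q \<le> ell \<gamma> a q)"

primrec tq :: "nat \<Rightarrow> real" where
  "tq 0 = 0"
| "tq (Suc q) = tq q + 3 / (pi^2 * (real q + 1)^2)"

text \<open>The sub-intervals are numbered \<open>i = 1, 2, 3\<close>.\<close>

definition J :: "nat \<Rightarrow> nat \<Rightarrow> real set" where
  "J q i = {tq q + (real i - 1) * (tq (Suc q) - tq q) / 3 ..< tq q + real i * (tq (Suc q) - tq q) / 3}"

section \<open>The velocity field\<close>

definition smooth :: "(real \<Rightarrow> real) \<Rightarrow> bool" where
  "smooth f \<longleftrightarrow> (\<forall>k x. (deriv ^^ k) f field_differentiable at x)"

definition time_cutoffs :: "(nat \<Rightarrow> nat \<Rightarrow> real \<Rightarrow> real) \<Rightarrow> bool" where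
  "time_cutoffs \<eta> \<longleftrightarrow>
     (\<forall>q. \<forall>i\<in>{1,2,3}. smooth (\<eta> q i) \<and> (\<forall>t. 0 \<le> \<eta> q i t) \<and>
        closure {t. \<eta> q i t \<noteq> 0} \<subseteq> J q i \<and> (\<integral>t. \<eta> q i t \<partial>lborel) = 1) \<and>
     (\<exists>C :: nat \<Rightarrow> real. \<forall>q. \<forall>i\<in>{1,2,3}. \<forall>k. \<forall>j\<le>k. \<forall>t.
        \<bar>(deriv ^^ j) (\<eta> q i) t\<bar> \<le> C k / (tq (Suc q) - tq q) ^ (k + 1))"

definition mollifier :: "(real \<Rightarrow> real) \<Rightarrow> bool" where
  "mollifier \<rho> \<longleftrightarrow> smooth \<rho> \<and> range \<rho> \<subseteq> {0..1} \<and> closure {s. \<rho> s \<noteq> 0} \<subseteq> {-1..1} \<and>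
     (\<integral>s. \<rho> s \<partial>lborel) = 1"

text \<open>With \<open>A = a\<^sub>q\<close> and \<open>b = a\<^sub>q\<^sub>+\<^sub>1\<close> this determines \<open>\<phi>\<^sub>q\<^sub>+\<^sub>1\<close> uniquely, since \<open>A / b \<in> 4\<nat>\<close>.
  It is 1-periodic because \<open>1 / A \<in> 2\<nat>\<close>.\<close>

definition zigzag :: "real \<Rightarrow> real \<Rightarrow> (real \<Rightarrow> real) \<Rightarrow> bool" where
  "zigzag A b \<phi> \<longleftrightarrow>
     continuous_on UNIV \<phi> \<and> (\<forall>x. \<phi> (x + 2*A) = \<phi> x) \<and> \<phi> 0 = 0 \<and>
     (\<forall>i::nat. 2 * (real i + 1) * b \<le> A \<longrightarrow>
        (\<forall>x\<in>{2 * real i * b <..< (2 * real i + 1) * b}. (\<phi> has_real_derivative 1) (at x)) \<and>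
        (\<forall>x\<in>{(2 * real i + 1) * b <..< 2 * (real i + 1) * b}. (\<phi> has_real_derivative -1) (at x))) \<and>
     (\<forall>x\<in>{A<..2*A}. \<phi> x = - \<phi> (x - A))"

text \<open>The value of \<open>deriv\<close> at the kinks is unspecified, but only mollifications of these
  fields are used.\<close>

definition v1 :: "(nat \<Rightarrow> real) \<Rightarrow> (nat \<Rightarrow> real \<Rightarrow> real) \<Rightarrow> nat \<Rightarrow> real^2 \<Rightarrow> real^2" where
  "v1 a \<phi> q x = (a q / 2) *\<^sub>R vector [deriv (\<phi> (Suc q)) (x $ 2), 0]"

definition v2 :: "(nat \<Rightarrow> real) \<Rightarrow> (nat \<Rightarrow> real \<Rightarrow> real) \<Rightarrow> nat \<Rightarrow> real^2 \<Rightarrow> real^2" where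
  "v2 a \<phi> q x = (a (Suc q) / 2) *\<^sub>R vector [0, deriv (\<phi> (Suc q)) (x $ 1) + 1]"

definition vswap :: "(nat \<Rightarrow> real) \<Rightarrow> nat \<Rightarrow> real^2" where
  "vswap a q = vector [a (Suc q), 0]"

text \<open>One-dimensional convolution with \<open>\<rho>\<^sub>l(y) = \<rho>(y / l) / l\<close> in the \<open>i\<close>-th variable.\<close>

definition mollify :: "(real \<Rightarrow> real) \<Rightarrow> real \<Rightarrow> 2 \<Rightarrow> (real^2 \<Rightarrow> real^2) \<Rightarrow> real^2 \<Rightarrow> real^2" where
  "mollify \<rho> l i v x = (\<integral>y. (\<rho> (y / l) / l) *\<^sub>R v (x - axis i y) \<partial>lborel)"

definition velocity_first_half ::
  "real \<Rightarrow> (real \<Rightarrow> real) \<Rightarrow> (nat \<Rightarrow> nat \<Rightarrow> real \<Rightarrow> real) \<Rightarrow> (nat \<Rightarrow> real) \<Rightarrow> (nat \<Rightarrow> real \<Rightarrow> real) \<Rightarrow>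
    real \<Rightarrow> real^2 \<Rightarrow> real^2" where
  "velocity_first_half \<gamma> \<rho> \<eta> a \<phi> t x =
     (let q = (THE q. t \<in> {tq q ..< tq (Suc q)}) in
        if t \<in> J q 1 then \<eta> q 1 t *\<^sub>R mollify \<rho> (ell \<gamma> a (Suc q)) 2 (v1 a \<phi> q) x
        else if t \<in> J q 2 then \<eta> q 2 t *\<^sub>R mollify \<rho> (ell \<gamma> a (Suc q)) 1 (v2 a \<phi> q) x
        else 0)"

definition velocity ::
  "real \<Rightarrow> (real \<Rightarrow> real) \<Rightarrow> (nat \<Rightarrow> nat \<Rightarrow> real \<Rightarrow> real) \<Rightarrow> (nat \<Rightarrow> real) \<Rightarrow> (nat \<Rightarrow> real \<Rightarrow> real) \<Rightarrow>
    real \<Rightarrow> real^2 \<Rightarrow> real^2" where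
  "velocity \<gamma> \<rho> \<eta> a \<phi> t x =
     (if t < 1/2 then velocity_first_half \<gamma> \<rho> \<eta> a \<phi> t x
      else if t = 1/2 then 0
      else - velocity_first_half \<gamma> \<rho> \<eta> a \<phi> (1 - t) x + (\<Sum>q. \<eta> q 3 (1 - t) *\<^sub>R vswap a q))"

section \<open>Torus functions and stochastic flows\<close>

definition lattice :: "(real^2) set" where
  "lattice = {k. \<forall>i. k $ i \<in> \<int>}"

definition torus_periodic :: "(real^2 \<Rightarrow> 'b) \<Rightarrow> bool" where
  "torus_periodic g \<longleftrightarrow> (\<forall>x. \<forall>k\<in>lattice. g (x + k) = g x)"

text \<open>For \<open>0 < \<alpha> < 1\<close>; for periodic fields the Euclidean distance gives the same condition as
  the distance of the torus, and boundedness is automatic.\<close>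

definition holder_field :: "real \<Rightarrow> (real \<Rightarrow> real^2 \<Rightarrow> real^2) \<Rightarrow> bool" where
  "holder_field \<alpha> u \<longleftrightarrow>
     (\<forall>t\<in>{0..1}. torus_periodic (u t)) \<and>
     (\<exists>C. \<forall>s\<in>{0..1}. \<forall>t\<in>{0..1}. \<forall>x y. norm (u s x - u t y) \<le> C * dist (s, x) (t, y) powr \<alpha>)"

definition noise_history :: "'w measure \<Rightarrow> (real \<Rightarrow> 'w \<Rightarrow> real^2) \<Rightarrow> real \<Rightarrow> 'w measure" where
  "noise_history M W t =
     sigma (space M) {W s -` A \<inter> space M | s A. s \<in> {0..t} \<and> A \<in> sets borel}"

text \<open>Lift to the plane of the stochastic flow of \<open>X\<^sub>t = x + \<integral>\<^sub>0\<^sup>t u(r, X\<^sub>r) dr + \<kappa> W\<^sub>t\<close>.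
  The flow is adapted to the noise up to null sets.\<close>

definition stochastic_flow ::
  "'w measure \<Rightarrow> (real \<Rightarrow> 'w \<Rightarrow> real^2) \<Rightarrow> (real \<Rightarrow> real^2 \<Rightarrow> real^2) \<Rightarrow> real \<Rightarrow>
    (real \<Rightarrow> real^2 \<Rightarrow> 'w \<Rightarrow> real^2) \<Rightarrow> bool" where
  "stochastic_flow M W u \<kappa> X \<longleftrightarrow>
     (\<forall>t\<in>{0..1}. \<forall>x. X t x \<in> borel_measurable M \<and>
        (\<exists>Y \<in> borel_measurable (noise_history M W t). AE \<omega> in M. X t x \<omega> = Y \<omega>)) \<and>
     (AE \<omega> in M. \<forall>t\<in>{0..1}.
        continuous_on UNIV (\<lambda>x. X t x \<omega>) \<and>
        (\<forall>x. \<forall>k\<in>lattice. X t (x + k) \<omega> = X t x \<omega> + k) \<and>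
        (\<forall>x. set_integrable lborel {0..t} (\<lambda>r. u r (X r x \<omega>)) \<and>
             X t x \<omega> = x + (LINT r:{0..t}|lborel. u r (X r x \<omega>)) + \<kappa> *\<^sub>R W t \<omega>))"

end

theory Submission
  imports Defs
begin

text \<open>For almost every starting point, the orbit under the noiseless shears of the stages \<open>j < q\<close>
  eventually keeps a distance of order \<open>\<ell>\<^sub>j\<^sub>+\<^sub>1\<close> from the discontinuities of these shears
  (Borel-Cantelli). There the mollified shears are locally constant, and
  \<open>\<kappa>\<^sub>q W = o(\<ell>\<^sub>q)\<close>, so the noisy path follows the noiseless one up to stage \<open>q\<close>. At stage \<open>q\<close>
  the noise is larger than the period \<open>2 a\<^sub>q\<^sub>+\<^sub>1\<close> by a power of \<open>a\<^sub>q / a\<^sub>q\<^sub>+\<^sub>1\<close>, and the horizontal shear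
  averages out: the Fourier coefficients of the square wave along the path are integrals
  \<open>\<integral> \<eta>(t) exp(i\<xi>W\<^sub>t) dt\<close>, whose second moments are small because the characteristic function of
  \<open>W\<^sub>t - W\<^sub>s\<close> decays like \<open>exp(- c \<xi>\<^sup>\<theta> |t - s|)\<close>; the condition \<open>\<theta> > 4 (1 - \<gamma>)\<close>, which is the lower bound
  on \<open>\<gamma>\<close>, makes the remainder \<open>o(\<ell>\<^sub>q)\<close>. All other motion until the time-reversed stage \<open>q\<close> is
  \<open>O(a\<^sub>q\<^sub>+\<^sub>1)\<close>. On the way back the swaps have displaced the path by whole grid cells, so it
  again avoids the discontinuities and follows a noiseless return orbit. Hence the endpoint
  is asymptotically deterministic.\<close>

section \<open>Characteristic functions of the noise increments\<close>

text \<open>The obstacle is that the height at which the path enters a shear of stage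
  \<open>q\<close> depends on the noise itself, on the way back through the whole earlier path. The
  average must therefore be small uniformly in the phase. Absolute values of Fourier coefficients
  achieve this: a phase only multiplies a coefficient by a unimodular number, so the single random
  quantity \<open>wave_sum\<close> serves every entry height. The 4 in 4 (1 - \<gamma>) < \<theta>
  is bookkeeping. With r = \<open>a (Suc q) / a q\<close> the frequencies are of order r^(-1/2), so
  second moments are of order r^(\<theta>/2) up to powers of q, amplitudes of order r^(\<theta>/4),
  and the displacement r^(\<theta>/4) \<open>a q\<close> has to be small against
  \<open>ell \<gamma> a q\<close>, which is r^(1 - \<gamma>) \<open>a q\<close>. The gain is
  geometric in \<open>q\<close>, so smallness in mean becomes almost sure smallness and the rest
  concerns a single path. A point may be bad for finitely many stages. Their number depends on the
  point but not on \<open>q\<close> or the noise, so their Lipschitz constants only multiply errors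
  that tend to 0.\<close>

lemma (in prob_space) distributed_normal_iexp:
  assumes Y: "distributed M lborel Y (normal_density 0 \<sigma>)" and \<sigma>: "0 < \<sigma>"
  shows "(\<integral>\<omega>. cis (Y \<omega>) \<partial>M) = of_real (exp (- \<sigma>\<^sup>2 / 2))"
    and "integrable M (\<lambda>\<omega>. (Y \<omega>)\<^sup>2)" and "(\<integral>\<omega>. (Y \<omega>)\<^sup>2 \<partial>M) = \<sigma>\<^sup>2"
proof -
  have Z: "distributed M lborel (\<lambda>\<omega>. Y \<omega> / \<sigma>) std_normal_density"
    using Y normal_standard_normal_convert[OF \<sigma>, of Y 0] by simp
  have "(\<integral>\<omega>. cis (Y \<omega>) \<partial>M) = (\<integral>\<omega>. cis (\<sigma> * (Y \<omega> / \<sigma>)) \<partial>M)"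
    using \<sigma> by simp
  also have "\<dots> = (\<integral>x. cis (\<sigma> * x) \<partial>distr M lborel (\<lambda>\<omega>. Y \<omega> / \<sigma>))"
    by (rule integral_distr[symmetric]) (use distributed_measurable[OF Z] in \<open>auto simp: cis_conv_exp\<close>)
  also have "\<dots> = char std_normal_distribution \<sigma>"
    unfolding char_def distributed_distr_eq_density[OF Z] by (simp add: cis_conv_exp)
  finally show "(\<integral>\<omega>. cis (Y \<omega>) \<partial>M) = of_real (exp (- \<sigma>\<^sup>2 / 2))"
    by (simp add: char_std_normal_distribution)
  have "integrable M (\<lambda>\<omega>. (Y \<omega> - 0)\<^sup>2)"
    by (rule distributed_integrable[OF Y, THEN iffD1])
      (use integrable_normal_moment[OF \<sigma>, of 0 2] in auto)
  then show "integrable M (\<lambda>\<omega>. (Y \<omega>)\<^sup>2)" by simp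
  show "(\<integral>\<omega>. (Y \<omega>)\<^sup>2 \<partial>M) = \<sigma>\<^sup>2"
    using normal_distributed_variance[OF \<sigma> Y] normal_distributed_expectation[OF \<sigma> Y] by simp
qed

text \<open>Writing the exponent with the second moment instead of \<sigma> covers both alternatives
  of \<open>centered_gaussian\<close>: in the degenerate one the second moment is 0 and the
  characteristic function is 1.\<close>

lemma (in prob_space) centered_gaussian_char:
  assumes "centered_gaussian M Y" and [measurable]: "Y \<in> borel_measurable M"
  shows "(\<integral>\<omega>. cis (Y \<omega>) \<partial>M) = of_real (exp (- (\<integral>\<omega>. (Y \<omega>)\<^sup>2 \<partial>M) / 2))"
    and "integrable M (\<lambda>\<omega>. (Y \<omega>)\<^sup>2)"
proof -
  have "(\<integral>\<omega>. cis (Y \<omega>) \<partial>M) = of_real (exp (- (\<integral>\<omega>. (Y \<omega>)\<^sup>2 \<partial>M) / 2)) \<and> integrable M (\<lambda>\<omega>. (Y \<omega>)\<^sup>2)"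
    using assms(1) unfolding centered_gaussian_def
  proof
    assume *: "AE \<omega> in M. Y \<omega> = 0"
    have "(\<integral>\<omega>. cis (Y \<omega>) \<partial>M) = (\<integral>\<omega>. 1 \<partial>M)"
      by (rule integral_cong_AE) (use * in \<open>auto simp: cis_conv_exp\<close>)
    moreover have "(\<integral>\<omega>. (Y \<omega>)\<^sup>2 \<partial>M) = (\<integral>\<omega>. 0 \<partial>M)"
      by (rule integral_cong_AE) (use * in auto)
    moreover have "integrable M (\<lambda>\<omega>. (Y \<omega>)\<^sup>2) \<longleftrightarrow> integrable M (\<lambda>\<omega>. 0::real)"
      by (rule integrable_cong_AE) (use * in auto)
    ultimately show ?thesis by (simp add: prob_space)
  qed (use distributed_normal_iexp in auto)
  then show "(\<integral>\<omega>. cis (Y \<omega>) \<partial>M) = of_real (exp (- (\<integral>\<omega>. (Y \<omega>)\<^sup>2 \<partial>M) / 2))"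
    and "integrable M (\<lambda>\<omega>. (Y \<omega>)\<^sup>2)" by auto
qed

text \<open>One-point sets in \<open>centered_gaussian_process\<close> give square integrability,
  hence integrable products, and the second moment of the Gaussian combination expands into the
  quadratic form of the covariance.\<close>

lemma (in prob_space) fbm_base_quadratic:
  assumes cg: "centered_gaussian_process M B"
    and cov: "\<forall>s\<in>{0..1}. \<forall>t\<in>{0..1}. (\<integral>\<omega>. B s \<omega> * B t \<omega> \<partial>M) = R s t"
    and S: "finite S" "S \<subseteq> {0..1}"
  shows "(\<integral>\<omega>. cis (\<Sum>t\<in>S. c t * B t \<omega>) \<partial>M) = of_real (exp (- (\<Sum>s\<in>S. \<Sum>t\<in>S. c s * c t * R s t) / 2))"
proof -
  have meas: "B t \<in> borel_measurable M" if "t \<in> S" for t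
    using cg that S unfolding centered_gaussian_process_def by auto
  have G: "centered_gaussian M (\<lambda>\<omega>. \<Sum>t\<in>S. c t * B t \<omega>)"
    using cg S unfolding centered_gaussian_process_def by auto
  have sq: "integrable M (\<lambda>\<omega>. (B t \<omega>)\<^sup>2)" if "t \<in> S" for t
  proof -
    have "centered_gaussian M (\<lambda>\<omega>. \<Sum>r\<in>{t}. (\<lambda>_. 1) r * B r \<omega>)"
      by (rule cg[unfolded centered_gaussian_process_def, THEN conjunct2, rule_format]) (use S that in auto)
    then show ?thesis using centered_gaussian_char(2)[of "B t"] meas that by simp
  qed
  have int: "integrable M (\<lambda>\<omega>. B s \<omega> * B t \<omega>)" if "s \<in> S" "t \<in> S" for s t
  proof (rule Bochner_Integration.integrable_bound)
    show "integrable M (\<lambda>\<omega>. (B s \<omega>)\<^sup>2 + (B t \<omega>)\<^sup>2)" using sq that by auto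
    have "\<bar>x * y\<bar> \<le> x\<^sup>2 + y\<^sup>2" for x y :: real
    proof -
      have "2 * (\<bar>x\<bar> * \<bar>y\<bar>) \<le> x\<^sup>2 + y\<^sup>2" using sum_squares_bound[of "\<bar>x\<bar>" "\<bar>y\<bar>"] by simp
      moreover have "0 \<le> \<bar>x\<bar> * \<bar>y\<bar>" by simp
      ultimately show ?thesis unfolding abs_mult by linarith
    qed
    then show "AE \<omega> in M. norm (B s \<omega> * B t \<omega>) \<le> norm ((B s \<omega>)\<^sup>2 + (B t \<omega>)\<^sup>2)" by simp
  qed (use meas that in auto)
  have "(\<integral>\<omega>. (\<Sum>t\<in>S. c t * B t \<omega>)\<^sup>2 \<partial>M) = (\<integral>\<omega>. (\<Sum>s\<in>S. \<Sum>t\<in>S. (c s * c t) * (B s \<omega> * B t \<omega>)) \<partial>M)"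
    by (simp add: power2_eq_square sum_product mult_ac)
  also have "\<dots> = (\<Sum>s\<in>S. \<Sum>t\<in>S. c s * c t * (\<integral>\<omega>. B s \<omega> * B t \<omega> \<partial>M))"
    using int by (simp add: Bochner_Integration.integral_sum)
  also have "\<dots> = (\<Sum>s\<in>S. \<Sum>t\<in>S. c s * c t * R s t)"
    using cov S by (intro sum.cong refl arg_cong2[where f="(*)"]) auto
  finally show ?thesis
    using centered_gaussian_char(1)[OF G] meas by (simp add: borel_measurable_sum)
qed

text \<open>The bound survives integration of the process in time, since integrals are limits of
  Riemann sums with nonnegative weights. No Gaussianity of the integrated process is needed.\<close>

definition char_decay :: "'w measure \<Rightarrow> (real \<Rightarrow> 'w \<Rightarrow> real) \<Rightarrow> bool" where
  "char_decay M B \<longleftrightarrow> (\<forall>a>0. \<exists>k>0. \<forall>S c. finite S \<and> S \<subseteq> {0..1} \<and> (\<forall>t\<in>S. 0 \<le> c t) \<longrightarrow>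
     norm (\<integral>\<omega>. cis (\<Sum>t\<in>S. c t * B t \<omega>) \<partial>M) \<le> exp (- k * (\<Sum>t\<in>{t\<in>S. a \<le> t}. c t)\<^sup>2))"

text \<open>The Riemann sums of several time integrals can sample the same time repeatedly, whereas
  \<open>char_decay\<close> speaks of sets of times. Coinciding times are merged by adding their
  weights, which keeps them nonnegative.\<close>

lemma char_decay_indexed:
  fixes \<tau> :: "'i \<Rightarrow> real"
  assumes k: "\<And>S c. finite S \<Longrightarrow> S \<subseteq> {0..1} \<Longrightarrow> (\<forall>t\<in>S. 0 \<le> c t) \<Longrightarrow>
      norm (\<integral>\<omega>. cis (\<Sum>t\<in>S. c t * B t \<omega>) \<partial>M) \<le> exp (- k * (\<Sum>t\<in>{t\<in>S. a \<le> t}. c t)\<^sup>2)"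
    and I: "finite I" "\<tau> ` I \<subseteq> {0..1}" "\<And>i. i \<in> I \<Longrightarrow> 0 \<le> c i"
  shows "norm (\<integral>\<omega>. cis (\<Sum>i\<in>I. c i * B (\<tau> i) \<omega>) \<partial>M) \<le> exp (- k * (\<Sum>i\<in>{i\<in>I. a \<le> \<tau> i}. c i)\<^sup>2)"
proof -
  define d where "d t = (\<Sum>i\<in>{i\<in>I. \<tau> i = t}. c i)" for t
  have 1: "(\<Sum>i\<in>I. c i * B (\<tau> i) \<omega>) = (\<Sum>t\<in>\<tau> ` I. d t * B t \<omega>)" for \<omega>
    unfolding d_def sum_distrib_right
    by (subst sum.image_gen[OF I(1), where g=\<tau>]) (auto intro!: sum.cong)
  have 2: "(\<Sum>i\<in>{i\<in>I. a \<le> \<tau> i}. c i) = (\<Sum>t\<in>{t\<in>\<tau> ` I. a \<le> t}. d t)"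
  proof -
    have "(\<Sum>i\<in>{i\<in>I. a \<le> \<tau> i}. c i) = (\<Sum>t\<in>\<tau> ` {i\<in>I. a \<le> \<tau> i}. \<Sum>i\<in>{x \<in> {i\<in>I. a \<le> \<tau> i}. \<tau> x = t}. c i)"
      using I by (intro sum.image_gen) auto
    also have "\<tau> ` {i\<in>I. a \<le> \<tau> i} = {t\<in>\<tau> ` I. a \<le> t}" by auto
    also have "(\<Sum>t\<in>{t\<in>\<tau> ` I. a \<le> t}. \<Sum>i\<in>{x \<in> {i\<in>I. a \<le> \<tau> i}. \<tau> x = t}. c i) = (\<Sum>t\<in>{t\<in>\<tau> ` I. a \<le> t}. d t)"
      unfolding d_def by (intro sum.cong) auto
    finally show ?thesis .
  qed
  show ?thesis unfolding 1 2
    by (rule k) (use I in \<open>auto simp: d_def intro!: sum_nonneg\<close>)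
qed

text \<open>Even when increments are negatively correlated, the values of the process are not: |t -
  s| \<le> max s t leaves a covariance of at least half of (min s t)^(2H). With nonnegative weights
  the quadratic form can only drop when restricted to times beyond \<open>a\<close>, and there every
  entry is at least a^(2H)/2, which is \<open>2 * k\<close>.\<close>

lemma (in prob_space) char_decay_fbm_base:
  assumes H: "0 < H" and cg: "centered_gaussian_process M B"
    and cov: "\<forall>s\<in>{0..1}. \<forall>t\<in>{0..1}.
        (\<integral>\<omega>. B s \<omega> * B t \<omega> \<partial>M) = 1/2 * (t powr (2*H) + s powr (2*H) - \<bar>t - s\<bar> powr (2*H))"
  shows "char_decay M B"
  unfolding char_decay_def
proof (intro allI impI)
  fix a :: real assume a: "0 < a"
  define R where "R s t = 1/2 * (t powr (2*H) + s powr (2*H) - \<bar>t - s\<bar> powr (2*H))" for s t :: real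
  have lower: "1/2 * (min s t) powr (2*H) \<le> R s t" if "0 \<le> s" "0 \<le> t" for s t
  proof -
    have "\<bar>t - s\<bar> powr (2*H) \<le> (max s t) powr (2*H)"
      by (rule powr_mono2) (use H that in auto)
    then show ?thesis unfolding R_def by (auto simp: min_def max_def split: if_splits)
  qed
  have nn: "0 \<le> R s t" if "0 \<le> s" "0 \<le> t" for s t
    by (rule order_trans[OF _ lower[OF that]]) simp
  define k where "k = a powr (2*H) / 4"
  have big: "2 * k \<le> R s t" if "a \<le> s" "a \<le> t" for s t
  proof -
    have "a powr (2*H) \<le> (min s t) powr (2*H)" by (rule powr_mono2) (use a H that in auto)
    then show ?thesis using lower[of s t] that a by (simp add: k_def)
  qed
  show "\<exists>k>0. \<forall>S c. finite S \<and> S \<subseteq> {0..1} \<and> (\<forall>t\<in>S. 0 \<le> c t) \<longrightarrow>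
     norm (\<integral>\<omega>. cis (\<Sum>t\<in>S. c t * B t \<omega>) \<partial>M) \<le> exp (- k * (\<Sum>t\<in>{t\<in>S. a \<le> t}. c t)\<^sup>2)"
  proof (intro exI[of _ k] conjI allI impI)
    show "k > 0" using a by (simp add: k_def)
    fix S and c :: "real \<Rightarrow> real" assume *: "finite S \<and> S \<subseteq> {0..1} \<and> (\<forall>t\<in>S. 0 \<le> c t)"
    let ?T = "{t\<in>S. a \<le> t}"
    have "(\<Sum>t\<in>?T. c t)\<^sup>2 * (2 * k) = (\<Sum>s\<in>?T. \<Sum>t\<in>?T. c s * c t * (2 * k))"
      unfolding power2_eq_square sum_product by (simp only: sum_distrib_right)
    also have "\<dots> \<le> (\<Sum>s\<in>?T. \<Sum>t\<in>?T. c s * c t * R s t)"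
      using * by (intro sum_mono mult_left_mono big) auto
    also have "\<dots> \<le> (\<Sum>s\<in>S. \<Sum>t\<in>?T. c s * c t * R s t)"
      using * by (intro sum_mono2 sum_nonneg mult_nonneg_nonneg nn) auto
    also have "\<dots> \<le> (\<Sum>s\<in>S. \<Sum>t\<in>S. c s * c t * R s t)"
      using * by (intro sum_mono sum_mono2 mult_nonneg_nonneg nn) auto
    finally have "k * (\<Sum>t\<in>?T. c t)\<^sup>2 \<le> (\<Sum>s\<in>S. \<Sum>t\<in>S. c s * c t * R s t) / 2"
      by (simp add: mult_ac)
    moreover have "(\<integral>\<omega>. cis (\<Sum>t\<in>S. c t * B t \<omega>) \<partial>M) = of_real (exp (- (\<Sum>s\<in>S. \<Sum>t\<in>S. c s * c t * R s t) / 2))"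
      by (rule fbm_base_quadratic[OF cg]) (use * cov in \<open>auto simp: R_def\<close>)
    ultimately show "norm (\<integral>\<omega>. cis (\<Sum>t\<in>S. c t * B t \<omega>) \<partial>M) \<le> exp (- k * (\<Sum>t\<in>?T. c t)\<^sup>2)"
      by simp
  qed
qed

lemma riemann_sum_tendsto:
  fixes g :: "real \<Rightarrow> real"
  assumes g: "continuous_on {s..t} g" and st: "s \<le> t"
  shows "(\<lambda>n. \<Sum>k<n. (t - s) / real n * g (s + (t - s) * (real k + 1) / real n)) \<longlonglongrightarrow> integral {s..t} g"
proof (rule LIMSEQ_I)
  fix e :: real assume e: "0 < e"
  define e' where "e' = e / (2 * (t - s + 1))"
  have e': "0 < e'" using e st by (simp add: e'_def)
  have "uniformly_continuous_on {s..t} g" using g by (intro compact_uniformly_continuous) auto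
  then obtain d where d: "d > 0" "\<And>x y. x \<in> {s..t} \<Longrightarrow> y \<in> {s..t} \<Longrightarrow> dist x y < d \<Longrightarrow> dist (g x) (g y) < e'"
    unfolding uniformly_continuous_on_def using e' by metis
  obtain N :: nat where N: "(t - s) / d < real N" using reals_Archimedean2 by blast
  show "\<exists>no. \<forall>n\<ge>no. norm ((\<Sum>k<n. (t - s) / real n * g (s + (t - s) * (real k + 1) / real n)) - integral {s..t} g) < e"
  proof (intro exI[of _ "Suc N"] allI impI)
    fix n assume n: "Suc N \<le> n"
    then have n0: "0 < real n" and "real N \<le> real n" by auto
    moreover have "t - s < real N * d" using N d(1) by (simp add: divide_less_eq)
    moreover have "real N * d \<le> real n * d" using calculation d(1) by (intro mult_right_mono) auto
    ultimately have "t - s < real n * d" by linarith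
    then have nd: "(t - s) / real n < d"
      using n0 by (simp add: pos_divide_less_eq mult.commute)
    define p where "p k = s + (t - s) * real k / real n" for k
    have p_in: "p k \<in> {s..t}" if "k \<le> n" for k
    proof -
      have "(t - s) * real k / real n \<le> t - s"
        using st n0 that by (simp add: divide_le_eq mult_left_mono)
      then show ?thesis using st n0 unfolding p_def by simp
    qed
    have p_le: "p k \<le> p (Suc k)" and p_diff: "p (Suc k) - p k = (t - s) / n" for k
      using st n0 by (auto simp: p_def divide_right_mono field_simps)
    have gi: "g integrable_on {p i..p j}" if "i \<le> j" "j \<le> n" for i j
      by (rule integrable_continuous_interval, rule continuous_on_subset[OF g]) (use p_in[of i] p_in[of j] that in auto)
    have p_mono: "p i \<le> p j" if "i \<le> j" for i j
      using st n0 that by (auto simp: p_def intro!: divide_right_mono mult_left_mono)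
    \<comment> \<open>The error is summed cell by cell: by uniform continuity each cell contributes
      at most its length times e'.\<close>
    have "norm ((\<Sum>k<m. (t - s) / n * g (p (Suc k))) - integral {s..p m} g) \<le> m * ((t - s) / n * e')" if "m \<le> n" for m
      using that
    proof (induction m)
      case 0 show ?case by (simp add: p_def)
    next
      case (Suc m)
      have ih: "norm ((\<Sum>k<m. (t - s) / n * g (p (Suc k))) - integral {s..p m} g) \<le> m * ((t - s) / n * e')"
        using Suc by simp
      have "integral {s..p (Suc m)} g = integral {s..p m} g + integral {p m..p (Suc m)} g"
        using gi[of 0 "Suc m"] Suc p_in[of m] p_le[of m]
        by (intro Henstock_Kurzweil_Integration.integral_combine[symmetric]) (auto simp: p_def)
      moreover have "norm ((t - s) / n * g (p (Suc m)) - integral {p m..p (Suc m)} g) \<le> (t - s) / n * e'"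
      proof -
        have "(t - s) / n * g (p (Suc m)) = integral {p m..p (Suc m)} (\<lambda>_. g (p (Suc m)))"
          using p_le[of m] p_diff[of m] by simp
        then have "(t - s) / n * g (p (Suc m)) - integral {p m..p (Suc m)} g
            = integral {p m..p (Suc m)} (\<lambda>x. g (p (Suc m)) - g x)"
          using gi[of m "Suc m"] Suc by (subst Henstock_Kurzweil_Integration.integral_diff) auto
        also have "norm \<dots> \<le> e' * measure lborel {p m..p (Suc m)}"
        proof (rule has_integral_bound_real[where f="\<lambda>x. g (p (Suc m)) - g x" and S="{}"])
          show "((\<lambda>x. g (p (Suc m)) - g x) has_integral integral {p m..p (Suc m)} (\<lambda>x. g (p (Suc m)) - g x)) {p m..p (Suc m)}"
            using gi[of m "Suc m"] Suc by (intro integrable_integral Henstock_Kurzweil_Integration.integrable_diff) auto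
          fix x assume x: "x \<in> {p m..p (Suc m)} - {}"
          have "dist (g (p (Suc m))) (g x) < e'"
            by (rule d(2)) (use x p_in[of m] p_in[of "Suc m"] p_diff[of m] nd Suc in \<open>auto simp: dist_real_def\<close>)
          then show "norm (g (p (Suc m)) - g x) \<le> e'" by (simp add: dist_real_def)
        qed (use e' in auto)
        finally show ?thesis using p_le[of m] p_diff[of m] by (simp add: mult.commute)
      qed
      moreover have "(\<Sum>k<Suc m. (t - s) / n * g (p (Suc k))) = (\<Sum>k<m. (t - s) / n * g (p (Suc k))) + (t - s) / n * g (p (Suc m))"
        by simp
      moreover have "real (Suc m) * ((t - s) / n * e') = m * ((t - s) / n * e') + (t - s) / n * e'"
        by (simp only: of_nat_Suc distrib_right mult_1_left add.commute)
      moreover have "\<bar>S' - I\<bar> \<le> M'" if "I = I1 + I2" "\<bar>x - I2\<bar> \<le> d" "S' = S + x" "M' = M + d" "\<bar>S - I1\<bar> \<le> M"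
        for I I1 I2 x d S' S M' M :: real using that by linarith
      ultimately show ?case using ih unfolding real_norm_def by metis
    qed
    from this[of n] have "norm ((\<Sum>k<n. (t - s) / n * g (p (Suc k))) - integral {s..t} g) \<le> (t - s) * e'"
      using n0 by (simp add: p_def)
    also have "\<dots> < e"
    proof -
      have "(t - s) * e < (2 * (t - s + 1)) * e" using e st by (intro mult_strict_right_mono) auto
      then show ?thesis using st unfolding e'_def by (simp add: divide_less_eq mult.commute)
    qed
    finally show "norm ((\<Sum>k<n. (t - s) / real n * g (s + (t - s) * (real k + 1) / real n)) - integral {s..t} g) < e"
      by (simp add: p_def add.commute)
  qed
qed

text \<open>Carries decay bounds from Riemann sums over to integrals; the constant 1 dominates every
  \<open>cis\<close>.\<close>

lemma (in prob_space) norm_char_limit_le: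
  assumes Y: "\<And>n. Y n \<in> borel_measurable M" "Z \<in> borel_measurable M"
    and lim: "AE \<omega> in M. (\<lambda>n. Y n \<omega>) \<longlonglongrightarrow> Z \<omega>"
    and bd: "\<And>n. n > 0 \<Longrightarrow> norm (\<integral>\<omega>. cis (Y n \<omega>) \<partial>M) \<le> K"
  shows "norm (\<integral>\<omega>. cis (Z \<omega> :: real) \<partial>M) \<le> K"
proof -
  have "(\<lambda>n. \<integral>\<omega>. cis (Y n \<omega>) \<partial>M) \<longlonglongrightarrow> (\<integral>\<omega>. cis (Z \<omega>) \<partial>M)"
  proof (rule integral_dominated_convergence[where w="\<lambda>_. 1"])
    show "AE \<omega> in M. (\<lambda>n. cis (Y n \<omega>)) \<longlonglongrightarrow> cis (Z \<omega>)"
      using lim by eventually_elim (auto simp: cis_conv_exp intro!: tendsto_intros)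
  qed (use Y in \<open>auto simp: cis_conv_exp\<close>)
  then show ?thesis
    by (rule Lim_norm_ubound[rotated]) (use bd in \<open>auto simp: eventually_sequentially intro!: exI[of _ 1]\<close>)
qed

text \<open>A weight c at a time t \<ge> a of the integrated process spreads over [0,t] as a weight
  on \<open>B\<close>. Of its mass c t at least c (t - a/2) \<ge> c a/2 lies beyond a/2. Hence the
  decay of \<open>B\<close> with cutoff a/2 and constant k yields the cutoff a with constant k
  (a/2)^2.\<close>

lemma (in prob_space) char_decay_integral:
  assumes B: "char_decay M B" and meas: "\<And>t. t \<in> {0..1} \<Longrightarrow> B t \<in> borel_measurable M"
    and cont: "AE \<omega> in M. continuous_on {0..1} (\<lambda>t. B t \<omega>)"
    and meas': "\<And>t. t \<in> {0..1} \<Longrightarrow> B' t \<in> borel_measurable M"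
    and B': "AE \<omega> in M. \<forall>t\<in>{0..1}. B' t \<omega> = integral {0..t} (\<lambda>r. B r \<omega>)"
  shows "char_decay M B'"
  unfolding char_decay_def
proof (intro allI impI)
  fix a :: real assume a: "0 < a"
  have "0 < a / 2" using a by simp
  from B[unfolded char_decay_def, rule_format, OF this]
  obtain k where k0: "k > 0" and kk: "\<forall>S c. finite S \<and> S \<subseteq> {0..1} \<and> (\<forall>t\<in>S. 0 \<le> c t) \<longrightarrow>
      norm (\<integral>\<omega>. cis (\<Sum>t\<in>S. c t * B t \<omega>) \<partial>M) \<le> exp (- k * (\<Sum>t\<in>{t\<in>S. a / 2 \<le> t}. c t)\<^sup>2)"
    by (elim exE conjE)
  have k: "norm (\<integral>\<omega>. cis (\<Sum>t\<in>S. c t * B t \<omega>) \<partial>M) \<le> exp (- k * (\<Sum>t\<in>{t\<in>S. a / 2 \<le> t}. c t)\<^sup>2)"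
    if "finite S" "S \<subseteq> {0..1}" "\<forall>t\<in>S. 0 \<le> c t" for S c
    by (rule kk[rule_format]) (use that in simp)
  show "\<exists>k>0. \<forall>S c. finite S \<and> S \<subseteq> {0..1} \<and> (\<forall>t\<in>S. 0 \<le> c t) \<longrightarrow>
     norm (\<integral>\<omega>. cis (\<Sum>t\<in>S. c t * B' t \<omega>) \<partial>M) \<le> exp (- k * (\<Sum>t\<in>{t\<in>S. a \<le> t}. c t)\<^sup>2)"
  proof (intro exI[of _ "k * (a / 2)\<^sup>2"] conjI allI impI)
    show "k * (a / 2)\<^sup>2 > 0" using k0 a by simp
    fix S and c :: "real \<Rightarrow> real" assume S: "finite S \<and> S \<subseteq> {0..1} \<and> (\<forall>t\<in>S. 0 \<le> c t)"
    define \<tau> where "\<tau> n = (\<lambda>(t, j). t * (real j + 1) / real n)" for n :: nat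
    define w where "w n = (\<lambda>(t, j::nat). c t * (t / real n))" for n :: nat
    define Y where "Y n \<omega> = (\<Sum>i\<in>S \<times> {..<n}. w n i * B (\<tau> n i) \<omega>)" for n \<omega>
    have \<tau>: "\<tau> n i \<in> {0..1}" if "i \<in> S \<times> {..<n}" for n i
    proof -
      obtain t j where i: "i = (t, j)" "t \<in> S" "j < n" using \<open>i \<in> S \<times> {..<n}\<close> by (elim SigmaE) auto
      have "t * (real j + 1) \<le> 1 * real n" using S i by (intro mult_mono) auto
      then show ?thesis using S i by (auto simp: \<tau>_def divide_le_eq)
    qed
    show "norm (\<integral>\<omega>. cis (\<Sum>t\<in>S. c t * B' t \<omega>) \<partial>M) \<le> exp (- (k * (a / 2)\<^sup>2) * (\<Sum>t\<in>{t\<in>S. a \<le> t}. c t)\<^sup>2)"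
    proof (rule norm_char_limit_le[where Y=Y])
      show "Y n \<in> borel_measurable M" for n
        unfolding Y_def using meas \<tau> by (intro borel_measurable_sum borel_measurable_times) auto
      show "(\<lambda>\<omega>. \<Sum>t\<in>S. c t * B' t \<omega>) \<in> borel_measurable M"
        using meas' S by (intro borel_measurable_sum borel_measurable_times) auto
      show "AE \<omega> in M. (\<lambda>n. Y n \<omega>) \<longlonglongrightarrow> (\<Sum>t\<in>S. c t * B' t \<omega>)"
        using cont B'
      proof eventually_elim
        case (elim \<omega>)
        have Y: "Y n \<omega> = (\<Sum>t\<in>S. c t * (\<Sum>j<n. (t - 0) / real n * B (0 + (t - 0) * (real j + 1) / real n) \<omega>))" for n
        proof -
          have "Y n \<omega> = (\<Sum>(t, j)\<in>S \<times> {..<n}. c t * (t / real n) * B (t * (real j + 1) / real n) \<omega>)"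
            unfolding Y_def w_def \<tau>_def by (simp add: split_beta)
          also have "\<dots> = (\<Sum>t\<in>S. \<Sum>j<n. c t * (t / real n) * B (t * (real j + 1) / real n) \<omega>)"
            by (rule sum.cartesian_product[symmetric])
          finally show ?thesis by (simp add: sum_distrib_left mult_ac)
        qed
        show ?case unfolding Y
        proof (intro tendsto_sum tendsto_mult tendsto_const)
          fix t assume t: "t \<in> S"
          have "(\<lambda>n. \<Sum>j<n. (t - 0) / real n * B (0 + (t - 0) * (real j + 1) / real n) \<omega>) \<longlonglongrightarrow> integral {0..t} (\<lambda>r. B r \<omega>)"
            by (rule riemann_sum_tendsto, rule continuous_on_subset[OF elim(1)]) (use S t in auto)
          then show "(\<lambda>n. \<Sum>j<n. (t - 0) / real n * B (0 + (t - 0) * (real j + 1) / real n) \<omega>) \<longlonglongrightarrow> B' t \<omega>"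
            using elim S t by auto
        qed
      qed
      fix n :: nat assume n: "n > 0"
      have "norm (\<integral>\<omega>. cis (Y n \<omega>) \<partial>M) \<le> exp (- k * (\<Sum>i\<in>{i\<in>S \<times> {..<n}. a / 2 \<le> \<tau> n i}. w n i)\<^sup>2)"
        unfolding Y_def by (rule char_decay_indexed[OF k]) (use S \<tau> in \<open>auto simp: w_def\<close>)
      also have "\<dots> \<le> exp (- (k * (a / 2)\<^sup>2) * (\<Sum>t\<in>{t\<in>S. a \<le> t}. c t)\<^sup>2)"
      proof -
        have mass: "a / 2 \<le> (\<Sum>j\<in>{j. j < n \<and> a / 2 \<le> \<tau> n (t, j)}. t / real n)" if t: "t \<in> S" "a \<le> t" for t
        proof -
          let ?G = "{j. j < n \<and> a / 2 \<le> \<tau> n (t, j)}" and ?N = "{j. j < n \<and> \<not> a / 2 \<le> \<tau> n (t, j)}"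
          have t0: "t > 0" using a t by simp
          \<comment> \<open>With right endpoints, a sample time below a/2 means t (j + 1) / n < a/2,
            so j + 1, and not merely j, is at most a n / (2 t). This saves the one index by which
            the count would otherwise exceed the floor.\<close>
          have "?N \<subseteq> {..<nat \<lfloor>a * n / (2 * t)\<rfloor>}"
          proof
            fix j assume "j \<in> ?N"
            then have "real j + 1 \<le> a * n / (2 * t)" using t0 n by (simp add: \<tau>_def field_simps)
            then show "j \<in> {..<nat \<lfloor>a * n / (2 * t)\<rfloor>}" by (simp add: zless_nat_eq_int_zless) linarith
          qed
          then have "card ?N \<le> nat \<lfloor>a * n / (2 * t)\<rfloor>" using card_mono[of "{..<nat \<lfloor>a * n / (2 * t)\<rfloor>}" ?N] by simp
          then have "real (card ?N) \<le> real (nat \<lfloor>a * n / (2 * t)\<rfloor>)" by (simp only: of_nat_le_iff)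
          also have "\<dots> \<le> a * n / (2 * t)" by (rule of_nat_floor) (use t0 a n in simp)
          finally have cN: "real (card ?N) \<le> a * n / (2 * t)" .
          have "?G \<union> ?N = {..<n}" by auto
          then have "n = card (?G \<union> ?N)" by simp
          also have "\<dots> = card ?G + card ?N" by (rule card_Un_disjoint) auto
          finally have "n = card ?G + card ?N" .
          moreover have "real g = real n - real m" if "n = g + m" for g m using that by simp
          ultimately have "real (card ?G) = real n - real (card ?N)" by metis
          then have "(\<Sum>j\<in>?G. t / real n) = (real n - real (card ?N)) * (t / n)" by simp
          also have "\<dots> \<ge> (real n - a * n / (2 * t)) * (t / n)"
            using cN t0 n by (intro mult_right_mono) auto
          also have "(real n - a * n / (2 * t)) * (t / n) = t - a / 2" using t0 n by (simp add: field_simps)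
          finally have "t - a / 2 \<le> (\<Sum>j\<in>?G. t / real n)" .
          moreover have "a / 2 \<le> t - a / 2" using t by simp
          ultimately show ?thesis by (rule order_trans[rotated])
        qed
        have "a / 2 * (\<Sum>t\<in>{t\<in>S. a \<le> t}. c t) = (\<Sum>t\<in>{t\<in>S. a \<le> t}. c t * (a / 2))"
          by (simp add: sum_distrib_left mult.commute)
        also have "\<dots> \<le> (\<Sum>t\<in>{t\<in>S. a \<le> t}. c t * (\<Sum>j\<in>{j. j < n \<and> a / 2 \<le> \<tau> n (t, j)}. t / real n))"
          using S mass by (intro sum_mono mult_left_mono) auto
        also have "\<dots> = (\<Sum>t\<in>{t\<in>S. a \<le> t}. \<Sum>j\<in>{j. j < n \<and> a / 2 \<le> \<tau> n (t, j)}. w n (t, j))"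
          unfolding w_def by (simp only: sum_distrib_left prod.case)
        also have "\<dots> = (\<Sum>(t, j)\<in>(SIGMA t:{t\<in>S. a \<le> t}. {j. j < n \<and> a / 2 \<le> \<tau> n (t, j)}). w n (t, j))"
          by (rule sum.Sigma) (use S in auto)
        also have "\<dots> = (\<Sum>i\<in>(SIGMA t:{t\<in>S. a \<le> t}. {j. j < n \<and> a / 2 \<le> \<tau> n (t, j)}). w n i)"
          by (intro sum.cong) auto
        also have "\<dots> \<le> (\<Sum>i\<in>{i\<in>S \<times> {..<n}. a / 2 \<le> \<tau> n i}. w n i)"
          using S by (intro sum_mono2) (auto simp: w_def)
        finally have le: "a / 2 * (\<Sum>t\<in>{t\<in>S. a \<le> t}. c t) \<le> (\<Sum>i\<in>{i\<in>S \<times> {..<n}. a / 2 \<le> \<tau> n i}. w n i)" .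
        have "(a / 2 * (\<Sum>t\<in>{t\<in>S. a \<le> t}. c t))\<^sup>2 \<le> (\<Sum>i\<in>{i\<in>S \<times> {..<n}. a / 2 \<le> \<tau> n i}. w n i)\<^sup>2"
          by (rule power_mono[OF le]) (use a S in \<open>auto intro!: mult_nonneg_nonneg sum_nonneg\<close>)
        from mult_left_mono[OF this, of k] show ?thesis
          using k0 unfolding power_mult_distrib by (simp only: exp_le_cancel_iff mult.assoc mult_minus_left neg_le_iff_le)
      qed
      finally show "norm (\<integral>\<omega>. cis (Y n \<omega>) \<partial>M) \<le> exp (- (k * (a / 2)\<^sup>2) * (\<Sum>t\<in>{t\<in>S. a \<le> t}. c t)\<^sup>2)" .
    qed
  qed
qed

lemma (in prob_space) fractional_brownian_props:
  assumes "fractional_brownian M H B"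
  shows "0 < H \<and> char_decay M B \<and> (\<forall>t\<in>{0..1}. B t \<in> borel_measurable M) \<and>
    (AE \<omega> in M. continuous_on {0..1} (\<lambda>t. B t \<omega>))"
  using assms
proof induction
  case (base H B)
  then show ?case
    using char_decay_fbm_base[OF base(1,3,4)] unfolding centered_gaussian_process_def by auto
next
  case (step H B B')
  have "AE \<omega> in M. continuous_on {0..1} (\<lambda>t. B' t \<omega>)"
  proof -
    from step have "AE \<omega> in M. continuous_on {0..1} (\<lambda>t. B t \<omega>)" by simp
    with step(3) show ?thesis
    proof eventually_elim
      case (elim \<omega>)
      have "continuous_on {0..1} (\<lambda>t. integral {0..t} (\<lambda>r. B r \<omega>))"
        by (rule indefinite_integral_continuous_1, rule integrable_continuous_interval, rule elim(2))
      then show ?case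
        by (rule continuous_on_eq) (use elim(1) in auto)
    qed
  qed
  moreover have "char_decay M B'"
    by (rule char_decay_integral[of B]) (use step in auto)
  ultimately show ?case using step by auto
qed

text \<open>Replaces an exponent y^p by the linear exponent of the two-point estimate, at the cost
  of a constant factor in front of the exponential.\<close>

lemma le_powr_add_one: "y \<le> y powr p + 1" if "0 \<le> y" "1 \<le> p" for y p :: real
proof (cases "1 \<le> y")
  case True
  then have "y powr 1 \<le> y powr p" using that by (intro powr_mono) auto
  then show ?thesis using True by simp
next
  case False then show ?thesis using that by (smt (verit) powr_ge_zero)
qed

lemma (in prob_space) fbm_increment_char_base:
  assumes H: "0 < H" and cg: "centered_gaussian_process M B"
    and cov: "\<forall>s\<in>{0..1}. \<forall>t\<in>{0..1}.
        (\<integral>\<omega>. B s \<omega> * B t \<omega> \<partial>M) = 1/2 * (t powr (2*H) + s powr (2*H) - \<bar>t - s\<bar> powr (2*H))"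
    and st: "s \<in> {0..1}" "t \<in> {0..1}"
  shows "norm (\<integral>\<omega>. cis (\<xi> * (B t \<omega> - B s \<omega>)) \<partial>M) = exp (- \<xi>\<^sup>2 * \<bar>t - s\<bar> powr (2*H) / 2)"
proof (cases "s = t")
  case False
  define c where "c r = (if r = t then \<xi> else - \<xi>)" for r
  have "(\<integral>\<omega>. cis (\<xi> * (B t \<omega> - B s \<omega>)) \<partial>M) = (\<integral>\<omega>. cis (\<Sum>r\<in>{s,t}. c r * B r \<omega>) \<partial>M)"
    using False by (simp add: c_def algebra_simps)
  also have "\<dots> = of_real (exp (- (\<Sum>r\<in>{s,t}. \<Sum>r'\<in>{s,t}. c r * c r' *
      (1/2 * (r' powr (2*H) + r powr (2*H) - \<bar>r' - r\<bar> powr (2*H)))) / 2))"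
    by (rule fbm_base_quadratic[OF cg cov]) (use st in auto)
  also have "(\<Sum>r\<in>{s,t}. \<Sum>r'\<in>{s,t}. c r * c r' * (1/2 * (r' powr (2*H) + r powr (2*H) - \<bar>r' - r\<bar> powr (2*H))))
      = \<xi>\<^sup>2 * \<bar>t - s\<bar> powr (2*H)"
    using False H by (simp add: c_def abs_minus_commute power2_eq_square) (simp add: algebra_simps)
  finally show ?thesis by simp
qed (simp add: prob_space)

text \<open>For H < 1/2 and times at distance at most 1, |t - s|^(2H) \<ge> |t - s|, which gives
  \<theta> = 2. For 1/2 \<le> H < 1 the exponent is a power 2H \<ge> 1 of \<xi>^(1/H) |t - s|, and
  \<open>le_powr_add_one\<close> makes it linear. For H > 1 the increment is an integral of the
  preceding process over [s,t], and its decay puts the mass \<xi> (t - s) on times beyond 1/4, so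
  \<theta> = 1. The integrated processes degenerate at time 0, which is why the times stay above
  1/4.\<close>

lemma (in prob_space) fbm_increment_char:
  assumes B: "fractional_brownian M H B"
  defines "\<theta> \<equiv> if H < 1/2 then 2 else if H < 1 then 1 / H else 1"
  shows "\<exists>K c. 0 < c \<and> (\<forall>s\<in>{1/4..1}. \<forall>t\<in>{1/4..1}. \<forall>\<xi>\<ge>1.
    norm (\<integral>\<omega>. cis (\<xi> * (B t \<omega> - B s \<omega>)) \<partial>M) \<le> K * exp (- c * \<xi> powr \<theta> * \<bar>t - s\<bar>))"
  using B
proof cases
  case base
  have char: "norm (\<integral>\<omega>. cis (\<xi> * (B t \<omega> - B s \<omega>)) \<partial>M) = exp (- \<xi>\<^sup>2 * \<bar>t - s\<bar> powr (2*H) / 2)"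
    if "s \<in> {1/4..1}" "t \<in> {1/4..1}" for s t \<xi>
    by (rule fbm_increment_char_base[OF base(1,3,4)]) (use that in auto)
  have "norm (\<integral>\<omega>. cis (\<xi> * (B t \<omega> - B s \<omega>)) \<partial>M) \<le> exp (1/2) * exp (- (1/2) * \<xi> powr \<theta> * \<bar>t - s\<bar>)"
    if st: "s \<in> {1/4..1}" "t \<in> {1/4..1}" and \<xi>: "1 \<le> \<xi>" for s t \<xi>
  proof (cases "H < 1/2")
    case True
    have "\<bar>t - s\<bar> powr 1 \<le> \<bar>t - s\<bar> powr (2*H)"
      by (rule powr_mono') (use st True base in auto)
    then have "\<xi>\<^sup>2 * \<bar>t - s\<bar> \<le> \<xi>\<^sup>2 * \<bar>t - s\<bar> powr (2*H)" by (intro mult_left_mono) auto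
    moreover have "\<xi> powr \<theta> = \<xi>\<^sup>2" using True \<xi> by (simp add: \<theta>_def powr_numeral)
    ultimately show ?thesis unfolding char[OF st] exp_add[symmetric] by simp
  next
    case False
    define y where "y = \<xi> powr (1/H) * \<bar>t - s\<bar>"
    have "y powr (2*H) = \<xi>\<^sup>2 * \<bar>t - s\<bar> powr (2*H)"
      using \<xi> base by (simp add: y_def powr_mult powr_powr powr_numeral)
    moreover have "y \<le> y powr (2*H) + 1" by (rule le_powr_add_one) (use False in \<open>auto simp: y_def\<close>)
    moreover have "\<xi> powr \<theta> * \<bar>t - s\<bar> = y" using False base by (simp add: y_def \<theta>_def)
    ultimately have "\<xi> powr \<theta> * \<bar>t - s\<bar> \<le> \<xi>\<^sup>2 * \<bar>t - s\<bar> powr (2*H) + 1" by simp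
    then show ?thesis unfolding char[OF st] exp_add[symmetric] by simp
  qed
  then show ?thesis by (intro exI[of _ "exp (1/2)"] exI[of _ "1/2"]) auto
next
  case (step H' B0)
  have B0: "0 < H'" "char_decay M B0" "\<And>t. t\<in>{0..1} \<Longrightarrow> B0 t \<in> borel_measurable M"
    "AE \<omega> in M. continuous_on {0..1} (\<lambda>t. B0 t \<omega>)"
    using fractional_brownian_props[OF step(2)] by auto
  have \<theta>: "\<theta> = 1" using step(1) B0(1) by (simp add: \<theta>_def)
  have "(0::real) < 1/4" by simp
  from B0(2)[unfolded char_decay_def, rule_format, OF this]
  obtain k where k0: "k > 0" and kk: "\<forall>S c. finite S \<and> S \<subseteq> {0..1} \<and> (\<forall>t\<in>S. 0 \<le> c t) \<longrightarrow>
      norm (\<integral>\<omega>. cis (\<Sum>t\<in>S. c t * B0 t \<omega>) \<partial>M) \<le> exp (- k * (\<Sum>t\<in>{t\<in>S. 1/4 \<le> t}. c t)\<^sup>2)"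
    by (elim exE conjE)
  have k: "norm (\<integral>\<omega>. cis (\<Sum>t\<in>S. c t * B0 t \<omega>) \<partial>M) \<le> exp (- k * (\<Sum>t\<in>{t\<in>S. 1/4 \<le> t}. c t)\<^sup>2)"
    if "finite S" "S \<subseteq> {0..1}" "\<forall>t\<in>S. 0 \<le> c t" for S c
    by (rule kk[rule_format]) (use that in simp)
  have le: "norm (\<integral>\<omega>. cis (\<xi> * (B t \<omega> - B s \<omega>)) \<partial>M) \<le> exp (- k * (\<xi> * (t - s))\<^sup>2)"
    if st: "1/4 \<le> s" "s \<le> t" "t \<le> 1" and \<xi>: "1 \<le> \<xi>" for s t \<xi>
  proof (rule norm_char_limit_le)
    define Y where "Y n \<omega> = (\<Sum>j<n. (\<xi> * ((t - s) / real n)) * B0 (s + (t - s) * (real j + 1) / real n) \<omega>)" for n \<omega>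
    have pt: "s + (t - s) * (real j + 1) / real n \<in> {s..t}" if "j < n" for j n
    proof -
      have "(t - s) * (real j + 1) \<le> (t - s) * real n" using that st by (intro mult_left_mono) auto
      then have "(t - s) * (real j + 1) / real n \<le> t - s"
        by (subst pos_divide_le_eq) (use that in auto)
      moreover have "0 \<le> (t - s) * (real j + 1) / real n" using st by simp
      ultimately show ?thesis by simp
    qed
    have pt': "s + (t - s) * (real j + 1) / real n \<in> {0..1}" if "j < n" for j n
      using pt[OF that] st by auto
    show "Y n \<in> borel_measurable M" for n
      unfolding Y_def by (intro borel_measurable_sum borel_measurable_times borel_measurable_const B0(3) pt') auto
    show "(\<lambda>\<omega>. \<xi> * (B t \<omega> - B s \<omega>)) \<in> borel_measurable M"
      by (intro borel_measurable_times borel_measurable_diff borel_measurable_const) (use step st in auto)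
    show "AE \<omega> in M. (\<lambda>n. Y n \<omega>) \<longlonglongrightarrow> \<xi> * (B t \<omega> - B s \<omega>)"
      using B0(4) step(4)
    proof eventually_elim
      case (elim \<omega>)
      have "(\<lambda>n. \<Sum>j<n. (t - s) / real n * B0 (s + (t - s) * (real j + 1) / real n) \<omega>) \<longlonglongrightarrow> integral {s..t} (\<lambda>r. B0 r \<omega>)"
        by (rule riemann_sum_tendsto, rule continuous_on_subset[OF elim(1)]) (use st in auto)
      moreover have "integral {0..s} (\<lambda>r. B0 r \<omega>) + integral {s..t} (\<lambda>r. B0 r \<omega>) = integral {0..t} (\<lambda>r. B0 r \<omega>)"
        by (intro Henstock_Kurzweil_Integration.integral_combine integrable_continuous_interval
            continuous_on_subset[OF elim(1)]) (use st in auto)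
      then have "integral {s..t} (\<lambda>r. B0 r \<omega>) = B t \<omega> - B s \<omega>" using elim(2) st by auto
      ultimately have "(\<lambda>n. \<Sum>j<n. (t - s) / real n * B0 (s + (t - s) * (real j + 1) / real n) \<omega>) \<longlonglongrightarrow> B t \<omega> - B s \<omega>"
        by simp
      from tendsto_mult[OF tendsto_const[of \<xi>] this] show ?case
        by (simp add: Y_def sum_distrib_left mult.assoc)
    qed
    fix n :: nat assume n: "n > 0"
    have "norm (\<integral>\<omega>. cis (Y n \<omega>) \<partial>M) \<le> exp (- k * (\<Sum>j\<in>{j\<in>{..<n}. 1/4 \<le> s + (t - s) * (real j + 1) / real n}. \<xi> * ((t - s) / real n))\<^sup>2)"
      unfolding Y_def
    proof (rule char_decay_indexed[OF k, where \<tau>="\<lambda>j. s + (t - s) * (real j + 1) / real n" and I="{..<n}"])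
      show "(\<lambda>j. s + (t - s) * (real j + 1) / real n) ` {..<n} \<subseteq> {0..1}" using pt' by blast
      show "0 \<le> \<xi> * ((t - s) / real n)" using \<xi> st by simp
    qed (assumption | simp)+
    also have "{j\<in>{..<n}. 1/4 \<le> s + (t - s) * (real j + 1) / real n} = {..<n}"
    proof -
      have "1/4 \<le> s + (t - s) * (real j + 1) / real n" if "j \<in> {..<n}" for j
        by (rule order_trans[OF st(1)]) (use pt[of j n] that in simp)
      then show ?thesis by blast
    qed
    finally show "norm (\<integral>\<omega>. cis (Y n \<omega>) \<partial>M) \<le> exp (- k * (\<xi> * (t - s))\<^sup>2)"
      using n by simp
  qed
  have "norm (\<integral>\<omega>. cis (\<xi> * (B t \<omega> - B s \<omega>)) \<partial>M) \<le> exp k * exp (- k * \<xi> powr \<theta> * \<bar>t - s\<bar>)"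
    if st: "s \<in> {1/4..1}" "t \<in> {1/4..1}" and \<xi>: "1 \<le> \<xi>" for s t \<xi>
  proof -
    have "norm (\<integral>\<omega>. cis (\<xi> * (B t \<omega> - B s \<omega>)) \<partial>M) \<le> exp (- k * (\<xi> * \<bar>t - s\<bar>)\<^sup>2)"
    proof (cases "s \<le> t")
      case True then show ?thesis using le[of s t \<xi>] st \<xi> by simp
    next
      case False
      have "(\<integral>\<omega>. cis (\<xi> * (B t \<omega> - B s \<omega>)) \<partial>M) = (\<integral>\<omega>. cnj (cis (\<xi> * (B s \<omega> - B t \<omega>))) \<partial>M)"
        by (intro Bochner_Integration.integral_cong refl) (simp add: cis_cnj algebra_simps)
      also have "\<dots> = cnj (\<integral>\<omega>. cis (\<xi> * (B s \<omega> - B t \<omega>)) \<partial>M)" by (rule Bochner_Integration.integral_cnj)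
      finally show ?thesis using le[of t s \<xi>] st \<xi> False by simp
    qed
    also have "\<dots> \<le> exp k * exp (- k * \<xi> powr \<theta> * \<bar>t - s\<bar>)"
    proof -
      define y where "y = \<xi> * \<bar>t - s\<bar>"
      have "y \<le> y powr 2 + 1" by (rule le_powr_add_one) (use \<xi> in \<open>auto simp: y_def\<close>)
      moreover have "y powr 2 = y\<^sup>2" using \<xi> by (simp add: y_def powr_numeral)
      ultimately have "k * y \<le> k * (y\<^sup>2 + 1)" using k0 by (intro mult_left_mono) auto
      then show ?thesis using \<xi> \<theta> unfolding exp_add[symmetric] y_def by (simp add: algebra_simps)
    qed
    finally show ?thesis .
  qed
  then show ?thesis using k0 by (intro exI[of _ "exp k"] exI[of _ k]) auto
qed

section \<open>Levy processes: from the generator to the characteristic function\<close>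

lemma borel_measurable_cis [measurable]: "cis \<in> borel_measurable borel"
  unfolding cis_conv_exp by (intro borel_measurable_continuous_onI continuous_intros)

lemma levy_processD:
  assumes "levy_process M L"
  shows "\<And>t. t \<in> {0..1} \<Longrightarrow> L t \<in> borel_measurable M"
    and "AE \<omega> in M. L 0 \<omega> = 0"
    and "\<And>(n::nat) \<tau>. mono_on {..n} \<tau> \<Longrightarrow> \<tau> ` {..n} \<subseteq> {0..1} \<Longrightarrow>
      prob_space.indep_vars M (\<lambda>i. borel) (\<lambda>i \<omega>. L (\<tau> (Suc i)) \<omega> - L (\<tau> i) \<omega>) {..<n}"
    and "\<And>s t. 0 \<le> s \<Longrightarrow> 0 \<le> t \<Longrightarrow> s + t \<le> 1 \<Longrightarrow>
      distr M borel (\<lambda>\<omega>. L (s + t) \<omega> - L s \<omega>) = distr M borel (L t)"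
    and "AE \<omega> in M. (\<forall>t\<in>{0..<1}. continuous (at_right t) (\<lambda>s. L s \<omega>)) \<and>
        (\<forall>t\<in>{0<..1}. \<exists>l. ((\<lambda>s. L s \<omega>) \<longlongrightarrow> l) (at_left t))"
  using assms unfolding levy_process_def by simp_all

text \<open>Infinite divisibility: this is what lets the generator, a statement about small times,
  determine the law at time t.\<close>

lemma (in prob_space) levy_char_power:
  assumes L: "levy_process M L" and t: "0 \<le> t" "t \<le> 1" and n: "0 < n"
  shows "(\<integral>\<omega>. cis (\<xi> \<bullet> L t \<omega>) \<partial>M) = (\<integral>\<omega>. cis (\<xi> \<bullet> L (t / real n) \<omega>) \<partial>M) ^ n"
proof -
  define \<tau> where "\<tau> i = t * real i / real n" for i :: nat
  have \<tau>_mono: "mono_on {..n} \<tau>"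
    using t n by (auto simp: mono_on_def \<tau>_def intro!: divide_right_mono mult_left_mono)
  have \<tau>_in: "\<tau> i \<in> {0..1}" if "i \<le> n" for i
  proof -
    have "t * real i \<le> 1 * real n" using t that by (intro mult_mono) auto
    then show ?thesis using t n by (auto simp: \<tau>_def divide_le_eq)
  qed
  note meas = levy_processD(1)[OF L]
  have m1: "L (\<tau> i) \<in> borel_measurable M" "L (\<tau> (Suc i)) \<in> borel_measurable M" if "i < n" for i
    using meas \<tau>_in that by auto
  define X where "X i \<omega> = \<xi> \<bullet> (L (\<tau> (Suc i)) \<omega> - L (\<tau> i) \<omega>)" for i \<omega>
  have "indep_vars (\<lambda>i. borel) (\<lambda>i \<omega>. L (\<tau> (Suc i)) \<omega> - L (\<tau> i) \<omega>) {..<n}"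
    by (rule levy_processD(3)[OF L \<tau>_mono]) (use \<tau>_in in auto)
  then have ind: "indep_vars (\<lambda>i. borel) X {..<n}"
    unfolding X_def by (rule indep_vars_compose2[where Y="\<lambda>i x. \<xi> \<bullet> x"]) auto
  have "X i \<in> borel_measurable M" if "i < n" for i
    using m1[OF that] unfolding X_def by (intro borel_measurable_inner borel_measurable_diff) auto
  then have Xm: "(\<lambda>\<omega>. \<Sum>i<n. X i \<omega>) \<in> borel_measurable M" by (intro borel_measurable_sum) auto
  have tel: "(\<Sum>i<n. X i \<omega>) = \<xi> \<bullet> (L t \<omega> - L 0 \<omega>)" for \<omega>
    unfolding X_def inner_sum_right[symmetric] using n by (subst sum_lessThan_telescope) (simp add: \<tau>_def)
  have "(\<integral>\<omega>. cis (\<xi> \<bullet> L t \<omega>) \<partial>M) = (\<integral>\<omega>. cis (\<Sum>i<n. X i \<omega>) \<partial>M)"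
  proof (rule integral_cong_AE)
    show "AE \<omega> in M. cis (\<xi> \<bullet> L t \<omega>) = cis (\<Sum>i<n. X i \<omega>)"
      using levy_processD(2)[OF L] by eventually_elim (simp add: tel)
    show "(\<lambda>\<omega>. cis (\<Sum>i<n. X i \<omega>)) \<in> borel_measurable M"
      by (rule measurable_compose[OF Xm borel_measurable_cis])
    have [measurable]: "L t \<in> borel_measurable M" using meas t by simp
    show "(\<lambda>\<omega>. cis (\<xi> \<bullet> L t \<omega>)) \<in> borel_measurable M" by measurable
  qed
  also have "\<dots> = char (distr M borel (\<lambda>\<omega>. \<Sum>i<n. X i \<omega>)) 1"
    unfolding char_def by (subst integral_distr[OF Xm]) (auto simp: cis_conv_exp)
  also have "\<dots> = (\<Prod>i<n. char (distr M borel (X i)) 1)" by (rule char_distr_sum[OF ind])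
  also have "\<dots> = (\<Prod>i<n. (\<integral>\<omega>. cis (\<xi> \<bullet> L (t / real n) \<omega>) \<partial>M))"
  proof (rule prod.cong[OF refl])
    fix i assume i: "i \<in> {..<n}"
    have Xi: "X i \<in> borel_measurable M"
      using m1[of i] i unfolding X_def by (auto intro!: borel_measurable_inner borel_measurable_diff)
    have eq: "\<tau> (Suc i) = \<tau> i + t / n" by (simp add: \<tau>_def distrib_left add_divide_distrib)
    have "char (distr M borel (X i)) 1 = (\<integral>\<omega>. cis (X i \<omega>) \<partial>M)"
      unfolding char_def by (subst integral_distr[OF Xi]) (auto simp: cis_conv_exp)
    also have "\<dots> = (\<integral>x. cis (\<xi> \<bullet> x) \<partial>distr M borel (\<lambda>\<omega>. L (\<tau> i + t / n) \<omega> - L (\<tau> i) \<omega>))"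
      unfolding X_def eq using m1[of i] i
      by (intro integral_distr[symmetric] borel_measurable_diff measurable_compose[OF _ borel_measurable_cis]
          borel_measurable_inner) (auto simp: eq)
    also have "distr M borel (\<lambda>\<omega>. L (\<tau> i + t / n) \<omega> - L (\<tau> i) \<omega>) = distr M borel (L (t / n))"
      by (rule levy_processD(4)[OF L]) (use \<tau>_in[of i] \<tau>_in[of "Suc i"] i t n in \<open>auto simp: eq\<close>)
    also have "(\<integral>x. cis (\<xi> \<bullet> x) \<partial>\<dots>) = (\<integral>\<omega>. cis (\<xi> \<bullet> L (t / real n) \<omega>) \<partial>M)"
      by (rule integral_distr, rule meas) (use t n in \<open>auto simp: divide_le_eq\<close>)
    finally show "char (distr M borel (X i)) 1 = (\<integral>\<omega>. cis (\<xi> \<bullet> L (t / real n) \<omega>) \<partial>M)" .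
  qed
  also have "\<dots> = (\<integral>\<omega>. cis (\<xi> \<bullet> L (t / real n) \<omega>) \<partial>M) ^ n" by simp
  finally show ?thesis .
qed

text \<open>For t < s the increment is the negative of a forward one, so its characteristic function
  is complex conjugated; the norm does not see this.\<close>

lemma (in prob_space) levy_increment_char:
  assumes L: "levy_process M L" and st: "0 \<le> s" "s \<le> 1" "0 \<le> t" "t \<le> 1"
  shows "norm (\<integral>\<omega>. cis (\<xi> \<bullet> (L t \<omega> - L s \<omega>)) \<partial>M) = norm (\<integral>\<omega>. cis (\<xi> \<bullet> L \<bar>t - s\<bar> \<omega>) \<partial>M)"
proof -
  note meas = levy_processD(1)[OF L]
  have *: "(\<integral>\<omega>. cis (\<xi> \<bullet> (L t \<omega> - L s \<omega>)) \<partial>M) = (\<integral>\<omega>. cis (\<xi> \<bullet> L (t - s) \<omega>) \<partial>M)"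
    if "0 \<le> s" "s \<le> t" "t \<le> 1" for s t
  proof -
    have "(\<integral>\<omega>. cis (\<xi> \<bullet> (L t \<omega> - L s \<omega>)) \<partial>M) = (\<integral>x. cis (\<xi> \<bullet> x) \<partial>distr M borel (\<lambda>\<omega>. L (s + (t - s)) \<omega> - L s \<omega>))"
      by (subst integral_distr) (use that in \<open>auto intro!: borel_measurable_diff meas\<close>)
    also have "distr M borel (\<lambda>\<omega>. L (s + (t - s)) \<omega> - L s \<omega>) = distr M borel (L (t - s))"
      by (rule levy_processD(4)[OF L]) (use that in auto)
    also have "(\<integral>x. cis (\<xi> \<bullet> x) \<partial>\<dots>) = (\<integral>\<omega>. cis (\<xi> \<bullet> L (t - s) \<omega>) \<partial>M)"
      by (rule integral_distr, rule meas) (use that in auto)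
    finally show ?thesis .
  qed
  show ?thesis
  proof (cases "s \<le> t")
    case True then show ?thesis using * st by simp
  next
    case False
    have "(\<integral>\<omega>. cis (\<xi> \<bullet> (L t \<omega> - L s \<omega>)) \<partial>M) = (\<integral>\<omega>. cnj (cis (\<xi> \<bullet> (L s \<omega> - L t \<omega>))) \<partial>M)"
      by (intro Bochner_Integration.integral_cong refl) (simp add: cis_cnj inner_diff_right)
    also have "\<dots> = cnj (\<integral>\<omega>. cis (\<xi> \<bullet> (L s \<omega> - L t \<omega>)) \<partial>M)" by (rule Bochner_Integration.integral_cnj)
    finally show ?thesis using *[of t s] st False by simp
  qed
qed

text \<open>The generator condition, tested with the indicator of a ball, only controls averages of
  \<open>(1 - \<psi>\<^sub>t) / t\<close> over that ball.\<close>

lemma (in prob_space) generator_ball_average: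
  fixes L :: "real \<Rightarrow> 'a \<Rightarrow> real^2"
  assumes G: "has_generator_minus_nabla_powr M \<beta> L" and meas: "\<And>t. t \<in> {0..1} \<Longrightarrow> L t \<in> borel_measurable M"
    and \<beta>: "0 < \<beta>"
  shows "((\<lambda>t. (\<integral>\<xi>. indicator (ball z r) \<xi> *\<^sub>R ((1 - (\<integral>\<omega>. cis (\<xi> \<bullet> L t \<omega>) \<partial>M)) / of_real t) \<partial>lborel))
     \<longlongrightarrow> of_real (\<integral>\<xi>. indicator (ball z r) \<xi> * norm \<xi> powr \<beta> \<partial>lborel)) (at_right 0)"
proof -
  define h where "h \<xi> = (indicator (ball z r) \<xi> :: complex)" for \<xi>
  have fin: "emeasure lborel (ball z r) < \<infinity>" by (rule emeasure_lborel_ball_finite)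
  have "integrable lborel (\<lambda>\<xi>. complex_of_real (indicator (ball z r) \<xi>))"
    by (intro integrable_of_real integrable_real_indicator) (use fin in auto)
  then have hint: "integrable lborel h"
    by (rule Bochner_Integration.integrable_cong[THEN iffD1, rotated 2]) (auto simp: h_def split: split_indicator)
  have bd: "norm \<xi> powr \<beta> \<le> (norm z + r) powr \<beta>" if "\<xi> \<in> ball z r" for \<xi>
  proof (rule powr_mono2)
    show "norm \<xi> \<le> norm z + r" using that norm_triangle_sub[of \<xi> z] by (auto simp: dist_norm norm_minus_commute)
  qed (use \<beta> in auto)
  have h2: "integrable lborel (\<lambda>\<xi>. complex_of_real (norm \<xi> powr \<beta>) * h \<xi>)"
  proof (rule Bochner_Integration.integrable_bound)
    show "integrable lborel (\<lambda>\<xi>. (norm z + r) powr \<beta> *\<^sub>R h \<xi>)" using hint by auto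
    show "AE \<xi> in lborel. norm (complex_of_real (norm \<xi> powr \<beta>) * h \<xi>) \<le> norm ((norm z + r) powr \<beta> *\<^sub>R h \<xi>)"
      using bd by (auto simp: h_def norm_mult split: split_indicator)
    have [measurable]: "ball z r \<in> sets borel" by simp
    show "(\<lambda>\<xi>. complex_of_real (norm \<xi> powr \<beta>) * h \<xi>) \<in> borel_measurable lborel"
      unfolding h_def by measurable
  qed
  have [measurable]: "ball z r \<in> sets borel" by simp
  \<comment> \<open>The semigroup is evaluated at the origin, where Fubini turns it into the
    integral of the characteristic function of \<open>L t\<close> against \<open>h\<close>.\<close>
  have F: "(\<integral>\<omega>. fourier_synthesis h (0 + L t \<omega>) \<partial>M) = (\<integral>\<xi>. (\<integral>\<omega>. cis (\<xi> \<bullet> L t \<omega>) \<partial>M) * h \<xi> \<partial>lborel)"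
    if t: "t \<in> {0..1}" for t
  proof -
    have [measurable]: "L t \<in> borel_measurable M" using meas t by auto
    interpret pair_sigma_finite M "lborel :: (real^2) measure" ..
    have "integrable (M \<Otimes>\<^sub>M lborel) (\<lambda>(\<omega>, \<xi>). cis (\<xi> \<bullet> L t \<omega>) * h \<xi>)"
    proof (rule Fubini_integrable)
      show "(\<lambda>(\<omega>, \<xi>). cis (\<xi> \<bullet> L t \<omega>) * h \<xi>) \<in> borel_measurable (M \<Otimes>\<^sub>M lborel)"
        unfolding h_def cis_conv_exp by measurable
      show "integrable M (\<lambda>\<omega>. \<integral>\<xi>. norm (case (\<omega>, \<xi>) of (\<omega>, \<xi>) \<Rightarrow> cis (\<xi> \<bullet> L t \<omega>) * h \<xi>) \<partial>lborel)"
        by (simp add: norm_mult)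
      show "AE \<omega> in M. integrable lborel (\<lambda>\<xi>. case (\<omega>, \<xi>) of (\<omega>, \<xi>) \<Rightarrow> cis (\<xi> \<bullet> L t \<omega>) * h \<xi>)"
      proof (intro AE_I2, simp)
        fix \<omega>
        show "integrable lborel (\<lambda>\<xi>. cis (\<xi> \<bullet> L t \<omega>) * h \<xi>)"
          by (rule Bochner_Integration.integrable_bound[OF hint]) (auto simp: h_def norm_mult cis_conv_exp)
      qed
    qed
    from Fubini_integral[OF this] show ?thesis
      by (simp add: fourier_synthesis_def)
  qed
  have "((\<lambda>t. ((\<integral>\<omega>. fourier_synthesis h (0 + L t \<omega>) \<partial>M) - fourier_synthesis h 0) / complex_of_real t)
      \<longlongrightarrow> - fourier_synthesis (\<lambda>\<xi>. complex_of_real (norm \<xi> powr \<beta>) * h \<xi>) 0) (at_right 0)"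
    by (rule tendsto_uniform_limitI[OF G[unfolded has_generator_minus_nabla_powr_def, rule_format]])
      (use hint h2 in auto)
  from tendsto_minus[OF this] have lim: "((\<lambda>t. - (((\<integral>\<omega>. fourier_synthesis h (0 + L t \<omega>) \<partial>M) - fourier_synthesis h 0) / complex_of_real t))
      \<longlongrightarrow> fourier_synthesis (\<lambda>\<xi>. complex_of_real (norm \<xi> powr \<beta>) * h \<xi>) 0) (at_right 0)"
    by (simp only: minus_minus)
  have R: "fourier_synthesis (\<lambda>\<xi>. complex_of_real (norm \<xi> powr \<beta>) * h \<xi>) 0
      = of_real (\<integral>\<xi>. indicator (ball z r) \<xi> * norm \<xi> powr \<beta> \<partial>lborel)"
    unfolding fourier_synthesis_def h_def integral_complex_of_real[symmetric]
    by (intro Bochner_Integration.integral_cong refl) (auto split: split_indicator)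
  show ?thesis
  proof (rule Lim_transform_eventually[OF lim[unfolded R]])
    have "eventually (\<lambda>t::real. t \<in> {0<..<1}) (at_right 0)"
      by (simp add: eventually_at_right_field) (use zero_less_one in blast)
    then show "\<forall>\<^sub>F t in at_right 0. - (((\<integral>\<omega>. fourier_synthesis h (0 + L t \<omega>) \<partial>M) - fourier_synthesis h 0) / complex_of_real t)
       = (\<integral>\<xi>. indicator (ball z r) \<xi> *\<^sub>R ((1 - (\<integral>\<omega>. cis (\<xi> \<bullet> L t \<omega>) \<partial>M)) / of_real t) \<partial>lborel)"
    proof eventually_elim
      case (elim t)
      have [measurable]: "L t \<in> borel_measurable M" using meas elim by auto
      have i1: "integrable lborel (\<lambda>\<xi>. (\<integral>\<omega>. cis (\<xi> \<bullet> L t \<omega>) \<partial>M) * h \<xi>)"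
      proof (rule Bochner_Integration.integrable_bound[OF hint])
        show "(\<lambda>\<xi>. (\<integral>\<omega>. cis (\<xi> \<bullet> L t \<omega>) \<partial>M) * h \<xi>) \<in> borel_measurable lborel"
          unfolding h_def cis_conv_exp by measurable
        have "norm (\<integral>\<omega>. cis (\<xi> \<bullet> L t \<omega>) \<partial>M) \<le> 1" for \<xi>
        proof -
          have "norm (\<integral>\<omega>. cis (\<xi> \<bullet> L t \<omega>) \<partial>M) \<le> (\<integral>\<omega>. norm (cis (\<xi> \<bullet> L t \<omega>)) \<partial>M)" by (rule integral_norm_bound)
          then show ?thesis by (simp add: prob_space)
        qed
        then show "AE \<xi> in lborel. norm ((\<integral>\<omega>. cis (\<xi> \<bullet> L t \<omega>) \<partial>M) * h \<xi>) \<le> norm (h \<xi>)"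
          by (auto simp: norm_mult mult_left_le_one_le)
      qed
      have "- ((\<integral>\<omega>. fourier_synthesis h (0 + L t \<omega>) \<partial>M) - fourier_synthesis h 0)
          = (\<integral>\<xi>. h \<xi> \<partial>lborel) - (\<integral>\<xi>. (\<integral>\<omega>. cis (\<xi> \<bullet> L t \<omega>) \<partial>M) * h \<xi> \<partial>lborel)"
        using elim by (subst F) (auto simp: fourier_synthesis_def)
      also have "\<dots> = (\<integral>\<xi>. h \<xi> - (\<integral>\<omega>. cis (\<xi> \<bullet> L t \<omega>) \<partial>M) * h \<xi> \<partial>lborel)"
        by (rule Bochner_Integration.integral_diff[OF hint i1, symmetric])
      finally have "- (((\<integral>\<omega>. fourier_synthesis h (0 + L t \<omega>) \<partial>M) - fourier_synthesis h 0) / complex_of_real t)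
         = (\<integral>\<xi>. h \<xi> - (\<integral>\<omega>. cis (\<xi> \<bullet> L t \<omega>) \<partial>M) * h \<xi> \<partial>lborel) / of_real t"
        by (simp only: minus_divide_left)
      also have "\<dots> = (\<integral>\<xi>. (h \<xi> - (\<integral>\<omega>. cis (\<xi> \<bullet> L t \<omega>) \<partial>M) * h \<xi>) / of_real t \<partial>lborel)"
        by simp
      also have "\<dots> = (\<integral>\<xi>. indicator (ball z r) \<xi> *\<^sub>R ((1 - (\<integral>\<omega>. cis (\<xi> \<bullet> L t \<omega>) \<partial>M)) / of_real t) \<partial>lborel)"
        by (intro Bochner_Integration.integral_cong refl) (auto simp: h_def split: split_indicator)
      finally show ?case .
    qed
  qed
qed

text \<open>Used for translations and for the point reflection of a ball, both of which have
  Jacobian of modulus 1.\<close>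

lemma lborel_integral_affine:
  fixes f :: "'a::euclidean_space \<Rightarrow> 'b::{banach, second_countable_topology}"
  assumes f: "f \<in> borel_measurable borel" and c: "\<bar>c\<bar> = 1"
  shows "(\<integral>x. f x \<partial>lborel) = (\<integral>x. f (t + c *\<^sub>R x) \<partial>lborel)"
proof -
  have "c \<noteq> 0" using c by auto
  then have "lborel = distr lborel borel (\<lambda>x. t + c *\<^sub>R x :: 'a)"
    using lborel_affine[of c t] c by (simp add: density_1)
  then have "(\<integral>x. f x \<partial>lborel) = (\<integral>x. f x \<partial>distr lborel borel (\<lambda>x. t + c *\<^sub>R x))" by simp
  also have "\<dots> = (\<integral>x. f (t + c *\<^sub>R x) \<partial>lborel)"
    by (rule integral_distr) (use f in auto)
  finally show ?thesis .
qed

text \<open>The generator condition is upgraded to a pointwise one by averaging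
  \<open>2 e\<^sup>i\<^sup>a = e\<^sup>i\<^sup>(\<^sup>a\<^sup>+\<^sup>b\<^sup>) + e\<^sup>i\<^sup>(\<^sup>a\<^sup>-\<^sup>b\<^sup>) + 2 e\<^sup>i\<^sup>a (1 - cos b)\<close> over small frequencies in \<open>b\<close>.\<close>

lemma (in prob_space) char_ball_average:
  fixes Y :: "'a \<Rightarrow> real^2"
  assumes [measurable]: "Y \<in> borel_measurable M" and r: "0 < r"
  defines "\<psi> \<equiv> \<lambda>\<xi>. \<integral>\<omega>. cis (\<xi> \<bullet> Y \<omega>) \<partial>M"
  shows "norm (measure lborel (ball (0::real^2) r) *\<^sub>R (1 - \<psi> z) - (\<integral>\<xi>. indicator (ball z r) \<xi> *\<^sub>R (1 - \<psi> \<xi>) \<partial>lborel))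
     \<le> norm (\<integral>\<xi>. indicator (ball 0 r) \<xi> *\<^sub>R (1 - \<psi> \<xi>) \<partial>lborel)"
proof -
  let ?B = "ball (0::real^2) r"
  have \<psi>_m [measurable]: "\<psi> \<in> borel_measurable borel" unfolding \<psi>_def by measurable
  have \<psi>1: "norm (\<psi> \<xi>) \<le> 1" for \<xi>
  proof -
    have "norm (\<psi> \<xi>) \<le> (\<integral>\<omega>. norm (cis (\<xi> \<bullet> Y \<omega>)) \<partial>M)" unfolding \<psi>_def by (rule integral_norm_bound)
    then show ?thesis by (simp add: prob_space)
  qed
  have fin: "emeasure lborel (ball w r) < \<infinity>" for w :: "real^2" by (rule emeasure_lborel_ball_finite)
  have int1: "integrable lborel (\<lambda>\<xi>. indicator ?B \<xi> *\<^sub>R f \<xi>)" if "f \<in> borel_measurable borel" "\<And>\<xi>. norm (f \<xi>) \<le> C"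
    for f :: "real^2 \<Rightarrow> complex" and C
  proof (rule Bochner_Integration.integrable_bound)
    show "integrable lborel (\<lambda>\<xi>. C * indicator ?B \<xi>)" using fin by auto
    show "AE \<xi> in lborel. norm (indicator ?B \<xi> *\<^sub>R f \<xi>) \<le> norm (C * indicator ?B \<xi>)"
    proof (rule AE_I2)
      fix \<xi> show "norm (indicator ?B \<xi> *\<^sub>R f \<xi>) \<le> norm (C * indicator ?B \<xi>)"
        using that(2)[of \<xi>] by (auto split: split_indicator)
    qed
    have [measurable]: "?B \<in> sets borel" by simp
    have [measurable]: "f \<in> borel_measurable borel" by (rule that)
    show "(\<lambda>\<xi>. indicator ?B \<xi> *\<^sub>R f \<xi>) \<in> borel_measurable lborel" by measurable
  qed
  have bd2: "norm (1 - \<psi> \<xi>) \<le> 2" for \<xi> using norm_triangle_ineq4[of 1 "\<psi> \<xi>"] \<psi>1[of \<xi>] by simp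
  have shift: "(\<integral>\<xi>. indicator (ball z r) \<xi> *\<^sub>R (1 - \<psi> \<xi>) \<partial>lborel) = (\<integral>\<eta>. indicator ?B \<eta> *\<^sub>R (1 - \<psi> (z + \<eta>)) \<partial>lborel)"
    using lborel_integral_affine[of "\<lambda>\<xi>. indicator (ball z r) \<xi> *\<^sub>R (1 - \<psi> \<xi>)" 1 z]
    by (auto simp: dist_norm indicator_def)
  have reflect: "(\<integral>\<xi>. indicator (ball z r) \<xi> *\<^sub>R (1 - \<psi> \<xi>) \<partial>lborel) = (\<integral>\<eta>. indicator ?B \<eta> *\<^sub>R (1 - \<psi> (z - \<eta>)) \<partial>lborel)"
    using lborel_integral_affine[of "\<lambda>\<xi>. indicator (ball z r) \<xi> *\<^sub>R (1 - \<psi> \<xi>)" "-1" z]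
    by (auto simp: dist_norm indicator_def)
  have pt: "norm (2 * (1 - \<psi> z) - (1 - \<psi> (z + \<eta>)) - (1 - \<psi> (z - \<eta>))) \<le> 2 * Re (1 - \<psi> \<eta>)" for \<eta>
  proof -
    have i: "integrable M (\<lambda>\<omega>. cis (\<xi> \<bullet> Y \<omega>))" for \<xi>
      by (rule integrable_const_bound[where B=1]) auto
    have "2 * (1 - \<psi> z) - (1 - \<psi> (z + \<eta>)) - (1 - \<psi> (z - \<eta>)) = \<psi> (z + \<eta>) + \<psi> (z - \<eta>) - 2 * \<psi> z" by simp
    also have "\<dots> = (\<integral>\<omega>. cis ((z + \<eta>) \<bullet> Y \<omega>) + cis ((z - \<eta>) \<bullet> Y \<omega>) - 2 * cis (z \<bullet> Y \<omega>) \<partial>M)"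
      unfolding \<psi>_def using i by simp
    also have "norm \<dots> \<le> (\<integral>\<omega>. norm (cis ((z + \<eta>) \<bullet> Y \<omega>) + cis ((z - \<eta>) \<bullet> Y \<omega>) - 2 * cis (z \<bullet> Y \<omega>)) \<partial>M)"
      by (rule integral_norm_bound)
    also have "\<dots> = (\<integral>\<omega>. 2 * Re (1 - cis (\<eta> \<bullet> Y \<omega>)) \<partial>M)"
    proof (rule Bochner_Integration.integral_cong[OF refl])
      fix \<omega>
      have "cis ((z + \<eta>) \<bullet> Y \<omega>) + cis ((z - \<eta>) \<bullet> Y \<omega>) - 2 * cis (z \<bullet> Y \<omega>)
          = cis (z \<bullet> Y \<omega>) * of_real (2 * cos (\<eta> \<bullet> Y \<omega>) - 2)"
        by (simp add: inner_add_left inner_diff_left complex_eq_iff cos_add sin_add cos_diff sin_diff algebra_simps)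
      then show "norm (cis ((z + \<eta>) \<bullet> Y \<omega>) + cis ((z - \<eta>) \<bullet> Y \<omega>) - 2 * cis (z \<bullet> Y \<omega>)) = 2 * Re (1 - cis (\<eta> \<bullet> Y \<omega>))"
        using cos_le_one[of "\<eta> \<bullet> Y \<omega>"] by (simp add: norm_mult del: of_real_mult of_real_diff)
    qed
    also have "\<dots> = 2 * Re (\<integral>\<omega>. 1 - cis (\<eta> \<bullet> Y \<omega>) \<partial>M)"
    proof -
      have "integrable M (\<lambda>\<omega>. 1 - cis (\<eta> \<bullet> Y \<omega>))" using i by simp
      then show ?thesis by (simp only: integral_Re integral_mult_right_zero)
    qed
    also have "\<dots> = 2 * Re (1 - \<psi> \<eta>)" using i by (simp add: \<psi>_def prob_space)
    finally show ?thesis .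
  qed
  let ?I = "\<integral>\<xi>. indicator (ball z r) \<xi> *\<^sub>R (1 - \<psi> \<xi>) \<partial>lborel"
  have i1: "integrable lborel (\<lambda>\<eta>. indicator ?B \<eta> *\<^sub>R (1 - \<psi> (z + \<eta>)))"
    and i2: "integrable lborel (\<lambda>\<eta>. indicator ?B \<eta> *\<^sub>R (1 - \<psi> (z - \<eta>)))"
    and i3: "integrable lborel (\<lambda>\<eta>. indicator ?B \<eta> *\<^sub>R (1 - \<psi> \<eta>))"
    and i4: "integrable lborel (\<lambda>\<eta>. indicator ?B \<eta> *\<^sub>R (2 * (1 - \<psi> z)))"
    by (intro int1[OF _ bd2] int1[OF _ order_refl]; measurable)+
  \<comment> \<open>After doubling, one copy of the ball integral is rewritten by translation and
    the other by reflection, so that the integrands combine into the symmetric second difference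
    estimated in \<open>pt\<close>.\<close>
  have "2 * norm (measure lborel ?B *\<^sub>R (1 - \<psi> z) - ?I) = norm (measure lborel ?B *\<^sub>R (2 * (1 - \<psi> z)) - ?I - ?I)"
  proof -
    have "measure lborel ?B *\<^sub>R (2 * (1 - \<psi> z)) - ?I - ?I = 2 * (measure lborel ?B *\<^sub>R (1 - \<psi> z) - ?I)"
      by (simp add: scaleR_conv_of_real algebra_simps)
    from arg_cong[OF this, of norm] show ?thesis by (simp only: norm_mult norm_numeral)
  qed
  also have "measure lborel ?B *\<^sub>R (2 * (1 - \<psi> z)) - ?I - ?I
      = (\<integral>\<eta>. indicator ?B \<eta> *\<^sub>R (2 * (1 - \<psi> z)) - indicator ?B \<eta> *\<^sub>R (1 - \<psi> (z + \<eta>)) - indicator ?B \<eta> *\<^sub>R (1 - \<psi> (z - \<eta>)) \<partial>lborel)"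
    using i1 i2 i4 shift reflect fin[of 0] by simp
  also have "norm \<dots> \<le> (\<integral>\<eta>. norm (indicator ?B \<eta> *\<^sub>R (2 * (1 - \<psi> z)) - indicator ?B \<eta> *\<^sub>R (1 - \<psi> (z + \<eta>)) - indicator ?B \<eta> *\<^sub>R (1 - \<psi> (z - \<eta>))) \<partial>lborel)"
    by (rule integral_norm_bound)
  also have "\<dots> \<le> (\<integral>\<eta>. 2 * Re (indicator ?B \<eta> *\<^sub>R (1 - \<psi> \<eta>)) \<partial>lborel)"
  proof (rule integral_mono)
    show "norm (indicator ?B \<eta> *\<^sub>R (2 * (1 - \<psi> z)) - indicator ?B \<eta> *\<^sub>R (1 - \<psi> (z + \<eta>)) - indicator ?B \<eta> *\<^sub>R (1 - \<psi> (z - \<eta>)))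
        \<le> 2 * Re (indicator ?B \<eta> *\<^sub>R (1 - \<psi> \<eta>))" for \<eta>
      using pt[of \<eta>] by (simp add: indicator_def)
  qed (intro integrable_norm Bochner_Integration.integrable_diff i1 i2 i4 integrable_mult_right integrable_Re i3)+
  also have "\<dots> = 2 * Re (\<integral>\<eta>. indicator ?B \<eta> *\<^sub>R (1 - \<psi> \<eta>) \<partial>lborel)"
    by (simp only: integral_Re[OF i3] integral_mult_right_zero)
  also have "\<dots> \<le> 2 * norm (\<integral>\<eta>. indicator ?B \<eta> *\<^sub>R (1 - \<psi> \<eta>) \<partial>lborel)"
    using complex_Re_le_cmod by simp
  finally show ?thesis by simp
qed

text \<open>By \<open>char_ball_average\<close> the value at z differs from its ball average by no
  more than the average over the ball around 0, and that one converges to the integral of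
  |\<xi>|^\<beta> over a small ball. The radius serves two purposes: it makes the symbol nearly
  constant around z and at most e/4 around 0. The four errors of a quarter each add up to e.\<close>

lemma (in prob_space) stable_symbol_limit:
  fixes L :: "real \<Rightarrow> 'a \<Rightarrow> real^2"
  assumes G: "has_generator_minus_nabla_powr M \<beta> L" and meas: "\<And>t. t \<in> {0..1} \<Longrightarrow> L t \<in> borel_measurable M"
    and \<beta>: "0 < \<beta>"
  shows "((\<lambda>t. (1 - (\<integral>\<omega>. cis (z \<bullet> L t \<omega>) \<partial>M)) / of_real t) \<longlongrightarrow> of_real (norm z powr \<beta>)) (at_right 0)"
proof (rule tendstoI)
  fix e :: real assume e: "0 < e"
  define D where "D t \<xi> = (1 - (\<integral>\<omega>. cis (\<xi> \<bullet> L t \<omega>) \<partial>M)) / of_real t" for t and \<xi> :: "real^2"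
  have "isCont (\<lambda>\<xi>::real^2. norm \<xi> powr \<beta>) z"
    unfolding isCont_def by (rule tendsto_powr2) (use \<beta> in \<open>auto intro!: tendsto_intros\<close>)
  then obtain r0 where r0: "r0 > 0" "\<And>\<xi>. dist \<xi> z < r0 \<Longrightarrow> \<bar>norm \<xi> powr \<beta> - norm z powr \<beta>\<bar> < e / 4"
    using e unfolding continuous_at_eps_delta dist_real_def by (elim allE[of _ "e / 4"]) auto
  define r where "r = min r0 ((e / 4) powr (1 / \<beta>))"
  have r: "0 < r" "r \<le> r0" using r0 e by (auto simp: r_def)
  have rb: "r powr \<beta> \<le> e / 4"
  proof -
    have "r powr \<beta> \<le> ((e / 4) powr (1 / \<beta>)) powr \<beta>" using r \<beta> by (intro powr_mono2) (auto simp: r_def)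
    then show ?thesis using \<beta> e by (simp add: powr_powr)
  qed
  define V where "V = measure lborel (ball (0::real^2) r)"
  have V: "0 < V" using r by (simp add: V_def)
  have fin: "emeasure lborel (ball w r) < \<infinity>" for w :: "real^2" by (rule emeasure_lborel_ball_finite)
  have Vz: "measure lborel (ball z r) = V"
    using r unfolding V_def by (simp add: content_ball)
  define a where "a w = (\<integral>\<xi>. indicator (ball w r) \<xi> * norm \<xi> powr \<beta> \<partial>lborel)" for w :: "real^2"
  have ind: "integrable lborel (\<lambda>\<xi>. indicator (ball w r) \<xi> * c)" for c :: real and w :: "real^2"
    using fin[of w] by auto
  have az: "\<bar>a z - V * norm z powr \<beta>\<bar> \<le> V * (e / 4)"
  proof -
    have [measurable]: "ball z r \<in> sets borel" by simp
    have 1: "integrable lborel (\<lambda>\<xi>. indicator (ball z r) \<xi> * norm \<xi> powr \<beta>)"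
    proof (rule Bochner_Integration.integrable_bound[OF ind[of z "norm z powr \<beta> + e / 4"]])
      show "AE \<xi> in lborel. norm (indicator (ball z r) \<xi> * norm \<xi> powr \<beta>) \<le> norm (indicator (ball z r) \<xi> * (norm z powr \<beta> + e / 4))"
      proof (rule AE_I2)
        fix \<xi> show "norm (indicator (ball z r) \<xi> * norm \<xi> powr \<beta>) \<le> norm (indicator (ball z r) \<xi> * (norm z powr \<beta> + e / 4))"
        proof (cases "\<xi> \<in> ball z r")
          case True
          then have "\<bar>norm \<xi> powr \<beta> - norm z powr \<beta>\<bar> < e / 4"
            by (intro r0(2)) (use r in \<open>auto simp: dist_commute\<close>)
          then have "norm \<xi> powr \<beta> \<le> \<bar>norm z powr \<beta> + e / 4\<bar>" by arith
          then show ?thesis using True by simp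
        qed simp
      qed
    qed measurable
    have "a z - V * norm z powr \<beta> = (\<integral>\<xi>. indicator (ball z r) \<xi> * norm \<xi> powr \<beta> - indicator (ball z r) \<xi> * norm z powr \<beta> \<partial>lborel)"
      using 1 ind[of z "norm z powr \<beta>"] Vz by (simp add: a_def)
    also have "\<bar>\<dots>\<bar> \<le> (\<integral>\<xi>. \<bar>indicator (ball z r) \<xi> * norm \<xi> powr \<beta> - indicator (ball z r) \<xi> * norm z powr \<beta>\<bar> \<partial>lborel)"
      by (rule integral_abs_bound)
    also have "\<dots> \<le> (\<integral>\<xi>. indicator (ball z r) \<xi> * (e / 4) \<partial>lborel)"
    proof (rule integral_mono)
      fix \<xi> show "\<bar>indicator (ball z r) \<xi> * norm \<xi> powr \<beta> - indicator (ball z r) \<xi> * norm z powr \<beta>\<bar> \<le> indicator (ball z r) \<xi> * (e / 4)"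
        using r0(2)[of \<xi>] r by (cases "\<xi> \<in> ball z r") (auto simp: dist_commute)
    qed (intro integrable_abs Bochner_Integration.integrable_diff 1 ind)+
    also have "\<dots> = V * (e / 4)" using Vz by simp
    finally show ?thesis .
  qed
  have a0: "0 \<le> a 0" "a 0 \<le> V * (e / 4)"
  proof -
    have [measurable]: "ball 0 r \<in> sets (borel :: (real^2) measure)" by simp
    have le: "indicator (ball 0 r) \<xi> * norm \<xi> powr \<beta> \<le> indicator (ball 0 r) \<xi> * (e / 4)" for \<xi> :: "real^2"
    proof (cases "\<xi> \<in> ball 0 r")
      case True
      then have "norm \<xi> powr \<beta> \<le> r powr \<beta>" using \<beta> by (intro powr_mono2) auto
      then show ?thesis using rb True by simp
    qed simp
    have 1: "integrable lborel (\<lambda>\<xi>::real^2. indicator (ball 0 r) \<xi> * norm \<xi> powr \<beta>)"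
      by (rule Bochner_Integration.integrable_bound[OF ind[of 0 "e / 4"]]) (use le e in auto)
    have "a 0 \<le> (\<integral>\<xi>. indicator (ball (0::real^2) r) \<xi> * (e / 4) \<partial>lborel)"
      unfolding a_def by (rule integral_mono[OF 1 ind le])
    then show "a 0 \<le> V * (e / 4)" by (simp add: V_def)
    show "0 \<le> a 0" unfolding a_def by simp
  qed
  have lim: "((\<lambda>t. \<integral>\<xi>. indicator (ball w r) \<xi> *\<^sub>R D t \<xi> \<partial>lborel) \<longlongrightarrow> of_real (a w)) (at_right 0)" for w
    unfolding D_def a_def by (rule generator_ball_average[OF G meas \<beta>])
  have Ve: "0 < V * (e / 4)" using V e by simp
  have "eventually (\<lambda>t::real. t \<in> {0<..<1}) (at_right 0)"
    by (simp add: eventually_at_right_field) (use zero_less_one in blast)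
  with tendstoD[OF lim[of z] Ve] tendstoD[OF lim[of 0] Ve]
  show "\<forall>\<^sub>F t in at_right 0. dist ((1 - (\<integral>\<omega>. cis (z \<bullet> L t \<omega>) \<partial>M)) / of_real t) (of_real (norm z powr \<beta>)) < e"
  proof eventually_elim
    case (elim t)
    define I where "I w = (\<integral>\<xi>. indicator (ball w r) \<xi> *\<^sub>R D t \<xi> \<partial>lborel)" for w
    have t: "0 < t" using elim by simp
    have I: "I w = (\<integral>\<xi>. indicator (ball w r) \<xi> *\<^sub>R (1 - (\<integral>\<omega>. cis (\<xi> \<bullet> L t \<omega>) \<partial>M)) \<partial>lborel) / of_real t" for w
      unfolding I_def D_def by (subst integral_divide_zero[symmetric]) (simp add: scaleR_conv_of_real)
    have "norm (V *\<^sub>R (1 - (\<integral>\<omega>. cis (z \<bullet> L t \<omega>) \<partial>M)) - of_real t * I z) \<le> norm (of_real t * I 0)"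
      using char_ball_average[of "L t" r z] meas[of t] elim r t unfolding I V_def by simp
    moreover have "V *\<^sub>R (1 - (\<integral>\<omega>. cis (z \<bullet> L t \<omega>) \<partial>M)) - of_real t * I z = of_real t * (V *\<^sub>R D t z - I z)"
    proof -
      have "1 - (\<integral>\<omega>. cis (z \<bullet> L t \<omega>) \<partial>M) = of_real t * D t z" using t by (simp add: D_def)
      then show ?thesis by (simp only: scaleR_conv_of_real right_diff_distrib mult.left_commute)
    qed
    ultimately have 1: "norm (V *\<^sub>R D t z - I z) \<le> norm (I 0)" using t by (simp add: norm_mult)
    have 2: "norm (I z - of_real (a z)) < V * (e / 4)" "norm (I 0 - of_real (a 0)) < V * (e / 4)"
      using elim unfolding I_def dist_norm by auto
    have 3: "norm (I 0) < 2 * (V * (e / 4))"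
    proof -
      have "norm (I 0) \<le> norm (I 0 - of_real (a 0)) + norm (complex_of_real (a 0))"
        using norm_triangle_ineq[of "I 0 - of_real (a 0)" "of_real (a 0)"] by simp
      then show ?thesis using 2 a0 by simp
    qed
    have 4: "norm (complex_of_real (a z) - of_real (V * norm z powr \<beta>)) \<le> V * (e / 4)"
      using az by (metis norm_of_real of_real_diff)
    have "V * norm (D t z - of_real (norm z powr \<beta>)) = norm (V *\<^sub>R D t z - of_real (V * norm z powr \<beta>))"
    proof -
      have "V *\<^sub>R D t z - of_real (V * norm z powr \<beta>) = V *\<^sub>R (D t z - of_real (norm z powr \<beta>))"
        by (simp add: scaleR_conv_of_real algebra_simps)
      then show ?thesis using V by simp
    qed
    also have "\<dots> = norm ((V *\<^sub>R D t z - I z) + (I z - of_real (a z)) + (of_real (a z) - of_real (V * norm z powr \<beta>)))" by simp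
    also have "\<dots> \<le> norm (V *\<^sub>R D t z - I z) + norm (I z - of_real (a z)) + norm (complex_of_real (a z) - of_real (V * norm z powr \<beta>))"
      by (intro norm_triangle_mono order_refl)
    also have "\<dots> < 4 * (V * (e / 4))" using 1 2 3 4 by linarith
    also have "\<dots> = V * e" by simp
    finally show ?case using V unfolding D_def dist_norm by simp
  qed
qed

text \<open>Both sides are n-th powers of their values at time t/n, and numbers of modulus at most 1
  satisfy |x^n - y^n| \<le> n |x - y|. The two values at time t/n have the same first-order
  expansion, so they differ by o(1/n), which n times remains negligible.\<close>

lemma (in prob_space) stable_char:
  fixes L :: "real \<Rightarrow> 'a \<Rightarrow> real^2"
  assumes L: "levy_process M L" and G: "has_generator_minus_nabla_powr M \<beta> L"
    and \<beta>: "0 < \<beta>" and t: "0 \<le> t" "t \<le> 1"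
  shows "(\<integral>\<omega>. cis (z \<bullet> L t \<omega>) \<partial>M) = of_real (exp (- t * norm z powr \<beta>))"
proof (cases "t = 0")
  case True
  have "(\<integral>\<omega>. cis (z \<bullet> L 0 \<omega>) \<partial>M) = (\<integral>\<omega>. 1 \<partial>M)"
    using levy_processD(1)[OF L, of 0] levy_processD(2)[OF L]
    by (intro integral_cong_AE) (auto elim!: eventually_mono)
  then show ?thesis using True by (simp add: prob_space)
next
  case False
  then have t0: "0 < t" using t by simp
  define b where "b = norm z powr \<beta>"
  have b0: "0 \<le> b" by (simp add: b_def)
  define \<psi> where "\<psi> s = (\<integral>\<omega>. cis (z \<bullet> L s \<omega>) \<partial>M)" for s
  have D: "((\<lambda>s. (1 - \<psi> s) / of_real s) \<longlongrightarrow> of_real b) (at_right 0)"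
    unfolding \<psi>_def b_def by (rule stable_symbol_limit[OF G levy_processD(1)[OF L] \<beta>])
  have E: "((\<lambda>s. (1 - exp (- s * b)) / s) \<longlongrightarrow> b) (at_right 0)"
  proof -
    have "((\<lambda>s. exp (- s * b)) has_real_derivative (- b)) (at 0)"
      by (auto intro!: derivative_eq_intros)
    then have "((\<lambda>s. (exp (- s * b) - 1) / s) \<longlongrightarrow> - b) (at 0)" unfolding has_field_derivative_iff by simp
    from tendsto_minus[OF this] have "((\<lambda>s. (1 - exp (- s * b)) / s) \<longlongrightarrow> b) (at 0)"
      by (simp add: minus_divide_left)
    then show ?thesis by (rule tendsto_mono[rotated]) (simp add: at_le)
  qed
  have lim0: "((\<lambda>s. (1 - \<psi> s) / of_real s - of_real ((1 - exp (- s * b)) / s)) \<longlongrightarrow> 0) (at_right 0)"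
    using tendsto_diff[OF D tendsto_of_real[OF E]] by simp
  have tn: "filterlim (\<lambda>n. t / real n) (at_right 0) sequentially"
    unfolding filterlim_at
  proof
    show "\<forall>\<^sub>F n in sequentially. t / real n \<in> {0<..} \<and> t / real n \<noteq> 0"
      using eventually_gt_at_top[of 0] by eventually_elim (use t0 in auto)
    show "(\<lambda>n. t / real n) \<longlonglongrightarrow> 0" by (rule lim_const_over_n)
  qed
  have lim1: "(\<lambda>n. (1 - \<psi> (t / n)) / of_real (t / n) - of_real ((1 - exp (- (t / n) * b)) / (t / n))) \<longlonglongrightarrow> 0"
    by (rule filterlim_compose[OF lim0 tn])
  have "norm (\<psi> t - of_real (exp (- t * b))) \<le> t * norm ((1 - \<psi> (t / n)) / of_real (t / n) - of_real ((1 - exp (- (t / n) * b)) / (t / n)))"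
    if n: "0 < n" for n :: nat
  proof -
    have p1: "\<psi> t = \<psi> (t / n) ^ n" unfolding \<psi>_def by (rule levy_char_power[OF L t n])
    have p2: "complex_of_real (exp (- t * b)) = of_real (exp (- (t / n) * b)) ^ n"
    proof -
      have "exp (- t * b) = exp (- (t / n) * b) ^ n" using n by (subst exp_of_nat_mult[symmetric]) simp
      then show ?thesis by (metis of_real_power)
    qed
    have n1: "norm (\<psi> s) \<le> 1" for s
    proof -
      have "norm (\<psi> s) \<le> (\<integral>\<omega>. norm (cis (z \<bullet> L s \<omega>)) \<partial>M)" unfolding \<psi>_def by (rule integral_norm_bound)
      then show ?thesis by (simp add: prob_space)
    qed
    have n2: "norm (complex_of_real (exp (- (t / n) * b))) \<le> 1" using b0 t0 by simp
    have "norm (\<psi> t - of_real (exp (- t * b))) \<le> n * norm (\<psi> (t / n) - of_real (exp (- (t / n) * b)))"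
      unfolding p1 p2 by (rule norm_power_diff[OF n1 n2])
    also have "\<psi> (t / n) - of_real (exp (- (t / n) * b)) = - of_real (t / n) *
        ((1 - \<psi> (t / n)) / of_real (t / n) - of_real ((1 - exp (- (t / n) * b)) / (t / n)))"
      using t0 n by (simp add: divide_simps) (simp add: algebra_simps)
    also have "n * norm \<dots> = t * norm ((1 - \<psi> (t / n)) / of_real (t / n) - of_real ((1 - exp (- (t / n) * b)) / (t / n)))"
      using t0 n unfolding norm_mult norm_minus_cancel norm_of_real by simp
    finally show ?thesis .
  qed
  moreover have "(\<lambda>n. t * norm ((1 - \<psi> (t / n)) / of_real (t / n) - of_real ((1 - exp (- (t / n) * b)) / (t / n)))) \<longlonglongrightarrow> t * norm (0::complex)"
    by (intro tendsto_mult tendsto_const tendsto_norm lim1)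
  ultimately have "norm (\<psi> t - of_real (exp (- t * b))) \<le> 0"
    by (intro LIMSEQ_le_const[of _ "t * norm (0::complex)", simplified]) (auto intro!: exI[of _ 1])
  then show ?thesis by (simp add: \<psi>_def b_def)
qed

section \<open>Regularity of the noise paths and one decay estimate for all noises\<close>

lemma cadlag_bounded:
  fixes f :: "real \<Rightarrow> 'a::real_normed_vector"
  assumes rc: "\<And>t. t \<in> {0..<1} \<Longrightarrow> continuous (at_right t) f"
    and ll: "\<And>t. t \<in> {0<..1} \<Longrightarrow> \<exists>l. (f \<longlongrightarrow> l) (at_left t)"
  shows "\<exists>K. \<forall>t\<in>{0..1}. norm (f t) \<le> K"
proof -
  define P where "P a b \<longleftrightarrow> (\<exists>K. \<forall>t\<in>{a..b} \<inter> {0..1}. norm (f t) \<le> K)" for a b :: real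
  have "P 0 1"
  proof (rule Bolzano)
    fix a b c :: real assume "P a b" "P b c"
    then obtain K K' where "\<forall>t\<in>{a..b} \<inter> {0..1}. norm (f t) \<le> K" "\<forall>t\<in>{b..c} \<inter> {0..1}. norm (f t) \<le> K'"
      unfolding P_def by blast
    then have "\<forall>t\<in>{a..c} \<inter> {0..1}. norm (f t) \<le> max K K'" by (auto simp: le_max_iff_disj)
    then show "P a c" unfolding P_def by blast
  next
    fix x :: real assume x: "0 \<le> x" "x \<le> 1"
    have "\<exists>d>0. \<exists>K. \<forall>t. x < t \<and> t < x + d \<and> t \<le> 1 \<longrightarrow> norm (f t) \<le> K"
    proof (cases "x < 1")
      case True
      then have "(f \<longlongrightarrow> f x) (at_right x)" using rc[of x] x by (simp add: continuous_within)
      from tendstoD[OF this zero_less_one]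
      obtain b where b: "b > x" "\<And>t. x < t \<Longrightarrow> t < b \<Longrightarrow> dist (f t) (f x) < 1"
        unfolding eventually_at_right[OF True] by blast
      have "norm (f t) \<le> norm (f x) + 1" if "x < t" "t < b" for t
        using b(2)[OF that] norm_triangle_sub[of "f t" "f x"] by (simp add: dist_norm)
      then show ?thesis using b(1) by (intro exI[of _ "b - x"] conjI exI[of _ "norm (f x) + 1"]) auto
    qed (auto intro!: exI[of _ 1])
    moreover have "\<exists>d>0. \<exists>K. \<forall>t. t < x \<and> x - d < t \<and> 0 \<le> t \<longrightarrow> norm (f t) \<le> K"
    proof (cases "0 < x")
      case True
      then obtain l where "(f \<longlongrightarrow> l) (at_left x)" using ll[of x] x by auto
      from tendstoD[OF this zero_less_one]
      obtain b where b: "b < x" "\<And>t. b < t \<Longrightarrow> t < x \<Longrightarrow> dist (f t) l < 1"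
        unfolding eventually_at_left[OF True] by blast
      have "norm (f t) \<le> norm l + 1" if "b < t" "t < x" for t
        using b(2)[OF that] norm_triangle_sub[of "f t" l] by (simp add: dist_norm)
      then show ?thesis using b(1) by (intro exI[of _ "x - b"] conjI exI[of _ "norm l + 1"]) auto
    qed (auto intro!: exI[of _ 1])
    ultimately obtain d K d' K' where *: "d > 0" "\<forall>t. x < t \<and> t < x + d \<and> t \<le> 1 \<longrightarrow> norm (f t) \<le> K"
      "d' > 0" "\<forall>t. t < x \<and> x - d' < t \<and> 0 \<le> t \<longrightarrow> norm (f t) \<le> K'" by blast
    show "\<exists>d>0. \<forall>a b. a \<le> x \<and> x \<le> b \<and> b - a < d \<longrightarrow> P a b"
    proof (intro exI[of _ "min d d'"] conjI allI impI)
      show "min d d' > 0" using * by simp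
      fix a b assume ab: "a \<le> x \<and> x \<le> b \<and> b - a < min d d'"
      have "norm (f t) \<le> max (norm (f x)) (max K K')" if "t \<in> {a..b} \<inter> {0..1}" for t
      proof (cases t x rule: linorder_cases)
        case less
        then have "norm (f t) \<le> K'" using *(4) that ab by auto
        then show ?thesis by simp
      next
        case greater
        then have "norm (f t) \<le> K" using *(2) that ab by auto
        then show ?thesis by simp
      qed simp
      then show "P a b" unfolding P_def by blast
    qed
  qed simp
  then show ?thesis unfolding P_def by simp
qed

lemma continuous_on_at_right_Icc:
  fixes f :: "real \<Rightarrow> 'a::topological_space"
  assumes f: "continuous_on {0..1} f" and t: "t \<in> {0..<1}"
  shows "continuous (at_right t) f"
proof -
  have "continuous (at t within {0..1}) f" using f t by (auto simp: continuous_on_eq_continuous_within)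
  then have "continuous (at t within {t..1}) f" by (rule continuous_within_subset) (use t in auto)
  then show ?thesis using t by (simp add: at_within_Icc_at_right)
qed

lemma norm_cart_le: "norm (v :: real^2) \<le> \<bar>v $ 1\<bar> + \<bar>v $ 2\<bar>"
  using norm_le_l1_cart[of v] by (simp add: UNIV_2)

text \<open>Measurability and right continuity are recorded for the second coordinate, on which the
  averaged horizontal shear depends; otherwise only the size of the noise enters.\<close>

lemma (in prob_space) noise_paths:
  assumes N: "is_noise M N W"
  shows "\<And>t. t \<in> {0..1} \<Longrightarrow> (\<lambda>\<omega>. W t \<omega> $ 2) \<in> borel_measurable M"
    and "AE \<omega> in M. (\<exists>K. \<forall>t\<in>{0..1}. norm (W t \<omega>) \<le> K) \<and> (\<forall>t\<in>{0..<1}. continuous (at_right t) (\<lambda>s. W s \<omega> $ 2))"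
proof -
  have "(\<forall>t\<in>{0..1}. (\<lambda>\<omega>. W t \<omega> $ 2) \<in> borel_measurable M) \<and>
    (AE \<omega> in M. (\<exists>K. \<forall>t\<in>{0..1}. norm (W t \<omega>) \<le> K) \<and> (\<forall>t\<in>{0..<1}. continuous (at_right t) (\<lambda>s. W s \<omega> $ 2)))"
  proof (cases N)
    case (FBM H)
    have fb: "fractional_brownian M H (\<lambda>t \<omega>. W t \<omega> $ i)" for i
      using N FBM by (simp add: fractional_brownian_plane_def)
    have c: "AE \<omega> in M. continuous_on {0..1} (\<lambda>t. W t \<omega> $ i)" for i
      using fractional_brownian_props[OF fb[of i]] by simp
    have "AE \<omega> in M. (\<exists>K. \<forall>t\<in>{0..1}. norm (W t \<omega>) \<le> K) \<and> (\<forall>t\<in>{0..<1}. continuous (at_right t) (\<lambda>s. W s \<omega> $ 2))"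
      using c[of 1] c[of 2]
    proof eventually_elim
      case (elim \<omega>)
      have b: "\<exists>K. \<forall>t\<in>{0..1}. \<bar>W t \<omega> $ i\<bar> \<le> K" if "continuous_on {0..1} (\<lambda>t. W t \<omega> $ i)" for i
      proof -
        have "compact ((\<lambda>t. W t \<omega> $ i) ` {0..1})" by (rule compact_continuous_image[OF that]) simp
        then have "bounded ((\<lambda>t. W t \<omega> $ i) ` {0..1})" by (rule compact_imp_bounded)
        then show ?thesis by (auto simp: bounded_iff)
      qed
      from b[OF elim(1)] b[OF elim(2)] obtain K K' where
        "\<forall>t\<in>{0..1}. \<bar>W t \<omega> $ 1\<bar> \<le> K" "\<forall>t\<in>{0..1}. \<bar>W t \<omega> $ 2\<bar> \<le> K'" by blast
      then have "norm (W t \<omega>) \<le> K + K'" if "t \<in> {0..1}" for t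
        using norm_cart_le[of "W t \<omega>"] that by (meson add_mono order_trans)
      then show ?case using continuous_on_at_right_Icc[OF elim(2)] by blast
    qed
    then show ?thesis using fractional_brownian_props[OF fb[of 2]] by simp
  next
    case (Stable \<beta>)
    then have L: "levy_process M W"
      using N by (auto simp: stable_process_def standard_brownian_plane_def split: if_splits)
    have "AE \<omega> in M. (\<exists>K. \<forall>t\<in>{0..1}. norm (W t \<omega>) \<le> K) \<and> (\<forall>t\<in>{0..<1}. continuous (at_right t) (\<lambda>s. W s \<omega> $ 2))"
      using levy_processD(5)[OF L]
    proof eventually_elim
      case (elim \<omega>)
      then show ?case
        by (intro conjI cadlag_bounded ballI continuous_component) auto
    qed
    moreover have "(\<lambda>\<omega>. W t \<omega> $ 2) \<in> borel_measurable M" if "t \<in> {0..1}" for t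
    proof -
      have [measurable]: "W t \<in> borel_measurable M" by (rule levy_processD(1)[OF L that])
      show ?thesis unfolding cart_eq_inner_axis by measurable
    qed
    ultimately show ?thesis by blast
  qed
  then show "\<And>t. t \<in> {0..1} \<Longrightarrow> (\<lambda>\<omega>. W t \<omega> $ 2) \<in> borel_measurable M"
    and "AE \<omega> in M. (\<exists>K. \<forall>t\<in>{0..1}. norm (W t \<omega>) \<le> K) \<and> (\<forall>t\<in>{0..<1}. continuous (at_right t) (\<lambda>s. W s \<omega> $ 2))"
    by auto
qed

text \<open>Solved for \<gamma>, the inequality 4 (1 - \<gamma>) < \<theta> reads 1/2 < \<gamma> for
  H < 1/2, 1 - 1/(4H) < \<gamma> for 1/2 \<le> H < 1, and 1 - \<beta>/4 < \<gamma> for the stable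
  processes, which is \<open>admissible_gamma\<close>. For H > 1, where \<theta> = 1, admissibility
  already forces \<gamma> > 3/4.\<close>

lemma (in prob_space) noise_increment_char:
  assumes N: "valid_noise N" "is_noise M N W" and \<gamma>: "admissible_gamma N \<gamma>"
  shows "\<exists>\<theta> K c. 0 < c \<and> 4 * (1 - \<gamma>) < \<theta> \<and> (\<forall>s\<in>{1/4..1}. \<forall>t\<in>{1/4..1}. \<forall>\<xi>\<ge>1.
    norm (\<integral>\<omega>. cis (\<xi> * (W t \<omega> $ 2 - W s \<omega> $ 2)) \<partial>M) \<le> K * exp (- c * \<xi> powr \<theta> * \<bar>t - s\<bar>))"
proof (cases N)
  case (FBM H)
  have H: "0 < H" "H \<noteq> 1" using N FBM by auto
  have fb: "fractional_brownian M H (\<lambda>t \<omega>. W t \<omega> $ 2)"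
    using N FBM by (simp add: fractional_brownian_plane_def)
  have "4 * (1 - \<gamma>) < (if H < 1/2 then 2 else if H < 1 then 1 / H else 1)"
  proof (cases "H < 1")
    case True
    then show ?thesis using \<gamma> FBM H by (auto simp: field_simps split: if_splits)
  next
    case False
    then have "1 / (4 * H) \<le> 1 / 4" by (simp add: field_simps)
    moreover have "1 - 1 / (4 * H) < \<gamma>" using \<gamma> FBM False by auto
    moreover have "4 * (1 - g) < 1" if "x \<le> 1 / 4" "1 - x < g" for x g :: real using that by simp
    ultimately have "4 * (1 - \<gamma>) < 1" by blast
    then show ?thesis using False by auto
  qed
  then show ?thesis using fbm_increment_char[OF fb] by blast
next
  case (Stable \<beta>)
  have \<beta>: "0 < \<beta>" "4 * (1 - \<gamma>) < \<beta>" using N \<gamma> Stable by auto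
  have L: "levy_process M W"
    using N Stable by (auto simp: stable_process_def standard_brownian_plane_def split: if_splits)
  have red: "norm (\<integral>\<omega>. cis (\<xi> * (W t \<omega> $ 2 - W s \<omega> $ 2)) \<partial>M) = norm (\<integral>\<omega>. cis (\<xi> * (W \<bar>t - s\<bar> \<omega> $ 2)) \<partial>M)"
    if "s \<in> {1/4..1}" "t \<in> {1/4..1}" for s t \<xi>
    using levy_increment_char[OF L, of s t "axis 2 \<xi>"] that by (simp add: inner_axis')
  show ?thesis
  proof (cases "\<beta> = 2")
    case False
    then have G: "has_generator_minus_nabla_powr M \<beta> W" using N Stable by (simp add: stable_process_def)
    have na: "norm (axis 2 \<xi> :: real^2) = \<bar>\<xi>\<bar>" for \<xi>
      by (simp add: norm_vec_def L2_set_def UNIV_2 axis_def)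
    have "norm (\<integral>\<omega>. cis (\<xi> * (W \<bar>t - s\<bar> \<omega> $ 2)) \<partial>M) = exp (- 1 * \<xi> powr \<beta> * \<bar>t - s\<bar>)"
      if "s \<in> {1/4..1}" "t \<in> {1/4..1}" "1 \<le> \<xi>" for s t \<xi>
      using stable_char[OF L G \<beta>(1), of "\<bar>t - s\<bar>" "axis 2 \<xi>"] that na[of \<xi>] abs_le_iff[of "t - s" 1] by (simp add: inner_axis' mult.commute)
    then show ?thesis using red \<beta> by (intro exI[of _ \<beta>] exI[of _ 1]) auto
  next
    case True
    then have B: "standard_brownian_plane M W" using N Stable by (simp add: stable_process_def)
    have "norm (\<integral>\<omega>. cis (\<xi> * (W \<bar>t - s\<bar> \<omega> $ 2)) \<partial>M) = exp (- (1/2) * \<xi> powr 2 * \<bar>t - s\<bar>)"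
      if "s \<in> {1/4..1}" "t \<in> {1/4..1}" "1 \<le> \<xi>" for s t \<xi>
    proof (cases "s = t")
      case True
      have "(\<integral>\<omega>. cis (\<xi> * (W 0 \<omega> $ 2)) \<partial>M) = (\<integral>\<omega>. 1 \<partial>M)"
      proof (rule integral_cong_AE)
        have [measurable]: "W 0 \<in> borel_measurable M" using levy_processD(1)[OF L] by simp
        show "(\<lambda>\<omega>. cis (\<xi> * (W 0 \<omega> $ 2))) \<in> borel_measurable M" unfolding cart_eq_inner_axis by measurable
      qed (use levy_processD(2)[OF L] in \<open>auto elim!: eventually_mono\<close>)
      then show ?thesis using True by (simp add: prob_space)
    next
      case False
      define r where "r = \<bar>t - s\<bar>"
      have r: "0 < r" "r \<le> 1" using that False by (auto simp: r_def)
      have D: "distributed M lborel (\<lambda>\<omega>. W r \<omega> $ 2) (normal_density 0 (sqrt r))"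
        using B r by (auto simp: standard_brownian_plane_def)
      have D': "distributed M lborel (\<lambda>\<omega>. 0 + \<xi> * (W r \<omega> $ 2)) (normal_density (0 + \<xi> * 0) (\<bar>\<xi>\<bar> * sqrt r))"
        by (rule normal_density_affine[OF D]) (use r that in auto)
      then have "(\<integral>\<omega>. cis (\<xi> * (W r \<omega> $ 2)) \<partial>M) = of_real (exp (- (\<bar>\<xi>\<bar> * sqrt r)\<^sup>2 / 2))"
        using r that by (intro distributed_normal_iexp(1)) auto
      then show ?thesis using r that unfolding r_def[symmetric] by (simp add: power_mult_distrib powr_numeral)
    qed
    then show ?thesis using red \<beta> True by (intro exI[of _ 2] exI[of _ 1] exI[of _ "1/2"]) auto
  qed
qed

section \<open>Square waves along oscillating paths\<close>

text \<open>The Poisson regularisation of the square wave. Its Fourier series converges absolutely,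
  with coefficients dominated by those of the square wave.\<close>

definition poisson_wave :: "real \<Rightarrow> real \<Rightarrow> real" where
  "poisson_wave r v = - (4 / pi) * Re (Arctan (\<i> * of_real r * cis (pi * v)))"

text \<open>In the power series of \<open>Arctan\<close> at z = i r exp(i pi v) the alternating
  signs cancel against the odd powers of i, and minus the real part leaves the sine series.\<close>

lemma poisson_wave_sums:
  assumes "0 \<le> r" "r < 1"
  shows "(\<lambda>n. 4 / pi * (r ^ (2 * n + 1) / real (2 * n + 1)) * sin (real (2 * n + 1) * (pi * v))) sums poisson_wave r v"
proof -
  define z where "z = \<i> * complex_of_real r * cis (pi * v)"
  have "norm z < 1" using assms by (simp add: z_def norm_mult)
  from Arctan_series(2)[OF this]
  have "(\<lambda>n. (-1) ^ n / of_nat (2 * n + 1) * z ^ (2 * n + 1)) sums Arctan z" by simp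
  from sums_mult[OF sums_Re[OF this], of "- (4 / pi)"]
  have "(\<lambda>n. - (4 / pi) * Re ((-1) ^ n / of_nat (2 * n + 1) * z ^ (2 * n + 1))) sums poisson_wave r v"
    by (simp add: poisson_wave_def z_def)
  moreover have "- (4 / pi) * Re ((-1) ^ n / of_nat (2 * n + 1) * z ^ (2 * n + 1))
      = 4 / pi * (r ^ (2 * n + 1) / real (2 * n + 1)) * sin (real (2 * n + 1) * (pi * v))" for n
  proof -
    have "z ^ (2 * n + 1) = \<i> ^ (2 * n + 1) * of_real (r ^ (2 * n + 1)) * cis (real (2 * n + 1) * (pi * v))"
    proof -
      have "cis (pi * v) ^ (2 * n + 1) = cis (real (2 * n + 1) * (pi * v))" by (rule Complex.DeMoivre)
      then show ?thesis by (simp only: z_def power_mult_distrib of_real_power)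
    qed
    moreover have "\<i> ^ (2 * n + 1) = (-1) ^ n * \<i>" by (simp add: power_mult)
    ultimately have e1: "(-1) ^ n / of_nat (2 * n + 1) * z ^ (2 * n + 1)
        = ((-1) ^ n * (-1) ^ n) * (\<i> * of_real (r ^ (2 * n + 1) / real (2 * n + 1)) * cis (real (2 * n + 1) * (pi * v)))"
      by (simp add: field_simps)
    have e2: "(-1) ^ n * (-1) ^ n = (1::complex)" by (simp add: power_mult_distrib[symmetric])
    have "Re (1 * (\<i> * of_real R * cis s)) = - (R * sin s)" for R s by simp
    then show ?thesis unfolding e1 e2 by simp
  qed
  ultimately show ?thesis by simp
qed

text \<open>A bound independent of \<open>r\<close>, serving as dominating function when r tends to
  1.\<close>

lemma poisson_wave_bounded:
  assumes "0 \<le> r" "r < 1"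
  shows "\<bar>poisson_wave r v\<bar> \<le> 2"
proof -
  have n: "norm (\<i> * complex_of_real r * cis (pi * v)) < 1" using assms by (simp add: norm_mult)
  have "\<bar>Re (Arctan (\<i> * of_real r * cis (pi * v)))\<bar> < pi / 2"
    by (rule Re_Arctan_bounds) (use n abs_Im_le_cmod[of "\<i> * complex_of_real r * cis (pi * v)"] in linarith)
  then have "4 / pi * \<bar>Re (Arctan (\<i> * of_real r * cis (pi * v)))\<bar> \<le> 4 / pi * (pi / 2)" by (intro mult_left_mono) auto
  then show ?thesis by (simp add: poisson_wave_def abs_mult)
qed

lemma poisson_wave_measurable:
  assumes "0 \<le> r" "r < 1"
  shows "poisson_wave r \<in> borel_measurable borel"
proof -
  have n: "norm (\<i> * complex_of_real r * cis (pi * v)) < 1" for v using assms by (simp add: norm_mult)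
  have "isCont (\<lambda>v. Arctan (\<i> * of_real r * cis (pi * v))) v" for v
  proof (rule isCont_o2[where g=Arctan])
    show "isCont (\<lambda>v. \<i> * complex_of_real r * cis (pi * v)) v" unfolding cis_conv_exp by (intro continuous_intros)
    show "isCont Arctan (\<i> * complex_of_real r * cis (pi * v))"
      by (rule continuous_at_Arctan) (use n[of v] abs_Im_le_cmod[of "\<i> * complex_of_real r * cis (pi * v)"] in linarith)
  qed
  then have "continuous_on UNIV (poisson_wave r)"
    unfolding poisson_wave_def by (intro continuous_at_imp_continuous_on continuous_intros ballI)
  then show ?thesis by (rule borel_measurable_continuous_onI)
qed

text \<open>\<open>Arctan\<close> is i/2 times the logarithm of a Cayley transform, which here sends
  the unit circle to the imaginary axis, to the point i y with y = cot(\<theta>/2). The argument of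
  that point is pi/2 or -pi/2 according to the sign of y, and this jump is the square wave.\<close>

lemma Arctan_i_cis:
  assumes "sin \<theta> \<noteq> 0"
  shows "Re (Arctan (\<i> * cis \<theta>)) = - (pi / 4) * sgn (sin \<theta>)"
proof -
  have c: "cos \<theta> < 1" using assms by (metis abs_0 cos_le_one cos_one_sin_zero less_eq_real_def)
  define y where "y = sin \<theta> / (1 - cos \<theta>)"
  have y: "y \<noteq> 0" "sgn y = sgn (sin \<theta>)" using assms c by (auto simp: y_def sgn_divide)
  have d: "1 - cis \<theta> \<noteq> 0" using c by (auto simp: complex_eq_iff)
  have sc: "sin \<theta> * sin \<theta> = 1 - cos \<theta> * cos \<theta>"
    using sin_cos_squared_add[of \<theta>] by (simp add: power2_eq_square)
  have "(1 + cis \<theta>) = (\<i> * of_real y) * (1 - cis \<theta>)"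
    using c sc by (simp add: complex_eq_iff y_def field_simps)
  then have q: "(1 - \<i> * (\<i> * cis \<theta>)) / (1 + \<i> * (\<i> * cis \<theta>)) = \<i> * of_real y"
    using d by (simp add: divide_eq_eq algebra_simps)
  have L: "Ln (\<i> * of_real y) = of_real (ln \<bar>y\<bar>) + \<i> * of_real (pi / 2 * sgn y)"
  proof (rule Ln_unique)
    have "exp (\<i> * of_real (pi / 2 * sgn y)) = \<i> * of_real (sgn y)"
    proof -
      have "sgn y = 1 \<or> sgn y = -1" using y(1) by (auto simp: sgn_if)
      then show ?thesis by (simp only: cis_conv_exp[symmetric]) (auto simp: complex_eq_iff)
    qed
    then show "exp (of_real (ln \<bar>y\<bar>) + \<i> * of_real (pi / 2 * sgn y)) = \<i> * of_real y"
      using y by (simp add: exp_add exp_of_real) (metis abs_mult_sgn mult.commute of_real_mult mult.left_commute)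
  qed (auto simp: sgn_if)
  have A: "Arctan (\<i> * cis \<theta>) = \<i> / 2 * Ln (\<i> * of_real y)" unfolding Arctan_def q ..
  have "Re (\<i> / 2 * (of_real a + \<i> * of_real b)) = - b / 2" for a b by simp
  then have "Re (Arctan (\<i> * cis \<theta>)) = - (pi / 2 * sgn y) / 2" unfolding A L .
  then show ?thesis using y(2) by simp
qed

lemma poisson_wave_tendsto:
  assumes "sin (pi * v) \<noteq> 0"
  shows "(\<lambda>n. poisson_wave (1 - 1 / real (Suc n)) v) \<longlonglongrightarrow> sgn (sin (pi * v))"
proof -
  have "(\<lambda>n. 1 - 1 / real (Suc n)) \<longlonglongrightarrow> 1 - 0"
    by (intro tendsto_diff tendsto_const lim_const_over_n[THEN LIMSEQ_Suc])
  then have l: "(\<lambda>n. \<i> * complex_of_real (1 - 1 / real (Suc n)) * cis (pi * v)) \<longlonglongrightarrow> \<i> * complex_of_real 1 * cis (pi * v)"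
    by (intro tendsto_mult tendsto_const tendsto_of_real) simp
  have "isCont Arctan (\<i> * cis (pi * v))"
    by (rule continuous_at_Arctan) (use assms in simp)
  then have "(\<lambda>n. Arctan (\<i> * complex_of_real (1 - 1 / real (Suc n)) * cis (pi * v))) \<longlonglongrightarrow> Arctan (\<i> * cis (pi * v))"
    using isCont_tendsto_compose[OF _ l, of Arctan] by simp
  then have "(\<lambda>n. poisson_wave (1 - 1 / real (Suc n)) v) \<longlonglongrightarrow> - (4 / pi) * Re (Arctan (\<i> * cis (pi * v)))"
    unfolding poisson_wave_def by (intro tendsto_mult tendsto_const tendsto_Re)
  then show ?thesis unfolding Arctan_i_cis[OF assms] by simp
qed

text \<open>The phase \<open>c\<close> turns into a unimodular factor
  \<open>cis (k * (pi * c))\<close> in front of the k-th time integral and disappears in the norm,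
  and the damping r^k is bounded by 1. The bound is thus uniform in \<open>c\<close> and
  \<open>r\<close>; r < 1 only serves to exchange sum and integral through a geometric
  majorant.\<close>

lemma poisson_wave_integral_bound:
  fixes \<eta> x :: "real \<Rightarrow> real"
  assumes \<eta>: "integrable lborel \<eta>" and [measurable]: "x \<in> borel_measurable borel"
    and r: "0 \<le> r" "r < 1"
    and sm: "summable (\<lambda>n. norm (\<integral>t. \<eta> t *\<^sub>R cis (real (2 * n + 1) * (pi * x t)) \<partial>lborel) / real (2 * n + 1))"
  shows "\<bar>\<integral>t. \<eta> t * poisson_wave r (c + x t) \<partial>lborel\<bar>
    \<le> 4 / pi * (\<Sum>n. norm (\<integral>t. \<eta> t *\<^sub>R cis (real (2 * n + 1) * (pi * x t)) \<partial>lborel) / real (2 * n + 1))"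
proof -
  define m where "m n = norm (\<integral>t. \<eta> t *\<^sub>R cis (real (2 * n + 1) * (pi * x t)) \<partial>lborel)" for n
  have [measurable]: "\<eta> \<in> borel_measurable borel" using \<eta> by (simp add: borel_measurable_integrable)
  define f where "f n t = \<eta> t * (4 / pi * (r ^ (2 * n + 1) / real (2 * n + 1)) * sin (real (2 * n + 1) * (pi * (c + x t))))" for n t
  have fb: "\<bar>f n t\<bar> \<le> 4 / pi * \<bar>\<eta> t\<bar> * r ^ n" for n t
  proof -
    have "r ^ (2 * n + 1) / real (2 * n + 1) \<le> r ^ (2 * n + 1) / 1" by (rule divide_left_mono) (use r in auto)
    also have "\<dots> = r ^ (2 * n + 1)" by simp
    also have "\<dots> \<le> r ^ n" using r by (intro power_decreasing) auto
    finally have "\<bar>r ^ (2 * n + 1) / real (2 * n + 1)\<bar> * \<bar>sin (real (2 * n + 1) * (pi * (c + x t)))\<bar> \<le> r ^ n * 1"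
      using r by (intro mult_mono) auto
    then have "(4 / pi * \<bar>\<eta> t\<bar>) * (\<bar>r ^ (2 * n + 1) / real (2 * n + 1)\<bar> * \<bar>sin (real (2 * n + 1) * (pi * (c + x t)))\<bar>) \<le> (4 / pi * \<bar>\<eta> t\<bar>) * (r ^ n * 1)"
      by (intro mult_left_mono) auto
    then show ?thesis unfolding f_def abs_mult by (simp add: mult_ac)
  qed
  have fm: "f n \<in> borel_measurable lborel" for n unfolding f_def by measurable
  have fi: "integrable lborel (f n)" for n
  proof (rule Bochner_Integration.integrable_bound)
    show "integrable lborel (\<lambda>t. 4 / pi * r ^ n * \<eta> t)" using \<eta> by simp
    show "AE t in lborel. norm (f n t) \<le> norm (4 / pi * r ^ n * \<eta> t)"
      using fb r by (intro AE_I2) (simp add: abs_mult mult_ac)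
  qed (rule fm)
  have fs: "(\<lambda>n. f n t) sums (\<eta> t * poisson_wave r (c + x t))" for t
    unfolding f_def by (intro sums_mult poisson_wave_sums r)
  have geo: "summable (\<lambda>n. r ^ n)" using r by simp
  have s1: "summable (\<lambda>n. norm (f n t))" for t
    by (rule summable_comparison_test'[where N=0 and g="\<lambda>n. 4 / pi * \<bar>\<eta> t\<bar> * r ^ n"]) (use geo fb in \<open>auto intro!: summable_mult\<close>)
  have s2: "summable (\<lambda>n. \<integral>t. norm (f n t) \<partial>lborel)"
  proof (rule summable_comparison_test'[where N=0])
    show "summable (\<lambda>n. (4 / pi * (\<integral>t. \<bar>\<eta> t\<bar> \<partial>lborel)) * r ^ n)" using geo by (rule summable_mult)
    fix n
    have "(\<integral>t. norm (f n t) \<partial>lborel) \<le> (\<integral>t. 4 / pi * \<bar>\<eta> t\<bar> * r ^ n \<partial>lborel)"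
      by (rule integral_mono) (use fi \<eta> fb in auto)
    then show "norm (\<integral>t. norm (f n t) \<partial>lborel) \<le> (4 / pi * (\<integral>t. \<bar>\<eta> t\<bar> \<partial>lborel)) * r ^ n" by simp
  qed
  have "(\<lambda>n. \<integral>t. f n t \<partial>lborel) sums (\<integral>t. (\<Sum>n. f n t) \<partial>lborel)"
    by (rule sums_integral) (use fi s1 s2 in auto)
  then have S: "(\<lambda>n. \<integral>t. f n t \<partial>lborel) sums (\<integral>t. \<eta> t * poisson_wave r (c + x t) \<partial>lborel)"
    using fs by (simp add: sums_iff)
  have b: "norm (\<integral>t. f n t \<partial>lborel) \<le> 4 / pi * (m n / real (2 * n + 1))" for n
  proof -
    let ?k = "real (2 * n + 1)"
    have ic: "integrable lborel (\<lambda>t. \<eta> t *\<^sub>R cis (?k * (pi * x t)))"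
      by (rule Bochner_Integration.integrable_bound[OF \<eta>]) auto
    have "(\<integral>t. \<eta> t * sin (?k * (pi * (c + x t))) \<partial>lborel) = (\<integral>t. Im (cis (?k * (pi * c)) * (\<eta> t *\<^sub>R cis (?k * (pi * x t)))) \<partial>lborel)"
    proof (rule Bochner_Integration.integral_cong[OF refl])
      fix t
      have "cis (?k * (pi * c)) * (\<eta> t *\<^sub>R cis (?k * (pi * x t))) = \<eta> t *\<^sub>R cis (?k * (pi * (c + x t)))"
        by (simp only: mult_scaleR_right cis_mult distrib_left)
      then show "\<eta> t * sin (?k * (pi * (c + x t))) = Im (cis (?k * (pi * c)) * (\<eta> t *\<^sub>R cis (?k * (pi * x t))))"
        by (simp only: scaleR_complex.simps cis.simps)
    qed
    also have "\<dots> = Im (\<integral>t. cis (?k * (pi * c)) * (\<eta> t *\<^sub>R cis (?k * (pi * x t))) \<partial>lborel)"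
      by (rule integral_Im, rule integrable_mult_right, rule ic)
    also have "\<bar>\<dots>\<bar> \<le> norm (\<integral>t. cis (?k * (pi * c)) * (\<eta> t *\<^sub>R cis (?k * (pi * x t))) \<partial>lborel)" by (rule abs_Im_le_cmod)
    also have "\<dots> = m n" by (simp only: integral_mult_right_zero norm_mult norm_cis mult_1_left m_def)
    finally have 1: "\<bar>\<integral>t. \<eta> t * sin (?k * (pi * (c + x t))) \<partial>lborel\<bar> \<le> m n" .
    have "f n = (\<lambda>t. (4 / pi * (r ^ (2 * n + 1) / ?k)) * (\<eta> t * sin (?k * (pi * (c + x t)))))"
      by (rule ext) (simp only: f_def mult_ac)
    then have "(\<integral>t. f n t \<partial>lborel) = (4 / pi * (r ^ (2 * n + 1) / ?k)) * (\<integral>t. \<eta> t * sin (?k * (pi * (c + x t))) \<partial>lborel)"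
      by (simp only: integral_mult_right_zero)
    also have "norm \<dots> \<le> (4 / pi * (1 / ?k)) * m n"
      unfolding real_norm_def abs_mult[of "4 / pi * (r ^ (2 * n + 1) / ?k)"]
    proof (rule mult_mono[OF _ 1])
      have "r ^ (2 * n + 1) \<le> 1" using r by (intro power_le_one) auto
      then have "4 / pi * (r ^ (2 * n + 1) / ?k) \<le> 4 / pi * (1 / ?k)"
        by (intro mult_left_mono divide_right_mono) auto
      moreover have "0 \<le> 4 / pi * (r ^ (2 * n + 1) / ?k)" using r by simp
      ultimately show "\<bar>4 / pi * (r ^ (2 * n + 1) / ?k)\<bar> \<le> 4 / pi * (1 / ?k)" by (simp only: abs_of_nonneg)
    qed auto
    finally show ?thesis by simp
  qed
  have "summable (\<lambda>n. 4 / pi * (m n / real (2 * n + 1)))" using sm unfolding m_def by (rule summable_mult)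
  from norm_suminf_le[OF b this]
  have "\<bar>\<Sum>n. \<integral>t. f n t \<partial>lborel\<bar> \<le> (\<Sum>n. 4 / pi * (m n / real (2 * n + 1)))" by (simp only: real_norm_def)
  also have "\<dots> = 4 / pi * (\<Sum>n. m n / real (2 * n + 1))"
    by (rule suminf_mult) (use sm in \<open>simp only: m_def\<close>)
  finally show ?thesis unfolding sums_unique[OF S] m_def .
qed

text \<open>Mollification averages over the phases c - \<mu> y with a probability density, so the
  phase-independent bound passes through it after Fubini. The sharp wave is reached by dominated
  convergence as r tends to 1.\<close>

lemma mollified_wave_integral_bound:
  fixes \<eta> x K :: "real \<Rightarrow> real"
  assumes \<eta>: "integrable lborel \<eta>" and [measurable]: "x \<in> borel_measurable borel"
    and K: "integrable lborel K" "\<And>y. 0 \<le> K y" "(\<integral>y. K y \<partial>lborel) = 1" and \<mu>: "\<mu> \<noteq> 0"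
    and sm: "summable (\<lambda>n. norm (\<integral>t. \<eta> t *\<^sub>R cis (real (2 * n + 1) * (pi * x t)) \<partial>lborel) / real (2 * n + 1))"
  shows "\<bar>\<integral>t. \<eta> t * (\<integral>y. K y * sgn (sin (pi * (c + x t - \<mu> * y))) \<partial>lborel) \<partial>lborel\<bar>
    \<le> 4 / pi * (\<Sum>n. norm (\<integral>t. \<eta> t *\<^sub>R cis (real (2 * n + 1) * (pi * x t)) \<partial>lborel) / real (2 * n + 1))"
    (is "_ \<le> ?bd")
proof -
  define r where "r n = 1 - 1 / real (Suc n)" for n
  have r: "0 \<le> r n" "r n < 1" for n by (auto simp: r_def divide_simps)
  have [measurable]: "\<eta> \<in> borel_measurable borel" "K \<in> borel_measurable borel"
    using \<eta> K by (simp_all add: borel_measurable_integrable)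
  have [measurable]: "poisson_wave (r n) \<in> borel_measurable borel" for n by (rule poisson_wave_measurable[OF r])
  define h where "h n t = (\<integral>y. K y * poisson_wave (r n) (c + x t - \<mu> * y) \<partial>lborel)" for n t
  have hm [measurable]: "h n \<in> borel_measurable borel" for n unfolding h_def by measurable
  have kb: "\<bar>K y * poisson_wave (r n) v\<bar> \<le> 2 * K y" for n y v
    using mult_left_mono[OF poisson_wave_bounded[OF r(1)[of n] r(2)[of n], of v] K(2)[of y]] K(2)[of y] by (simp add: abs_mult mult.commute)
  have ki: "integrable lborel (\<lambda>y. K y * poisson_wave (r n) (c + x t - \<mu> * y))" for n t
    by (rule Bochner_Integration.integrable_bound[of _ "\<lambda>y. 2 * K y"]) (use K kb in \<open>auto intro!: AE_I2 order_trans[OF kb]\<close>)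
  have hb: "\<bar>h n t\<bar> \<le> 2" for n t
  proof -
    have "\<bar>h n t\<bar> \<le> (\<integral>y. \<bar>K y * poisson_wave (r n) (c + x t - \<mu> * y)\<bar> \<partial>lborel)"
      unfolding h_def by (rule integral_abs_bound)
    also have "\<dots> \<le> (\<integral>y. 2 * K y \<partial>lborel)" by (rule integral_mono) (use ki K kb in auto)
    finally show ?thesis using K by simp
  qed
  have hl: "(\<lambda>n. h n t) \<longlonglongrightarrow> (\<integral>y. K y * sgn (sin (pi * (c + x t - \<mu> * y))) \<partial>lborel)" for t
    unfolding h_def
  proof (rule integral_dominated_convergence[where w="\<lambda>y. 2 * K y"])
    \<comment> \<open>The regularised waves are shown to converge to the sign only away from the
      jumps; these are countably many values of \<open>y\<close> because \<mu> is nonzero.\<close>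
    have "countable {y. sin (pi * (c + x t - \<mu> * y)) = 0}"
    proof (rule countable_subset)
      show "{y. sin (pi * (c + x t - \<mu> * y)) = 0} \<subseteq> (\<lambda>i. (c + x t - of_int i) / \<mu>) ` UNIV"
      proof
        fix y assume "y \<in> {y. sin (pi * (c + x t - \<mu> * y)) = 0}"
        then have "\<exists>i::int. pi * (c + x t - \<mu> * y) = of_int i * pi" by (simp only: mem_Collect_eq sin_zero_iff_int2)
        then obtain i :: int where "pi * (c + x t - \<mu> * y) = pi * of_int i" by (auto simp: mult.commute)
        then have "c + x t - \<mu> * y = of_int i" by (simp only: mult_cancel_left) simp
        then have "y = (c + x t - of_int i) / \<mu>" using \<mu> by (simp add: field_simps)
        then show "y \<in> (\<lambda>i. (c + x t - of_int i) / \<mu>) ` UNIV" by blast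
      qed
    qed simp
    then have "AE y in lborel. y \<notin> {y. sin (pi * (c + x t - \<mu> * y)) = 0}"
      by (intro AE_not_in countable_imp_null_set_lborel)
    then show "AE y in lborel. (\<lambda>n. K y * poisson_wave (r n) (c + x t - \<mu> * y)) \<longlonglongrightarrow> K y * sgn (sin (pi * (c + x t - \<mu> * y)))"
      unfolding r_def by eventually_elim (intro tendsto_mult tendsto_const poisson_wave_tendsto, simp)
  qed (use K kb in auto)
  have lim: "(\<lambda>n. \<integral>t. \<eta> t * h n t \<partial>lborel) \<longlonglongrightarrow> (\<integral>t. \<eta> t * (\<integral>y. K y * sgn (sin (pi * (c + x t - \<mu> * y))) \<partial>lborel) \<partial>lborel)"
  proof (rule integral_dominated_convergence[where w="\<lambda>t. 2 * \<bar>\<eta> t\<bar>"])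
    show "AE t in lborel. (\<lambda>n. \<eta> t * h n t) \<longlonglongrightarrow> \<eta> t * (\<integral>y. K y * sgn (sin (pi * (c + x t - \<mu> * y))) \<partial>lborel)"
      by (intro AE_I2 tendsto_mult tendsto_const hl)
    show "AE t in lborel. norm (\<eta> t * h n t) \<le> 2 * \<bar>\<eta> t\<bar>" for n
      using mult_left_mono[OF hb[of n] abs_ge_zero] by (intro AE_I2) (simp add: abs_mult mult.commute)
  qed (use \<eta> in auto)
  have bound: "\<bar>\<integral>t. \<eta> t * h n t \<partial>lborel\<bar> \<le> ?bd" for n
  proof -
    have I: "integrable (lborel \<Otimes>\<^sub>M lborel) (\<lambda>(t, y). \<eta> t * (K y * poisson_wave (r n) (c + x t - \<mu> * y)))"
    proof (rule Bochner_Integration.integrable_bound)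
      show "integrable (lborel \<Otimes>\<^sub>M lborel) (\<lambda>(t, y). \<eta> t * (2 * K y))"
        using lborel_pair.Fubini_integrable[of "\<lambda>(t, y). \<eta> t * (2 * K y)"] \<eta> K by (auto simp: abs_mult)
      show "AE p in lborel \<Otimes>\<^sub>M lborel. norm (case p of (t, y) \<Rightarrow> \<eta> t * (K y * poisson_wave (r n) (c + x t - \<mu> * y)))
          \<le> norm (case p of (t, y) \<Rightarrow> \<eta> t * (2 * K y))"
      proof (intro AE_I2, clarify)
        fix t y
        have "\<bar>\<eta> t\<bar> * \<bar>K y * poisson_wave (r n) (c + x t - \<mu> * y)\<bar> \<le> \<bar>\<eta> t\<bar> * (2 * K y)"
          by (rule mult_left_mono[OF kb]) simp
        then show "norm (\<eta> t * (K y * poisson_wave (r n) (c + x t - \<mu> * y))) \<le> norm (\<eta> t * (2 * K y))"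
          using K(2)[of y] by (simp add: abs_mult)
      qed
    qed measurable
    have "(\<integral>t. \<eta> t * h n t \<partial>lborel) = (\<integral>t. (\<integral>y. \<eta> t * (K y * poisson_wave (r n) (c + x t - \<mu> * y)) \<partial>lborel) \<partial>lborel)"
      unfolding h_def by simp
    also have "\<dots> = (\<integral>y. (\<integral>t. \<eta> t * (K y * poisson_wave (r n) (c + x t - \<mu> * y)) \<partial>lborel) \<partial>lborel)"
      using lborel_pair.Fubini_integral[OF I] by simp
    also have "\<dots> = (\<integral>y. K y * (\<integral>t. \<eta> t * poisson_wave (r n) (c + x t - \<mu> * y) \<partial>lborel) \<partial>lborel)"
    proof (rule Bochner_Integration.integral_cong[OF refl])
      fix y
      have "(\<lambda>t. \<eta> t * (K y * poisson_wave (r n) (c + x t - \<mu> * y))) = (\<lambda>t. K y * (\<eta> t * poisson_wave (r n) (c + x t - \<mu> * y)))"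
        by (rule ext) (rule mult.left_commute)
      then show "(\<integral>t. \<eta> t * (K y * poisson_wave (r n) (c + x t - \<mu> * y)) \<partial>lborel)
          = K y * (\<integral>t. \<eta> t * poisson_wave (r n) (c + x t - \<mu> * y) \<partial>lborel)"
        by (simp only: integral_mult_right_zero)
    qed
    also have "\<bar>\<dots>\<bar> \<le> (\<integral>y. \<bar>K y * (\<integral>t. \<eta> t * poisson_wave (r n) (c + x t - \<mu> * y) \<partial>lborel)\<bar> \<partial>lborel)"
      by (rule integral_abs_bound)
    also have "\<dots> \<le> (\<integral>y. K y * ?bd \<partial>lborel)"
    proof (rule integral_mono)
      have b: "\<bar>\<integral>t. \<eta> t * poisson_wave (r n) (c + x t - \<mu> * y) \<partial>lborel\<bar> \<le> ?bd" for y
        using poisson_wave_integral_bound[OF \<eta> _ r(1)[of n] r(2)[of n] sm, of "c - \<mu> * y"] by (simp add: algebra_simps)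
      show le: "\<bar>K y * (\<integral>t. \<eta> t * poisson_wave (r n) (c + x t - \<mu> * y) \<partial>lborel)\<bar> \<le> K y * ?bd" for y
        unfolding abs_mult abs_of_nonneg[OF K(2)] by (rule mult_left_mono[OF b K(2)])
      show *: "integrable lborel (\<lambda>y. K y * ?bd)" using K by simp
      show "integrable lborel (\<lambda>y. \<bar>K y * (\<integral>t. \<eta> t * poisson_wave (r n) (c + x t - \<mu> * y) \<partial>lborel)\<bar>)"
      proof (rule Bochner_Integration.integrable_bound[OF *])
        show "(\<lambda>y. \<bar>K y * (\<integral>t. \<eta> t * poisson_wave (r n) (c + x t - \<mu> * y) \<partial>lborel)\<bar>) \<in> borel_measurable lborel"
          using r[of n] by measurable
        show "AE y in lborel. norm \<bar>K y * (\<integral>t. \<eta> t * poisson_wave (r n) (c + x t - \<mu> * y) \<partial>lborel)\<bar> \<le> norm (K y * ?bd)"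
          by (intro AE_I2) (simp only: real_norm_def abs_idempotent order_trans[OF le abs_ge_self])
      qed
    qed
    also have "\<dots> = ?bd" using K by simp
    finally show ?thesis .
  qed
  show ?thesis
    by (rule LIMSEQ_le_const2[OF tendsto_rabs[OF lim]]) (use bound in auto)
qed

section \<open>Second moments of oscillating time integrals\<close>

lemma integral_exp_abs_le:
  fixes a s :: real
  assumes a: "0 < a"
  shows "integrable lborel (\<lambda>t. exp (- a * \<bar>t - s\<bar>))" and "(\<integral>t. exp (- a * \<bar>t - s\<bar>) \<partial>lborel) \<le> 2 / a"
proof -
  let ?d = "exponential_density a"
  interpret D: prob_space "density lborel ?d" by (rule prob_space_exponential_density[OF a])
  have nn: "0 \<le> ?d x" for x by (rule exponential_density_nonneg[OF a])
  have i1: "integrable lborel ?d"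
    using D.integrable_const[of "1::real"] nn by (subst (asm) integrable_density) auto
  have v1: "(\<integral>x. ?d x \<partial>lborel) = 1"
  proof -
    have "(\<integral>x. (1::real) \<partial>density lborel ?d) = (\<integral>x. ?d x *\<^sub>R 1 \<partial>lborel)"
      using nn by (intro integral_density) auto
    then show ?thesis using D.prob_space by simp
  qed
  have i2: "integrable lborel (\<lambda>t. ?d (- s + 1 * t))" "integrable lborel (\<lambda>t. ?d (s + (-1) * t))"
    by (rule lborel_integrable_real_affine[OF i1], simp)+
  have v2: "(\<integral>t. ?d (- s + 1 * t) \<partial>lborel) = 1" "(\<integral>t. ?d (s + (-1) * t) \<partial>lborel) = 1"
    using lborel_integral_real_affine[of 1 ?d "- s"] lborel_integral_real_affine[of "-1" ?d s] v1 by auto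
  have i3: "integrable lborel (\<lambda>t. (?d (- s + 1 * t) + ?d (s + (-1) * t)) / a)"
    using i2 by simp
  \<comment> \<open>On either side of \<open>s\<close> one of the two exponential densities equals a
    times the left-hand side.\<close>
  have le: "exp (- a * \<bar>t - s\<bar>) \<le> (?d (- s + 1 * t) + ?d (s + (-1) * t)) / a" for t
    using a by (auto simp: exponential_density_def field_simps abs_if)
  show i: "integrable lborel (\<lambda>t. exp (- a * \<bar>t - s\<bar>))"
    by (rule Bochner_Integration.integrable_bound[OF i3])
      (measurable, intro AE_I2, simp only: real_norm_def abs_exp_cancel order_trans[OF le abs_ge_self])
  have "(\<integral>t. exp (- a * \<bar>t - s\<bar>) \<partial>lborel) \<le> (\<integral>t. (?d (- s + 1 * t) + ?d (s + (-1) * t)) / a \<partial>lborel)"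
    by (rule integral_mono[OF i i3 le])
  also have "\<dots> = 2 / a" using i2 v2 by simp
  finally show "(\<integral>t. exp (- a * \<bar>t - s\<bar>) \<partial>lborel) \<le> 2 / a" .
qed

text \<open>The squared modulus expands into a double time integral of the characteristic function
  of \<open>B t - B s\<close>. One copy of \<eta> is estimated by its supremum \<open>E\<close>, the
  exponential decay integrates to at most 2/a, and the other copy of \<eta> has mass 1.\<close>

lemma (in prob_space) oscillation_second_moment:
  fixes B :: "real \<Rightarrow> 'a \<Rightarrow> real" and \<eta> :: "real \<Rightarrow> real"
  assumes Bm [measurable]: "(\<lambda>p. B (fst p) (snd p)) \<in> borel_measurable (lborel \<Otimes>\<^sub>M M)"
    and [measurable]: "\<eta> \<in> borel_measurable borel"
    and \<eta>: "\<And>t. 0 \<le> \<eta> t" "\<And>t. \<eta> t \<le> E" "integrable lborel \<eta>" "(\<integral>t. \<eta> t \<partial>lborel) = 1"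
      "\<And>t. \<eta> t \<noteq> 0 \<Longrightarrow> t \<in> T"
    and char: "\<And>s t. s \<in> T \<Longrightarrow> t \<in> T \<Longrightarrow> norm (\<integral>\<omega>. cis (\<xi> * (B t \<omega> - B s \<omega>)) \<partial>M) \<le> K * exp (- a * \<bar>t - s\<bar>)"
    and a: "0 < a" and K: "0 \<le> K"
  shows "(\<integral>\<omega>. (norm (\<integral>t. \<eta> t *\<^sub>R cis (\<xi> * B t \<omega>) \<partial>lborel))\<^sup>2 \<partial>M) \<le> 2 * K * E / a"
proof -
  have [measurable]: "(\<lambda>p. B (snd p) (fst p)) \<in> borel_measurable (M \<Otimes>\<^sub>M lborel)"
    using measurable_compose[OF measurable_pair_swap' Bm] by (simp add: split_beta)
  have Bt [measurable]: "B t \<in> borel_measurable M" for t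
    using measurable_compose[OF measurable_Pair1'[of t lborel M] Bm] by simp
  interpret P: pair_sigma_finite lborel M ..
  interpret Q: pair_sigma_finite M lborel ..
  define g where "g \<omega> = (\<integral>t. \<eta> t *\<^sub>R cis (\<xi> * B t \<omega>) \<partial>lborel)" for \<omega>
  have [measurable]: "g \<in> borel_measurable M" unfolding g_def by measurable
  have Bs: "(\<lambda>t. B t \<omega>) \<in> borel_measurable borel" if "\<omega> \<in> space M" for \<omega>
    using measurable_compose[OF measurable_Pair2'[OF that] Bm] by simp
  have ei: "integrable lborel (\<lambda>t. \<eta> t *\<^sub>R cis (\<xi> * B t \<omega>))" if "\<omega> \<in> space M" for \<omega>
    using Bs[OF that] by (intro Bochner_Integration.integrable_bound[OF \<eta>(3)]) auto
  have g1: "norm (g \<omega>) \<le> 1" if "\<omega> \<in> space M" for \<omega>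
  proof -
    have "norm (g \<omega>) \<le> (\<integral>t. norm (\<eta> t *\<^sub>R cis (\<xi> * B t \<omega>)) \<partial>lborel)" unfolding g_def by (rule integral_norm_bound)
    then show ?thesis using \<eta> by simp
  qed
  have [measurable]: "cnj \<in> borel_measurable borel" by (intro borel_measurable_continuous_onI continuous_intros)
  \<comment> \<open>The conjugate factor is kept as \<open>g\<close> while the outer time integral
    is exchanged with the expectation. Each exchange then involves just one time variable and
    \<omega>, and no triple integral appears.\<close>
  define inner where "inner t = (\<integral>\<omega>. cis (\<xi> * B t \<omega>) * cnj (g \<omega>) \<partial>M)" for t
  have E0: "0 \<le> E" using \<eta>(1,2) order_trans by blast
  have innerb: "norm (inner t) \<le> 2 * K * E / a" if t: "t \<in> T" for t
  proof -
    have I: "integrable (M \<Otimes>\<^sub>M lborel) (\<lambda>(\<omega>, s). \<eta> s *\<^sub>R cis (\<xi> * (B t \<omega> - B s \<omega>)))"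
    proof (rule Q.Fubini_integrable)
      show "(\<lambda>(\<omega>, s). \<eta> s *\<^sub>R cis (\<xi> * (B t \<omega> - B s \<omega>))) \<in> borel_measurable (M \<Otimes>\<^sub>M lborel)"
        unfolding split_beta by measurable
      show "integrable M (\<lambda>\<omega>. \<integral>s. norm (case (\<omega>, s) of (\<omega>, s) \<Rightarrow> \<eta> s *\<^sub>R cis (\<xi> * (B t \<omega> - B s \<omega>))) \<partial>lborel)"
        using \<eta> by simp
      show "AE \<omega> in M. integrable lborel (\<lambda>s. case (\<omega>, s) of (\<omega>, s) \<Rightarrow> \<eta> s *\<^sub>R cis (\<xi> * (B t \<omega> - B s \<omega>)))"
        using Bs by (intro AE_I2) (auto intro!: Bochner_Integration.integrable_bound[OF \<eta>(3)])
    qed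
    have "inner t = (\<integral>\<omega>. (\<integral>s. \<eta> s *\<^sub>R cis (\<xi> * (B t \<omega> - B s \<omega>)) \<partial>lborel) \<partial>M)"
      unfolding inner_def
    proof (rule Bochner_Integration.integral_cong[OF refl])
      fix \<omega> assume "\<omega> \<in> space M"
      have "cis (\<xi> * B t \<omega>) * cnj (g \<omega>) = (\<integral>s. cis (\<xi> * B t \<omega>) * cnj (\<eta> s *\<^sub>R cis (\<xi> * B s \<omega>)) \<partial>lborel)"
        unfolding g_def by (simp only: Bochner_Integration.integral_cnj integral_mult_right_zero)
      also have "(\<lambda>s. cis (\<xi> * B t \<omega>) * cnj (\<eta> s *\<^sub>R cis (\<xi> * B s \<omega>))) = (\<lambda>s. \<eta> s *\<^sub>R cis (\<xi> * (B t \<omega> - B s \<omega>)))"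
        by (simp add: fun_eq_iff cis_cnj cis_mult right_diff_distrib)
      finally show "cis (\<xi> * B t \<omega>) * cnj (g \<omega>) = (\<integral>s. \<eta> s *\<^sub>R cis (\<xi> * (B t \<omega> - B s \<omega>)) \<partial>lborel)" .
    qed
    also have "\<dots> = (\<integral>s. (\<integral>\<omega>. \<eta> s *\<^sub>R cis (\<xi> * (B t \<omega> - B s \<omega>)) \<partial>M) \<partial>lborel)"
      using Q.Fubini_integral[OF I] by simp
    also have "norm \<dots> \<le> (\<integral>s. norm (\<integral>\<omega>. \<eta> s *\<^sub>R cis (\<xi> * (B t \<omega> - B s \<omega>)) \<partial>M) \<partial>lborel)"
      by (rule integral_norm_bound)
    also have "\<dots> \<le> (\<integral>s. E * (K * exp (- a * \<bar>s - t\<bar>)) \<partial>lborel)"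
    proof (rule integral_mono)
      show "integrable lborel (\<lambda>s. norm (\<integral>\<omega>. \<eta> s *\<^sub>R cis (\<xi> * (B t \<omega> - B s \<omega>)) \<partial>M))"
        using Q.integrable_snd[OF I] by (intro integrable_norm) simp
      show "integrable lborel (\<lambda>s. E * (K * exp (- a * \<bar>s - t\<bar>)))"
        using integral_exp_abs_le(1)[OF a] by simp
      fix s
      show "norm (\<integral>\<omega>. \<eta> s *\<^sub>R cis (\<xi> * (B t \<omega> - B s \<omega>)) \<partial>M) \<le> E * (K * exp (- a * \<bar>s - t\<bar>))"
      proof (cases "\<eta> s = 0")
        case False
        have "norm (\<integral>\<omega>. \<eta> s *\<^sub>R cis (\<xi> * (B t \<omega> - B s \<omega>)) \<partial>M) = \<eta> s * norm (\<integral>\<omega>. cis (\<xi> * (B t \<omega> - B s \<omega>)) \<partial>M)"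
          using \<eta>(1)[of s] by simp
        also have "\<dots> \<le> E * (K * exp (- a * \<bar>t - s\<bar>))"
          using \<eta>(1,2)[of s] E0 by (intro mult_mono char t \<eta>(5)[OF False]) auto
        finally show ?thesis by (simp add: abs_minus_commute)
      qed (use E0 K in simp)
    qed
    also have "\<dots> = E * K * (\<integral>s. exp (- a * \<bar>s - t\<bar>) \<partial>lborel)" by (simp add: mult.assoc)
    also have "\<dots> \<le> E * K * (2 / a)"
      using integral_exp_abs_le(2)[OF a, of t] E0 K by (intro mult_left_mono) auto
    finally show ?thesis by (simp add: mult_ac)
  qed
  have J: "integrable (lborel \<Otimes>\<^sub>M M) (\<lambda>(t, \<omega>). \<eta> t *\<^sub>R (cis (\<xi> * B t \<omega>) * cnj (g \<omega>)))"
  proof (rule P.Fubini_integrable)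
    show "(\<lambda>(t, \<omega>). \<eta> t *\<^sub>R (cis (\<xi> * B t \<omega>) * cnj (g \<omega>))) \<in> borel_measurable (lborel \<Otimes>\<^sub>M M)"
      unfolding split_beta by measurable
    have gi: "integrable M (\<lambda>\<omega>. norm (g \<omega>))"
      by (rule integrable_const_bound[where B=1]) (use g1 in auto)
    show "integrable lborel (\<lambda>t. \<integral>\<omega>. norm (case (t, \<omega>) of (t, \<omega>) \<Rightarrow> \<eta> t *\<^sub>R (cis (\<xi> * B t \<omega>) * cnj (g \<omega>))) \<partial>M)"
      using \<eta> by (simp add: norm_mult)
    show "AE t in lborel. integrable M (\<lambda>\<omega>. case (t, \<omega>) of (t, \<omega>) \<Rightarrow> \<eta> t *\<^sub>R (cis (\<xi> * B t \<omega>) * cnj (g \<omega>)))"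
    proof (intro AE_I2, simp only: prod.case)
      fix t
      have "integrable M (\<lambda>\<omega>. cis (\<xi> * B t \<omega>) * cnj (g \<omega>))"
        by (rule Bochner_Integration.integrable_bound[OF gi]) (auto simp: norm_mult)
      then show "integrable M (\<lambda>\<omega>. \<eta> t *\<^sub>R (cis (\<xi> * B t \<omega>) * cnj (g \<omega>)))" by simp
    qed
  qed
  have "complex_of_real (\<integral>\<omega>. (norm (g \<omega>))\<^sup>2 \<partial>M) = (\<integral>\<omega>. g \<omega> * cnj (g \<omega>) \<partial>M)"
    unfolding integral_complex_of_real[symmetric]
    by (intro Bochner_Integration.integral_cong refl) (rule complex_norm_square)
  also have "\<dots> = (\<integral>\<omega>. (\<integral>t. \<eta> t *\<^sub>R (cis (\<xi> * B t \<omega>) * cnj (g \<omega>)) \<partial>lborel) \<partial>M)"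
    by (intro Bochner_Integration.integral_cong refl)
      (simp only: g_def integral_mult_left_zero[symmetric] mult_scaleR_left)
  also have "\<dots> = (\<integral>t. (\<integral>\<omega>. \<eta> t *\<^sub>R (cis (\<xi> * B t \<omega>) * cnj (g \<omega>)) \<partial>M) \<partial>lborel)"
    using P.Fubini_integral[OF J] by simp
  also have "\<dots> = (\<integral>t. \<eta> t *\<^sub>R inner t \<partial>lborel)" by (simp add: inner_def)
  finally have eq: "complex_of_real (\<integral>\<omega>. (norm (g \<omega>))\<^sup>2 \<partial>M) = (\<integral>t. \<eta> t *\<^sub>R inner t \<partial>lborel)" .
  have "(\<integral>\<omega>. (norm (g \<omega>))\<^sup>2 \<partial>M) \<le> norm (complex_of_real (\<integral>\<omega>. (norm (g \<omega>))\<^sup>2 \<partial>M))" by simp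
  also have "\<dots> \<le> (\<integral>t. norm (\<eta> t *\<^sub>R inner t) \<partial>lborel)" unfolding eq by (rule integral_norm_bound)
  also have "\<dots> \<le> (\<integral>t. \<eta> t * (2 * K * E / a) \<partial>lborel)"
  proof (rule integral_mono)
    show "integrable lborel (\<lambda>t. norm (\<eta> t *\<^sub>R inner t))"
      using P.integrable_fst'[OF J] by (intro integrable_norm) (simp add: inner_def)
    show "integrable lborel (\<lambda>t. \<eta> t * (2 * K * E / a))" using \<eta> by simp
    fix t show "norm (\<eta> t *\<^sub>R inner t) \<le> \<eta> t * (2 * K * E / a)"
    proof (cases "\<eta> t = 0")
      case False
      show ?thesis unfolding norm_scaleR abs_of_nonneg[OF \<eta>(1)]
        by (rule mult_left_mono[OF innerb \<eta>(1)]) (rule \<eta>(5)[OF False])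
    qed simp
  qed
  also have "\<dots> = 2 * K * E / a" using \<eta> by simp
  finally show ?thesis unfolding g_def .
qed

lemma (in prob_space) expectation_le_sqrt_second_moment:
  fixes X :: "'a \<Rightarrow> real"
  assumes "integrable M X" "integrable M (\<lambda>\<omega>. (X \<omega>)\<^sup>2)" "(\<integral>\<omega>. (X \<omega>)\<^sup>2 \<partial>M) \<le> b"
  shows "(\<integral>\<omega>. X \<omega> \<partial>M) \<le> sqrt b"
proof (rule real_le_rsqrt)
  show "(\<integral>\<omega>. X \<omega> \<partial>M)\<^sup>2 \<le> b"
    using variance_positive[of X] variance_eq[OF assms(1,2)] assms(3) by linarith
qed

lemma summable_powr_odd: "0 < p \<Longrightarrow> summable (\<lambda>n. real (2 * n + 1) powr (- 1 - p))"
proof (rule summable_comparison_test'[where N=1])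
  assume p: "0 < p"
  then show "summable (\<lambda>n. real n powr (- 1 - p))" by (subst summable_real_powr_iff) simp
  show "norm (real (2 * n + 1) powr (- 1 - p)) \<le> real n powr (- 1 - p)" if "1 \<le> n" for n
    using that p by (simp, intro powr_mono2') auto
qed

text \<open>The Fourier series of a square wave along the path \<open>w\<close>, with its
  coefficients 1/(2n+1) and phases removed by the norm. Values in \<open>ennreal\<close> allow
  expectation and sum to be exchanged before finiteness is known; finiteness then holds almost
  surely because the expectation is finite.\<close>

definition wave_sum :: "(real \<Rightarrow> real) \<Rightarrow> real \<Rightarrow> (real \<Rightarrow> real) \<Rightarrow> ennreal" where
  "wave_sum \<eta> \<zeta> w = (\<Sum>n. ennreal (norm (\<integral>t. \<eta> t *\<^sub>R cis (real (2 * n + 1) * \<zeta> * w t) \<partial>lborel) / real (2 * n + 1)))"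

text \<open>The root of the second moment at frequency (2n+1) \<zeta> is of order ((2n+1)
  \<zeta>)^(-\<theta>/2). Together with the coefficient 1/(2n+1) this is summable in n for every
  \<theta> > 0, leaving the factor \<zeta>^(-\<theta>/2).\<close>

lemma (in prob_space) wave_sum_expectation:
  fixes B :: "real \<Rightarrow> 'a \<Rightarrow> real" and \<eta> :: "real \<Rightarrow> real"
  assumes Bm [measurable]: "(\<lambda>p. B (fst p) (snd p)) \<in> borel_measurable (lborel \<Otimes>\<^sub>M M)"
    and [measurable]: "\<eta> \<in> borel_measurable borel"
    and \<eta>: "\<And>t. 0 \<le> \<eta> t" "\<And>t. \<eta> t \<le> E" "integrable lborel \<eta>" "(\<integral>t. \<eta> t \<partial>lborel) = 1"
      "\<And>t. \<eta> t \<noteq> 0 \<Longrightarrow> t \<in> T"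
    and char: "\<And>s t \<xi>. s \<in> T \<Longrightarrow> t \<in> T \<Longrightarrow> 1 \<le> \<xi> \<Longrightarrow>
      norm (\<integral>\<omega>. cis (\<xi> * (B t \<omega> - B s \<omega>)) \<partial>M) \<le> K * exp (- c * \<xi> powr \<theta> * \<bar>t - s\<bar>)"
    and c: "0 < c" and \<theta>: "0 < \<theta>" and K: "0 \<le> K" and \<zeta>: "1 \<le> \<zeta>"
  shows "(\<integral>\<^sup>+\<omega>. wave_sum \<eta> \<zeta> (\<lambda>t. B t \<omega>) \<partial>M)
     \<le> ennreal (sqrt (2 * K / c) * (\<Sum>n. real (2 * n + 1) powr (- 1 - \<theta> / 2)) * (sqrt E * \<zeta> powr (- \<theta> / 2)))"
proof -
  have [measurable]: "(\<lambda>p. B (snd p) (fst p)) \<in> borel_measurable (M \<Otimes>\<^sub>M lborel)"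
    using measurable_compose[OF measurable_pair_swap' Bm] by (simp add: split_beta)
  have E0: "0 \<le> E" using \<eta>(1,2) order_trans by blast
  define m where "m n \<omega> = norm (\<integral>t. \<eta> t *\<^sub>R cis (real (2 * n + 1) * \<zeta> * B t \<omega>) \<partial>lborel)" for n \<omega>
  have mm [measurable]: "m n \<in> borel_measurable M" for n unfolding m_def by measurable
  have m1: "m n \<omega> \<le> 1" for n \<omega>
  proof -
    have "m n \<omega> \<le> (\<integral>t. norm (\<eta> t *\<^sub>R cis (real (2 * n + 1) * \<zeta> * B t \<omega>)) \<partial>lborel)" unfolding m_def by (rule integral_norm_bound)
    then show ?thesis using \<eta> by simp
  qed
  have m0: "0 \<le> m n \<omega>" for n \<omega> by (simp add: m_def)
  have mi: "integrable M (m n)" "integrable M (\<lambda>\<omega>. (m n \<omega>)\<^sup>2)" for n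
    using m0 m1 by (auto intro!: integrable_const_bound[where B=1] simp: power_le_one)
  have pw: "(\<integral>\<omega>. m n \<omega> \<partial>M) \<le> sqrt (2 * K / c) * (sqrt E * \<zeta> powr (- \<theta> / 2)) * real (2 * n + 1) powr (- \<theta> / 2)" for n
  proof -
    define \<xi> where "\<xi> = real (2 * n + 1) * \<zeta>"
    have \<xi>: "1 \<le> \<xi>" unfolding \<xi>_def using \<zeta> mult_mono[of 1 "real (2 * n + 1)" 1 \<zeta>] by simp
    have "(\<integral>\<omega>. (m n \<omega>)\<^sup>2 \<partial>M) \<le> 2 * K * E / (c * \<xi> powr \<theta>)"
      unfolding m_def \<xi>_def[symmetric]
      by (rule oscillation_second_moment[OF Bm _ \<eta>]) (use char[OF _ _ \<xi>] c \<xi> K in \<open>auto simp: mult.assoc\<close>)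
    from expectation_le_sqrt_second_moment[OF mi this]
    have "(\<integral>\<omega>. m n \<omega> \<partial>M) \<le> sqrt (2 * K * E / (c * \<xi> powr \<theta>))" .
    also have "\<dots> = sqrt (2 * K / c) * sqrt E * sqrt (1 / \<xi> powr \<theta>)"
      unfolding real_sqrt_mult[symmetric] by simp
    also have "sqrt (1 / \<xi> powr \<theta>) = \<xi> powr (- \<theta> / 2)"
      using \<xi> by (simp add: powr_half_sqrt[symmetric] powr_powr powr_minus_divide[symmetric])
    also have "\<dots> = \<zeta> powr (- \<theta> / 2) * real (2 * n + 1) powr (- \<theta> / 2)"
      unfolding \<xi>_def by (subst powr_mult) (use \<zeta> in auto)
    finally show ?thesis by (simp only: mult_ac)
  qed
  let ?C = "sqrt (2 * K / c) * (sqrt E * \<zeta> powr (- \<theta> / 2))"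
  have C0: "0 \<le> ?C" using K c E0 by simp
  have sm: "summable (\<lambda>n. real (2 * n + 1) powr (- 1 - \<theta> / 2))" by (rule summable_powr_odd) (use \<theta> in simp)
  have "(\<integral>\<^sup>+\<omega>. wave_sum \<eta> \<zeta> (\<lambda>t. B t \<omega>) \<partial>M) = (\<integral>\<^sup>+\<omega>. (\<Sum>n. ennreal (m n \<omega> / real (2 * n + 1))) \<partial>M)"
    by (simp add: wave_sum_def m_def)
  also have "\<dots> = (\<Sum>n. \<integral>\<^sup>+\<omega>. ennreal (m n \<omega> / real (2 * n + 1)) \<partial>M)"
    by (rule nn_integral_suminf) measurable
  also have "\<dots> \<le> (\<Sum>n. ennreal (?C * real (2 * n + 1) powr (- 1 - \<theta> / 2)))"
  proof (rule suminf_le)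
    fix n
    have "(\<integral>\<^sup>+\<omega>. ennreal (m n \<omega> / real (2 * n + 1)) \<partial>M) = ennreal (\<integral>\<omega>. m n \<omega> / real (2 * n + 1) \<partial>M)"
      by (rule nn_integral_eq_integral) (use mi m0 in auto)
    also have "(\<integral>\<omega>. m n \<omega> / real (2 * n + 1) \<partial>M) = (\<integral>\<omega>. m n \<omega> \<partial>M) / real (2 * n + 1)" by simp
    also have "\<dots> \<le> (?C * real (2 * n + 1) powr (- \<theta> / 2)) / real (2 * n + 1)"
      by (rule divide_right_mono[OF pw]) simp
    also have "\<dots> = ?C * (real (2 * n + 1) powr (- \<theta> / 2) / real (2 * n + 1) powr 1)" by simp
    also have "\<dots> = ?C * real (2 * n + 1) powr (- 1 - \<theta> / 2)"
    proof -
      have "- \<theta> / 2 - 1 = - 1 - \<theta> / 2" by simp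
      then show ?thesis unfolding powr_diff[symmetric] by (simp only:)
    qed
    finally show "(\<integral>\<^sup>+\<omega>. ennreal (m n \<omega> / real (2 * n + 1)) \<partial>M) \<le> ennreal (?C * real (2 * n + 1) powr (- 1 - \<theta> / 2))"
      by (simp add: ennreal_leI)
  qed auto
  also have "\<dots> = ennreal (\<Sum>n. ?C * real (2 * n + 1) powr (- 1 - \<theta> / 2))"
    by (rule suminf_ennreal2) (use C0 sm in \<open>auto intro!: summable_mult\<close>)
  also have "(\<Sum>n. ?C * real (2 * n + 1) powr (- 1 - \<theta> / 2)) = ?C * (\<Sum>n. real (2 * n + 1) powr (- 1 - \<theta> / 2))"
    by (rule suminf_mult[OF sm])
  finally show ?thesis by (simp only: mult_ac)
qed

section \<open>Square-wave shears\<close>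

definition par :: "int \<Rightarrow> real" where
  "par n = (if even n then 1 else -1)"

lemma par_add: "par (m + n) = par m * par n"
  by (auto simp: par_def)

lemma par_simps [simp]: "\<bar>par n\<bar> = 1" "par 0 = 1" "par (2 * n) = 1" "par (4 * n) = 1" "par (8 * n) = 1"
  by (auto simp: par_def)

text \<open>The slope of the zigzag: the parity of the fine index alternates on cells of width
  \<open>b\<close>, and the parity of the coarse index is the change of sign from one half period
  \<open>A\<close> to the next.\<close>

definition wave :: "real \<Rightarrow> real \<Rightarrow> real \<Rightarrow> real" where
  "wave A b z = par (\<lfloor>z / b\<rfloor> + \<lfloor>z / A\<rfloor>)"

lemma wave_bounds [simp]: "\<bar>wave A b z\<bar> = 1"
  by (simp add: wave_def)

lemma wave_cases: "wave A b z = 1 \<or> wave A b z = -1"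
  by (auto simp: wave_def par_def)

lemma wave_measurable [measurable]: "wave A b \<in> borel_measurable borel"
proof -
  have "(\<lambda>z. par (\<lfloor>z / b\<rfloor> + \<lfloor>z / A\<rfloor>)) \<in> borel_measurable borel"
  proof (rule measurable_compose[where N="count_space UNIV" and g=par])
    show "(\<lambda>z. \<lfloor>z / b\<rfloor> + \<lfloor>z / A\<rfloor>) \<in> measurable borel (count_space UNIV)" by measurable
  qed simp
  then show ?thesis unfolding wave_def[abs_def] .
qed

text \<open>After reduction to one period 2A, the second half is compared with the first by a shift
  of A = 4 k b. This moves the fine cell index by an even number, so the fine parity is kept and the
  sign change of \<phi> is carried by the coarse index alone.\<close>

lemma zigzag_deriv:
  assumes zz: "zigzag A b \<phi>" and b: "0 < b" and A: "A = 4 * real k * b" "0 < k" and z: "\<And>i::int. z \<noteq> of_int i * b"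
  shows "deriv \<phi> z = wave A b z"
proof -
  have A0: "0 < A" using A b by simp
  have per: "\<phi> (x + 2 * A) = \<phi> x" for x using zz by (simp add: zigzag_def)
  have pern: "\<phi> (x + of_int m * (2 * A)) = \<phi> x" for x and m :: int
  proof (induction m rule: int_induct[where k=0])
    case (step1 i) then show ?case using per[of "x + of_int i * (2 * A)"] by (simp add: algebra_simps)
  next
    case (step2 i) then show ?case using per[of "x + of_int (i - 1) * (2 * A)"] by (simp add: algebra_simps)
  qed simp
  have C: "(\<phi> has_real_derivative par \<lfloor>x / b\<rfloor>) (at x)" if x: "0 < x" "x < A" "\<And>i::int. x \<noteq> of_int i * b" for x
  proof -
    define i where "i = nat \<lfloor>x / (2 * b)\<rfloor>"
    have fl0: "0 \<le> \<lfloor>x / (2 * b)\<rfloor>" using x b by simp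
    then have ir: "real i = of_int \<lfloor>x / (2 * b)\<rfloor>" by (simp add: i_def)
    have "real i \<le> x / (2 * b)" "x / (2 * b) < real i + 1" unfolding ir by linarith+
    then have i1: "2 * real i * b \<le> x" "x < 2 * (real i + 1) * b" using b by (auto simp: field_simps)
    have "x / (2 * b) < 2 * real k" using x A b by (simp add: field_simps)
    then have "\<lfloor>x / (2 * b)\<rfloor> < 2 * int k" by (simp add: floor_less_iff)
    moreover have "int i = \<lfloor>x / (2 * b)\<rfloor>" using fl0 by (simp add: i_def)
    ultimately have "i + 1 \<le> 2 * k" by linarith
    then have "real i + 1 \<le> 2 * real k" by linarith
    then have iA: "2 * (real i + 1) * b \<le> A" using A b by (simp add: mult_right_mono)
    have n1: "x \<noteq> 2 * real i * b" "x \<noteq> (2 * real i + 1) * b" using x(3)[of "2 * int i"] x(3)[of "2 * int i + 1"] by auto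
    note D = zz[unfolded zigzag_def, THEN conjunct2, THEN conjunct2, THEN conjunct2, THEN conjunct1, rule_format, OF iA]
    show ?thesis
    proof (cases "x < (2 * real i + 1) * b")
      case True
      then have "\<lfloor>x / b\<rfloor> = 2 * int i" using i1 b by (intro floor_unique) (auto simp: field_simps)
      then show ?thesis using D True i1 n1 by simp
    next
      case False
      then have "\<lfloor>x / b\<rfloor> = 2 * int i + 1" using i1 b by (intro floor_unique) (auto simp: field_simps)
      then show ?thesis using D False i1 n1 by (simp add: par_def)
    qed
  qed
  define m where "m = \<lfloor>z / (2 * A)\<rfloor>"
  define x where "x = z - of_int m * (2 * A)"
  have "of_int m \<le> z / (2 * A)" "z / (2 * A) < of_int m + 1" unfolding m_def by linarith+
  then have x: "0 \<le> x" "x < 2 * A" using A0 by (auto simp: x_def field_simps)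
  have xn: "x \<noteq> of_int i * b" for i :: int
    using z[of "i + m * (8 * int k)"] by (auto simp: x_def A algebra_simps)
  have xs: "x \<noteq> 0" "x \<noteq> A" using xn[of 0] xn[of "4 * int k"] A by auto
  have fb: "\<lfloor>z / b\<rfloor> = \<lfloor>x / b\<rfloor> + 8 * (int k * m)"
  proof -
    have "z / b = x / b + of_int (8 * (int k * m))" using b by (simp add: x_def A field_simps)
    then show ?thesis by (simp only: floor_add_int)
  qed
  have fA: "\<lfloor>z / A\<rfloor> = \<lfloor>x / A\<rfloor> + 2 * m"
  proof -
    have "z / A = x / A + of_int (2 * m)" using A0 by (simp add: x_def field_simps)
    then show ?thesis by (simp only: floor_add_int)
  qed
  have wx: "wave A b z = par \<lfloor>x / b\<rfloor> * par \<lfloor>x / A\<rfloor>"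
    unfolding wave_def fb fA by (simp add: par_add)
  have "(\<phi> has_real_derivative par \<lfloor>x / b\<rfloor> * par \<lfloor>x / A\<rfloor>) (at x)"
  proof (cases "x < A")
    case True
    then have "\<lfloor>x / A\<rfloor> = 0" using x A0 by (simp add: floor_eq_iff)
    then show ?thesis using C[of x] True x xs xn by simp
  next
    case False
    then have xA: "A < x" using xs by simp
    have "\<lfloor>x / A\<rfloor> = 1" using xA x A0 by (simp add: floor_eq_iff field_simps)
    moreover have "\<lfloor>x / b\<rfloor> = \<lfloor>(x - A) / b\<rfloor> + 4 * int k"
    proof -
      have "x / b = (x - A) / b + of_int (4 * int k)" using b by (simp add: A field_simps)
      then show ?thesis by (simp only: floor_add_int)
    qed
    ultimately have e: "par \<lfloor>x / b\<rfloor> * par \<lfloor>x / A\<rfloor> = - par \<lfloor>(x - A) / b\<rfloor>"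
      by (simp add: par_add) (simp add: par_def)
    have "(x - A) \<noteq> of_int i * b" for i :: int using xn[of "i + 4 * int k"] by (auto simp: A algebra_simps)
    then have "(\<phi> has_real_derivative par \<lfloor>(x - A) / b\<rfloor>) (at (x + (- A)))"
      using C[of "x - A"] xA x by simp
    then have "((\<lambda>y. \<phi> (y + (- A))) has_real_derivative par \<lfloor>(x - A) / b\<rfloor>) (at x)"
      by (simp only: DERIV_shift)
    then have "((\<lambda>y. - \<phi> (y - A)) has_real_derivative - par \<lfloor>(x - A) / b\<rfloor>) (at x)"
      by (auto intro: DERIV_minus)
    then show ?thesis unfolding e
    proof (rule has_field_derivative_transform_within_open[where S="{A<..<2*A}"])
      show "- \<phi> (y - A) = \<phi> y" if "y \<in> {A<..<2*A}" for y
        using zz that by (simp add: zigzag_def)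
    qed (use xA x in auto)
  qed
  moreover have "x = z + of_int (- m) * (2 * A)" by (simp add: x_def)
  ultimately have "((\<lambda>y. \<phi> (y + of_int (- m) * (2 * A))) has_real_derivative wave A b z) (at z)"
    unfolding wx by (simp only: DERIV_shift[symmetric])
  then show ?thesis unfolding pern by (rule DERIV_imp_deriv)
qed

section \<open>Mollification in one variable\<close>

definition moll :: "(real \<Rightarrow> real) \<Rightarrow> real \<Rightarrow> (real \<Rightarrow> real) \<Rightarrow> real \<Rightarrow> real" where
  "moll \<rho> l f z = (\<integral>y. \<rho> (y / l) / l * f (z - y) \<partial>lborel)"

lemma mollifier_zero: "mollifier \<rho> \<Longrightarrow> 1 < \<bar>y\<bar> \<Longrightarrow> \<rho> y = 0"
  unfolding mollifier_def using closure_subset[of "{s. \<rho> s \<noteq> 0}"] by force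

lemma mollifier_kernel:
  assumes \<rho>: "mollifier \<rho>" and l: "0 < l"
  shows "integrable lborel (\<lambda>y. \<rho> (y / l) / l)" "\<And>y. 0 \<le> \<rho> (y / l) / l"
    "(\<integral>y. \<rho> (y / l) / l \<partial>lborel) = 1" "\<And>y. l < \<bar>y\<bar> \<Longrightarrow> \<rho> (y / l) / l = 0"
proof -
  have int: "(\<integral>s. \<rho> s \<partial>lborel) = 1" using \<rho> by (simp add: mollifier_def)
  then have i: "integrable lborel \<rho>" using not_integrable_integral_eq by fastforce
  have "integrable lborel (\<lambda>y. \<rho> (0 + 1 / l * y))" by (rule lborel_integrable_real_affine[OF i]) (use l in simp)
  then show "integrable lborel (\<lambda>y. \<rho> (y / l) / l)" by simp
  show "(\<integral>y. \<rho> (y / l) / l \<partial>lborel) = 1"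
    using lborel_integral_real_affine[of "1 / l" \<rho> 0] l int by simp
  have "range \<rho> \<subseteq> {0..1}" using \<rho> by (simp add: mollifier_def)
  then have "\<rho> s \<in> {0..1}" for s by blast
  then show "0 \<le> \<rho> (y / l) / l" for y using l by simp
  show "\<rho> (y / l) / l = 0" if "l < \<bar>y\<bar>" for y
    using mollifier_zero[OF \<rho>, of "y / l"] that l by (simp add: field_simps)
qed

lemma moll_integrable:
  assumes \<rho>: "mollifier \<rho>" and l: "0 < l" and [measurable]: "f \<in> borel_measurable borel" and f: "\<And>x. \<bar>f x\<bar> \<le> C"
  shows "integrable lborel (\<lambda>y. \<rho> (y / l) / l * f (z - y))"
proof -
  note k = mollifier_kernel[OF \<rho> l]
  have [measurable]: "(\<lambda>y. \<rho> (y / l) / l) \<in> borel_measurable lborel" by (rule borel_measurable_integrable[OF k(1)])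
  show ?thesis
  proof (rule Bochner_Integration.integrable_bound)
    show "integrable lborel (\<lambda>y. \<rho> (y / l) / l * C)" by (rule integrable_mult_left, rule k(1))
    show "AE y in lborel. norm (\<rho> (y / l) / l * f (z - y)) \<le> norm (\<rho> (y / l) / l * C)"
    proof (rule AE_I2)
      fix y
      have "\<bar>f (z - y)\<bar> \<le> \<bar>C\<bar>" using f[of "z - y"] by linarith
      then show "norm (\<rho> (y / l) / l * f (z - y)) \<le> norm (\<rho> (y / l) / l * C)"
        unfolding real_norm_def abs_mult by (rule mult_left_mono) simp
    qed
  qed measurable
qed

lemma moll_mono_const:
  assumes \<rho>: "mollifier \<rho>" and l: "0 < l" and [measurable]: "f \<in> borel_measurable borel" and f: "\<And>x. \<bar>f x\<bar> \<le> C"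
  shows "(\<And>x. f x \<le> c) \<Longrightarrow> moll \<rho> l f z \<le> c" and "(\<And>x. c \<le> f x) \<Longrightarrow> c \<le> moll \<rho> l f z"
    and "(\<And>x. \<bar>x - z\<bar> \<le> l \<Longrightarrow> f x = c) \<Longrightarrow> moll \<rho> l f z = c"
proof -
  note k = mollifier_kernel[OF \<rho> l]
  note i = moll_integrable[OF \<rho> l assms(3) f]
  have c: "(\<integral>y. \<rho> (y / l) / l * c \<partial>lborel) = c" using k(3) by simp
  have ci: "integrable lborel (\<lambda>y. \<rho> (y / l) / l * c)" by (rule integrable_mult_left, rule k(1))
  show "moll \<rho> l f z \<le> c" if "\<And>x. f x \<le> c"
    unfolding moll_def by (subst c[symmetric], rule integral_mono[OF i ci]) (intro mult_left_mono that k)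
  show "c \<le> moll \<rho> l f z" if "\<And>x. c \<le> f x"
    unfolding moll_def by (subst c[symmetric], rule integral_mono[OF ci i]) (intro mult_left_mono that k)
  show "moll \<rho> l f z = c" if "\<And>x. \<bar>x - z\<bar> \<le> l \<Longrightarrow> f x = c"
  proof -
    have "(\<lambda>y. \<rho> (y / l) / l * f (z - y)) = (\<lambda>y. \<rho> (y / l) / l * c)"
    proof
      fix y show "\<rho> (y / l) / l * f (z - y) = \<rho> (y / l) / l * c"
        using that[of "z - y"] k(4)[of y] by (cases "\<bar>y\<bar> \<le> l") auto
    qed
    then show ?thesis unfolding moll_def using c by simp
  qed
qed

lemma mollifier_lipschitz:
  assumes \<rho>: "mollifier \<rho>"
  shows "\<exists>D\<ge>0. \<forall>x y. \<bar>\<rho> x - \<rho> y\<bar> \<le> D * \<bar>x - y\<bar>"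
proof -
  have sm: "\<And>k x. (deriv ^^ k) \<rho> field_differentiable at x" using \<rho> by (simp add: mollifier_def smooth_def)
  have d: "(\<rho> has_real_derivative deriv \<rho> x) (at x)" for x
    using sm[of 0 x] by (simp add: DERIV_deriv_iff_field_differentiable)
  have "continuous_on UNIV (deriv \<rho>)"
    using sm[of 1] by (auto intro!: continuous_at_imp_continuous_on field_differentiable_imp_continuous_at)
  then have "continuous_on {-2..2} (deriv \<rho>)" by (rule continuous_on_subset) simp
  then have "compact (deriv \<rho> ` {-2..2})" by (intro compact_continuous_image) auto
  then have "bounded (deriv \<rho> ` {-2..2})" by (rule compact_imp_bounded)
  then obtain D where "\<forall>x\<in>deriv \<rho> ` {-2..2}. norm x \<le> D" unfolding bounded_iff by blast
  then have D: "\<And>x. x \<in> {-2..2} \<Longrightarrow> \<bar>deriv \<rho> x\<bar> \<le> D" by simp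
  have D0: "0 \<le> D" using D[of 0] by auto
  have bd: "\<bar>deriv \<rho> x\<bar> \<le> D" for x
  proof (cases "x \<in> {-2..2}")
    case False
    have "(\<rho> has_real_derivative 0) (at x)"
    proof (rule has_field_derivative_transform_within_open[where f="\<lambda>_. 0" and S="- {-2..2}"])
      show "0 = \<rho> y" if "y \<in> - {-2..2}" for y using mollifier_zero[OF \<rho>, of y] that by auto
    qed (use False in auto)
    then show ?thesis using D0 by (simp add: DERIV_imp_deriv)
  qed (rule D)
  have "\<bar>\<rho> x - \<rho> y\<bar> \<le> D * \<bar>x - y\<bar>" for x y
    using field_differentiable_bound[of UNIV \<rho> "deriv \<rho>" D x y] d bd by simp
  then show ?thesis using D0 by blast
qed

text \<open>The square wave jumps, so regularity must come from the kernel: two shifted kernels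
  differ by at most D |z - z'| / l^2 on a set of measure at most 4 l. The constant grows like 1/l,
  but the tracking of orbits uses it only at the finitely many stages before a point becomes
  good.\<close>

lemma moll_lipschitz:
  assumes \<rho>: "mollifier \<rho>" and l: "0 < l" and [measurable]: "f \<in> borel_measurable borel" and f: "\<And>x. \<bar>f x\<bar> \<le> C"
  shows "\<exists>L\<ge>0. \<forall>z z'. \<bar>moll \<rho> l f z - moll \<rho> l f z'\<bar> \<le> L * \<bar>z - z'\<bar>"
proof -
  obtain D where D: "D \<ge> 0" "\<And>x y. \<bar>\<rho> x - \<rho> y\<bar> \<le> D * \<bar>x - y\<bar>" using mollifier_lipschitz[OF \<rho>] by blast
  note k = mollifier_kernel[OF \<rho> l]
  have C: "0 \<le> C" using f[of 0] by linarith
  have eq: "moll \<rho> l f z = (\<integral>y. \<rho> ((z - y) / l) / l * f y \<partial>lborel)"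
    and int: "integrable lborel (\<lambda>y. \<rho> ((z - y) / l) / l * f y)" for z
  proof -
    show "moll \<rho> l f z = (\<integral>y. \<rho> ((z - y) / l) / l * f y \<partial>lborel)"
      unfolding moll_def using lborel_integral_real_affine[of "-1" "\<lambda>y. \<rho> (y / l) / l * f (z - y)" z] by simp
    show "integrable lborel (\<lambda>y. \<rho> ((z - y) / l) / l * f y)"
      using lborel_integrable_real_affine[OF moll_integrable[OF \<rho> l assms(3) f, of z], of "-1" z] by simp
  qed
  have "\<bar>moll \<rho> l f z - moll \<rho> l f z'\<bar> \<le> (C * D * 4 / l) * \<bar>z - z'\<bar>" for z z'
  proof -
    define S where "S = {z - l..z + l} \<union> {z' - l..z' + l}"
    have [measurable]: "S \<in> sets lborel" by (simp add: S_def)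
    have fin: "emeasure lborel S < \<infinity>"
      unfolding S_def by (rule le_less_trans[OF emeasure_subadditive]) (use l in auto)
    have mS: "measure lborel S \<le> 4 * l"
    proof -
      have "measure lborel S \<le> measure lborel {z - l..z + l} + measure lborel {z' - l..z' + l}"
        unfolding S_def by (rule measure_Un_le) auto
      then show ?thesis using l by simp
    qed
    have pt: "\<bar>\<rho> ((z - y) / l) / l * f y - \<rho> ((z' - y) / l) / l * f y\<bar> \<le> indicator S y * (C * D * \<bar>z - z'\<bar> / l\<^sup>2)" for y
    proof (cases "y \<in> S")
      case True
      have "\<bar>\<rho> ((z - y) / l) / l * f y - \<rho> ((z' - y) / l) / l * f y\<bar> = \<bar>\<rho> ((z - y) / l) - \<rho> ((z' - y) / l)\<bar> / l * \<bar>f y\<bar>"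
        using l by (simp add: left_diff_distrib[symmetric] diff_divide_distrib[symmetric] abs_mult)
      also have "\<dots> \<le> (D * \<bar>(z - y) / l - (z' - y) / l\<bar>) / l * C"
        using l D f C by (intro mult_mono divide_right_mono) auto
      also have "\<bar>(z - y) / l - (z' - y) / l\<bar> = \<bar>z - z'\<bar> / l" using l by (simp add: diff_divide_distrib[symmetric])
      finally show ?thesis using True by (simp add: power2_eq_square mult_ac)
    next
      case False
      then have "l < \<bar>z - y\<bar>" "l < \<bar>z' - y\<bar>" by (auto simp: S_def)
      then have "\<rho> ((z - y) / l) / l = 0" "\<rho> ((z' - y) / l) / l = 0" using k(4) by blast+
      then show ?thesis using False l by auto
    qed
    have "\<bar>moll \<rho> l f z - moll \<rho> l f z'\<bar> = \<bar>\<integral>y. \<rho> ((z - y) / l) / l * f y - \<rho> ((z' - y) / l) / l * f y \<partial>lborel\<bar>"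
      unfolding eq using int by simp
    also have "\<dots> \<le> (\<integral>y. \<bar>\<rho> ((z - y) / l) / l * f y - \<rho> ((z' - y) / l) / l * f y\<bar> \<partial>lborel)"
      by (rule integral_abs_bound)
    also have "\<dots> \<le> (\<integral>y. indicator S y * (C * D * \<bar>z - z'\<bar> / l\<^sup>2) \<partial>lborel)"
    proof (rule integral_mono[OF _ _ pt])
      show "integrable lborel (\<lambda>y. indicator S y * (C * D * \<bar>z - z'\<bar> / l\<^sup>2))"
        by (rule integrable_mult_left, rule integrable_real_indicator) (use fin in \<open>auto simp: S_def\<close>)
    qed (use int in simp)
    also have "\<dots> = measure lborel S * (C * D * \<bar>z - z'\<bar> / l\<^sup>2)" by simp
    also have "\<dots> \<le> (4 * l) * (C * D * \<bar>z - z'\<bar> / l\<^sup>2)"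
      using mS C D by (intro mult_right_mono) auto
    also have "\<dots> = (C * D * 4 / l) * \<bar>z - z'\<bar>" using l by (simp add: power2_eq_square field_simps)
    finally show ?thesis .
  qed
  moreover have "0 \<le> C * D * 4 / l" using C D l by simp
  ultimately show ?thesis by blast
qed

section \<open>Distance from the discontinuities\<close>

definition grid_off :: "real \<Rightarrow> real \<Rightarrow> real \<Rightarrow> bool" where
  "grid_off b m z \<longleftrightarrow> (\<forall>i::int. m \<le> \<bar>z - of_int i * b\<bar>)"

lemma grid_offD: "grid_off b m z \<Longrightarrow> m \<le> \<bar>z - of_int i * b\<bar>"
  by (simp add: grid_off_def)

lemma grid_off_perturb:
  assumes "grid_off b m z" "\<bar>w - z - of_int i * b\<bar> \<le> d"
  shows "grid_off b (m - d) w"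
  unfolding grid_off_def
proof
  fix n :: int
  have "m \<le> \<bar>z - of_int (n - i) * b\<bar>" using assms(1) by (rule grid_offD)
  moreover have "z - of_int (n - i) * b = (w - of_int n * b) - (w - z - of_int i * b)" by (simp add: algebra_simps)
  ultimately show "m - d \<le> \<bar>w - of_int n * b\<bar>" using assms(2) by linarith
qed

lemma grid_off_multiple: "grid_off b m z \<Longrightarrow> A = 4 * real k * b \<Longrightarrow> grid_off A m z"
  unfolding grid_off_def
proof
  fix i :: int assume "\<forall>i::int. m \<le> \<bar>z - of_int i * b\<bar>" and A: "A = 4 * real k * b"
  then have "m \<le> \<bar>z - of_int (i * (4 * int k)) * b\<bar>" by blast
  then show "m \<le> \<bar>z - of_int i * A\<bar>" by (simp add: A mult.assoc)
qed

lemma floor_grid_off: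
  assumes b: "0 < b" and g: "grid_off b m z" and w: "\<bar>w - z\<bar> < m"
  shows "\<lfloor>w / b\<rfloor> = \<lfloor>z / b\<rfloor>"
proof -
  define i where "i = \<lfloor>z / b\<rfloor>"
  have "of_int i \<le> z / b" "z / b < of_int i + 1" unfolding i_def by linarith+
  then have 1: "of_int i * b \<le> z" "z < (of_int i + 1) * b" using b by (auto simp: field_simps)
  have "m \<le> \<bar>z - of_int i * b\<bar>" "m \<le> \<bar>z - of_int (i + 1) * b\<bar>" using g by (rule grid_offD)+
  then have 2: "m \<le> z - of_int i * b" "m \<le> (of_int i + 1) * b - z" using 1 by auto
  have "of_int i * b \<le> w" "w < (of_int i + 1) * b" using 2 w by linarith+
  then have "\<lfloor>w / b\<rfloor> = i" using b by (intro floor_unique) (auto simp: field_simps)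
  then show ?thesis by (simp add: i_def)
qed

text \<open>Connects the combinatorial form of the wave with the one that has a Fourier series. At
  integers the sine vanishes while the parity does not; under a mollification these points form a
  null set.\<close>

lemma par_floor_sgn_sin: "v \<notin> \<int> \<Longrightarrow> par \<lfloor>v\<rfloor> = sgn (sin (pi * v))"
proof -
  assume v: "v \<notin> \<int>"
  define f where "f = frac v"
  have f: "0 < f" "f < 1" using v frac_lt_1[of v] by (auto simp: f_def frac_gt_0_iff)
  have "pi * v = pi * f + pi * of_int \<lfloor>v\<rfloor>" by (simp add: f_def frac_def algebra_simps)
  then have "sin (pi * v) = sin (pi * f) * cos (pi * of_int \<lfloor>v\<rfloor>)"
    by (simp only: sin_add sin_npi_int)
  moreover have "cos (pi * of_int n) = par n" for n :: int
    by (simp add: par_def cos_npi_int)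
  moreover have "0 < sin (pi * f)" using f by (intro sin_gt_zero) auto
  ultimately show ?thesis by (auto simp: par_def sgn_if)
qed

section \<open>The scales and the mollified shear profiles\<close>

locale cascade =
  fixes \<delta> \<gamma> :: real and \<rho> :: "real \<Rightarrow> real" and \<eta> :: "nat \<Rightarrow> nat \<Rightarrow> real \<Rightarrow> real"
    and a :: "nat \<Rightarrow> real" and \<phi> :: "nat \<Rightarrow> real \<Rightarrow> real"
  assumes \<delta>: "0 < \<delta>" and \<gamma>: "1/2 < \<gamma>" "\<gamma> < 1" and scale: "scale_sequence \<delta> \<gamma> a"
    and moll: "mollifier \<rho>" and cutoffs: "time_cutoffs \<eta>"
    and zigzags: "\<And>q. zigzag (a q) (a (Suc q)) (\<phi> (Suc q))"
begin

lemma a_pos [simp]: "0 < a q"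
  using scale by (simp add: scale_sequence_def)

lemma a_nonneg [simp]: "0 \<le> a q" "a q \<noteq> 0" "\<not> a q \<le> 0"
  by (simp_all add: less_imp_le less_imp_neq[symmetric] not_le)

lemma a_multiple: obtains k where "a q = 4 * real k * a (Suc q)" "0 < k"
proof -
  obtain k :: nat where k: "a q / a (Suc q) = 4 * real k"
    using scale unfolding scale_sequence_def by blast
  then have "a q = 4 * real k * a (Suc q)" by (simp add: field_simps)
  moreover from this a_pos[of q] have "0 < k" by (cases k) auto
  ultimately show ?thesis by (rule that)
qed

lemma a_Suc_le: "a (Suc q) \<le> a q / 4"
proof -
  obtain k where k: "a q = 4 * real k * a (Suc q)" "0 < k" by (rule a_multiple)
  have "1 * a (Suc q) \<le> real k * a (Suc q)" using k(2) by (intro mult_right_mono) auto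
  then show ?thesis using k(1) by simp
qed

lemma a_le_power: "a q \<le> (1/4) ^ q"
proof (induction q)
  case 0 then show ?case using scale by (simp add: scale_sequence_def)
next
  case (Suc q) then show ?case using a_Suc_le[of q] by simp
qed

lemma a_le_1: "a q \<le> 1"
  by (rule order_trans[OF a_le_power]) (simp add: power_le_one)

lemma a_mono: "i \<le> j \<Longrightarrow> a j \<le> a i"
proof (rule lift_Suc_antimono_le[of a])
  show "a (Suc n) \<le> a n" for n using a_Suc_le[of n] a_pos[of n] by linarith
qed

lemma a_ratio: "a (Suc q) / a q \<le> a q powr \<delta>"
proof -
  have "a q powr (- \<delta>) \<le> a q / a (Suc q)" using scale by (simp add: scale_sequence_def)
  then show ?thesis by (simp add: powr_minus divide_simps mult.commute)
qed

abbreviation "lq \<equiv> ell \<gamma> a"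

lemma ell_pos [simp]: "0 < lq q"
  by (simp add: ell_def)

text \<open>All comparisons of length scales reduce to powers of the single ratio
  \<open>a (Suc q) / a q\<close>.\<close>

lemma ell_over_a: "lq q / a q = (a (Suc q) / a q) powr (1 - \<gamma>)" "a (Suc q) / lq q = (a (Suc q) / a q) powr \<gamma>"
proof -
  have "a q = a q powr \<gamma> * a q powr (1 - \<gamma>)" "a (Suc q) = a (Suc q) powr \<gamma> * a (Suc q) powr (1 - \<gamma>)"
    by (simp_all add: powr_add[symmetric])
  then show "lq q / a q = (a (Suc q) / a q) powr (1 - \<gamma>)" "a (Suc q) / lq q = (a (Suc q) / a q) powr \<gamma>"
    unfolding ell_def by (simp_all add: powr_divide divide_simps)
qed

lemma a_ratio_le_1: "a (Suc q) / a q \<le> 1"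
  using a_mono[of q "Suc q"] by (simp add: divide_le_eq)

lemma ell_bounds: "a (Suc q) \<le> lq q" "lq q \<le> a q"
proof -
  have "(a (Suc q) / a q) powr \<gamma> \<le> 1" "(a (Suc q) / a q) powr (1 - \<gamma>) \<le> 1"
    using a_ratio_le_1[of q] \<gamma> by (auto intro!: powr_le1)
  then show "a (Suc q) \<le> lq q" "lq q \<le> a q"
    unfolding ell_over_a[symmetric] by (simp_all add: divide_le_eq)
qed

lemma ell_mono: "i \<le> j \<Longrightarrow> lq j \<le> lq i"
proof (rule lift_Suc_antimono_le[of lq])
  show "lq (Suc n) \<le> lq n" for n using ell_bounds[of n] ell_bounds[of "Suc n"] by linarith
qed

definition g1 :: "nat \<Rightarrow> real \<Rightarrow> real" where
  "g1 j = moll \<rho> (lq (Suc j)) (\<lambda>x. a j / 2 * wave (a j) (a (Suc j)) x)"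

definition g2 :: "nat \<Rightarrow> real \<Rightarrow> real" where
  "g2 j = moll \<rho> (lq (Suc j)) (\<lambda>x. a (Suc j) / 2 * (wave (a j) (a (Suc j)) x + 1))"

lemma wave1_bound: "\<bar>a j / 2 * wave A b x\<bar> \<le> a j / 2"
  by (simp add: abs_mult)

lemma wave2_bound: "\<bar>a (Suc j) / 2 * (wave A b x + 1)\<bar> \<le> a (Suc j)"
  using wave_cases[of A b x] by auto

lemma g1_bound: "\<bar>g1 j z\<bar> \<le> a j / 2"
proof -
  have "a j / 2 * wave (a j) (a (Suc j)) x \<le> a j / 2" "- (a j / 2) \<le> a j / 2 * wave (a j) (a (Suc j)) x" for x
    using wave_cases[of "a j" "a (Suc j)" x] by auto
  note w = this
  have "g1 j z \<le> a j / 2" unfolding g1_def by (rule moll_mono_const(1)[OF moll ell_pos _ wave1_bound w(1)]) measurable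
  moreover have "- (a j / 2) \<le> g1 j z" unfolding g1_def by (rule moll_mono_const(2)[OF moll ell_pos _ wave1_bound w(2)]) measurable
  ultimately show ?thesis by linarith
qed

lemma g2_bound: "0 \<le> g2 j z" "g2 j z \<le> a (Suc j)"
proof -
  have w: "a (Suc j) / 2 * (wave (a j) (a (Suc j)) x + 1) \<le> a (Suc j)" "0 \<le> a (Suc j) / 2 * (wave (a j) (a (Suc j)) x + 1)" for x
    using wave_cases[of "a j" "a (Suc j)" x] by auto
  show "g2 j z \<le> a (Suc j)" unfolding g2_def by (rule moll_mono_const(1)[OF moll ell_pos _ wave2_bound w(1)]) measurable
  show "0 \<le> g2 j z" unfolding g2_def by (rule moll_mono_const(2)[OF moll ell_pos _ wave2_bound w(2)]) measurable
qed

lemma g_lipschitz: "\<exists>L\<ge>0. \<forall>z z'. \<bar>g1 j z - g1 j z'\<bar> \<le> L * \<bar>z - z'\<bar> \<and> \<bar>g2 j z - g2 j z'\<bar> \<le> L * \<bar>z - z'\<bar>"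
proof -
  have m: "(\<lambda>x. a j / 2 * wave (a j) (a (Suc j)) x) \<in> borel_measurable borel"
    "(\<lambda>x. a (Suc j) / 2 * (wave (a j) (a (Suc j)) x + 1)) \<in> borel_measurable borel" by measurable
  obtain L where L: "L \<ge> 0" "\<And>z z'. \<bar>g1 j z - g1 j z'\<bar> \<le> L * \<bar>z - z'\<bar>"
    using moll_lipschitz[OF moll ell_pos[of "Suc j"] m(1) wave1_bound] unfolding g1_def by blast
  obtain L' where L': "L' \<ge> 0" "\<And>z z'. \<bar>g2 j z - g2 j z'\<bar> \<le> L' * \<bar>z - z'\<bar>"
    using moll_lipschitz[OF moll ell_pos[of "Suc j"] m(2) wave2_bound] unfolding g2_def by blast
  have "\<bar>g1 j z - g1 j z'\<bar> \<le> max L L' * \<bar>z - z'\<bar> \<and> \<bar>g2 j z - g2 j z'\<bar> \<le> max L L' * \<bar>z - z'\<bar>" for z z'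
    using L(2)[of z z'] L'(2)[of z z'] mult_right_mono[of L "max L L'" "\<bar>z - z'\<bar>"] mult_right_mono[of L' "max L L'" "\<bar>z - z'\<bar>"]
    by fastforce
  then show ?thesis using L(1) by (intro exI[of _ "max L L'"]) auto
qed

text \<open>\<open>wave\<close> jumps on two grids, but the coarse spacing is a multiple of the fine
  one, so distance from the fine grid controls both.\<close>

lemma wave_grid_off:
  assumes "grid_off (a (Suc j)) m z" "\<bar>w - z\<bar> < m"
  shows "wave (a j) (a (Suc j)) w = wave (a j) (a (Suc j)) z"
proof -
  obtain k where k: "a j = 4 * real k * a (Suc j)" by (rule a_multiple)
  have "grid_off (a j) m z" by (rule grid_off_multiple[OF assms(1) k])
  then show ?thesis unfolding wave_def
    using floor_grid_off[OF a_pos assms] floor_grid_off[OF a_pos _ assms(2)] by simp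
qed

text \<open>The whole mollification window lies in one cell, so the profile equals a constant
  exactly. Exactness is essential: a good stage then contributes no error, and the number of good
  stages up to \<open>q\<close> does not matter.\<close>

lemma g_grid_off:
  assumes g: "grid_off (a (Suc j)) m z" and w: "\<bar>w - z\<bar> + lq (Suc j) < m"
  shows "g1 j w = a j / 2 * wave (a j) (a (Suc j)) z" "g2 j w = a (Suc j) / 2 * (wave (a j) (a (Suc j)) z + 1)"
proof -
  have W: "wave (a j) (a (Suc j)) x = wave (a j) (a (Suc j)) z" if "\<bar>x - w\<bar> \<le> lq (Suc j)" for x
    by (rule wave_grid_off[OF g]) (use that w in linarith)
  show "g1 j w = a j / 2 * wave (a j) (a (Suc j)) z"
    unfolding g1_def by (rule moll_mono_const(3)[OF moll ell_pos _ wave1_bound]) (measurable, simp add: W)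
  show "g2 j w = a (Suc j) / 2 * (wave (a j) (a (Suc j)) z + 1)"
    unfolding g2_def by (rule moll_mono_const(3)[OF moll ell_pos _ wave2_bound]) (measurable, simp add: W)
qed

text \<open>Here the distance is measured from the coarse grid, since at stage \<open>q\<close> the
  noise crosses many fine cells. Inside one coarse cell the coarse sign is frozen, and what remains
  is a periodic square wave with a Fourier series.\<close>

lemma g1_cell:
  assumes g: "grid_off (a j) m z" and w: "\<bar>w - z\<bar> + lq (Suc j) < m"
  shows "g1 j w = par \<lfloor>z / a j\<rfloor> * (a j / 2) *
    (\<integral>y. \<rho> (y / lq (Suc j)) / lq (Suc j) * sgn (sin (pi * (w / a (Suc j) - 1 / a (Suc j) * y))) \<partial>lborel)"
proof -
  let ?l = "lq (Suc j)" and ?b = "a (Suc j)"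
  have "g1 j w = (\<integral>y. par \<lfloor>z / a j\<rfloor> * (a j / 2) * (\<rho> (y / ?l) / ?l * sgn (sin (pi * (w / ?b - 1 / ?b * y)))) \<partial>lborel)"
    unfolding g1_def moll_def
  proof (rule integral_discrete_difference[where X="(\<lambda>i. w - of_int i * ?b) ` (UNIV :: int set)"])
    fix y assume y: "y \<notin> (\<lambda>i. w - of_int i * ?b) ` (UNIV :: int set)"
    show "\<rho> (y / ?l) / ?l * (a j / 2 * wave (a j) ?b (w - y))
        = par \<lfloor>z / a j\<rfloor> * (a j / 2) * (\<rho> (y / ?l) / ?l * sgn (sin (pi * (w / ?b - 1 / ?b * y))))"
    proof (cases "\<bar>y\<bar> \<le> ?l")
      case True
      have fl: "\<lfloor>(w - y) / a j\<rfloor> = \<lfloor>z / a j\<rfloor>" by (rule floor_grid_off[OF a_pos g]) (use w True in linarith)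
      have "(w - y) / ?b \<notin> \<int>"
      proof
        assume "(w - y) / ?b \<in> \<int>"
        then obtain i :: int where "(w - y) / ?b = of_int i" by (auto elim: Ints_cases)
        then have "y = w - of_int i * ?b" by (simp add: field_simps)
        then show False using y by blast
      qed
      from par_floor_sgn_sin[OF this] have "par \<lfloor>(w - y) / ?b\<rfloor> = sgn (sin (pi * (w / ?b - 1 / ?b * y)))"
        by (simp add: diff_divide_distrib)
      then show ?thesis unfolding wave_def par_add fl by (simp add: mult_ac)
    next
      case False
      then have "\<rho> (y / ?l) / ?l = 0" by (intro mollifier_kernel(4)[OF moll ell_pos]) simp
      then show ?thesis by auto
    qed
  qed auto
  then show ?thesis by simp
qed

lemma vector_axis: "vector [r, 0] = r *\<^sub>R (axis 1 1 :: real^2)" "vector [0, r] = r *\<^sub>R (axis 2 1 :: real^2)" for r :: real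
  by (simp_all add: vec_eq_iff forall_2 axis_def)

text \<open>For fixed \<open>x\<close> the kinks correspond to countably many \<open>y\<close>, so
  the convolution does not see the value of \<open>deriv\<close> there.\<close>

lemma mollify_v:
  shows "mollify \<rho> (lq (Suc q)) 2 (v1 a \<phi> q) x = vector [g1 q (x $ 2), 0]"
    and "mollify \<rho> (lq (Suc q)) 1 (v2 a \<phi> q) x = vector [0, g2 q (x $ 1)]"
proof -
  let ?l = "lq (Suc q)" and ?b = "a (Suc q)"
  obtain k where k: "a q = 4 * real k * a (Suc q)" "0 < k" by (rule a_multiple)
  have d: "deriv (\<phi> (Suc q)) z = wave (a q) ?b z" if "z \<notin> range (\<lambda>i::int. of_int i * ?b)" for z
    by (rule zigzag_deriv[OF zigzags a_pos k]) (use that in auto)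
  have X: "s - y \<notin> range (\<lambda>i::int. of_int i * ?b)" if "y \<notin> (\<lambda>i. s - of_int i * ?b) ` (UNIV :: int set)" for s y
    using that by (auto simp: image_iff) (metis diff_diff_eq2 add_diff_cancel_left')
  have "mollify \<rho> ?l 2 (v1 a \<phi> q) x
      = (\<integral>y. (\<rho> (y / ?l) / ?l * (a q / 2 * wave (a q) ?b (x $ 2 - y))) *\<^sub>R (axis 1 1 :: real^2) \<partial>lborel)"
    unfolding mollify_def
  proof (rule integral_discrete_difference[where X="(\<lambda>i. x $ 2 - of_int i * ?b) ` (UNIV :: int set)"])
    fix y assume "y \<notin> (\<lambda>i. x $ 2 - of_int i * ?b) ` (UNIV :: int set)"
    from d[OF X[OF this]] show "(\<rho> (y / ?l) / ?l) *\<^sub>R v1 a \<phi> q (x - axis 2 y)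
        = (\<rho> (y / ?l) / ?l * (a q / 2 * wave (a q) ?b (x $ 2 - y))) *\<^sub>R axis 1 1"
      by (simp add: v1_def vector_axis axis_def[of 2 y])
  qed auto
  also have "\<dots> = g1 q (x $ 2) *\<^sub>R axis 1 1"
    unfolding g1_def moll_def
    by (rule integral_scaleR_left) (rule moll_integrable[OF moll ell_pos _ wave1_bound], measurable)
  finally show "mollify \<rho> ?l 2 (v1 a \<phi> q) x = vector [g1 q (x $ 2), 0]" by (simp add: vector_axis)
  have "mollify \<rho> ?l 1 (v2 a \<phi> q) x
      = (\<integral>y. (\<rho> (y / ?l) / ?l * (?b / 2 * (wave (a q) ?b (x $ 1 - y) + 1))) *\<^sub>R (axis 2 1 :: real^2) \<partial>lborel)"
    unfolding mollify_def
  proof (rule integral_discrete_difference[where X="(\<lambda>i. x $ 1 - of_int i * ?b) ` (UNIV :: int set)"])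
    fix y assume "y \<notin> (\<lambda>i. x $ 1 - of_int i * ?b) ` (UNIV :: int set)"
    from d[OF X[OF this]] show "(\<rho> (y / ?l) / ?l) *\<^sub>R v2 a \<phi> q (x - axis 1 y)
        = (\<rho> (y / ?l) / ?l * (?b / 2 * (wave (a q) ?b (x $ 1 - y) + 1))) *\<^sub>R axis 2 1"
      by (simp add: v2_def vector_axis axis_def[of 1 y])
  qed auto
  also have "\<dots> = g2 q (x $ 1) *\<^sub>R axis 2 1"
    unfolding g2_def moll_def
    by (rule integral_scaleR_left) (rule moll_integrable[OF moll ell_pos _ wave2_bound], measurable)
  finally show "mollify \<rho> ?l 1 (v2 a \<phi> q) x = vector [0, g2 q (x $ 1)]" by (simp add: vector_axis)
qed

end

section \<open>The velocity field stage by stage\<close>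

lemma tq_strict: "tq q < tq (Suc q)"
  by (simp add: divide_pos_pos zero_less_mult_iff)

lemma tq_mono: "i \<le> j \<Longrightarrow> tq i \<le> tq j"
  by (rule lift_Suc_mono_le[of tq]) (auto intro: less_imp_le[OF tq_strict] simp del: tq.simps)

lemma tq_less: "i < j \<Longrightarrow> tq i < tq j"
  by (rule lift_Suc_mono_less[of tq]) (auto intro: tq_strict simp del: tq.simps)

text \<open>The weights 3/pi^2 normalise the Basel series pi^2/6 to 1/2.\<close>

lemma tq_tendsto: "tq \<longlonglongrightarrow> 1/2"
proof -
  have eq: "tq n = (\<Sum>k<n. 3 / pi\<^sup>2 * (1 / (real k + 1)\<^sup>2))" for n
    by (induction n) simp_all
  have "(\<lambda>n. 3 / pi\<^sup>2 * (1 / (real n + 1)\<^sup>2)) sums (3 / pi\<^sup>2 * (pi\<^sup>2 / 6))"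
    by (rule sums_mult) (use inverse_squares_sums in \<open>simp add: add.commute\<close>)
  then show ?thesis unfolding sums_def eq[abs_def] by simp
qed

lemma tq_lt_half: "tq q < 1/2"
proof -
  have "tq (Suc q) \<le> 1/2"
    by (rule LIMSEQ_le_const[OF tq_tendsto]) (auto intro!: exI[of _ "Suc q"] tq_mono simp del: tq.simps)
  then show ?thesis using tq_strict[of q] by linarith
qed

lemma tq_nonneg: "0 \<le> tq q"
  using tq_mono[of 0 q] by simp

lemma tq_diff: "tq (Suc q) - tq q = 3 / (pi\<^sup>2 * (real q + 1)\<^sup>2)"
  by simp

definition tau :: "nat \<Rightarrow> nat \<Rightarrow> real" where
  "tau q i = tq q + real i * (tq (Suc q) - tq q) / 3"

lemma tau_ends: "tau q 0 = tq q" "tau q 3 = tq (Suc q)"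
  by (simp_all add: tau_def field_simps del: tq.simps)

lemma tau_less: "i < j \<Longrightarrow> tau q i < tau q j"
  using tq_strict[of q] by (simp add: tau_def del: tq.simps)

lemma tau_le: "i \<le> j \<Longrightarrow> tau q i \<le> tau q j"
  using tau_less[of i j q] by (cases "i = j") auto

lemma tau_range: "i \<le> 3 \<Longrightarrow> tq q \<le> tau q i \<and> tau q i \<le> tq (Suc q)"
  using tau_le[of 0 i q] tau_le[of i 3 q] unfolding tau_ends by simp

lemma tau_01: "i \<le> 3 \<Longrightarrow> 0 \<le> tau q i \<and> tau q i < 1/2"
  using tau_range[of i q] tq_nonneg[of q] tq_lt_half[of "Suc q"] by linarith

lemma J_tau: "J q 1 = {tau q 0..<tau q 1}" "J q 2 = {tau q 1..<tau q 2}" "J q 3 = {tau q 2..<tau q 3}"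
  "J q (Suc 0) = {tau q 0..<tau q (Suc 0)}"
  by (simp_all add: J_def tau_def del: tq.simps)

lemma J_inj: "t \<in> J q i \<Longrightarrow> t \<in> J q' j \<Longrightarrow> i \<in> {1,2,3} \<Longrightarrow> j \<in> {1,2,3} \<Longrightarrow> q = q' \<and> i = j"
proof -
  assume t: "t \<in> J q i" "t \<in> J q' j" and ij: "i \<in> {1,2,3}" "j \<in> {1,2,3}"
  have sub: "J q i \<subseteq> {tq q..<tq (Suc q)}" if "i \<in> {1,2,3}" for q i
    using that tau_range[of 1 q] tau_range[of 2 q] by (auto simp: J_tau tau_ends simp del: tq.simps)
  have q: "q = q'"
  proof (rule ccontr)
    assume "q \<noteq> q'"
    then have "Suc q \<le> q' \<or> Suc q' \<le> q" by auto
    then have "tq (Suc q) \<le> tq q' \<or> tq (Suc q') \<le> tq q" using tq_mono by blast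
    then show False using sub[OF ij(1), of q] sub[OF ij(2), of q'] t by force
  qed
  then show "q = q' \<and> i = j"
    using t ij tau_less[of 0 1 q] tau_less[of 1 2 q] tau_less[of 2 3 q] by (auto simp: J_tau)
qed

lemma the_stage: "t \<in> {tq q..<tq (Suc q)} \<Longrightarrow> (THE q. t \<in> {tq q..<tq (Suc q)}) = q"
proof (rule the_equality)
  fix q' assume t: "t \<in> {tq q..<tq (Suc q)}" "t \<in> {tq q'..<tq (Suc q')}"
  show "q' = q"
  proof (rule ccontr)
    assume "q' \<noteq> q"
    then have "Suc q \<le> q' \<or> Suc q' \<le> q" by auto
    then have "tq (Suc q) \<le> tq q' \<or> tq (Suc q') \<le> tq q" using tq_mono by blast
    then show False using t by force
  qed
qed

lemma J_in_stage: "t \<in> J q i \<Longrightarrow> i \<in> {1,2,3} \<Longrightarrow> t \<in> {tq q..<tq (Suc q)}"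
  using tau_range[of 1 q] tau_range[of 2 q] by (auto simp: J_tau tau_ends simp del: tq.simps)

context cascade
begin

abbreviation "u \<equiv> velocity \<gamma> \<rho> \<eta> a \<phi>"

lemma eta_props:
  assumes "i \<in> {1,2,3}"
  shows "0 \<le> \<eta> q i t" "\<eta> q i t \<noteq> 0 \<Longrightarrow> t \<in> J q i" "(\<integral>t. \<eta> q i t \<partial>lborel) = 1"
    "continuous_on UNIV (\<eta> q i)" "integrable lborel (\<eta> q i)"
proof -
  have *: "smooth (\<eta> q i) \<and> (\<forall>t. 0 \<le> \<eta> q i t) \<and> closure {t. \<eta> q i t \<noteq> 0} \<subseteq> J q i \<and> (\<integral>t. \<eta> q i t \<partial>lborel) = 1"
    using cutoffs assms unfolding time_cutoffs_def by blast
  then show "0 \<le> \<eta> q i t" "(\<integral>t. \<eta> q i t \<partial>lborel) = 1" by auto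
  then show "integrable lborel (\<eta> q i)" using not_integrable_integral_eq by fastforce
  show "t \<in> J q i" if "\<eta> q i t \<noteq> 0" using * that closure_subset[of "{t. \<eta> q i t \<noteq> 0}"] by auto
  have "(deriv ^^ 0) (\<eta> q i) field_differentiable at x" for x
    using * unfolding smooth_def by blast
  then show "continuous_on UNIV (\<eta> q i)"
    by (auto intro!: continuous_at_imp_continuous_on field_differentiable_imp_continuous_at)
qed

lemma eta_zero: "i \<in> {1,2,3} \<Longrightarrow> t \<notin> J q i \<Longrightarrow> \<eta> q i t = 0"
  using eta_props(2) by blast

text \<open>The cutoffs become steep only at a quadratic rate, which later loses against the
  geometric decay of the ratios.\<close>

lemma eta_bound: "\<exists>C\<ge>0. \<forall>q t. \<eta> q 1 t \<le> C * (real q + 1)\<^sup>2"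
proof -
  obtain C :: "nat \<Rightarrow> real" where C: "\<forall>q. \<forall>i\<in>{1,2,3}. \<forall>k. \<forall>j\<le>k. \<forall>t.
        \<bar>(deriv ^^ j) (\<eta> q i) t\<bar> \<le> C k / (tq (Suc q) - tq q) ^ (k + 1)"
    using cutoffs unfolding time_cutoffs_def by blast
  have b: "\<bar>\<eta> q 1 t\<bar> \<le> C 0 * pi\<^sup>2 / 3 * (real q + 1)\<^sup>2" for q t
  proof -
    have "\<bar>(deriv ^^ 0) (\<eta> q 1) t\<bar> \<le> C 0 / (tq (Suc q) - tq q) ^ (0 + 1)" using C by blast
    then show ?thesis unfolding tq_diff by simp
  qed
  have "0 \<le> C 0 * pi\<^sup>2 / 3" using b[of 0 0] by simp
  moreover have "\<eta> q 1 t \<le> C 0 * pi\<^sup>2 / 3 * (real q + 1)\<^sup>2" for q t using b[of q t] by linarith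
  ultimately show ?thesis by blast
qed

lemma first_half_J:
  "t \<in> J q 1 \<Longrightarrow> velocity_first_half \<gamma> \<rho> \<eta> a \<phi> t z = \<eta> q 1 t *\<^sub>R vector [g1 q (z $ 2), 0]"
  "t \<in> J q 2 \<Longrightarrow> velocity_first_half \<gamma> \<rho> \<eta> a \<phi> t z = \<eta> q 2 t *\<^sub>R vector [0, g2 q (z $ 1)]"
  "t \<in> J q 3 \<Longrightarrow> velocity_first_half \<gamma> \<rho> \<eta> a \<phi> t z = 0"
  using the_stage[OF J_in_stage[of t q 1]] the_stage[OF J_in_stage[of t q 2]] the_stage[OF J_in_stage[of t q 3]]
    J_inj[of t q 1 q 2] J_inj[of t q 1 q 3] J_inj[of t q 2 q 3]
  by (auto simp: velocity_first_half_def Let_def mollify_v simp del: tq.simps)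

lemma swap_sum:
  assumes "t \<in> J q i" "i \<in> {1,2,3}"
  shows "(\<Sum>q. \<eta> q 3 t *\<^sub>R vswap a q) = (if i = 3 then \<eta> q 3 t *\<^sub>R vswap a q else 0)"
proof -
  have z: "\<eta> q' 3 t = 0" if "q' \<noteq> q \<or> i \<noteq> 3" for q'
    using that J_inj[OF assms(1) _ assms(2), of q' 3] by (intro eta_zero) auto
  have "(\<Sum>q. \<eta> q 3 t *\<^sub>R vswap a q) = (\<Sum>q'\<in>{q}. \<eta> q' 3 t *\<^sub>R vswap a q')"
    by (rule suminf_finite) (use z in auto)
  then show ?thesis using z by auto
qed

lemma J_half: "t \<in> J q i \<Longrightarrow> i \<in> {1,2,3} \<Longrightarrow> 0 \<le> t \<and> t < 1/2"
  using J_in_stage[of t q i] tq_nonneg[of q] tq_lt_half[of "Suc q"] by force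

lemma velocity_forward:
  "t \<in> J q 1 \<Longrightarrow> u t z = \<eta> q 1 t *\<^sub>R vector [g1 q (z $ 2), 0]"
  "t \<in> J q 2 \<Longrightarrow> u t z = \<eta> q 2 t *\<^sub>R vector [0, g2 q (z $ 1)]"
  "t \<in> J q 3 \<Longrightarrow> u t z = 0"
  using J_half[of t q 1] J_half[of t q 2] J_half[of t q 3] first_half_J[of t q z]
  by (auto simp: velocity_def)

lemma velocity_backward:
  "1 - t \<in> J q 1 \<Longrightarrow> u t z = - \<eta> q 1 (1 - t) *\<^sub>R vector [g1 q (z $ 2), 0]"
  "1 - t \<in> J q 2 \<Longrightarrow> u t z = - \<eta> q 2 (1 - t) *\<^sub>R vector [0, g2 q (z $ 1)]"
  "1 - t \<in> J q 3 \<Longrightarrow> u t z = \<eta> q 3 (1 - t) *\<^sub>R vswap a q"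
  using J_half[of "1 - t" q 1] J_half[of "1 - t" q 2] J_half[of "1 - t" q 3] first_half_J[of "1 - t" q z]
    swap_sum[of "1 - t" q 1] swap_sum[of "1 - t" q 2] swap_sum[of "1 - t" q 3]
  by (auto simp: velocity_def)

end

section \<open>Displacement of a path during one stage\<close>

lemma weighted_average:
  fixes e h :: "real \<Rightarrow> real"
  assumes i: "(\<lambda>r. e r * h r) integrable_on {s..t}" and e: "(e has_integral 1) {s..t}" "\<And>r. 0 \<le> e r"
    and h: "\<And>r. r \<in> {s..t} \<Longrightarrow> e r \<noteq> 0 \<Longrightarrow> \<bar>h r - c\<bar> \<le> \<epsilon>"
  shows "\<bar>integral {s..t} (\<lambda>r. e r * h r) - c\<bar> \<le> \<epsilon>"
proof -
  have c: "((\<lambda>r. e r * c) has_integral c) {s..t}" and eps: "((\<lambda>r. e r * \<epsilon>) has_integral \<epsilon>) {s..t}"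
    using has_integral_mult_left[OF e(1), of c] has_integral_mult_left[OF e(1), of \<epsilon>] by simp_all
  have "integral {s..t} (\<lambda>r. e r * h r) - c = integral {s..t} (\<lambda>r. e r * h r - e r * c)"
    using i c by (simp add: Henstock_Kurzweil_Integration.integral_diff has_integral_iff)
  also have "norm \<dots> \<le> integral {s..t} (\<lambda>r. e r * \<epsilon>)"
  proof (rule Henstock_Kurzweil_Integration.integral_norm_bound_integral)
    show "(\<lambda>r. e r * h r - e r * c) integrable_on {s..t}"
      using i c by (intro Henstock_Kurzweil_Integration.integrable_diff) (auto simp: has_integral_iff)
    show "(\<lambda>r. e r * \<epsilon>) integrable_on {s..t}" using eps by (auto simp: has_integral_iff)
    fix r assume r: "r \<in> {s..t}"
    show "norm (e r * h r - e r * c) \<le> e r * \<epsilon>"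
    proof (cases "e r = 0")
      case False
      have "\<bar>e r * h r - e r * c\<bar> = e r * \<bar>h r - c\<bar>" using e(2)[of r] by (simp add: right_diff_distrib[symmetric] abs_mult)
      also have "\<dots> \<le> e r * \<epsilon>" by (rule mult_left_mono[OF h[OF r False] e(2)])
      finally show ?thesis by simp
    qed simp
  qed
  also have "\<dots> = \<epsilon>" using eps by (simp add: has_integral_iff)
  finally show ?thesis by simp
qed

lemma has_integral_Icc_lborel:
  fixes f :: "real \<Rightarrow> real"
  assumes "integrable lborel f" "\<And>r. r \<notin> {s..t} \<Longrightarrow> f r = 0"
  shows "(f has_integral (\<integral>r. f r \<partial>lborel)) {s..t}"
proof -
  have "(f has_integral (\<integral>r. f r \<partial>lborel)) UNIV" using assms(1) by (rule has_integral_integral_lborel)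
  moreover have "f = (\<lambda>r. if r \<in> {s..t} then f r else 0)" using assms(2) by auto
  ultimately show ?thesis using has_integral_restrict_UNIV[of "{s..t}" f] by metis
qed

text \<open>One sample: \<open>w\<close> is a single noise path and \<open>X\<close> the trajectory
  from \<open>x0\<close>. Everything proved here is deterministic.\<close>

locale cascade_path = cascade +
  fixes \<kappa> :: real and w X :: "real \<Rightarrow> real^2" and x0 :: "real^2"
  assumes path: "\<And>t. t \<in> {0..1} \<Longrightarrow> set_integrable lborel {0..t} (\<lambda>r. velocity \<gamma> \<rho> \<eta> a \<phi> r (X r))"
    "\<And>t. t \<in> {0..1} \<Longrightarrow> X t = x0 + (LINT r:{0..t}|lborel. velocity \<gamma> \<rho> \<eta> a \<phi> r (X r)) + \<kappa> *\<^sub>R w t"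
begin

definition V :: "real \<Rightarrow> real^2" where
  "V r = u r (X r)"

text \<open>Removing the noise leaves the integral of the drift, which is continuous even when
  \<open>w\<close> has jumps.\<close>

definition Y :: "real \<Rightarrow> real^2" where
  "Y t = X t - \<kappa> *\<^sub>R w t"

lemma V_integral: "0 \<le> t \<Longrightarrow> t \<le> 1 \<Longrightarrow> V integrable_on {0..t} \<and> Y t = x0 + integral {0..t} V"
  using path[of t] set_borel_integral_eq_integral[of "{0..t}" "\<lambda>r. u r (X r)"]
  by (simp add: V_def[abs_def] Y_def algebra_simps)

lemma V_integrable: "0 \<le> s \<Longrightarrow> t \<le> 1 \<Longrightarrow> V integrable_on {s..t}"
proof (cases "s \<le> t")
  case True
  assume "0 \<le> s" "t \<le> 1"
  then show ?thesis using V_integral[of t] True by (auto intro: integrable_on_subinterval)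
qed auto

lemma Y_0: "Y 0 = x0"
  using V_integral[of 0] by simp

lemma Y_diff: "0 \<le> s \<Longrightarrow> s \<le> t \<Longrightarrow> t \<le> 1 \<Longrightarrow> Y t - Y s = integral {s..t} V"
  using V_integral[of t] V_integral[of s] Henstock_Kurzweil_Integration.integral_combine[of 0 s t V]
  by (auto simp: algebra_simps)

lemma Y_continuous: "continuous_on {0..1} Y"
proof -
  have "continuous_on {0..1} (\<lambda>t. x0 + integral {0..t} V)"
    by (intro continuous_intros indefinite_integral_continuous_1 V_integrable) auto
  then show ?thesis by (rule continuous_on_eq) (use V_integral in auto)
qed

lemma Y_diff_component:
  assumes st: "0 \<le> s" "s \<le> t" "t \<le> 1" and f: "\<And>r. s < r \<Longrightarrow> r < t \<Longrightarrow> V r $ i = f r"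
  shows "Y t $ i - Y s $ i = integral {s..t} f" "f integrable_on {s..t}"
proof -
  have V: "V integrable_on {s..t}" using st by (intro V_integrable) auto
  have Vi: "((\<lambda>r. V r $ i) has_integral (integral {s..t} V $ i)) {s..t}"
    using has_integral_linear[OF integrable_integral[OF V] bounded_linear_vec_nth[of i]] by (simp add: o_def)
  then have "(f has_integral (integral {s..t} V $ i)) {s..t}"
  proof (rule has_integral_spike_finite[of "{s,t}", rotated 2])
    show "f r = V r $ i" if "r \<in> {s..t} - {s, t}" for r using f[of r] that by auto
  qed simp
  then show "Y t $ i - Y s $ i = integral {s..t} f" "f integrable_on {s..t}"
    unfolding vector_minus_component[symmetric] Y_diff[OF st] by (auto simp: has_integral_iff)
qed

text \<open>A shear moves coordinate \<open>i\<close> while its profile reads coordinate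
  \<open>j\<close>. During the shear \<open>Y $ j\<close> is therefore frozen, the profile is
  evaluated at a constant plus \<kappa> \<open>w r $ j\<close>, and the equation is solved by an
  explicit integral over the noise.\<close>

lemma shear_step:
  assumes st: "0 \<le> s" "s \<le> t" "t \<le> 1" and ij: "i \<noteq> j"
    and V: "\<And>r. s < r \<Longrightarrow> r < t \<Longrightarrow> V r = (\<sigma> * e r * g (X r $ j)) *\<^sub>R axis i 1" and \<sigma>: "\<sigma> \<noteq> 0"
  shows "\<And>r. r \<in> {s..t} \<Longrightarrow> Y r $ j = Y s $ j"
    and "Y t $ i - Y s $ i = \<sigma> * integral {s..t} (\<lambda>r. e r * g (Y s $ j + \<kappa> * w r $ j))"
    and "(\<lambda>r. e r * g (Y s $ j + \<kappa> * w r $ j)) integrable_on {s..t}"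
proof -
  show *: "Y r $ j = Y s $ j" if "r \<in> {s..t}" for r
    using Y_diff_component(1)[of s r j "\<lambda>_. 0"] that st V ij by (auto simp: axis_def)
  have "V r $ i = \<sigma> * (e r * g (Y s $ j + \<kappa> * w r $ j))" if "s < r" "r < t" for r
  proof -
    have "X r $ j = Y s $ j + \<kappa> * w r $ j" using *[of r] that by (simp add: Y_def)
    then show ?thesis using V[OF that] by (simp add: axis_def)
  qed
  note d = Y_diff_component[OF st this]
  from d show "Y t $ i - Y s $ i = \<sigma> * integral {s..t} (\<lambda>r. e r * g (Y s $ j + \<kappa> * w r $ j))" by simp
  from d(2) show "(\<lambda>r. e r * g (Y s $ j + \<kappa> * w r $ j)) integrable_on {s..t}"
    using \<sigma> by (simp add: integrable_on_cmult_iff)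
qed

lemma eta_integral_Icc:
  assumes "i \<in> {1,2,3}" "J q i \<subseteq> {s..t}"
  shows "(\<eta> q i has_integral 1) {s..t}" "((\<lambda>r. \<eta> q i (1 - r)) has_integral 1) {1 - t..1 - s}"
proof -
  show "(\<eta> q i has_integral 1) {s..t}"
    using has_integral_Icc_lborel[of "\<eta> q i" s t] eta_props(3,5)[OF assms(1), of q] eta_zero[OF assms(1), of _ q] assms(2)
    by fastforce
  have "integrable lborel (\<lambda>r. \<eta> q i (1 + (-1) * r))"
    by (rule lborel_integrable_real_affine[OF eta_props(5)[OF assms(1)]]) simp
  moreover have "(\<integral>r. \<eta> q i (1 + (-1) * r) \<partial>lborel) = 1"
    using lborel_integral_real_affine[of "-1" "\<eta> q i" 1] eta_props(3)[OF assms(1), of q] by simp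
  moreover have "\<eta> q i (1 + (-1) * r) = 0" if "r \<notin> {1 - t..1 - s}" for r
    using that assms(2) by (intro eta_zero[OF assms(1)]) auto
  ultimately show "((\<lambda>r. \<eta> q i (1 - r)) has_integral 1) {1 - t..1 - s}"
    using has_integral_Icc_lborel[of "\<lambda>r. \<eta> q i (1 + (-1) * r)" "1 - t" "1 - s"] by simp
qed

lemma shear_average:
  assumes st: "0 \<le> s" "s \<le> t" "t \<le> 1" and ij: "i \<noteq> j"
    and V: "\<And>r. s < r \<Longrightarrow> r < t \<Longrightarrow> V r = (\<sigma> * e r * g (X r $ j)) *\<^sub>R axis i 1" and \<sigma>: "\<bar>\<sigma>\<bar> = 1"
    and e: "(e has_integral 1) {s..t}" "\<And>r. 0 \<le> e r"
    and h: "\<And>r. r \<in> {s..t} \<Longrightarrow> e r \<noteq> 0 \<Longrightarrow> \<bar>g (Y s $ j + \<kappa> * w r $ j) - c\<bar> \<le> \<epsilon>"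
  shows "\<bar>Y t $ i - Y s $ i - \<sigma> * c\<bar> \<le> \<epsilon>"
proof -
  have \<sigma>0: "\<sigma> \<noteq> 0" using \<sigma> by auto
  note S = shear_step[OF st ij V \<sigma>0]
  have "Y t $ i - Y s $ i - \<sigma> * c = \<sigma> * (integral {s..t} (\<lambda>r. e r * g (Y s $ j + \<kappa> * w r $ j)) - c)"
    using S(2) by (simp add: algebra_simps)
  then have "\<bar>Y t $ i - Y s $ i - \<sigma> * c\<bar> = \<bar>integral {s..t} (\<lambda>r. e r * g (Y s $ j + \<kappa> * w r $ j)) - c\<bar>"
    using \<sigma> by (simp add: abs_mult)
  also have "\<dots> \<le> \<epsilon>" by (rule weighted_average[OF S(3) e h])
  finally show ?thesis .
qed

text \<open>The first coordinate moves only in the first third and the second only in the second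
  third, so the vertical profile may be evaluated at \<open>Y (tq (Suc q)) $ 1\<close>, the value at
  the end of the stage. The exact formula for the horizontal move is kept for the averaging; the
  other two claims are its approximate forms.\<close>

lemma forward_stage:
  shows "Y (tq (Suc q)) $ 1 - Y (tq q) $ 1 = integral {tau q 0..tau q 1} (\<lambda>r. \<eta> q 1 r * g1 q (Y (tq q) $ 2 + \<kappa> * w r $ 2))"
    and "(\<And>r. r \<in> J q 1 \<Longrightarrow> \<bar>g1 q (Y (tq q) $ 2 + \<kappa> * w r $ 2) - c1\<bar> \<le> \<epsilon>1) \<Longrightarrow>
      \<bar>Y (tq (Suc q)) $ 1 - Y (tq q) $ 1 - c1\<bar> \<le> \<epsilon>1"
    and "(\<And>r. r \<in> J q 2 \<Longrightarrow> \<bar>g2 q (Y (tq (Suc q)) $ 1 + \<kappa> * w r $ 1) - c2\<bar> \<le> \<epsilon>2) \<Longrightarrow>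
      \<bar>Y (tq (Suc q)) $ 2 - Y (tq q) $ 2 - c2\<bar> \<le> \<epsilon>2"
proof -
  have t1: "0 \<le> tau q 0" "tau q 0 \<le> tau q 1" "tau q 1 \<le> 1"
    and t2: "0 \<le> tau q 1" "tau q 1 \<le> tau q 2" "tau q 2 \<le> 1"
    and t3: "0 \<le> tau q 2" "tau q 2 \<le> tau q 3" "tau q 3 \<le> 1"
    using tau_01[of 0 q] tau_01[of 1 q] tau_01[of 2 q] tau_01[of 3 q] tau_le[of 0 1 q] tau_le[of 1 2 q] tau_le[of 2 3 q]
    by auto
  have ne: "(1::2) \<noteq> 2" "(2::2) \<noteq> 1" by simp_all
  have V1: "V r = (1 * \<eta> q 1 r * g1 q (X r $ 2)) *\<^sub>R axis 1 1" if "tau q 0 < r" "r < tau q 1" for r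
    unfolding V_def using velocity_forward(1)[of r q "X r"] that by (simp add: J_tau vector_axis)
  have V2: "V r = (1 * \<eta> q 2 r * g2 q (X r $ 1)) *\<^sub>R axis 2 1" if "tau q 1 < r" "r < tau q 2" for r
    unfolding V_def using velocity_forward(2)[of r q "X r"] that by (simp add: J_tau vector_axis)
  have V3: "V r $ i = 0" if "tau q 2 < r" "r < tau q 3" for r i
    unfolding V_def using velocity_forward(3)[of r q "X r"] that by (simp add: J_tau)
  have c3: "Y (tau q 3) $ i = Y (tau q 2) $ i" for i using Y_diff_component(1)[OF t3 V3] by simp
  have c2: "Y (tau q 2) $ 1 = Y (tau q 1) $ 1"
    using shear_step(1)[OF t2 ne(2) V2, of "tau q 2"] t2 by simp
  have c1: "Y (tau q 1) $ 2 = Y (tau q 0) $ 2"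
    using shear_step(1)[OF t1 ne(1) V1, of "tau q 1"] t1 by simp
  show "Y (tq (Suc q)) $ 1 - Y (tq q) $ 1 = integral {tau q 0..tau q 1} (\<lambda>r. \<eta> q 1 r * g1 q (Y (tq q) $ 2 + \<kappa> * w r $ 2))"
    using shear_step(2)[OF t1 ne(1) V1] c2 c3 by (simp add: tau_ends del: tq.simps)
  show "\<bar>Y (tq (Suc q)) $ 1 - Y (tq q) $ 1 - c1\<bar> \<le> \<epsilon>1"
    if "\<And>r. r \<in> J q 1 \<Longrightarrow> \<bar>g1 q (Y (tq q) $ 2 + \<kappa> * w r $ 2) - c1\<bar> \<le> \<epsilon>1"
  proof -
    have "\<bar>Y (tau q 1) $ 1 - Y (tau q 0) $ 1 - 1 * c1\<bar> \<le> \<epsilon>1"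
    proof (rule shear_average[OF t1 ne(1) V1])
      show "(\<eta> q 1 has_integral 1) {tau q 0..tau q 1}" by (rule eta_integral_Icc(1)) (auto simp: J_tau)
      show "0 \<le> \<eta> q 1 r" for r by (rule eta_props(1)) simp
      show "\<bar>g1 q (Y (tau q 0) $ 2 + \<kappa> * w r $ 2) - c1\<bar> \<le> \<epsilon>1" if "\<eta> q 1 r \<noteq> 0" for r
        using that \<open>\<And>r. r \<in> J q 1 \<Longrightarrow> _\<close>[of r] eta_props(2)[of 1 q r] by (simp add: tau_ends del: tq.simps)
    qed simp_all
    then show ?thesis using c2 c3 by (simp add: tau_ends del: tq.simps)
  qed
  show "\<bar>Y (tq (Suc q)) $ 2 - Y (tq q) $ 2 - c2\<bar> \<le> \<epsilon>2"
    if "\<And>r. r \<in> J q 2 \<Longrightarrow> \<bar>g2 q (Y (tq (Suc q)) $ 1 + \<kappa> * w r $ 1) - c2\<bar> \<le> \<epsilon>2"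
  proof -
    have "\<bar>Y (tau q 2) $ 2 - Y (tau q 1) $ 2 - 1 * c2\<bar> \<le> \<epsilon>2"
    proof (rule shear_average[OF t2 ne(2) V2])
      show "(\<eta> q 2 has_integral 1) {tau q 1..tau q 2}" by (rule eta_integral_Icc(1)) (auto simp: J_tau)
      show "0 \<le> \<eta> q 2 r" for r by (rule eta_props(1)) simp
      show "\<bar>g2 q (Y (tau q 1) $ 1 + \<kappa> * w r $ 1) - c2\<bar> \<le> \<epsilon>2" if "\<eta> q 2 r \<noteq> 0" for r
        using that \<open>\<And>r. r \<in> J q 2 \<Longrightarrow> _\<close>[of r] eta_props(2)[of 2 q r] c2 c3 by (simp add: tau_ends del: tq.simps)
    qed simp_all
    then show ?thesis using c1 c3 by (simp add: tau_ends del: tq.simps)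
  qed
qed

text \<open>Time reversal runs through the thirds in the opposite order: swap, vertical shear,
  horizontal shear. Hence the vertical profile is read after the shift by \<open>a (Suc q)\<close>,
  and the horizontal one at the final height \<open>Y (1 - tq q) $ 2\<close>.\<close>

lemma backward_stage:
  shows "Y (1 - tq q) $ 1 - Y (1 - tq (Suc q)) $ 1 - a (Suc q)
      = - integral {1 - tau q 1..1 - tau q 0} (\<lambda>r. \<eta> q 1 (1 - r) * g1 q (Y (1 - tq q) $ 2 + \<kappa> * w r $ 2))"
    and "(\<And>r. 1 - r \<in> J q 1 \<Longrightarrow> \<bar>g1 q (Y (1 - tq q) $ 2 + \<kappa> * w r $ 2) - c1\<bar> \<le> \<epsilon>1) \<Longrightarrow>
      \<bar>Y (1 - tq q) $ 1 - Y (1 - tq (Suc q)) $ 1 - a (Suc q) + c1\<bar> \<le> \<epsilon>1"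
    and "(\<And>r. 1 - r \<in> J q 2 \<Longrightarrow> \<bar>g2 q (Y (1 - tq (Suc q)) $ 1 + a (Suc q) + \<kappa> * w r $ 1) - c2\<bar> \<le> \<epsilon>2) \<Longrightarrow>
      \<bar>Y (1 - tq q) $ 2 - Y (1 - tq (Suc q)) $ 2 + c2\<bar> \<le> \<epsilon>2"
proof -
  have t1: "0 \<le> 1 - tau q 1" "1 - tau q 1 \<le> 1 - tau q 0" "1 - tau q 0 \<le> 1"
    and t2: "0 \<le> 1 - tau q 2" "1 - tau q 2 \<le> 1 - tau q 1" "1 - tau q 1 \<le> 1"
    and t3: "0 \<le> 1 - tau q 3" "1 - tau q 3 \<le> 1 - tau q 2" "1 - tau q 2 \<le> 1"
    using tau_01[of 0 q] tau_01[of 1 q] tau_01[of 2 q] tau_01[of 3 q] tau_le[of 0 1 q] tau_le[of 1 2 q] tau_le[of 2 3 q]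
    by auto
  have ne: "(1::2) \<noteq> 2" "(2::2) \<noteq> 1" by simp_all
  have V1: "V r = (-1 * \<eta> q 1 (1 - r) * g1 q (X r $ 2)) *\<^sub>R axis 1 1" if "1 - tau q 1 < r" "r < 1 - tau q 0" for r
    unfolding V_def using velocity_backward(1)[of r q "X r"] that by (simp add: J_tau vector_axis)
  have V2: "V r = (-1 * \<eta> q 2 (1 - r) * g2 q (X r $ 1)) *\<^sub>R axis 2 1" if "1 - tau q 2 < r" "r < 1 - tau q 1" for r
    unfolding V_def using velocity_backward(2)[of r q "X r"] that by (simp add: J_tau vector_axis)
  have V3: "V r = (1 * \<eta> q 3 (1 - r) * a (Suc q)) *\<^sub>R axis 1 1" if "1 - tau q 3 < r" "r < 1 - tau q 2" for r
    unfolding V_def using velocity_backward(3)[of r q "X r"] that by (simp add: J_tau vector_axis vswap_def)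
  have s2: "Y (1 - tau q 2) $ 2 = Y (1 - tau q 3) $ 2"
    using shear_step(1)[OF t3 ne(1), of 1 "\<lambda>r. \<eta> q 3 (1 - r)" "\<lambda>_. a (Suc q)" "1 - tau q 2"] V3 t3 by simp
  have "\<bar>Y (1 - tau q 2) $ 1 - Y (1 - tau q 3) $ 1 - 1 * a (Suc q)\<bar> \<le> 0"
  proof (rule shear_average[OF t3 ne(1)])
    show "V r = (1 * \<eta> q 3 (1 - r) * (\<lambda>_. a (Suc q)) (X r $ 2)) *\<^sub>R axis 1 1" if "1 - tau q 3 < r" "r < 1 - tau q 2" for r
      by (rule V3[OF that])
    show "((\<lambda>r. \<eta> q 3 (1 - r)) has_integral 1) {1 - tau q 3..1 - tau q 2}" by (rule eta_integral_Icc(2)) (auto simp: J_tau)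
    show "0 \<le> \<eta> q 3 (1 - r)" for r by (rule eta_props(1)) simp
  qed simp_all
  then have s1: "Y (1 - tau q 2) $ 1 = Y (1 - tau q 3) $ 1 + a (Suc q)" by simp
  have c2: "Y (1 - tau q 1) $ 1 = Y (1 - tau q 2) $ 1"
    using shear_step(1)[OF t2 ne(2) V2, of "1 - tau q 1"] t2 by simp
  have c1: "Y (1 - tau q 0) $ 2 = Y (1 - tau q 1) $ 2"
    using shear_step(1)[OF t1 ne(1) V1, of "1 - tau q 0"] t1 by simp
  show "Y (1 - tq q) $ 1 - Y (1 - tq (Suc q)) $ 1 - a (Suc q)
      = - integral {1 - tau q 1..1 - tau q 0} (\<lambda>r. \<eta> q 1 (1 - r) * g1 q (Y (1 - tq q) $ 2 + \<kappa> * w r $ 2))"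
    using shear_step(2)[OF t1 ne(1) V1] c1 c2 s1 by (simp add: tau_ends del: tq.simps)
  show "\<bar>Y (1 - tq q) $ 1 - Y (1 - tq (Suc q)) $ 1 - a (Suc q) + c1\<bar> \<le> \<epsilon>1"
    if "\<And>r. 1 - r \<in> J q 1 \<Longrightarrow> \<bar>g1 q (Y (1 - tq q) $ 2 + \<kappa> * w r $ 2) - c1\<bar> \<le> \<epsilon>1"
  proof -
    have "\<bar>Y (1 - tau q 0) $ 1 - Y (1 - tau q 1) $ 1 - -1 * c1\<bar> \<le> \<epsilon>1"
    proof (rule shear_average[OF t1 ne(1) V1])
      show "((\<lambda>r. \<eta> q 1 (1 - r)) has_integral 1) {1 - tau q 1..1 - tau q 0}" by (rule eta_integral_Icc(2)) (auto simp: J_tau)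
      show "0 \<le> \<eta> q 1 (1 - r)" for r by (rule eta_props(1)) simp
      show "\<bar>g1 q (Y (1 - tau q 1) $ 2 + \<kappa> * w r $ 2) - c1\<bar> \<le> \<epsilon>1" if "\<eta> q 1 (1 - r) \<noteq> 0" for r
        using that \<open>\<And>r. 1 - r \<in> J q 1 \<Longrightarrow> _\<close>[of r] eta_props(2)[of 1 q "1 - r"] c1 by (simp add: tau_ends del: tq.simps)
    qed simp_all
    then show ?thesis using c2 s1 by (simp add: tau_ends del: tq.simps)
  qed
  show "\<bar>Y (1 - tq q) $ 2 - Y (1 - tq (Suc q)) $ 2 + c2\<bar> \<le> \<epsilon>2"
    if "\<And>r. 1 - r \<in> J q 2 \<Longrightarrow> \<bar>g2 q (Y (1 - tq (Suc q)) $ 1 + a (Suc q) + \<kappa> * w r $ 1) - c2\<bar> \<le> \<epsilon>2"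
  proof -
    have "\<bar>Y (1 - tau q 1) $ 2 - Y (1 - tau q 2) $ 2 - -1 * c2\<bar> \<le> \<epsilon>2"
    proof (rule shear_average[OF t2 ne(2) V2])
      show "((\<lambda>r. \<eta> q 2 (1 - r)) has_integral 1) {1 - tau q 2..1 - tau q 1}" by (rule eta_integral_Icc(2)) (auto simp: J_tau)
      show "0 \<le> \<eta> q 2 (1 - r)" for r by (rule eta_props(1)) simp
      show "\<bar>g2 q (Y (1 - tau q 2) $ 1 + \<kappa> * w r $ 1) - c2\<bar> \<le> \<epsilon>2" if "\<eta> q 2 (1 - r) \<noteq> 0" for r
        using that \<open>\<And>r. 1 - r \<in> J q 2 \<Longrightarrow> _\<close>[of r] eta_props(2)[of 2 q "1 - r"] s1 by (simp add: tau_ends del: tq.simps)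
    qed simp_all
    then show ?thesis using c1 s2 by (simp add: tau_ends del: tq.simps)
  qed
qed

end

section \<open>Shadowing the noiseless orbit\<close>

context cascade
begin

text \<open>The noiseless orbit at the times \<open>tq j\<close>, for the mollified shears: every
  cutoff has integral 1, so a stage is a composition of two plain shears.\<close>

primrec fwd :: "nat \<Rightarrow> real \<times> real \<Rightarrow> real \<times> real" where
  "fwd 0 p = p"
| "fwd (Suc j) p = (let y1 = fst (fwd j p) + g1 j (snd (fwd j p)) in (y1, snd (fwd j p) + g2 j y1))"

lemma fwd_Suc:
  "fst (fwd (Suc j) p) = fst (fwd j p) + g1 j (snd (fwd j p))"
  "snd (fwd (Suc j) p) = snd (fwd j p) + g2 j (fst (fwd (Suc j) p))"
  by (simp_all add: Let_def)

declare fwd.simps(2) [simp del]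

text \<open>The noiseless return through stage \<open>j\<close>: swap, inverse vertical shear,
  inverse horizontal shear. Apart from the swap it inverts the forward stage.\<close>

definition bstep :: "nat \<Rightarrow> real \<times> real \<Rightarrow> real \<times> real" where
  "bstep j y = (let y2 = snd y - g2 j (fst y + a (Suc j)) in (fst y + a (Suc j) - g1 j y2, y2))"

lemma bstep:
  "snd (bstep j y) = snd y - g2 j (fst y + a (Suc j))"
  "fst (bstep j y) = fst y + a (Suc j) - g1 j (snd (bstep j y))"
  by (simp_all add: bstep_def Let_def)

text \<open>The recursion counts the stages already undone, because the stage index itself decreases
  along the return orbit.\<close>

primrec bwd :: "nat \<Rightarrow> real \<times> real \<Rightarrow> nat \<Rightarrow> real \<times> real" where
  "bwd q p 0 = fwd q p"
| "bwd q p (Suc n) = bstep (q - Suc n) (bwd q p n)"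

text \<open>The noiseless return orbit, started at time \<open>1 - t\<^sub>q\<close> and stopped at time \<open>1 - t\<^sub>j\<close>.\<close>

definition ret :: "nat \<Rightarrow> real \<times> real \<Rightarrow> nat \<Rightarrow> real \<times> real" where
  "ret q p j = bwd q p (q - j)"

lemma ret_start: "ret q p q = fwd q p"
  by (simp add: ret_def)

lemma ret_step: "j < q \<Longrightarrow> ret q p j = bstep j (ret q p (Suc j))"
proof -
  assume "j < q"
  then have "q - j = Suc (q - Suc j)" "q - Suc (q - Suc j) = j" by auto
  then show ?thesis by (simp add: ret_def)
qed

text \<open>The margin \<open>5 \<ell>\<^sub>j\<^sub>+\<^sub>1\<close> covers the mollification radius \<open>\<ell>\<^sub>j\<^sub>+\<^sub>1\<close> and the distance
  between the noisy and the noiseless orbit.\<close>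

definition good :: "nat \<Rightarrow> real \<times> real \<Rightarrow> bool" where
  "good j p \<longleftrightarrow> grid_off (a (Suc j)) (5 * lq (Suc j)) (snd (fwd j p)) \<and>
     grid_off (a (Suc j)) (5 * lq (Suc j)) (fst (fwd (Suc j) p))"

text \<open>Its growth in \<open>j\<close> is harmless for the tracking: it enters there through
  stages below an index that is fixed before q tends to infinity.\<close>

definition Lip :: "nat \<Rightarrow> real" where
  "Lip j = (SOME L. 0 \<le> L \<and> (\<forall>z z'. \<bar>g1 j z - g1 j z'\<bar> \<le> L * \<bar>z - z'\<bar> \<and> \<bar>g2 j z - g2 j z'\<bar> \<le> L * \<bar>z - z'\<bar>))"

lemma Lip: "0 \<le> Lip j" "\<bar>g1 j z - g1 j z'\<bar> \<le> Lip j * \<bar>z - z'\<bar>" "\<bar>g2 j z - g2 j z'\<bar> \<le> Lip j * \<bar>z - z'\<bar>"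
proof -
  have "0 \<le> Lip j \<and> (\<forall>z z'. \<bar>g1 j z - g1 j z'\<bar> \<le> Lip j * \<bar>z - z'\<bar> \<and> \<bar>g2 j z - g2 j z'\<bar> \<le> Lip j * \<bar>z - z'\<bar>)"
    unfolding Lip_def by (rule someI_ex) (use g_lipschitz[of j] in blast)
  then show "0 \<le> Lip j" "\<bar>g1 j z - g1 j z'\<bar> \<le> Lip j * \<bar>z - z'\<bar>" "\<bar>g2 j z - g2 j z'\<bar> \<le> Lip j * \<bar>z - z'\<bar>" by auto
qed

text \<open>Merges the two shears of a stage into one factor: the first bound is for the coordinate
  sheared first, the second for the one sheared afterwards, which inherits the error of the
  first.\<close>

lemma Lip_two_steps:
  assumes "0 \<le> e" "0 \<le> k"
  shows "e + Lip j * (e + k) \<le> (1 + Lip j)\<^sup>2 * (e + k)" "e + Lip j * (e + Lip j * (e + k) + k) \<le> (1 + Lip j)\<^sup>2 * (e + k)"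
proof -
  have "0 \<le> Lip j * (e + k)" "0 \<le> Lip j * Lip j * (e + k)" using Lip(1)[of j] assms by auto
  then show "e + Lip j * (e + k) \<le> (1 + Lip j)\<^sup>2 * (e + k)" "e + Lip j * (e + Lip j * (e + k) + k) \<le> (1 + Lip j)\<^sup>2 * (e + k)"
    using assms(2) by (simp_all add: power2_eq_square algebra_simps)
qed

text \<open>Amplification of the error on the way out, in units of the noise size \<open>k\<close>;
  the summand 1 is the fresh noise of each stage.\<close>

primrec Cf :: "nat \<Rightarrow> real" where
  "Cf 0 = 0"
| "Cf (Suc j) = (1 + Lip j)\<^sup>2 * (Cf j + 1)"

text \<open>Amplification on the way back through the stages below \<open>j\<close>. The extra 1 in
  the factor absorbs the \<open>k\<close> that is added again before the next stage.\<close>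

primrec Cb :: "nat \<Rightarrow> real" where
  "Cb 0 = 1"
| "Cb (Suc j) = Cb j * ((1 + Lip j)\<^sup>2 + 1)"

lemma Cf_nonneg: "0 \<le> Cf j"
  using Lip(1) by (induction j) auto

lemma Cb_ge_1: "1 \<le> Cb j"
proof (induction j)
  case (Suc j)
  have "1 * 1 \<le> Cb j * ((1 + Lip j)\<^sup>2 + 1)" using Suc by (intro mult_mono) auto
  then show ?case by simp
qed simp

text \<open>Off the grid the vertical shear moves by no cell or by one whole fine cell, so it
  preserves the distance from the fine grid.\<close>

lemma g2_good:
  assumes "grid_off (a (Suc j)) m z" "lq (Suc j) < m"
  shows "\<exists>i::int. \<bar>i\<bar> \<le> 1 \<and> 0 \<le> i \<and> g2 j z = of_int i * a (Suc j)"
proof -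
  have "g2 j z = a (Suc j) / 2 * (wave (a j) (a (Suc j)) z + 1)"
    by (rule g_grid_off(2)[OF assms(1)]) (use assms(2) in simp)
  then show ?thesis using wave_cases[of "a j" "a (Suc j)" z]
    by (elim disjE) (auto intro: exI[of _ "1::int"] exI[of _ "0::int"])
qed

text \<open>Two such values differ by a multiple of \<open>a j\<close>, the translation allowed in
  \<open>ret_invariant\<close>.\<close>

lemma g1_good:
  assumes "grid_off (a (Suc j)) m z" "lq (Suc j) < m"
  shows "g1 j z = a j / 2 \<or> g1 j z = - (a j / 2)"
proof -
  have "g1 j z = a j / 2 * wave (a j) (a (Suc j)) z"
    by (rule g_grid_off(1)[OF assms(1)]) (use assms(2) in simp)
  then show ?thesis using wave_cases[of "a j" "a (Suc j)" z] by auto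
qed

text \<open>The vertical shear of a good stage moves by whole cells, so the height keeps its
  distance from the grid of spacing \<open>a (Suc j)\<close>. For stage \<open>Suc j\<close> this is
  the coarse grid, which is the input needed for averaging there.\<close>

lemma good_off_next:
  assumes "good j p"
  shows "grid_off (a (Suc j)) (5 * lq (Suc j)) (snd (fwd (Suc j) p))"
proof -
  have "lq (Suc j) < 5 * lq (Suc j)" using ell_pos[of "Suc j"] by linarith
  then obtain i :: int where "g2 j (fst (fwd (Suc j) p)) = of_int i * a (Suc j)"
    using g2_good[of j "5 * lq (Suc j)" "fst (fwd (Suc j) p)"] assms by (auto simp: good_def)
  then have "\<bar>snd (fwd (Suc j) p) - snd (fwd j p) - of_int i * a (Suc j)\<bar> \<le> 0"
    using fwd_Suc(2)[of j p] by simp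
  from grid_off_perturb[OF _ this, of "5 * lq (Suc j)"] show ?thesis using assms by (simp add: good_def)
qed

text \<open>The return orbit visits, up to smaller scales, translates by grid vectors of the points visited
  by the forward orbit, so it inherits the distance to the discontinuities.\<close>

lemma ret_invariant:
  assumes good: "\<And>j. j0 \<le> j \<Longrightarrow> j < q \<Longrightarrow> good j p"
    and small: "\<And>j. j0 \<le> j \<Longrightarrow> 3 * a (Suc (Suc j)) \<le> lq (Suc j)" and j: "j0 \<le> j" "j \<le> q"
  shows "(\<exists>m::int. \<bar>m\<bar> \<le> 1 \<and> \<bar>fst (ret q p j) - fst (fwd j p) - of_int m * a j\<bar> \<le> 3 * a (Suc j)) \<and>
     \<bar>snd (ret q p j) - snd (fwd j p)\<bar> \<le> 2 * a (Suc j) \<and>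
     (j < q \<longrightarrow> grid_off (a (Suc j)) (4 * lq (Suc j)) (fst (ret q p (Suc j)) + a (Suc j)) \<and>
       grid_off (a (Suc j)) (4 * lq (Suc j)) (snd (ret q p j)))"
  using j(2,1)
proof (induction j rule: inc_induct)
  case base
  show ?case by (auto simp: ret_start less_imp_le intro!: exI[of _ 0])
next
  case (step j)
  from step.IH[OF le_SucI[OF step.prems]] obtain m :: int where m: "\<bar>m\<bar> \<le> 1"
    "\<bar>fst (ret q p (Suc j)) - fst (fwd (Suc j) p) - of_int m * a (Suc j)\<bar> \<le> 3 * a (Suc (Suc j))"
    and s: "\<bar>snd (ret q p (Suc j)) - snd (fwd (Suc j) p)\<bar> \<le> 2 * a (Suc (Suc j))" by auto
  let ?z1 = "fst (ret q p (Suc j)) + a (Suc j)" and ?l = "lq (Suc j)"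
  have l: "0 < ?l" by simp
  have sm: "3 * a (Suc (Suc j)) \<le> ?l" by (rule small[OF step.prems])
  have a4: "a (Suc (Suc j)) \<le> a (Suc j) / 4" by (rule a_Suc_le)
  have ap: "0 < a (Suc (Suc j))" "0 < a (Suc j)" by simp_all
  have g: "good j p" by (rule good[OF step.prems step.hyps(2)])
  have r: "ret q p j = bstep j (ret q p (Suc j))" by (rule ret_step[OF step.hyps(2)])
  \<comment> \<open>The swap changes the grid offset from m to m + 1. The residual 3
    \<open>a (Suc (Suc j))\<close> is at most \<open>lq (Suc j)\<close> by \<open>small\<close>, so
    the margin falls from 5 to 4 and, since it is always taken from the forward orbit, never
    further.\<close>
  have "\<bar>?z1 - fst (fwd (Suc j) p) - of_int (m + 1) * a (Suc j)\<bar> \<le> ?l"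
    using m(2) sm by (simp add: algebra_simps)
  from grid_off_perturb[OF _ this, of "5 * ?l"] g have z1: "grid_off (a (Suc j)) (4 * ?l) ?z1"
    by (simp add: good_def)
  obtain i i' :: int where i: "\<bar>i\<bar> \<le> 1" "0 \<le> i" "g2 j ?z1 = of_int i * a (Suc j)"
    and i': "\<bar>i'\<bar> \<le> 1" "0 \<le> i'" "g2 j (fst (fwd (Suc j) p)) = of_int i' * a (Suc j)"
    using g2_good[OF z1] g2_good[of j "5 * ?l" "fst (fwd (Suc j) p)"] g l unfolding good_def by auto
  have d2: "snd (ret q p j) - snd (fwd j p) = (snd (ret q p (Suc j)) - snd (fwd (Suc j) p)) + of_int (i' - i) * a (Suc j)"
    unfolding r bstep(1) using fwd_Suc(2)[of j p] i(3) i'(3) by (simp add: algebra_simps)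
  have ii: "\<bar>i' - i\<bar> \<le> 1" using i i' by auto
  have "\<bar>of_int (i' - i) * a (Suc j)\<bar> \<le> 1 * a (Suc j)"
    unfolding abs_mult using ii ap by (intro mult_mono) auto
  then have D2: "\<bar>snd (ret q p j) - snd (fwd j p)\<bar> \<le> 2 * a (Suc j)"
    unfolding d2 using s a4 ap by linarith
  have "\<bar>snd (ret q p j) - snd (fwd j p) - of_int (i' - i) * a (Suc j)\<bar> \<le> ?l"
    unfolding d2 using s sm ap by linarith
  from grid_off_perturb[OF _ this, of "5 * ?l"] g have y2: "grid_off (a (Suc j)) (4 * ?l) (snd (ret q p j))"
    by (simp add: good_def)
  have "g1 j (snd (ret q p j)) = a j / 2 \<or> g1 j (snd (ret q p j)) = - (a j / 2)"
    by (rule g1_good[OF y2]) (use l in linarith)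
  moreover have "g1 j (snd (fwd j p)) = a j / 2 \<or> g1 j (snd (fwd j p)) = - (a j / 2)"
    by (rule g1_good[of j "5 * ?l"]) (use g l in \<open>auto simp: good_def\<close>)
  ultimately obtain m' :: int where m': "\<bar>m'\<bar> \<le> 1" "g1 j (snd (fwd j p)) - g1 j (snd (ret q p j)) = of_int m' * a j"
    by (elim disjE) (auto intro: that[of 0] that[of 1] that[of "-1"])
  \<comment> \<open>Offsets do not accumulate: the former offset m + 1 \<le> 2 in units of
    \<open>a (Suc j)\<close> is now part of the error, where 2 + 3/4 \<le> 3, and the new offset m'
    comes from the two horizontal shears of stage \<open>j\<close> alone.\<close>
  have d1: "fst (ret q p j) - fst (fwd j p) - of_int m' * a j
      = (fst (ret q p (Suc j)) - fst (fwd (Suc j) p) - of_int m * a (Suc j)) + of_int (m + 1) * a (Suc j)"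
    unfolding r bstep(2) unfolding r[symmetric] using fwd_Suc(1)[of j p] m'(2) by (simp add: algebra_simps)
  have "\<bar>of_int (m + 1) * a (Suc j)\<bar> \<le> 2 * a (Suc j)"
    unfolding abs_mult using m(1) ap by (intro mult_mono) auto
  then have "\<bar>fst (ret q p j) - fst (fwd j p) - of_int m' * a j\<bar> \<le> 3 * a (Suc j)"
    unfolding d1 using m(2) a4 ap by linarith
  then show ?case using m'(1) D2 z1 y2 by blast
qed

end

section \<open>The noisy path compared with the noiseless orbits\<close>

locale bounded_path = cascade_path +
  fixes k :: real
  assumes wk: "\<And>r i. r \<in> {0..1} \<Longrightarrow> \<bar>\<kappa> * w r $ i\<bar> \<le> k"
begin

abbreviation "p0 \<equiv> (x0 $ 1, x0 $ 2)"

lemma k_nonneg: "0 \<le> k"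
  using wk[of 0 1] by (auto intro: order_trans[OF abs_ge_zero])

definition near :: "real \<Rightarrow> real^2 \<Rightarrow> real \<times> real \<Rightarrow> bool" where
  "near e y p \<longleftrightarrow> \<bar>y $ 1 - fst p\<bar> \<le> e \<and> \<bar>y $ 2 - snd p\<bar> \<le> e"

lemma J_01: "r \<in> J q i \<Longrightarrow> i \<in> {1,2,3} \<Longrightarrow> r \<in> {0..1}"
  using J_half[of r q i] by auto

lemma noise_shift: "\<bar>y - z\<bar> \<le> e \<Longrightarrow> r \<in> {0..1} \<Longrightarrow> \<bar>(y + \<kappa> * w r $ i) - z\<bar> \<le> e + k"
  using wk[of r i] by (simp add: abs_le_iff)

lemma forward_lipschitz:
  assumes "near e (Y (tq j)) (fwd j p0)" and e: "0 \<le> e"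
  shows "near ((1 + Lip j)\<^sup>2 * (e + k)) (Y (tq (Suc j))) (fwd (Suc j) p0)"
proof -
  let ?f = "fwd j p0" and ?f' = "fwd (Suc j) p0"
  have n: "\<bar>Y (tq j) $ 1 - fst ?f\<bar> \<le> e" "\<bar>Y (tq j) $ 2 - snd ?f\<bar> \<le> e" using assms by (auto simp: near_def)
  have L: "0 \<le> Lip j" by (rule Lip)
  have b: "\<bar>Y (tq (Suc j)) $ 1 - Y (tq j) $ 1 - g1 j (snd ?f)\<bar> \<le> Lip j * (e + k)"
    by (rule forward_stage(2), rule order_trans[OF Lip(2) mult_left_mono[OF noise_shift[OF n(2)] L]]) (rule J_01, assumption, simp)
  then have n1: "\<bar>Y (tq (Suc j)) $ 1 - fst ?f'\<bar> \<le> e + Lip j * (e + k)"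
    unfolding fwd_Suc(1) using n(1) by linarith
  have "\<bar>Y (tq (Suc j)) $ 2 - Y (tq j) $ 2 - g2 j (fst ?f')\<bar> \<le> Lip j * (e + Lip j * (e + k) + k)"
    by (rule forward_stage(3), rule order_trans[OF Lip(3) mult_left_mono[OF noise_shift[OF n1] L]]) (rule J_01, assumption, simp)
  then have n2: "\<bar>Y (tq (Suc j)) $ 2 - snd ?f'\<bar> \<le> e + Lip j * (e + Lip j * (e + k) + k)"
    unfolding fwd_Suc(2) using n(2) by linarith
  show ?thesis unfolding near_def
    using order_trans[OF n1 Lip_two_steps(1)[OF e k_nonneg]] order_trans[OF n2 Lip_two_steps(2)[OF e k_nonneg]] by blast
qed

text \<open>Covers stages at which no distance from the grid is known. Lipschitz bounds cost a
  constant factor, but the error stays proportional to \<open>k\<close>.\<close>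

lemma forward_bad: "near (Cf j * k) (Y (tq j)) (fwd j p0)"
proof (induction j)
  case 0 show ?case by (simp add: near_def Y_0)
next
  case (Suc j)
  have "(1 + Lip j)\<^sup>2 * (Cf j * k + k) = Cf (Suc j) * k" by (simp add: algebra_simps)
  then show ?case using forward_lipschitz[OF Suc] Cf_nonneg[of j] k_nonneg by (simp only: mult_nonneg_nonneg)
qed

text \<open>Noisy and noiseless point see the same constant value of each profile, because e + k
  plus the mollification radius stays below the margin 5 \<open>lq (Suc j)\<close>. The error
  therefore leaves the stage exactly as it entered.\<close>

lemma forward_good:
  assumes "near e (Y (tq j)) (fwd j p0)" "good j p0" "e + k < 4 * lq (Suc j)"
  shows "near e (Y (tq (Suc j))) (fwd (Suc j) p0)"
proof -
  let ?f = "fwd j p0" and ?f' = "fwd (Suc j) p0" and ?l = "lq (Suc j)"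
  have n: "\<bar>Y (tq j) $ 1 - fst ?f\<bar> \<le> e" "\<bar>Y (tq j) $ 2 - snd ?f\<bar> \<le> e" using assms by (auto simp: near_def)
  have g: "grid_off (a (Suc j)) (5 * ?l) (snd ?f)" "grid_off (a (Suc j)) (5 * ?l) (fst ?f')"
    using assms by (auto simp: good_def)
  have l: "?l < 5 * ?l" using ell_pos[of "Suc j"] by linarith
  have "\<bar>Y (tq (Suc j)) $ 1 - Y (tq j) $ 1 - g1 j (snd ?f)\<bar> \<le> 0"
  proof (rule forward_stage(2))
    fix r assume "r \<in> J j 1"
    then have "\<bar>(Y (tq j) $ 2 + \<kappa> * w r $ 2) - snd ?f\<bar> \<le> e + k" by (intro noise_shift n J_01[of r j 1]) auto
    then show "\<bar>g1 j (Y (tq j) $ 2 + \<kappa> * w r $ 2) - g1 j (snd ?f)\<bar> \<le> 0"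
      using g_grid_off(1)[OF g(1), of "Y (tq j) $ 2 + \<kappa> * w r $ 2"] g_grid_off(1)[OF g(1), of "snd ?f"] assms(3) l by simp
  qed
  then have n1: "\<bar>Y (tq (Suc j)) $ 1 - fst ?f'\<bar> \<le> e" using n(1) unfolding fwd_Suc(1) by linarith
  have "\<bar>Y (tq (Suc j)) $ 2 - Y (tq j) $ 2 - g2 j (fst ?f')\<bar> \<le> 0"
  proof (rule forward_stage(3))
    fix r assume "r \<in> J j 2"
    then have "\<bar>(Y (tq (Suc j)) $ 1 + \<kappa> * w r $ 1) - fst ?f'\<bar> \<le> e + k" by (intro noise_shift n1 J_01[of r j 2]) auto
    then show "\<bar>g2 j (Y (tq (Suc j)) $ 1 + \<kappa> * w r $ 1) - g2 j (fst ?f')\<bar> \<le> 0"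
      using g_grid_off(2)[OF g(2), of "Y (tq (Suc j)) $ 1 + \<kappa> * w r $ 1"] g_grid_off(2)[OF g(2), of "fst ?f'"] assms(3) l by simp
  qed
  then show ?thesis using n(2) n1 unfolding near_def fwd_Suc(2)[of j p0] by linarith
qed

lemma forward_track:
  assumes good: "\<And>j. j0 \<le> j \<Longrightarrow> j < q \<Longrightarrow> good j p0" and e: "Cf j0 * k + k < 4 * lq q" and "j0 \<le> q"
  shows "near (Cf j0 * k) (Y (tq q)) (fwd q p0)"
proof -
  have "near (Cf j0 * k) (Y (tq j)) (fwd j p0)" if "j0 \<le> j" "j \<le> q" for j
    using that
  proof (induction j rule: dec_induct)
    case base show ?case by (rule forward_bad)
  next
    case (step j)
    \<comment> \<open>The margins shrink with the stage, so the smallness condition at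
      \<open>q\<close> implies those at all earlier stages.\<close>
    have "lq q \<le> lq (Suc j)" using step by (intro ell_mono) auto
    then show ?case using step e by (intro forward_good good) auto
  qed
  then show ?thesis using assms by blast
qed

lemma backward_lipschitz:
  assumes "near e (Y (1 - tq (Suc j))) y" and e: "0 \<le> e"
  shows "near ((1 + Lip j)\<^sup>2 * (e + k)) (Y (1 - tq j)) (bstep j y)"
proof -
  have n: "\<bar>Y (1 - tq (Suc j)) $ 1 - fst y\<bar> \<le> e" "\<bar>Y (1 - tq (Suc j)) $ 2 - snd y\<bar> \<le> e" using assms by (auto simp: near_def)
  then have n': "\<bar>Y (1 - tq (Suc j)) $ 1 + a (Suc j) - (fst y + a (Suc j))\<bar> \<le> e" by simp
  have L: "0 \<le> Lip j" by (rule Lip)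
  have J': "r \<in> {0..1}" if "1 - r \<in> J j i" "i \<in> {1,2,3}" for r i using J_half[OF that] by auto
  have "\<bar>Y (1 - tq j) $ 2 - Y (1 - tq (Suc j)) $ 2 + g2 j (fst y + a (Suc j))\<bar> \<le> Lip j * (e + k)"
    by (rule backward_stage(3), rule order_trans[OF Lip(3) mult_left_mono[OF noise_shift[OF n'] L]]) (rule J', assumption, simp)
  then have n2: "\<bar>Y (1 - tq j) $ 2 - snd (bstep j y)\<bar> \<le> e + Lip j * (e + k)"
    unfolding bstep(1) using n(2) by linarith
  have "\<bar>Y (1 - tq j) $ 1 - Y (1 - tq (Suc j)) $ 1 - a (Suc j) + g1 j (snd (bstep j y))\<bar> \<le> Lip j * (e + Lip j * (e + k) + k)"
    by (rule backward_stage(2), rule order_trans[OF Lip(2) mult_left_mono[OF noise_shift[OF n2] L]]) (rule J', assumption, simp)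
  then have n1: "\<bar>Y (1 - tq j) $ 1 - fst (bstep j y)\<bar> \<le> e + Lip j * (e + Lip j * (e + k) + k)"
    unfolding bstep(2) using n(1) by linarith
  show ?thesis unfolding near_def
    using order_trans[OF n2 Lip_two_steps(1)[OF e k_nonneg]] order_trans[OF n1 Lip_two_steps(2)[OF e k_nonneg]] by blast
qed

text \<open>From stage \<open>j\<close> down to 0 the return orbit may be arbitrarily close to the
  grid; each stage multiplies e + k by a factor that does not depend on \<open>q\<close>.\<close>

lemma backward_bad:
  assumes "near e (Y (1 - tq j)) (ret q p0 j)" "0 \<le> e" "j \<le> q"
  shows "near (Cb j * (e + k)) (Y 1) (ret q p0 0)"
  using assms
proof (induction j arbitrary: e)
  case 0
  then show ?case using k_nonneg by (auto simp: near_def)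
next
  case (Suc j)
  let ?e = "(1 + Lip j)\<^sup>2 * (e + k)"
  have e: "0 \<le> ?e" using Suc.prems k_nonneg by simp
  have "near ?e (Y (1 - tq j)) (ret q p0 j)"
    using backward_lipschitz[OF Suc.prems(1,2)] ret_step[of j q p0] Suc.prems by (simp add: Suc_le_eq)
  from Suc.IH[OF this e] have b: "near (Cb j * (?e + k)) (Y 1) (ret q p0 0)" using Suc.prems by simp
  have "Cb j * (?e + k) \<le> Cb j * (((1 + Lip j)\<^sup>2 + 1) * (e + k))"
    using Cb_ge_1[of j] Suc.prems by (intro mult_left_mono) (auto simp: algebra_simps)
  also have "\<dots> = Cb (Suc j) * (e + k)" by (simp add: mult.assoc)
  finally show ?case using b unfolding near_def by linarith
qed

text \<open>As on the way out, but starting from the margin 4 \<open>lq (Suc j)\<close> of the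
  return orbit, which leaves 3 for error and noise.\<close>

lemma backward_good:
  assumes "near e (Y (1 - tq (Suc j))) y" "e + k < 3 * lq (Suc j)"
    and g: "grid_off (a (Suc j)) (4 * lq (Suc j)) (fst y + a (Suc j))" "grid_off (a (Suc j)) (4 * lq (Suc j)) (snd (bstep j y))"
  shows "near e (Y (1 - tq j)) (bstep j y)"
proof -
  have n: "\<bar>Y (1 - tq (Suc j)) $ 1 - fst y\<bar> \<le> e" "\<bar>Y (1 - tq (Suc j)) $ 2 - snd y\<bar> \<le> e" using assms by (auto simp: near_def)
  then have n': "\<bar>Y (1 - tq (Suc j)) $ 1 + a (Suc j) - (fst y + a (Suc j))\<bar> \<le> e" by simp
  have J': "r \<in> {0..1}" if "1 - r \<in> J j i" "i \<in> {1,2,3}" for r i using J_half[OF that] by auto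
  have l: "lq (Suc j) < 4 * lq (Suc j)" using ell_pos[of "Suc j"] by linarith
  have "\<bar>Y (1 - tq j) $ 2 - Y (1 - tq (Suc j)) $ 2 + g2 j (fst y + a (Suc j))\<bar> \<le> 0"
  proof (rule backward_stage(3))
    fix r assume "1 - r \<in> J j 2"
    then have "\<bar>(Y (1 - tq (Suc j)) $ 1 + a (Suc j) + \<kappa> * w r $ 1) - (fst y + a (Suc j))\<bar> \<le> e + k"
      by (intro noise_shift n' J'[of r 2]) auto
    then show "\<bar>g2 j (Y (1 - tq (Suc j)) $ 1 + a (Suc j) + \<kappa> * w r $ 1) - g2 j (fst y + a (Suc j))\<bar> \<le> 0"
      using g_grid_off(2)[OF g(1), of "Y (1 - tq (Suc j)) $ 1 + a (Suc j) + \<kappa> * w r $ 1"]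
        g_grid_off(2)[OF g(1), of "fst y + a (Suc j)"] assms(2) l by simp
  qed
  then have n2: "\<bar>Y (1 - tq j) $ 2 - snd (bstep j y)\<bar> \<le> e" using n(2) unfolding bstep(1) by linarith
  have "\<bar>Y (1 - tq j) $ 1 - Y (1 - tq (Suc j)) $ 1 - a (Suc j) + g1 j (snd (bstep j y))\<bar> \<le> 0"
  proof (rule backward_stage(2))
    fix r assume "1 - r \<in> J j 1"
    then have "\<bar>(Y (1 - tq j) $ 2 + \<kappa> * w r $ 2) - snd (bstep j y)\<bar> \<le> e + k"
      by (intro noise_shift n2 J'[of r 1]) auto
    then show "\<bar>g1 j (Y (1 - tq j) $ 2 + \<kappa> * w r $ 2) - g1 j (snd (bstep j y))\<bar> \<le> 0"
      using g_grid_off(1)[OF g(2), of "Y (1 - tq j) $ 2 + \<kappa> * w r $ 2"] g_grid_off(1)[OF g(2), of "snd (bstep j y)"] assms(2) l by simp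
  qed
  then show ?thesis using n(1) n2 unfolding near_def bstep(2)[of j y] by linarith
qed

lemma backward_track:
  assumes good: "\<And>j. j0 \<le> j \<Longrightarrow> j < q \<Longrightarrow> good j p0"
    and small: "\<And>j. j0 \<le> j \<Longrightarrow> 3 * a (Suc (Suc j)) \<le> lq (Suc j)"
    and n: "near e (Y (1 - tq q)) (fwd q p0)" and e: "0 \<le> e" "e + k < 3 * lq q" and q: "j0 \<le> q"
  shows "near (Cb j0 * (e + k)) (Y 1) (ret q p0 0)"
proof -
  have "near e (Y (1 - tq j)) (ret q p0 j)" if "j0 \<le> j" "j \<le> q" for j
    using that(2,1)
  proof (induction j rule: inc_induct)
    case base show ?case using n by (simp add: ret_start)
  next
    case (step j)
    have "lq q \<le> lq (Suc j)" using step by (intro ell_mono) auto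
    then have "near e (Y (1 - tq j)) (bstep j (ret q p0 (Suc j)))"
      using step e(2) ret_invariant[of j0 q p0 j, OF good small] ret_step[of j q p0]
      by (intro backward_good) auto
    then show ?case using step by (simp add: ret_step)
  qed
  from backward_bad[OF this[OF order_refl q] e(1) q] show ?thesis .
qed

text \<open>Written as a difference in order to telescope. A stage moves a coordinate by at most
  a_j/2 + a_(j+1), swap included, and this is at most a_j - a_(j+1) because a_(j+1) \<le>
  a_j/4.\<close>

lemma increments_outer:
  "\<bar>Y (tq (Suc j)) $ i - Y (tq j) $ i\<bar> \<le> a j - a (Suc j)"
  "\<bar>Y (1 - tq j) $ i - Y (1 - tq (Suc j)) $ i\<bar> \<le> a j - a (Suc j)"
proof -
  note a4 = a_Suc_le[of j] a_pos[of "Suc j"]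
  have f1: "\<bar>Y (tq (Suc j)) $ 1 - Y (tq j) $ 1 - 0\<bar> \<le> a j / 2"
    by (rule forward_stage(2)) (simp only: diff_zero g1_bound)
  have f2: "\<bar>Y (tq (Suc j)) $ 2 - Y (tq j) $ 2 - 0\<bar> \<le> a (Suc j)"
    by (rule forward_stage(3)) (use g2_bound[of j] in simp)
  have b1: "\<bar>Y (1 - tq j) $ 1 - Y (1 - tq (Suc j)) $ 1 - a (Suc j) + 0\<bar> \<le> a j / 2"
    by (rule backward_stage(2)) (simp only: diff_zero g1_bound)
  have b2: "\<bar>Y (1 - tq j) $ 2 - Y (1 - tq (Suc j)) $ 2 + 0\<bar> \<le> a (Suc j)"
    by (rule backward_stage(3)) (use g2_bound[of j] in simp)
  have i: "i = 1 \<or> i = 2" using exhaust_2 by blast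
  show "\<bar>Y (tq (Suc j)) $ i - Y (tq j) $ i\<bar> \<le> a j - a (Suc j)"
    using i
  proof
    assume "i = 1" show ?thesis unfolding \<open>i = 1\<close> using f1 a4 by linarith
  next
    assume "i = 2" show ?thesis unfolding \<open>i = 2\<close> using f2 a4 by linarith
  qed
  show "\<bar>Y (1 - tq j) $ i - Y (1 - tq (Suc j)) $ i\<bar> \<le> a j - a (Suc j)"
    using i
  proof
    assume "i = 1" show ?thesis unfolding \<open>i = 1\<close> using b1 a4 by linarith
  next
    assume "i = 2" show ?thesis unfolding \<open>i = 2\<close> using b2 a4 by linarith
  qed
qed

text \<open>Infinitely many stages accumulate at time 1/2. The telescoped bounds control them from
  both sides up to any stage \<open>n\<close>, and the remaining gap closes as n grows because
  \<open>Y\<close> is continuous at 1/2.\<close>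

lemma turning_point:
  "\<bar>Y (1 - tq j) $ i - Y (tq j) $ i\<bar> \<le> 2 * a j"
proof -
  have f: "\<bar>Y (tq n) $ i - Y (tq j) $ i\<bar> \<le> a j - a n" if "j \<le> n" for n
    using that
  proof (induction n rule: dec_induct)
    case (step n) then show ?case using increments_outer(1)[of n i] by linarith
  qed simp
  have b: "\<bar>Y (1 - tq j) $ i - Y (1 - tq n) $ i\<bar> \<le> a j - a n" if "j \<le> n" for n
    using that
  proof (induction n rule: dec_induct)
    case (step n) then show ?case using increments_outer(2)[of n i] by linarith
  qed simp
  have fb: "\<bar>Y (1 - tq j) $ i - Y (tq j) $ i\<bar> \<le> 2 * a j + \<bar>Y (1 - tq n) $ i - Y (tq n) $ i\<bar>" if "j \<le> n" for n
    using f[OF that] b[OF that] a_pos[of n] by linarith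
  have iY: "isCont Y (1/2)"
    using Y_continuous by (rule continuous_on_interior) simp
  have l1: "(\<lambda>n. Y (tq n) $ i) \<longlonglongrightarrow> Y (1/2) $ i"
    by (intro tendsto_vec_nth isCont_tendsto_compose[OF iY] tq_tendsto)
  have "(\<lambda>n. 1 - tq n) \<longlonglongrightarrow> 1 - 1/2" by (intro tendsto_intros tq_tendsto)
  then have "(\<lambda>n. 1 - tq n) \<longlonglongrightarrow> 1/2" by simp
  then have l2: "(\<lambda>n. Y (1 - tq n) $ i) \<longlonglongrightarrow> Y (1/2) $ i"
    by (intro tendsto_vec_nth isCont_tendsto_compose[OF iY])
  have "(\<lambda>n. 2 * a j + \<bar>Y (1 - tq n) $ i - Y (tq n) $ i\<bar>) \<longlonglongrightarrow> 2 * a j + \<bar>Y (1/2) $ i - Y (1/2) $ i\<bar>"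
    by (intro tendsto_intros l1 l2)
  then have "\<bar>Y (1 - tq j) $ i - Y (tq j) $ i\<bar> \<le> 2 * a j + \<bar>Y (1/2) $ i - Y (1/2) $ i\<bar>"
    by (rule LIMSEQ_le_const) (use fb in blast)
  then show ?thesis by simp
qed

text \<open>\<open>Z\<close> is quantified over all heights \<open>c\<close>, since those on the way
  out and back are different and depend on the noise. Horizontally the path picks up
  \<open>A\<close> twice, once \<open>a (Suc q)\<close> from the swap and twice from the later
  stages; vertically once on each side and twice from the later stages. The 5 covers both, and in
  \<open>small\<close> also the mollification radius \<open>lq (Suc q)\<close>.\<close>

lemma middle:
  assumes n: "near e (Y (tq q)) (fwd q p0)" and off: "grid_off (a q) (5 * lq q) (snd (fwd q p0))"
    and Z: "\<And>c. (\<And>t. t \<in> {0..1} \<Longrightarrow> \<bar>c + \<kappa> * w t $ 2 - snd (fwd q p0)\<bar> + lq (Suc q) < 5 * lq q) \<Longrightarrow>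
      \<bar>integral {tau q 0..tau q 1} (\<lambda>r. \<eta> q 1 r * g1 q (c + \<kappa> * w r $ 2))\<bar> \<le> A \<and>
      \<bar>integral {1 - tau q 1..1 - tau q 0} (\<lambda>r. \<eta> q 1 (1 - r) * g1 q (c + \<kappa> * w r $ 2))\<bar> \<le> A"
    and small: "e + k + 5 * a (Suc q) < 4 * lq q" and A: "0 \<le> A"
  shows "near (e + 2 * A + 5 * a (Suc q)) (Y (1 - tq q)) (fwd q p0)"
proof -
  have e: "\<bar>Y (tq q) $ 1 - fst (fwd q p0)\<bar> \<le> e" "\<bar>Y (tq q) $ 2 - snd (fwd q p0)\<bar> \<le> e" using n by (auto simp: near_def)
  have l: "lq (Suc q) \<le> a (Suc q)" "a (Suc q) \<le> lq q" by (rule ell_bounds)+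
  have wk2: "\<bar>\<kappa> * w t $ 2\<bar> \<le> k" if "t \<in> {0..1}" for t by (rule wk[OF that])
  have ap: "0 < a (Suc q)" by simp
  have f2: "\<bar>Y (tq (Suc q)) $ 2 - Y (tq q) $ 2 - 0\<bar> \<le> a (Suc q)"
    by (rule forward_stage(3)) (use g2_bound[of q] in simp)
  have b2: "\<bar>Y (1 - tq q) $ 2 - Y (1 - tq (Suc q)) $ 2 + 0\<bar> \<le> a (Suc q)"
    by (rule backward_stage(3)) (use g2_bound[of q] in simp)
  have tp: "\<bar>Y (1 - tq (Suc q)) $ i - Y (tq (Suc q)) $ i\<bar> \<le> 2 * a (Suc q)" for i by (rule turning_point)
  have d2: "\<bar>Y (1 - tq q) $ 2 - snd (fwd q p0)\<bar> \<le> e + 4 * a (Suc q)"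
    using e(2) f2 b2 tp[of 2] by linarith
  have f1: "\<bar>Y (tq (Suc q)) $ 1 - Y (tq q) $ 1\<bar> \<le> A"
    unfolding forward_stage(1)
  proof (rule Z[THEN conjunct1])
    fix t :: real assume "t \<in> {0..1}"
    from wk2[OF this] show "\<bar>Y (tq q) $ 2 + \<kappa> * w t $ 2 - snd (fwd q p0)\<bar> + lq (Suc q) < 5 * lq q"
      using e(2) small l ap by linarith
  qed
  have b1: "\<bar>Y (1 - tq q) $ 1 - Y (1 - tq (Suc q)) $ 1 - a (Suc q)\<bar> \<le> A"
    unfolding backward_stage(1) abs_minus_cancel
  proof (rule Z[THEN conjunct2])
    fix t :: real assume "t \<in> {0..1}"
    from wk2[OF this] show "\<bar>Y (1 - tq q) $ 2 + \<kappa> * w t $ 2 - snd (fwd q p0)\<bar> + lq (Suc q) < 5 * lq q"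
      using d2 small l ap by linarith
  qed
  show ?thesis unfolding near_def using e(1) f1 b1 tp[of 1] d2 A ap by linarith
qed

text \<open>Three regimes are joined: Lipschitz growth below \<open>j0\<close>, error-free transport
  from \<open>j0\<close> to \<open>q\<close>, and averaging at \<open>q\<close>. The last
  \<open>k\<close> passes from \<open>Y 1\<close> back to \<open>X 1\<close>.\<close>

lemma endpoint:
  assumes good: "\<And>j. j0 \<le> j \<Longrightarrow> j < q \<Longrightarrow> good j p0" and q: "j0 < q"
    and small: "\<And>j. j0 \<le> j \<Longrightarrow> 3 * a (Suc (Suc j)) \<le> lq (Suc j)"
    and Z: "\<And>c. (\<And>t. t \<in> {0..1} \<Longrightarrow> \<bar>c + \<kappa> * w t $ 2 - snd (fwd q p0)\<bar> + lq (Suc q) < 5 * lq q) \<Longrightarrow>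
      \<bar>integral {tau q 0..tau q 1} (\<lambda>r. \<eta> q 1 r * g1 q (c + \<kappa> * w r $ 2))\<bar> \<le> A \<and>
      \<bar>integral {1 - tau q 1..1 - tau q 0} (\<lambda>r. \<eta> q 1 (1 - r) * g1 q (c + \<kappa> * w r $ 2))\<bar> \<le> A"
    and A: "0 \<le> A" and sm: "Cf j0 * k + 2 * A + 5 * a (Suc q) + k < 3 * lq q"
  shows "near (Cb j0 * (Cf j0 * k + 2 * A + 5 * a (Suc q) + k) + k) (X 1) (ret q p0 0)"
proof -
  have C: "0 \<le> Cf j0 * k" using Cf_nonneg k_nonneg by simp
  have l: "0 < lq q" "0 < a (Suc q)" by simp_all
  \<comment> \<open>The distance from the coarse grid at stage \<open>q\<close> is inherited from
    goodness of stage q - 1, hence j0 < q and not just j0 \<le> q.\<close>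
  obtain q' where q': "q = Suc q'" "j0 \<le> q'" using q by (cases q) auto
  have "near (Cf j0 * k) (Y (tq q)) (fwd q p0)"
  proof (rule forward_track[OF good])
    show "Cf j0 * k + k < 4 * lq q" using sm A l by linarith
  qed (use q in auto)
  moreover have "grid_off (a q) (5 * lq q) (snd (fwd q p0))"
    unfolding q'(1) by (rule good_off_next, rule good) (use q' in auto)
  ultimately have n: "near (Cf j0 * k + 2 * A + 5 * a (Suc q)) (Y (1 - tq q)) (fwd q p0)"
  proof (rule middle[OF _ _ Z])
    show "Cf j0 * k + k + 5 * a (Suc q) < 4 * lq q" using sm A l by linarith
  qed (blast | rule A)+
  have "near (Cb j0 * (Cf j0 * k + 2 * A + 5 * a (Suc q) + k)) (Y 1) (ret q p0 0)"
  proof (rule backward_track[OF good small n])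
    show "0 \<le> Cf j0 * k + 2 * A + 5 * a (Suc q)" using C A l by linarith
  qed (use sm q in auto)
  then show ?thesis
    using wk[of 1 1] wk[of 1 2] unfolding near_def Y_def by (auto simp: abs_le_iff)
qed

end

text \<open>A jointly measurable version of the noise is only needed along the time cutoffs, where
  \<open>B\<close> and \<open>w\<close> agree.\<close>

lemma (in cascade) averaged_shear:
  fixes w B :: "real \<Rightarrow> real" and e :: "real \<Rightarrow> real"
  assumes off: "grid_off (a q) m z" and close: "\<And>t. t \<in> {0..1} \<Longrightarrow> \<bar>c + \<kappa> * w t - z\<bar> + lq (Suc q) < m"
    and e: "integrable lborel e" "\<And>t. e t \<noteq> 0 \<Longrightarrow> t \<in> {s..s'}" and ss: "{s..s'} \<subseteq> {0..<1}"
    and B: "B \<in> borel_measurable borel" "\<And>t. t \<in> {0..<1} \<Longrightarrow> w t = B t"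
    and W: "wave_sum e (pi * \<kappa> / a (Suc q)) B \<le> ennreal Z" and Z: "0 \<le> Z"
  shows "\<bar>integral {s..s'} (\<lambda>r. e r * g1 q (c + \<kappa> * w r))\<bar> \<le> 2 / pi * a q * Z"
proof -
  let ?b = "a (Suc q)" and ?l = "lq (Suc q)"
  \<comment> \<open>The noise in units of a fine cell, so that the frequency in
    \<open>wave_sum\<close> times \<open>B t\<close> is pi times \<open>x t\<close>.\<close>
  define x where "x t = \<kappa> * B t / ?b" for t
  have [measurable]: "x \<in> borel_measurable borel" using B(1) unfolding x_def by measurable
  have [measurable]: "e \<in> borel_measurable borel" using e(1) by (simp add: borel_measurable_integrable)
  define N where "N n = norm (\<integral>t. e t *\<^sub>R cis (real (2 * n + 1) * (pi * x t)) \<partial>lborel) / real (2 * n + 1)" for n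
  have Neq: "wave_sum e (pi * \<kappa> / ?b) B = (\<Sum>n. ennreal (N n))"
    unfolding wave_sum_def N_def x_def by (simp add: mult.assoc)
  \<comment> \<open>The bound by a real \<open>Z\<close> makes the series finite, which supplies the
    summability required for the Fourier estimate.\<close>
  have fin: "(\<Sum>n. ennreal (N n)) \<noteq> top" using W unfolding Neq by (metis ennreal_less_top neq_top_trans less_top)
  have sm: "summable N" by (rule summable_suminf_not_top[OF _ fin]) (simp add: N_def)
  have "ennreal (suminf N) = (\<Sum>n. ennreal (N n))"
    by (rule suminf_ennreal2[symmetric, OF _ sm]) (simp add: N_def)
  then have "ennreal (suminf N) \<le> ennreal Z" using W unfolding Neq by simp
  then have NZ: "suminf N \<le> Z" by (simp only: ennreal_le_iff[OF Z])
  define H where "H t = (\<integral>y. \<rho> (y / ?l) / ?l * sgn (sin (pi * (c / ?b + x t - 1 / ?b * y))) \<partial>lborel)" for t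
  have "\<bar>\<integral>t. e t * H t \<partial>lborel\<bar> \<le> 4 / pi * suminf N"
    unfolding H_def N_def
    by (rule mollified_wave_integral_bound[OF e(1) _ mollifier_kernel(1,2,3)[OF moll ell_pos]])
      (use sm in \<open>auto simp: N_def[abs_def]\<close>)
  also have "\<dots> \<le> 4 / pi * Z" using NZ by (intro mult_left_mono) auto
  finally have HZ: "\<bar>\<integral>t. e t * H t \<partial>lborel\<bar> \<le> 4 / pi * Z" .
  have kern: "(\<lambda>y. \<rho> (y / ?l) / ?l) \<in> borel_measurable lborel"
    by (rule borel_measurable_integrable[OF mollifier_kernel(1)[OF moll ell_pos]])
  note [measurable] = kern[unfolded measurable_lborel2]
  have Hm [measurable]: "H \<in> borel_measurable borel" unfolding H_def by measurable
  have Hb: "\<bar>H t\<bar> \<le> 1" for t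
  proof -
    have "\<bar>H t\<bar> \<le> (\<integral>y. \<bar>\<rho> (y / ?l) / ?l * sgn (sin (pi * (c / ?b + x t - 1 / ?b * y)))\<bar> \<partial>lborel)"
      unfolding H_def by (rule integral_abs_bound)
    also have "\<dots> \<le> (\<integral>y. \<rho> (y / ?l) / ?l \<partial>lborel)"
    proof (rule Bochner_Integration.integral_mono_AE')
      show "integrable lborel (\<lambda>y. \<rho> (y / ?l) / ?l)" by (rule mollifier_kernel(1)[OF moll ell_pos])
      show "AE y in lborel. \<bar>\<rho> (y / ?l) / ?l * sgn (sin (pi * (c / ?b + x t - 1 / ?b * y)))\<bar> \<le> \<rho> (y / ?l) / ?l"
      proof (intro AE_I2)
        fix y
        have "\<bar>p * sgn v\<bar> \<le> p" if "0 \<le> p" for p v :: real using that by (auto simp: abs_mult sgn_if)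
        then show "\<bar>\<rho> (y / ?l) / ?l * sgn (sin (pi * (c / ?b + x t - 1 / ?b * y)))\<bar> \<le> \<rho> (y / ?l) / ?l"
          using mollifier_kernel(2)[OF moll ell_pos[of "Suc q"]] by blast
      qed
      show "AE y in lborel. 0 \<le> \<rho> (y / ?l) / ?l"
        using mollifier_kernel(2)[OF moll ell_pos[of "Suc q"]] by (intro AE_I2)
    qed
    finally show ?thesis using mollifier_kernel(3)[OF moll ell_pos[of "Suc q"]] by simp
  qed
  have ei: "integrable lborel (\<lambda>t. e t * H t)"
  proof (rule Bochner_Integration.integrable_bound[OF e(1)])
    show "AE t in lborel. norm (e t * H t) \<le> norm (e t)"
      using mult_left_mono[OF Hb abs_ge_zero] by (intro AE_I2) (auto simp: abs_mult)
  qed measurable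
  have "e r * g1 q (c + \<kappa> * w r) = par \<lfloor>z / a q\<rfloor> * (a q / 2) * (e r * H r)" if r: "r \<in> {s..s'}" for r
  proof -
    have r1: "r \<in> {0..<1}" using r ss by blast
    then have "g1 q (c + \<kappa> * w r) = par \<lfloor>z / a q\<rfloor> * (a q / 2) *
        (\<integral>y. \<rho> (y / ?l) / ?l * sgn (sin (pi * ((c + \<kappa> * w r) / ?b - 1 / ?b * y))) \<partial>lborel)"
      by (intro g1_cell[OF off] close) auto
    also have "(c + \<kappa> * w r) / ?b = c / ?b + x r" using B(2)[OF r1] by (simp add: x_def add_divide_distrib)
    finally show ?thesis by (simp add: H_def)
  qed
  then have "integral {s..s'} (\<lambda>r. e r * g1 q (c + \<kappa> * w r)) = integral {s..s'} (\<lambda>r. par \<lfloor>z / a q\<rfloor> * (a q / 2) * (e r * H r))"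
    by (intro Henstock_Kurzweil_Integration.integral_cong) auto
  also have "\<dots> = par \<lfloor>z / a q\<rfloor> * (a q / 2) * (\<integral>t. e t * H t \<partial>lborel)"
  proof -
    have "((\<lambda>r. e r * H r) has_integral (\<integral>t. e t * H t \<partial>lborel)) {s..s'}"
      by (rule has_integral_Icc_lborel[OF ei]) (use e(2) in auto)
    from has_integral_mult_right[OF this] show ?thesis by (rule integral_unique)
  qed
  also have "\<bar>\<dots>\<bar> = a q / 2 * \<bar>\<integral>t. e t * H t \<partial>lborel\<bar>" by (simp add: abs_mult)
  also have "\<dots> \<le> a q / 2 * (4 / pi * Z)" by (rule mult_left_mono[OF HZ]) simp
  finally show ?thesis by (simp add: mult_ac)
qed

section \<open>Almost every point is good\<close>

definition vec2 :: "real \<times> real \<Rightarrow> real^2" where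
  "vec2 p = fst p *\<^sub>R axis 1 1 + snd p *\<^sub>R axis 2 1"

lemma vec2_nth [simp]: "vec2 p $ 1 = fst p" "vec2 p $ 2 = snd p"
  by (simp_all add: vec2_def axis_def)

lemma vec2_measurable [measurable]: "vec2 \<in> borel_measurable borel"
  unfolding vec2_def by (intro borel_measurable_continuous_onI continuous_intros)

text \<open>Iterated integrals live on the product of two lines; this identification carries null
  sets over to \<open>real^2\<close>.\<close>

lemma lborel_vec2: "lborel = distr lborel borel vec2"
proof (rule lborel_eqI)
  show "sets (distr lborel borel vec2) = sets borel" by simp
  fix l u :: "real^2" assume le: "\<And>b. b \<in> Basis \<Longrightarrow> l \<bullet> b \<le> u \<bullet> b"
  have le': "l $ 1 \<le> u $ 1" "l $ 2 \<le> u $ 2"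
    using le[of "axis 1 1"] le[of "axis 2 1"] by (auto simp: inner_axis Basis_vec_def)
  have "vec2 -` box l u = {l $ 1<..<u $ 1} \<times> {l $ 2<..<u $ 2}"
    by (auto simp: mem_box_cart forall_2)
  then have "emeasure (distr lborel borel vec2) (box l u) = emeasure lborel ({l $ 1<..<u $ 1} \<times> {l $ 2<..<u $ 2})"
    by (subst emeasure_distr) auto
  also have "\<dots> = emeasure lborel {l $ 1<..<u $ 1} * emeasure lborel {l $ 2<..<u $ 2}"
    unfolding lborel_prod[symmetric] by (rule lborel.emeasure_pair_measure_Times) auto
  also have "\<dots> = ennreal ((u - l) $ 1 * (u - l) $ 2)"
    using le' by (simp add: ennreal_mult)
  also have "(u - l) $ 1 * (u - l) $ 2 = (\<Prod>b\<in>Basis. (u - l) \<bullet> b)"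
  proof -
    have B: "(Basis :: (real^2) set) = {axis 1 1, axis 2 1}"
      by (auto simp: Basis_vec_def) (metis exhaust_2)
    show ?thesis unfolding B by (simp add: inner_axis axis_eq_axis)
  qed
  finally show "emeasure (distr lborel borel vec2) (box l u) = (\<Prod>b\<in>Basis. (u - l) \<bullet> b)" .
qed

definition sh1 :: "(real \<Rightarrow> real) \<Rightarrow> real \<times> real \<Rightarrow> real \<times> real" where
  "sh1 g p = (fst p + g (snd p), snd p)"

definition sh2 :: "(real \<Rightarrow> real) \<Rightarrow> real \<times> real \<Rightarrow> real \<times> real" where
  "sh2 g p = (fst p, snd p + g (fst p))"

lemma sh_measurable [measurable (raw)]:
  assumes [measurable]: "g \<in> borel_measurable borel"
  shows "sh1 g \<in> measurable borel borel" "sh2 g \<in> measurable borel borel"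
  unfolding sh1_def[abs_def] sh2_def[abs_def] borel_prod[symmetric] by measurable

lemma nn_integral_translate:
  fixes f :: "real \<Rightarrow> ennreal"
  assumes "f \<in> borel_measurable borel"
  shows "(\<integral>\<^sup>+x. f (x + c) \<partial>lborel) = (\<integral>\<^sup>+x. f x \<partial>lborel)"
  using nn_integral_real_affine[OF assms, of 1 c] by (simp add: add.commute)

text \<open>On each horizontal line the shear is a translation, so Tonelli and translation
  invariance suffice.\<close>

lemma sh1_preserves:
  assumes [measurable]: "g \<in> borel_measurable borel" and A [measurable]: "A \<in> sets borel"
  shows "emeasure lborel (sh1 g -` A) = emeasure lborel A"
proof -
  have A' [measurable]: "A \<in> sets (lborel \<Otimes>\<^sub>M lborel)" unfolding lborel_prod using A by simp
  have Bb: "sh1 g -` A \<in> sets borel" using measurable_sets[OF sh_measurable(1)[OF assms(1)] A] by simp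
  then have B' [measurable]: "sh1 g -` A \<in> sets (lborel \<Otimes>\<^sub>M lborel)" unfolding lborel_prod by simp
  have "emeasure lborel (sh1 g -` A) = (\<integral>\<^sup>+p. indicator (sh1 g -` A) p \<partial>(lborel \<Otimes>\<^sub>M lborel))"
    unfolding lborel_prod using Bb by simp
  also have "\<dots> = (\<integral>\<^sup>+y. \<integral>\<^sup>+x. indicator (sh1 g -` A) (x, y) \<partial>lborel \<partial>lborel)"
    by (rule lborel_pair.nn_integral_snd[symmetric]) measurable
  also have "\<dots> = (\<integral>\<^sup>+y. \<integral>\<^sup>+x. indicator A (x + g y, y) \<partial>lborel \<partial>lborel)"
    by (simp add: sh1_def indicator_def)
  also have "\<dots> = (\<integral>\<^sup>+y. \<integral>\<^sup>+x. indicator A (x, y) \<partial>lborel \<partial>lborel)"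
  proof (rule nn_integral_cong)
    fix y :: real
    have "(\<lambda>x. indicator A (x, y) :: ennreal) \<in> borel_measurable lborel" by measurable
    then show "(\<integral>\<^sup>+x. indicator A (x + g y, y) \<partial>lborel) = (\<integral>\<^sup>+x. indicator A (x, y) \<partial>lborel)"
      by (intro nn_integral_translate) simp
  qed
  also have "\<dots> = (\<integral>\<^sup>+p. indicator A p \<partial>(lborel \<Otimes>\<^sub>M lborel))"
    by (rule lborel_pair.nn_integral_snd) measurable
  also have "\<dots> = emeasure lborel A" unfolding lborel_prod using A by simp
  finally show ?thesis .
qed

lemma sh2_preserves:
  assumes [measurable]: "g \<in> borel_measurable borel" and A [measurable]: "A \<in> sets borel"
  shows "emeasure lborel (sh2 g -` A) = emeasure lborel A"
proof -
  have A' [measurable]: "A \<in> sets (lborel \<Otimes>\<^sub>M lborel)" unfolding lborel_prod using A by simp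
  have Bb: "sh2 g -` A \<in> sets borel" using measurable_sets[OF sh_measurable(2)[OF assms(1)] A] by simp
  then have B' [measurable]: "sh2 g -` A \<in> sets (lborel \<Otimes>\<^sub>M lborel)" unfolding lborel_prod by simp
  have "emeasure lborel (sh2 g -` A) = (\<integral>\<^sup>+p. indicator (sh2 g -` A) p \<partial>(lborel \<Otimes>\<^sub>M lborel))"
    unfolding lborel_prod using Bb by simp
  also have "\<dots> = (\<integral>\<^sup>+x. \<integral>\<^sup>+y. indicator (sh2 g -` A) (x, y) \<partial>lborel \<partial>lborel)"
    by (rule lborel.nn_integral_fst[symmetric]) measurable
  also have "\<dots> = (\<integral>\<^sup>+x. \<integral>\<^sup>+y. indicator A (x, y + g x) \<partial>lborel \<partial>lborel)"
    by (simp add: sh2_def indicator_def)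
  also have "\<dots> = (\<integral>\<^sup>+x. \<integral>\<^sup>+y. indicator A (x, y) \<partial>lborel \<partial>lborel)"
  proof (rule nn_integral_cong)
    fix x :: real
    have "(\<lambda>y. indicator A (x, y) :: ennreal) \<in> borel_measurable lborel" by measurable
    then show "(\<integral>\<^sup>+y. indicator A (x, y + g x) \<partial>lborel) = (\<integral>\<^sup>+y. indicator A (x, y) \<partial>lborel)"
      by (intro nn_integral_translate) simp
  qed
  also have "\<dots> = (\<integral>\<^sup>+p. indicator A p \<partial>(lborel \<Otimes>\<^sub>M lborel))"
    by (rule lborel.nn_integral_fst) measurable
  also have "\<dots> = emeasure lborel A" unfolding lborel_prod using A by simp
  finally show ?thesis .
qed

text \<open>Bad coordinates, cut to an interval of finite length that contains every coordinate of
  an orbit starting in the unit square, by \<open>fwd_displacement\<close>.\<close>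

definition strip :: "real \<Rightarrow> real \<Rightarrow> real set" where
  "strip b m = {z \<in> {-1..2}. \<not> grid_off b m z}"

lemma strip_cover:
  assumes b: "0 < b" "b \<le> 1" and m: "0 \<le> m" "m \<le> 5"
  shows "strip b m \<in> sets borel" "emeasure lborel (strip b m) \<le> ennreal (30 * m / b)"
proof -
  \<comment> \<open>A grid point whose m-neighbourhood meets [-1,2] has modulus at most 2 + 5 = 7.
    There are at most 2 (7/b) + 1 \<le> 15/b of them, each with an interval of length 2m, which
    gives 30 m/b.\<close>
  define I where "I = {- \<lfloor>7 / b\<rfloor>..\<lfloor>7 / b\<rfloor>}"
  have eq: "strip b m = {-1..2} \<inter> (\<Union>i\<in>UNIV. {of_int i * b - m<..<of_int i * b + m})"
    by (auto simp: strip_def grid_off_def not_le abs_less_iff algebra_simps)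
  show s: "strip b m \<in> sets borel" unfolding eq by auto
  have sub: "strip b m \<subseteq> (\<Union>i\<in>I. {of_int i * b - m..of_int i * b + m})"
  proof
    fix z assume "z \<in> strip b m"
    then obtain i :: int where z: "-1 \<le> z" "z \<le> 2" "of_int i * b - m < z" "z < of_int i * b + m" unfolding eq by auto
    have "of_int i * b \<le> 7" "- 7 \<le> of_int i * b" using z m by linarith+
    then have "of_int i \<le> 7 / b" "of_int (- i) \<le> 7 / b" using b by (auto simp: field_simps)
    then have "i \<in> I" unfolding I_def by (simp add: le_floor_iff) linarith
    then show "z \<in> (\<Union>i\<in>I. {of_int i * b - m..of_int i * b + m})" using z by force
  qed
  have "emeasure lborel (strip b m) \<le> emeasure lborel (\<Union>i\<in>I. {of_int i * b - m..of_int i * b + m})"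
    by (rule emeasure_mono[OF sub]) (auto simp: I_def)
  also have "\<dots> \<le> (\<Sum>i\<in>I. emeasure lborel {of_int i * b - m..of_int i * b + m})"
    by (rule emeasure_subadditive_finite) (auto simp: I_def)
  also have "\<dots> = (\<Sum>i\<in>I. ennreal (2 * m))" using m by (intro sum.cong) auto
  also have "\<dots> = ennreal (real (card I) * (2 * m))" using m by (simp add: ennreal_mult ennreal_of_nat_eq_real_of_nat)
  also have "\<dots> \<le> ennreal (30 * m / b)"
  proof (rule ennreal_leI)
    have b1: "1 \<le> 1 / b" using b by simp
    have "0 \<le> \<lfloor>7 / b\<rfloor>" using b by simp
    then have "real (card I) = of_int (2 * \<lfloor>7 / b\<rfloor> + 1)" unfolding I_def by simp
    also have "\<dots> \<le> 2 * (7 / b) + 1" using of_int_floor_le[of "7 / b"] by linarith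
    also have "\<dots> \<le> 15 * (1 / b)" using b1 by simp
    finally have "real (card I) * (2 * m) \<le> 15 * (1 / b) * (2 * m)" using m by (intro mult_right_mono) auto
    then show "real (card I) * (2 * m) \<le> 30 * m / b" by simp
  qed
  finally show "emeasure lborel (strip b m) \<le> ennreal (30 * m / b)" .
qed

context cascade
begin

lemma g_measurable [measurable]: "g1 j \<in> borel_measurable borel" "g2 j \<in> borel_measurable borel"
proof -
  have c: "continuous_on UNIV g" if "\<And>z z'. \<bar>g z - g z'\<bar> \<le> Lip j * \<bar>z - z'\<bar>" for g :: "real \<Rightarrow> real"
    by (rule lipschitz_on_continuous_on[of "Lip j"], rule lipschitz_onI) (use that Lip(1) in \<open>auto simp: dist_real_def\<close>)
  show "g1 j \<in> borel_measurable borel" "g2 j \<in> borel_measurable borel"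
    by (rule borel_measurable_continuous_onI, rule c, rule Lip)+
qed

lemma fwd_Suc_sh: "fwd (Suc j) p = sh2 (g2 j) (sh1 (g1 j) (fwd j p))"
  by (simp add: fwd.simps(2) sh1_def sh2_def Let_def)

lemma fwd_mid: "sh1 (g1 j) (fwd j p) = (fst (fwd (Suc j) p), snd (fwd j p))"
  by (simp add: sh1_def fwd_Suc(1))

lemma fwd_measurable [measurable]: "fwd j \<in> measurable borel borel"
proof (induction j)
  case (Suc j)
  have "fwd (Suc j) = (\<lambda>p. sh2 (g2 j) (sh1 (g1 j) (fwd j p)))" using fwd_Suc_sh by blast
  moreover have "(\<lambda>p. sh2 (g2 j) (sh1 (g1 j) (fwd j p))) \<in> measurable borel borel"
    by (rule measurable_compose[OF measurable_compose[OF Suc sh_measurable(1)[OF g_measurable(1)]]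
          sh_measurable(2)[OF g_measurable(2)]])
  ultimately show ?case by metis
qed (simp add: measurable_ident_sets)

lemma fwd_preserves: "A \<in> sets borel \<Longrightarrow> emeasure lborel (fwd j -` A) = emeasure lborel A"
proof (induction j arbitrary: A)
  case (Suc j)
  have 1: "sh2 (g2 j) -` A \<in> sets borel"
    using measurable_sets[OF sh_measurable(2)[OF g_measurable(2)] Suc.prems] by simp
  have 2: "sh1 (g1 j) -` (sh2 (g2 j) -` A) \<in> sets borel"
    using measurable_sets[OF sh_measurable(1)[OF g_measurable(1)] 1] by simp
  have "fwd (Suc j) -` A = fwd j -` (sh1 (g1 j) -` (sh2 (g2 j) -` A))" by (auto simp: fwd_Suc_sh)
  then show ?case
    using Suc.IH[OF 2] sh1_preserves[OF g_measurable(1) 1] sh2_preserves[OF g_measurable(2) Suc.prems] by simp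
qed (simp add: vimage_def)

text \<open>The same telescoping as for the noisy path keeps orbits of the unit square in
  [-1,2].\<close>

lemma fwd_displacement: "\<bar>fst (fwd j p) - fst p\<bar> \<le> a 0 - a j" "\<bar>snd (fwd j p) - snd p\<bar> \<le> a 0 - a j"
proof (induction j)
  case (Suc j)
  note a4 = a_Suc_le[of j] a_pos[of "Suc j"]
  { case 1 then show ?case using Suc(1) a4 g1_bound[of j "snd (fwd j p)"] unfolding fwd_Suc(1) by linarith }
  { case 2 then show ?case using Suc(2) a4 g2_bound[of j "fst (fwd (Suc j) p)"] unfolding fwd_Suc(2) by linarith }
qed simp_all

text \<open>The points bad at stage \<open>j\<close> are preimages of strips under area-preserving
  maps, so their measure is of order \<open>lq (Suc j) / a (Suc j)\<close>, a power 1 - \<gamma> of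
  the ratio of scales. It is at most of order a_(j+1)^(\<delta> (1 - \<gamma>)), whose sum converges
  by \<open>scale_sequence\<close>; Borel-Cantelli concludes.\<close>

lemma ae_good_pairs: "AE p in lborel. p \<in> {0..1} \<times> {0..1} \<longrightarrow> (\<exists>j0. \<forall>j\<ge>j0. good j p)"
proof -
  let ?S = "\<lambda>j. strip (a (Suc j)) (5 * lq (Suc j))"
  \<comment> \<open>The second part tests the first coordinate between the two shears of the stage.
    The vertical shear leaves that coordinate alone, so it is the one occurring in
    \<open>good\<close>.\<close>
  define A where "A j = fwd j -` ({-1..2::real} \<times> ?S j) \<union> (\<lambda>p. sh1 (g1 j) (fwd j p)) -` (?S j \<times> {-1..2::real})" for j
  have b: "0 < a (Suc j)" "a (Suc j) \<le> 1" "0 \<le> 5 * lq (Suc j)" "5 * lq (Suc j) \<le> 5" for j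
    using a_le_1[of "Suc j"] ell_bounds(2)[of "Suc j"] by (auto simp: less_imp_le intro: order_trans)
  note S = strip_cover[OF b]
  have S1: "?S j \<in> sets borel" for j by (rule S(1))
  have m1: "{-1..2::real} \<times> ?S j \<in> sets borel" "?S j \<times> {-1..2::real} \<in> sets borel" for j
    unfolding borel_prod[symmetric] using S1[of j] by auto
  have p1: "fwd j -` ({-1..2::real} \<times> ?S j) \<in> sets borel" for j
    using measurable_sets[OF fwd_measurable m1(1)] by simp
  have p2': "sh1 (g1 j) -` (?S j \<times> {-1..2::real}) \<in> sets borel" for j
    using measurable_sets[OF sh_measurable(1)[OF g_measurable(1)] m1(2)] by simp
  have p2eq: "(\<lambda>p. sh1 (g1 j) (fwd j p)) -` (?S j \<times> {-1..2::real}) = fwd j -` (sh1 (g1 j) -` (?S j \<times> {-1..2::real}))" for j by auto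
  have p2: "(\<lambda>p. sh1 (g1 j) (fwd j p)) -` (?S j \<times> {-1..2::real}) \<in> sets borel" for j
    unfolding p2eq using measurable_sets[OF fwd_measurable p2'] by simp
  have Am: "A j \<in> sets lborel" for j unfolding A_def using p1 p2 by auto
  \<comment> \<open>Two strips, each of width 3 in the free coordinate and of measure 30 * 5 times
    the quotient in the other: 2 * 3 * 150 = 900.\<close>
  define c where "c j = 900 * (lq (Suc j) / a (Suc j))" for j
  have c0: "0 \<le> c j" for j by (simp add: c_def less_imp_le)
  have ej: "emeasure lborel (A j) \<le> ennreal (c j)" for j
  proof -
    have i3: "emeasure lborel {-1..2::real} = ennreal 3" by simp
    have "emeasure lborel (A j) \<le> emeasure lborel (fwd j -` ({-1..2::real} \<times> ?S j))
        + emeasure lborel ((\<lambda>p. sh1 (g1 j) (fwd j p)) -` (?S j \<times> {-1..2::real}))"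
      unfolding A_def by (rule emeasure_subadditive) (use p1 p2 in auto)
    also have "\<dots> = emeasure lborel ({-1..2::real} \<times> ?S j) + emeasure lborel (?S j \<times> {-1..2::real})"
      unfolding p2eq fwd_preserves[OF m1(1)] fwd_preserves[OF p2'] sh1_preserves[OF g_measurable(1) m1(2)] ..
    also have "\<dots> = ennreal 3 * emeasure lborel (?S j) + emeasure lborel (?S j) * ennreal 3"
      unfolding lborel_prod[symmetric] i3[symmetric]
      by (intro arg_cong2[where f="(+)"] lborel.emeasure_pair_measure_Times) (use S(1)[of j] in auto)
    also have "\<dots> \<le> ennreal 3 * ennreal (30 * (5 * lq (Suc j)) / a (Suc j)) + ennreal (30 * (5 * lq (Suc j)) / a (Suc j)) * ennreal 3"
      by (intro add_mono mult_mono S(2)) auto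
    also have "\<dots> = ennreal (c j)"
    proof -
      have x: "ennreal 3 * ennreal x + ennreal x * ennreal 3 = ennreal (3 * x + x * 3)" if "0 \<le> x" for x
        using that by (simp only: ennreal_mult[symmetric] ennreal_plus mult_nonneg_nonneg zero_le_numeral)
      have "0 \<le> 30 * (5 * lq (Suc j)) / a (Suc j)" by (simp add: less_imp_le)
      from x[OF this] show ?thesis unfolding c_def by (simp only:) (simp add: field_simps)
    qed
    finally show ?thesis .
  qed
  have sm: "summable c"
  proof -
    have "summable (\<lambda>q. a q powr (\<delta> * (1 - \<gamma>)))" using scale by (simp add: scale_sequence_def)
    then have "summable (\<lambda>q. a (Suc q) powr (\<delta> * (1 - \<gamma>)))"
      using summable_Suc_iff[of "\<lambda>q. a q powr (\<delta> * (1 - \<gamma>))"] by blast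
    then have s: "summable (\<lambda>q. 900 * a (Suc q) powr (\<delta> * (1 - \<gamma>)))" by (rule summable_mult)
    show ?thesis
    proof (rule summable_comparison_test'[where N=0, OF s])
      fix j
      have "(a (Suc (Suc j)) / a (Suc j)) powr (1 - \<gamma>) \<le> (a (Suc j) powr \<delta>) powr (1 - \<gamma>)"
        using a_ratio[of "Suc j"] \<gamma> by (intro powr_mono2) (auto simp: less_imp_le)
      then have "c j \<le> 900 * a (Suc j) powr (\<delta> * (1 - \<gamma>))"
        unfolding c_def ell_over_a by (simp add: powr_powr)
      then show "norm (c j) \<le> 900 * a (Suc j) powr (\<delta> * (1 - \<gamma>))" using c0[of j] by simp
    qed
  qed
  have "AE p in lborel. eventually (\<lambda>j. p \<in> space lborel - A j) sequentially"
  proof (rule borel_cantelli_AE1)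
    show "emeasure lborel (A j) < \<infinity>" for j by (rule le_less_trans[OF ej]) simp
    show "summable (\<lambda>j. measure lborel (A j))"
    proof (rule summable_comparison_test'[where N=0, OF sm])
      show "norm (measure lborel (A j)) \<le> c j" for j
        using ej[of j] c0[of j] by (simp add: measure_def enn2real_leI)
    qed
  qed (rule Am)
  then show ?thesis
  proof eventually_elim
    case (elim p)
    show ?case
    proof
      assume p: "p \<in> {0..1} \<times> {0..1}"
      have in2: "fst (fwd j p) \<in> {-1..2}" "snd (fwd j p) \<in> {-1..2}" for j
      proof -
        have p': "0 \<le> fst p" "fst p \<le> 1" "0 \<le> snd p" "snd p \<le> 1" using p by (auto simp: mem_Times_iff)
        show "fst (fwd j p) \<in> {-1..2}" "snd (fwd j p) \<in> {-1..2}"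
          unfolding atLeastAtMost_iff using fwd_displacement[of j p] p' a_le_1[of 0] a_pos[of j] by linarith+
      qed
      have "good j p" if "p \<notin> A j" for j
      proof -
        have "fwd j p \<notin> {-1..2} \<times> ?S j" "(fst (fwd (Suc j) p), snd (fwd j p)) \<notin> ?S j \<times> {-1..2}"
          using that unfolding A_def fwd_mid[symmetric] by blast+
        then have "snd (fwd j p) \<notin> ?S j" "fst (fwd (Suc j) p) \<notin> ?S j"
          using in2(1)[of j] in2(2)[of j] unfolding mem_Times_iff fst_conv snd_conv by blast+
        then show ?thesis using in2(2)[of j] in2(1)[of "Suc j"] unfolding good_def strip_def by blast
      qed
      moreover from elim obtain j0 where "\<And>j. j0 \<le> j \<Longrightarrow> p \<notin> A j"
        unfolding eventually_sequentially by blast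
      ultimately show "\<exists>j0. \<forall>j\<ge>j0. good j p" by blast
    qed
  qed
qed

lemma ae_good: "AE x::real^2 in lborel. x \<in> cbox 0 1 \<longrightarrow> (\<exists>j0. \<forall>j\<ge>j0. good j (x $ 1, x $ 2))"
proof -
  from ae_good_pairs obtain N where N: "N \<in> null_sets lborel"
    "{p \<in> space lborel. \<not> (p \<in> {0..1} \<times> {0..1} \<longrightarrow> (\<exists>j0. \<forall>j\<ge>j0. good j p))} \<subseteq> N"
    unfolding eventually_ae_filter by blast
  define v where "v x = (x $ 1, x $ 2)" for x :: "real^2"
  have vv: "vec2 (v x) = x" "v (vec2 p) = p" for x p
    by (simp_all add: v_def vec_eq_iff forall_2)
  have vm: "v \<in> measurable borel borel"
    unfolding v_def borel_prod[symmetric] cart_eq_inner_axis by measurable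
  have Nb: "N \<in> sets borel" using N(1) by auto
  have vN: "v -` N \<in> sets borel" using measurable_sets[OF vm Nb] by simp
  moreover have "emeasure lborel (v -` N) = emeasure lborel (vec2 -` (v -` N))"
  proof -
    have "emeasure lborel (v -` N) = emeasure (distr lborel borel vec2) (v -` N)"
      by (rule arg_cong[where f="\<lambda>M. emeasure M (v -` N)", OF lborel_vec2])
    also have "\<dots> = emeasure lborel (vec2 -` (v -` N))"
      using vN by (subst emeasure_distr) auto
    finally show ?thesis .
  qed
  moreover have "vec2 -` (v -` N) = N" by (auto simp: vv)
  ultimately have "v -` N \<in> null_sets lborel" using N(1) by (auto simp: null_sets_def)
  then show ?thesis
  proof (rule AE_I', intro subsetI)
    fix x :: "real^2" assume "x \<in> {x \<in> space lborel. \<not> (x \<in> cbox 0 1 \<longrightarrow> (\<exists>j0. \<forall>j\<ge>j0. good j (x $ 1, x $ 2)))}"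
    then have "v x \<in> {p \<in> space lborel. \<not> (p \<in> {0..1} \<times> {0..1} \<longrightarrow> (\<exists>j0. \<forall>j\<ge>j0. good j p))}"
      by (simp add: v_def mem_box_cart forall_2)
    from subsetD[OF N(2) this] show "x \<in> v -` N" by (rule vimageI2)
  qed
qed

end

section \<open>Vanishing variance\<close>

text \<open>The variance is at most the second moment about any constant. The constants may vary
  with \<open>q\<close> and need not converge; boundedness gives the dominated convergence.\<close>

lemma (in prob_space) variance_tendsto_0:
  fixes Z :: "nat \<Rightarrow> 'a \<Rightarrow> real"
  assumes Z [measurable]: "\<And>q. Z q \<in> borel_measurable M" and b: "\<And>q \<omega>. \<bar>Z q \<omega>\<bar> \<le> b" "\<And>q. \<bar>c q\<bar> \<le> b"
    and lim: "AE \<omega> in M. (\<lambda>q. Z q \<omega> - c q) \<longlonglongrightarrow> 0"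
  shows "(\<lambda>q. variance (Z q)) \<longlonglongrightarrow> 0"
proof (rule tendsto_sandwich[where f="\<lambda>_. 0"])
  have b0: "0 \<le> b" using b(2)[of 0] by linarith
  have bc: "\<bar>Z q \<omega> - c q\<bar> \<le> 2 * b" for q \<omega> using b(1)[of q \<omega>] b(2)[of q] by linarith
  have i1: "integrable M (\<lambda>\<omega>. Z q \<omega> - c q)" for q
    by (rule integrable_const_bound[where B="2 * b"]) (use bc in auto)
  have sq: "(Z q \<omega> - c q)\<^sup>2 \<le> (2 * b)\<^sup>2" for q \<omega>
    using bc[of q \<omega>] b0 by (intro abs_le_square_iff[THEN iffD1]) simp
  have i2: "integrable M (\<lambda>\<omega>. (Z q \<omega> - c q)\<^sup>2)" for q
    by (rule integrable_const_bound[where B="(2 * b)\<^sup>2"]) (use sq in auto)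
  have iZ: "integrable M (Z q)" for q
    by (rule integrable_const_bound[where B=b]) (use b in auto)
  have "variance (Z q) \<le> (\<integral>\<omega>. (Z q \<omega> - c q)\<^sup>2 \<partial>M)" for q
  proof -
    have "variance (Z q) = variance (\<lambda>\<omega>. Z q \<omega> - c q)" using iZ[of q] by (simp add: prob_space)
    then show ?thesis unfolding variance_eq[OF i1 i2] by simp
  qed
  then show "\<forall>\<^sub>F q in sequentially. variance (Z q) \<le> (\<integral>\<omega>. (Z q \<omega> - c q)\<^sup>2 \<partial>M)" by simp
  have "(\<lambda>q. \<integral>\<omega>. (Z q \<omega> - c q)\<^sup>2 \<partial>M) \<longlonglongrightarrow> (\<integral>\<omega>. 0 \<partial>M)"
  proof (rule integral_dominated_convergence[where w="\<lambda>_. (2 * b)\<^sup>2"])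
    show "AE \<omega> in M. (\<lambda>q. (Z q \<omega> - c q)\<^sup>2) \<longlonglongrightarrow> 0"
      using lim
    proof eventually_elim
      case (elim \<omega>) from tendsto_power[OF this, of 2] show ?case by simp
    qed
  qed (use sq in auto)
  then show "(\<lambda>q. \<integral>\<omega>. (Z q \<omega> - c q)\<^sup>2 \<partial>M) \<longlonglongrightarrow> 0" by simp
qed simp_all

lemma torus_reduce:
  assumes "torus_periodic (f :: real^2 \<Rightarrow> 'b)"
  shows "\<exists>k. x - k \<in> cbox 0 1 \<and> (\<forall>y. f y = f (y - k))"
proof -
  define k :: "real^2" where "k = (\<chi> i. of_int \<lfloor>x $ i\<rfloor>)"
  have k: "k \<in> lattice" by (simp add: k_def lattice_def)
  have "x - k \<in> cbox 0 1"
  proof -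
    have "0 \<le> x $ i - of_int \<lfloor>x $ i\<rfloor> \<and> x $ i - of_int \<lfloor>x $ i\<rfloor> \<le> 1" for i by linarith
    then show ?thesis by (simp add: mem_box_cart k_def)
  qed
  moreover have "f y = f (y - k)" for y
  proof -
    have "f ((y - k) + k) = f (y - k)" using assms k unfolding torus_periodic_def by blast
    then show ?thesis by simp
  qed
  ultimately show ?thesis by blast
qed

lemma torus_continuous:
  assumes c: "continuous_on UNIV (f :: real^2 \<Rightarrow> real)" and p: "torus_periodic f"
  shows "\<exists>b. \<forall>x. \<bar>f x\<bar> \<le> b" and "uniformly_continuous_on UNIV f"
proof -
  have "compact (f ` cbox 0 1)"
    by (intro compact_continuous_image continuous_on_subset[OF c]) auto
  then have "bounded (f ` cbox 0 1)" by (rule compact_imp_bounded)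
  then obtain b where b: "\<forall>y\<in>f ` cbox 0 1. norm y \<le> b" unfolding bounded_iff by blast
  have "\<bar>f x\<bar> \<le> b" for x
  proof -
    obtain k where k1: "x - k \<in> cbox 0 1" and k2: "\<forall>y. f y = f (y - k)"
      using torus_reduce[OF p, of x] by (elim exE conjE)
    show ?thesis using b k1 unfolding k2[rule_format, of x] by simp
  qed
  then show "\<exists>b. \<forall>x. \<bar>f x\<bar> \<le> b" by blast
  \<comment> \<open>Points reduced to the unit square have norm at most 2, and a neighbour at
    distance below 1, shifted by the same lattice vector, remains in this ball.\<close>
  define Q where "Q = (cball 0 4 :: (real^2) set)"
  have "uniformly_continuous_on Q f"
    unfolding Q_def by (intro compact_uniformly_continuous continuous_on_subset[OF c]) auto
  show "uniformly_continuous_on UNIV f"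
    unfolding uniformly_continuous_on_def
  proof (intro allI impI)
    fix e :: real assume "0 < e"
    then obtain d where d: "d > 0" "\<And>x y. x \<in> Q \<Longrightarrow> y \<in> Q \<Longrightarrow> dist y x < d \<Longrightarrow> dist (f y) (f x) < e"
      using \<open>uniformly_continuous_on Q f\<close> unfolding uniformly_continuous_on_def by metis
    show "\<exists>d>0. \<forall>x\<in>UNIV. \<forall>y\<in>UNIV. dist y x < d \<longrightarrow> dist (f y) (f x) < e"
    proof (intro exI[of _ "min d 1"] conjI ballI impI)
      show "min d 1 > 0" using d by simp
      fix x y :: "real^2" assume xy: "dist y x < min d 1"
      obtain k where k1: "x - k \<in> cbox 0 1" and k2: "\<forall>y. f y = f (y - k)"
      using torus_reduce[OF p, of x] by (elim exE conjE)
      have n: "norm (x - k) \<le> 2"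
        using norm_cart_le[of "x - k"] k1 by (auto simp: mem_box_cart forall_2)
      have d': "dist (y - k) (x - k) < min d 1" using xy by (simp add: dist_norm)
      have "norm (y - k) \<le> norm (x - k) + dist (y - k) (x - k)"
        using norm_triangle_sub[of "y - k" "x - k"] by (simp add: dist_norm)
      then have "x - k \<in> Q" "y - k \<in> Q" using n d' by (auto simp: Q_def)
      then show "dist (f y) (f x) < e" unfolding k2[rule_format, of x] k2[rule_format, of y] using d' by (intro d(2)) auto
    qed
  qed
qed

text \<open>The noise is measurable for each fixed time, but exchanging expectation and time
  integral needs measurability in both variables. Sampling the path at a grid time to the right of t
  gives jointly measurable approximations, and right continuity identifies their limit.\<close>

lemma jointly_measurable_version:
  fixes w :: "real \<Rightarrow> 'w \<Rightarrow> real"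
  assumes w: "\<And>t. t \<in> {0..1} \<Longrightarrow> w t \<in> borel_measurable M"
    and rc: "AE \<omega> in M. \<forall>t\<in>{0..<1}. continuous (at_right t) (\<lambda>s. w s \<omega>)"
  shows "\<exists>B. (\<lambda>p. B (fst p) (snd p)) \<in> borel_measurable (lborel \<Otimes>\<^sub>M M) \<and>
    (AE \<omega> in M. \<forall>t\<in>{0..<1}. B t \<omega> = w t \<omega>)"
proof -
  \<comment> \<open>The + 1 places the sample strictly to the right of t, as the limit at
    \<open>at_right t\<close> demands; clipping keeps it in [0,1], where \<open>w\<close> is
    measurable.\<close>
  define r where "r n i = min 1 (max 0 ((of_int i + 1) / real (Suc n)))" for n and i :: int
  \<comment> \<open>\<open>lim\<close> takes a default value where the limit fails to exist. For t
    in [0,1) this concerns a null set of \<omega> that does not depend on t.\<close>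
  define B where "B t \<omega> = lim (\<lambda>n. w (r n \<lfloor>real (Suc n) * t\<rfloor>) \<omega>)" for t \<omega>
  have r01: "r n i \<in> {0..1}" for n i by (simp add: r_def)
  have "(\<lambda>p. w (r n \<lfloor>real (Suc n) * fst p\<rfloor>) (snd p)) \<in> borel_measurable (lborel \<Otimes>\<^sub>M M)" for n
  proof (rule measurable_compose_countable[where f="\<lambda>i p. w (r n i) (snd p)" and g="\<lambda>p. \<lfloor>real (Suc n) * fst p\<rfloor>"])
    show "(\<lambda>p. w (r n i) (snd p)) \<in> borel_measurable (lborel \<Otimes>\<^sub>M M)" for i
      by (rule measurable_compose[OF measurable_snd w[OF r01]])
    show "(\<lambda>p. \<lfloor>real (Suc n) * fst p\<rfloor>) \<in> measurable (lborel \<Otimes>\<^sub>M M) (count_space UNIV)" by measurable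
  qed
  then have Bm: "(\<lambda>p. B (fst p) (snd p)) \<in> borel_measurable (lborel \<Otimes>\<^sub>M M)"
    unfolding B_def by (rule borel_measurable_lim_metric)
  have "AE \<omega> in M. \<forall>t\<in>{0..<1}. B t \<omega> = w t \<omega>"
    using rc
  proof eventually_elim
    case (elim \<omega>)
    show ?case
    proof
      fix t :: real assume t: "t \<in> {0..<1}"
      define s where "s n = r n \<lfloor>real (Suc n) * t\<rfloor>" for n
      have gt: "t < s n" and le: "s n \<le> t + 1 / real (Suc n)" for n
      proof -
        let ?i = "real_of_int \<lfloor>real (Suc n) * t\<rfloor>"
        have "real (Suc n) * t < ?i + 1" "?i \<le> real (Suc n) * t" by linarith+
        then have "t < (?i + 1) / real (Suc n)" and "(?i + 1) / real (Suc n) \<le> (real (Suc n) * t + 1) / real (Suc n)"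
          by (simp_all add: pos_less_divide_eq mult.commute divide_right_mono del: of_nat_Suc)
        moreover have "(real (Suc n) * t + 1) / real (Suc n) = t + 1 / real (Suc n)"
          by (simp add: add_divide_distrib del: of_nat_Suc)
        moreover have "0 \<le> t + 1 / real (Suc n)" using t by simp
        ultimately show "t < s n" "s n \<le> t + 1 / real (Suc n)" using t unfolding s_def r_def by auto
      qed
      have "(\<lambda>n. t + 1 / real (Suc n)) \<longlonglongrightarrow> t + 0"
        by (intro tendsto_add tendsto_const LIMSEQ_Suc[OF lim_const_over_n])
      then have "(\<lambda>n. t + 1 / real (Suc n)) \<longlonglongrightarrow> t" by simp
      then have "s \<longlonglongrightarrow> t"
        by (rule real_tendsto_sandwich[rotated 3]) (auto intro!: always_eventually less_imp_le[OF gt] le tendsto_const simp del: of_nat_Suc)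
      then have "filterlim s (at_right t) sequentially"
        using gt by (auto simp: filterlim_at intro: always_eventually less_imp_neq[symmetric])
      moreover have "((\<lambda>s. w s \<omega>) \<longlongrightarrow> w t \<omega>) (at_right t)"
        using elim t by (auto simp: continuous_within)
      ultimately have "(\<lambda>n. w (s n) \<omega>) \<longlonglongrightarrow> w t \<omega>" by (rule filterlim_compose[rotated])
      then show "B t \<omega> = w t \<omega>" unfolding B_def s_def by (rule limI)
    qed
  qed
  then show ?thesis using Bm by blast
qed

lemma suminf_ennreal_tendsto_0:
  assumes "(\<Sum>n. f n :: ennreal) \<noteq> top"
  shows "(\<lambda>n. enn2real (f n)) \<longlonglongrightarrow> 0" and "ennreal (enn2real (f n)) = f n"
proof -
  have "f n \<le> (\<Sum>n. f n)" for n
    using sum_le_suminf[of f "{n}"] by simp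
  then have fin: "f n < top" for n using assms by (meson le_less_trans top.not_eq_extremum)
  then show eq: "ennreal (enn2real (f n)) = f n" for n by simp
  have "(\<Sum>n. ennreal (enn2real (f n))) \<noteq> top" using assms by (simp add: eq)
  then have "summable (\<lambda>n. enn2real (f n))" by (intro summable_suminf_not_top) auto
  then show "(\<lambda>n. enn2real (f n)) \<longlonglongrightarrow> 0" by (rule summable_LIMSEQ_zero)
qed

lemma summable_Suc_power: "0 \<le> s \<Longrightarrow> s < 1 \<Longrightarrow> summable (\<lambda>q. (real q + 1) * s ^ q :: real)"
proof -
  assume s: "0 \<le> s" "s < 1"
  have "summable (\<lambda>q. diffs (\<lambda>_. 1::real) q * s ^ q)"
    by (rule termdiff_converges[of s 1]) (use s in \<open>auto intro: summable_geometric\<close>)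
  then show ?thesis by (simp add: diffs_def add.commute)
qed

section \<open>Asymptotics as q tends to infinity\<close>

context cascade
begin

abbreviation "kap \<equiv> kappa a"
abbreviation "ratio q \<equiv> a (Suc q) / a q"

lemma kap_pos [simp]: "0 < kap q"
  by (simp add: kappa_def)

lemma ratio_bounds: "0 < ratio q" "ratio q \<le> ((1/4) powr \<delta>) ^ q"
proof -
  have "ratio q \<le> a q powr \<delta>" by (rule a_ratio)
  also have "\<dots> \<le> ((1/4) ^ q) powr \<delta>" using \<delta> a_le_power by (intro powr_mono2) (auto simp: less_imp_le)
  also have "\<dots> = ((1/4) powr \<delta>) ^ q" by (simp add: powr_realpow[symmetric] powr_powr mult.commute)
  finally show "ratio q \<le> ((1/4) powr \<delta>) ^ q" .
qed simp

lemma quarter_powr: "0 < p \<Longrightarrow> (1/4::real) powr p < 1"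
  using powr_less_mono2[of p "1/4" 1] by simp

lemma ratio_powr_tendsto_0: "0 < p \<Longrightarrow> (\<lambda>q. ratio q powr p) \<longlonglongrightarrow> 0"
proof -
  assume p: "0 < p"
  have le: "ratio q powr p \<le> (((1/4) powr \<delta>) powr p) ^ q" for q
  proof -
    have "ratio q powr p \<le> (((1/4) powr \<delta>) ^ q) powr p" using ratio_bounds[of q] p by (intro powr_mono2) (auto simp: less_imp_le)
    then show ?thesis by (simp add: powr_powr powr_realpow[symmetric] mult_ac)
  qed
  have lim: "(\<lambda>q. (((1/4) powr \<delta>) powr p) ^ q) \<longlonglongrightarrow> 0"
    using quarter_powr[of "\<delta> * p"] \<delta> p by (intro LIMSEQ_power_zero) (simp add: powr_powr)
  show ?thesis
  proof (rule tendsto_sandwich[OF _ _ tendsto_const lim])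
    show "\<forall>\<^sub>F q in sequentially. 0 \<le> ratio q powr p"
      by (rule always_eventually) (rule allI, rule powr_ge_zero)
    show "\<forall>\<^sub>F q in sequentially. ratio q powr p \<le> (((1/4) powr \<delta>) powr p) ^ q"
      by (rule always_eventually) (rule allI, rule le)
  qed
qed

text \<open>This makes the noise negligible against the margins of all good stages up to
  \<open>q\<close>.\<close>

lemma kap_over_ell: "(\<lambda>q. kap q / lq q) \<longlonglongrightarrow> 0"
proof -
  have le: "kap q / lq q \<le> 1 / real q" if "1 \<le> q" for q
  proof -
    have "10 * real q ^ 4 * kap q \<le> lq q" using scale by (simp add: scale_sequence_def)
    moreover have "real q * kap q \<le> 10 * real q ^ 4 * kap q"
    proof (rule mult_right_mono)
      have "real q ^ 1 \<le> real q ^ 4" using that by (intro power_increasing) auto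
      then show "real q \<le> 10 * real q ^ 4" using zero_le_power[of "real q" 4] unfolding power_one_right by linarith
    qed (simp add: less_imp_le)
    ultimately have "real q * kap q \<le> lq q" by linarith
    then show ?thesis using that by (simp add: field_simps)
  qed
  show ?thesis
  proof (rule tendsto_sandwich[where f="\<lambda>_. 0" and h="\<lambda>q. 1 / real q"])
    show "\<forall>\<^sub>F q in sequentially. kap q / lq q \<le> 1 / real q"
      using eventually_ge_at_top[of 1] by eventually_elim (rule le)
    show "(\<lambda>q. 1 / real q) \<longlonglongrightarrow> 0" by (rule lim_const_over_n)
  qed (simp_all add: less_imp_le)
qed

lemma kap_over_a: "kap q / a (Suc q) = ratio q powr (- 1/2)"
proof -
  have "a (Suc q) = a (Suc q) powr (1/2) * a (Suc q) powr (1/2)" by (simp add: powr_add[symmetric])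
  then have "kap q / a (Suc q) = a q powr (1/2) / a (Suc q) powr (1/2)" unfolding kappa_def by (simp add: field_simps)
  also have "\<dots> = ratio q powr (- 1/2)" by (simp add: powr_divide powr_minus field_simps)
  finally show ?thesis .
qed

text \<open>The fundamental frequency of the stage-\<open>q\<close> square wave, whose period is 2
  \<open>a (Suc q)\<close>, as a function of the noise \<open>W\<close>.\<close>

definition zeta :: "nat \<Rightarrow> real" where
  "zeta q = pi * kap q / a (Suc q)"

lemma zeta_ge: "ratio q powr (- 1/2) \<le> zeta q" "1 \<le> zeta q"
proof -
  have eq: "zeta q = pi * ratio q powr (- 1/2)" unfolding zeta_def kap_over_a[symmetric] by simp
  have r: "1 \<le> ratio q powr (- 1/2)"
    using powr_mono2'[of "-1/2" "ratio q" 1] a_ratio_le_1[of q] by simp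
  have "1 * ratio q powr (- 1/2) \<le> pi * ratio q powr (- 1/2)" using pi_gt3 by (intro mult_right_mono) auto
  then show "ratio q powr (- 1/2) \<le> zeta q" "1 \<le> zeta q" using r unfolding eq by linarith+
qed

text \<open>The outgoing and the returning horizontal shear of stage \<open>q\<close> in one
  quantity; the reversed cutoff samples the same noise path at the mirrored times.\<close>

definition both_waves :: "nat \<Rightarrow> (real \<Rightarrow> real) \<Rightarrow> ennreal" where
  "both_waves q b = wave_sum (\<eta> q 1) (zeta q) b + wave_sum (\<lambda>r. \<eta> q 1 (1 - r)) (zeta q) b"

lemma tq_quarter: "\<exists>q1. \<forall>q\<ge>q1. 1/4 \<le> tq q"
proof -
  have "eventually (\<lambda>q. 1/4 < tq q) sequentially"
    by (rule order_tendstoD(1)[OF tq_tendsto]) simp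
  then show ?thesis unfolding eventually_sequentially by (auto intro: less_imp_le)
qed

text \<open>The mean of \<open>both_waves\<close> times \<open>a q / lq q\<close> is at most a
  constant times (q + 1) times ratio^(\<theta>/4 - (1 - \<gamma>)), hence summable. Then the sum
  over \<open>q\<close> is almost surely finite and its terms tend to 0, which is stronger than
  convergence in mean.\<close>

lemma waves_negligible:
  fixes M :: "'w measure" and B :: "real \<Rightarrow> 'w \<Rightarrow> real"
  assumes M: "prob_space M" and Bm: "(\<lambda>p. B (fst p) (snd p)) \<in> borel_measurable (lborel \<Otimes>\<^sub>M M)"
    and char: "\<And>s t \<xi>. s \<in> {1/4..<1} \<Longrightarrow> t \<in> {1/4..<1} \<Longrightarrow> 1 \<le> \<xi> \<Longrightarrow>
      norm (\<integral>\<omega>. cis (\<xi> * (B t \<omega> - B s \<omega>)) \<partial>M) \<le> K * exp (- c * \<xi> powr \<theta> * \<bar>t - s\<bar>)"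
    and c: "0 < c" and \<theta>: "4 * (1 - \<gamma>) < \<theta>" and K: "0 \<le> K"
  shows "AE \<omega> in M. (\<lambda>q. a q / lq q * enn2real (both_waves q (\<lambda>t. B t \<omega>))) \<longlonglongrightarrow> 0 \<and>
     (\<exists>q1. \<forall>q\<ge>q1. both_waves q (\<lambda>t. B t \<omega>) \<noteq> top)"
proof -
  interpret prob_space M by (rule M)
  obtain C where C: "0 \<le> C" "\<And>q t. \<eta> q 1 t \<le> C * (real q + 1)\<^sup>2" using eta_bound by blast
  obtain q1 where q1: "\<And>q. q1 \<le> q \<Longrightarrow> 1/4 \<le> tq q" using tq_quarter by blast
  have "0 < 4 * (1 - \<gamma>)" using \<gamma> by simp
  then have \<theta>0: "0 < \<theta>" using \<theta> by (rule order.strict_trans)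
  have one: "(1::nat) \<in> {1,2,3}" by simp
  have em [measurable]: "\<eta> q 1 \<in> borel_measurable borel" for q
    by (rule borel_measurable_continuous_onI) (rule eta_props(4)[OF one])
  \<comment> \<open>From \<open>q1\<close> on, the outgoing cutoffs live in [1/4,1/2) and the
    mirrored ones in (1/2,3/4], where the decay of the characteristic functions is
    available.\<close>
  have T: "t \<in> {1/4..<1} \<and> 1 - t \<in> {1/4..<1}" if "\<eta> q 1 t \<noteq> 0" "q1 \<le> q" for q t
  proof -
    have "t \<in> J q 1" by (rule eta_props(2)[OF one that(1)])
    from J_in_stage[OF this one] J_half[OF this one] show ?thesis using q1[OF that(2)] by auto
  qed
  define D where "D = sqrt (2 * K / c) * (\<Sum>n. real (2 * n + 1) powr (- 1 - \<theta> / 2)) * sqrt C"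
  have D0: "0 \<le> D"
  proof -
    have "0 \<le> (\<Sum>n. real (2 * n + 1) powr (- 1 - \<theta> / 2))"
      by (rule suminf_nonneg) (use summable_powr_odd[of "\<theta> / 2"] \<theta>0 in auto)
    then show ?thesis using K c C by (simp add: D_def)
  qed
  define E where "E q = C * (real q + 1)\<^sup>2" for q
  have sE: "sqrt (E q) = sqrt C * (real q + 1)" for q by (simp add: E_def real_sqrt_mult)
  have revi: "integrable lborel (\<lambda>r. \<eta> q 1 (1 - r))" "(\<integral>r. \<eta> q 1 (1 - r) \<partial>lborel) = 1" for q
    using lborel_integrable_real_affine[OF eta_props(5)[OF one, of q], of "-1" 1]
      lborel_integral_real_affine[of "-1" "\<eta> q 1" 1] eta_props(3)[OF one, of q] by simp_all
  have b1: "(\<integral>\<^sup>+\<omega>. wave_sum (\<eta> q 1) (zeta q) (\<lambda>t. B t \<omega>) \<partial>M) \<le> ennreal (D * ((real q + 1) * zeta q powr (- \<theta> / 2)))"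
    if "q1 \<le> q" for q
  proof -
    have "(\<integral>\<^sup>+\<omega>. wave_sum (\<eta> q 1) (zeta q) (\<lambda>t. B t \<omega>) \<partial>M)
      \<le> ennreal (sqrt (2 * K / c) * (\<Sum>n. real (2 * n + 1) powr (- 1 - \<theta> / 2)) * (sqrt (E q) * zeta q powr (- \<theta> / 2)))"
    proof (rule wave_sum_expectation[where T="{1/4..<1}" and B=B and c=c and K=K])
      show "\<eta> q 1 t \<le> E q" for t using C(2) by (simp only: E_def)
      show "t \<in> {1/4..<1}" if "\<eta> q 1 t \<noteq> 0" for t using T[OF that \<open>q1 \<le> q\<close>] by blast
      show "norm (\<integral>\<omega>. cis (\<xi> * (B t \<omega> - B s \<omega>)) \<partial>M) \<le> K * exp (- c * \<xi> powr \<theta> * \<bar>t - s\<bar>)"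
        if "s \<in> {1/4..<1}" "t \<in> {1/4..<1}" "1 \<le> \<xi>" for s t \<xi> by (rule char[OF that])
    qed (rule Bm em eta_props(1)[OF one] eta_props(5)[OF one] eta_props(3)[OF one] c \<theta>0 K zeta_ge(2))+
    then show ?thesis unfolding sE D_def by (simp only: mult_ac)
  qed
  have b2: "(\<integral>\<^sup>+\<omega>. wave_sum (\<lambda>r. \<eta> q 1 (1 - r)) (zeta q) (\<lambda>t. B t \<omega>) \<partial>M) \<le> ennreal (D * ((real q + 1) * zeta q powr (- \<theta> / 2)))"
    if "q1 \<le> q" for q
  proof -
    have T': "t \<in> {1/4..<1}" if "\<eta> q 1 (1 - t) \<noteq> 0" for t using T[OF that \<open>q1 \<le> q\<close>] by simp
    have "(\<integral>\<^sup>+\<omega>. wave_sum (\<lambda>r. \<eta> q 1 (1 - r)) (zeta q) (\<lambda>t. B t \<omega>) \<partial>M)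
      \<le> ennreal (sqrt (2 * K / c) * (\<Sum>n. real (2 * n + 1) powr (- 1 - \<theta> / 2)) * (sqrt (E q) * zeta q powr (- \<theta> / 2)))"
    proof (rule wave_sum_expectation[where T="{1/4..<1}" and B=B and c=c and K=K])
      show "\<eta> q 1 (1 - t) \<le> E q" for t using C(2) by (simp only: E_def)
      show "norm (\<integral>\<omega>. cis (\<xi> * (B t \<omega> - B s \<omega>)) \<partial>M) \<le> K * exp (- c * \<xi> powr \<theta> * \<bar>t - s\<bar>)"
        if "s \<in> {1/4..<1}" "t \<in> {1/4..<1}" "1 \<le> \<xi>" for s t \<xi> by (rule char[OF that])
      show "(\<lambda>r. \<eta> q 1 (1 - r)) \<in> borel_measurable borel" by measurable
    qed (rule Bm eta_props(1)[OF one] revi T' c \<theta>0 K zeta_ge(2) | assumption)+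
    then show ?thesis unfolding sE D_def by (simp only: mult_ac)
  qed
  \<comment> \<open>The net gain: \<theta>/4 from the averaging minus 1 - \<gamma> from dividing by
    \<open>lq q / a q\<close>.\<close>
  define \<mu> where "\<mu> = \<theta> / 4 - (1 - \<gamma>)"
  have \<mu>: "0 < \<mu>" using \<theta> by (simp add: \<mu>_def)
  define s where "s = ((1/4) powr \<delta>) powr \<mu>"
  have s: "0 \<le> s" "s < 1" using quarter_powr[of "\<delta> * \<mu>"] \<delta> \<mu> by (auto simp: s_def powr_powr)
  have decay: "a q / lq q * zeta q powr (- \<theta> / 2) \<le> s ^ q" for q
  proof -
    have "zeta q powr (- \<theta> / 2) \<le> (ratio q powr (- 1/2)) powr (- \<theta> / 2)"
      using zeta_ge[of q] \<theta>0 by (intro powr_mono2') auto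
    also have "\<dots> = ratio q powr (\<theta> / 4)" by (simp add: powr_powr)
    finally have z: "zeta q powr (- \<theta> / 2) \<le> ratio q powr (\<theta> / 4)" .
    have "a q / lq q = ratio q powr (- (1 - \<gamma>))"
      unfolding powr_minus ell_over_a[symmetric] by simp
    then have "a q / lq q * zeta q powr (- \<theta> / 2) \<le> ratio q powr (- (1 - \<gamma>)) * ratio q powr (\<theta> / 4)"
      using z by (simp add: mult_left_mono)
    also have "\<dots> = ratio q powr \<mu>" unfolding powr_add[symmetric] \<mu>_def by (simp add: algebra_simps)
    also have "\<dots> \<le> (((1/4) powr \<delta>) ^ q) powr \<mu>" using ratio_bounds[of q] \<mu> by (intro powr_mono2) (auto simp: less_imp_le)
    also have "\<dots> = s ^ q" by (simp add: s_def powr_powr powr_realpow[symmetric] mult_ac)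
    finally show ?thesis .
  qed
  have wm [measurable]: "(\<lambda>\<omega>. wave_sum e z (\<lambda>t. B t \<omega>)) \<in> borel_measurable M" if [measurable]: "e \<in> borel_measurable borel" for e z
  proof -
    have [measurable]: "(\<lambda>p. B (snd p) (fst p)) \<in> borel_measurable (M \<Otimes>\<^sub>M lborel)"
      using measurable_compose[OF measurable_pair_swap' Bm] by (simp add: split_beta)
    show ?thesis unfolding wave_sum_def by measurable
  qed
  have bm: "(\<lambda>\<omega>. both_waves q (\<lambda>t. B t \<omega>)) \<in> borel_measurable M" for q
    unfolding both_waves_def by measurable
  \<comment> \<open>The index is shifted by \<open>q1\<close> so that the bounds on the means hold
    for every term of the series.\<close>
  define R where "R q \<omega> = ennreal (a (q + q1) / lq (q + q1)) * both_waves (q + q1) (\<lambda>t. B t \<omega>)" for q \<omega>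
  have [measurable]: "R q \<in> borel_measurable M" for q
    unfolding R_def using bm by measurable
  have Rb: "(\<integral>\<^sup>+\<omega>. R q \<omega> \<partial>M) \<le> ennreal (2 * D * ((real (q + q1) + 1) * s ^ (q + q1)))" for q
  proof -
    let ?q = "q + q1"
    have q: "q1 \<le> ?q" by simp
    have al: "0 \<le> a ?q / lq ?q" by (simp add: less_imp_le)
    have x0: "0 \<le> D * ((real ?q + 1) * zeta ?q powr (- \<theta> / 2))" using D0 by simp
    have "(\<integral>\<^sup>+\<omega>. R q \<omega> \<partial>M) = ennreal (a ?q / lq ?q) * ((\<integral>\<^sup>+\<omega>. wave_sum (\<eta> ?q 1) (zeta ?q) (\<lambda>t. B t \<omega>) \<partial>M)
        + (\<integral>\<^sup>+\<omega>. wave_sum (\<lambda>r. \<eta> ?q 1 (1 - r)) (zeta ?q) (\<lambda>t. B t \<omega>) \<partial>M))"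
      unfolding R_def both_waves_def by (subst nn_integral_cmult, measurable, subst nn_integral_add, measurable)
    also have "\<dots> \<le> ennreal (a ?q / lq ?q) * (ennreal (D * ((real ?q + 1) * zeta ?q powr (- \<theta> / 2))) + ennreal (D * ((real ?q + 1) * zeta ?q powr (- \<theta> / 2))))"
      by (intro mult_left_mono add_mono b1[OF q] b2[OF q]) simp
    also have "\<dots> = ennreal (a ?q / lq ?q * (D * ((real ?q + 1) * zeta ?q powr (- \<theta> / 2)) + D * ((real ?q + 1) * zeta ?q powr (- \<theta> / 2))))"
      by (simp only: ennreal_plus[OF x0 x0, symmetric] ennreal_mult[OF al add_nonneg_nonneg[OF x0 x0]])
    also have "\<dots> \<le> ennreal (2 * D * ((real ?q + 1) * s ^ ?q))"
    proof (rule ennreal_leI)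
      have "a ?q / lq ?q * (D * ((real ?q + 1) * zeta ?q powr (- \<theta> / 2)) + D * ((real ?q + 1) * zeta ?q powr (- \<theta> / 2)))
          = 2 * D * (real ?q + 1) * (a ?q / lq ?q * zeta ?q powr (- \<theta> / 2))"
      proof -
        have "A * (D * (n * z) + D * (n * z)) = 2 * D * n * (A * z)" for A n z by (simp add: algebra_simps)
        then show ?thesis .
      qed
      also have "\<dots> \<le> 2 * D * (real ?q + 1) * s ^ ?q" using D0 by (intro mult_left_mono decay) auto
      finally show "a ?q / lq ?q * (D * ((real ?q + 1) * zeta ?q powr (- \<theta> / 2)) + D * ((real ?q + 1) * zeta ?q powr (- \<theta> / 2)))
          \<le> 2 * D * ((real ?q + 1) * s ^ ?q)" by (simp only: mult.assoc)
    qed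
    finally show ?thesis .
  qed
  have sm: "summable (\<lambda>q. 2 * D * ((real (q + q1) + 1) * s ^ (q + q1)))"
    using summable_ignore_initial_segment[OF summable_Suc_power[OF s], of q1] by (intro summable_mult) simp
  have "(\<integral>\<^sup>+\<omega>. (\<Sum>q. R q \<omega>) \<partial>M) = (\<Sum>q. \<integral>\<^sup>+\<omega>. R q \<omega> \<partial>M)"
    by (rule nn_integral_suminf) measurable
  also have "\<dots> \<le> (\<Sum>q. ennreal (2 * D * ((real (q + q1) + 1) * s ^ (q + q1))))"
    by (rule suminf_le[OF Rb]) auto
  also have "\<dots> = ennreal (\<Sum>q. 2 * D * ((real (q + q1) + 1) * s ^ (q + q1)))"
    by (rule suminf_ennreal2[OF _ sm]) (use D0 s in auto)
  finally have le: "(\<integral>\<^sup>+\<omega>. (\<Sum>q. R q \<omega>) \<partial>M) \<le> ennreal (\<Sum>q. 2 * D * ((real (q + q1) + 1) * s ^ (q + q1)))" .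
  have "(\<integral>\<^sup>+\<omega>. (\<Sum>q. R q \<omega>) \<partial>M) < top" by (rule le_less_trans[OF le ennreal_less_top])
  then have "(\<integral>\<^sup>+\<omega>. (\<Sum>q. R q \<omega>) \<partial>M) \<noteq> \<infinity>" by (simp only: infinity_ennreal_def less_top)
  then have "AE \<omega> in M. (\<Sum>q. R q \<omega>) \<noteq> \<infinity>" by (rule nn_integral_PInf_AE[rotated]) measurable
  then show ?thesis
  proof eventually_elim
    case (elim \<omega>)
    then have ne: "(\<Sum>q. R q \<omega>) \<noteq> top" by simp
    have fin: "both_waves q (\<lambda>t. B t \<omega>) \<noteq> top" if "q1 \<le> q" for q
    proof
      assume "both_waves q (\<lambda>t. B t \<omega>) = top"
      then have "R (q - q1) \<omega> = ennreal (a q / lq q) * top" using that by (simp add: R_def)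
      moreover have "ennreal (a q / lq q) \<noteq> 0" unfolding ennreal_eq_0_iff not_le by simp
      ultimately have "R (q - q1) \<omega> = top" by (simp only: ennreal_mult_top if_False)
      moreover have "ennreal (enn2real (R (q - q1) \<omega>)) = R (q - q1) \<omega>" by (rule suminf_ennreal_tendsto_0(2)[OF ne])
      ultimately show False by (metis ennreal_neq_top)
    qed
    have "(\<lambda>q. enn2real (R q \<omega>)) \<longlonglongrightarrow> 0" by (rule suminf_ennreal_tendsto_0(1)[OF ne])
    moreover have "enn2real (R q \<omega>) = a (q + q1) / lq (q + q1) * enn2real (both_waves (q + q1) (\<lambda>t. B t \<omega>))" for q
      by (simp add: R_def enn2real_mult less_imp_le)
    ultimately have "(\<lambda>q. a (q + q1) / lq (q + q1) * enn2real (both_waves (q + q1) (\<lambda>t. B t \<omega>))) \<longlonglongrightarrow> 0" by simp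
    then have "(\<lambda>q. a q / lq q * enn2real (both_waves q (\<lambda>t. B t \<omega>))) \<longlonglongrightarrow> 0"
      by (rule LIMSEQ_offset[of _ q1])
    then show ?case using fin by blast
  qed
qed

lemma eventually_small: "\<exists>j1. \<forall>j\<ge>j1. 3 * a (Suc (Suc j)) \<le> lq (Suc j)"
proof -
  have "(\<lambda>q. a (Suc q) / lq q) \<longlonglongrightarrow> 0"
    unfolding ell_over_a by (rule ratio_powr_tendsto_0) (use \<gamma> in simp)
  then have "eventually (\<lambda>q. a (Suc q) / lq q < 1/3) sequentially"
    by (rule order_tendstoD(2)) simp
  then obtain q1 where q1: "\<And>q. q1 \<le> q \<Longrightarrow> a (Suc q) / lq q < 1/3"
    unfolding eventually_sequentially by blast
  have "3 * a (Suc (Suc j)) \<le> lq (Suc j)" if "q1 \<le> j" for j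
  proof -
    have "q1 \<le> Suc j" using that by simp
    from q1[OF this] show ?thesis by (simp add: pos_divide_less_eq)
  qed
  then show ?thesis by blast
qed

text \<open>Every contribution to the error is o(\<open>lq q\<close>): noise, averaged shear and the
  motion beyond stage \<open>q\<close>. Eventually the error is below 3 \<open>lq q\<close>, as
  \<open>endpoint\<close> requires, and the remaining factors depend on the fixed stage
  \<open>j2\<close> only.\<close>

lemma endpoint_limit:
  fixes w :: "real \<Rightarrow> real^2" and B :: "real \<Rightarrow> real" and X :: "real \<Rightarrow> real \<Rightarrow> real^2"
  assumes good: "\<And>j. j0 \<le> j \<Longrightarrow> good j (x $ 1, x $ 2)"
    and path: "\<And>q t. t \<in> {0..1} \<Longrightarrow> set_integrable lborel {0..t} (\<lambda>r. velocity \<gamma> \<rho> \<eta> a \<phi> r (X (kap q) r))"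
      "\<And>q t. t \<in> {0..1} \<Longrightarrow> X (kap q) t = x + (LINT r:{0..t}|lborel. velocity \<gamma> \<rho> \<eta> a \<phi> r (X (kap q) r)) + kap q *\<^sub>R w t"
    and w: "\<And>t. t \<in> {0..1} \<Longrightarrow> norm (w t) \<le> K"
    and B: "B \<in> borel_measurable borel" "\<And>t. t \<in> {0..<1} \<Longrightarrow> w t $ 2 = B t"
    and lim: "(\<lambda>q. a q / lq q * enn2real (both_waves q B)) \<longlonglongrightarrow> 0"
    and fin: "\<And>q. q1 \<le> q \<Longrightarrow> both_waves q B \<noteq> top"
  shows "(\<lambda>q. X (kap q) 1 - vec2 (ret q (x $ 1, x $ 2) 0)) \<longlonglongrightarrow> 0"
proof -
  have K: "0 \<le> K" using w[of 0] norm_ge_zero[of "w 0"] by (simp del: norm_ge_zero)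
  obtain j1 where j1: "\<And>j. j1 \<le> j \<Longrightarrow> 3 * a (Suc (Suc j)) \<le> lq (Suc j)" using eventually_small by blast
  define j2 where "j2 = max j0 j1"
  define A where "A q = 2 / pi * a q * enn2real (both_waves q B)" for q
  define E where "E q = Cf j2 * (kap q * K) + 2 * A q + 5 * a (Suc q) + kap q * K" for q
  have A0: "0 \<le> A q" for q by (simp add: A_def)
  have "(\<lambda>q. Cf j2 * K * (kap q / lq q) + 4 / pi * (a q / lq q * enn2real (both_waves q B))
      + 5 * (ratio q powr \<gamma>) + K * (kap q / lq q)) \<longlonglongrightarrow> Cf j2 * K * 0 + 4 / pi * 0 + 5 * 0 + K * 0"
    using \<gamma> by (intro tendsto_intros lim kap_over_ell ratio_powr_tendsto_0) simp
  moreover have "Cf j2 * K * (kap q / lq q) + 4 / pi * (a q / lq q * enn2real (both_waves q B))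
      + 5 * (ratio q powr \<gamma>) + K * (kap q / lq q) = E q / lq q" for q
    unfolding ell_over_a[symmetric] E_def A_def by (simp add: add_divide_distrib mult_ac)
  ultimately have E_ell: "(\<lambda>q. E q / lq q) \<longlonglongrightarrow> 0" by simp
  have l0: "lq \<longlonglongrightarrow> 0"
  proof (rule tendsto_sandwich[OF _ _ tendsto_const])
    show "(\<lambda>q. (1/4::real) ^ q) \<longlonglongrightarrow> 0" by (rule LIMSEQ_power_zero) simp
    show "\<forall>\<^sub>F q in sequentially. lq q \<le> (1/4) ^ q"
      by (rule always_eventually) (rule allI, rule order_trans[OF ell_bounds(2) a_le_power])
    show "\<forall>\<^sub>F q in sequentially. 0 \<le> lq q"
      by (rule always_eventually) (rule allI, rule less_imp_le[OF ell_pos])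
  qed
  have "(\<lambda>q. E q / lq q * lq q) \<longlonglongrightarrow> 0 * 0" by (rule tendsto_mult[OF E_ell l0])
  moreover have "E q / lq q * lq q = E q" for q using less_imp_neq[OF ell_pos[of q]] by simp
  ultimately have E0: "E \<longlonglongrightarrow> 0" by simp
  have kap0: "kap \<longlonglongrightarrow> 0"
  proof -
    have "(\<lambda>q. kap q / lq q * lq q) \<longlonglongrightarrow> 0 * 0" by (rule tendsto_mult[OF kap_over_ell l0])
    moreover have "kap q / lq q * lq q = kap q" for q using less_imp_neq[OF ell_pos[of q]] by simp
    ultimately show ?thesis by simp
  qed
  define G where "G q = Cb j2 * E q + kap q * K" for q
  have G0: "G \<longlonglongrightarrow> 0"
  proof -
    have "(\<lambda>q. Cb j2 * E q + kap q * K) \<longlonglongrightarrow> Cb j2 * 0 + 0 * K" by (intro tendsto_intros E0 kap0)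
    then show ?thesis by (simp add: G_def[abs_def])
  qed
  have near: "\<bar>(X (kap q) 1 - vec2 (ret q (x $ 1, x $ 2) 0)) $ i\<bar> \<le> G q"
    if q: "j2 < q" "q1 \<le> q" and Eq: "E q / lq q < 3" for q i
  proof -
    have wi: "\<bar>kap q * w r $ i\<bar> \<le> kap q * K" if "r \<in> {0..1}" for r i
    proof -
      have "\<bar>w r $ i\<bar> \<le> K" using component_le_norm_cart[of "w r" i] w[OF that] by linarith
      then show ?thesis by (simp add: abs_mult mult_left_mono less_imp_le)
    qed
    interpret bounded_path \<delta> \<gamma> \<rho> \<eta> a \<phi> "kap q" w "X (kap q)" x "kap q * K"
      by unfold_locales (use path wi in blast)+
    obtain q' where q': "q = Suc q'" "j2 \<le> q'" using q by (cases q) auto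
    have "good q' p0" by (rule good) (use q' in \<open>simp add: j2_def\<close>)
    then have off: "grid_off (a q) (5 * lq q) (snd (fwd q p0))" unfolding q'(1) by (rule good_off_next)
    have tq0: "0 < tq q" using tq_less[of 0 q] q by (simp del: tq.simps(2))
    have Z0: "0 \<le> enn2real (both_waves q B)" by simp
    have both: "both_waves q B = ennreal (enn2real (both_waves q B))" using fin[OF q(2)] by (simp add: less_top)
    have W1: "wave_sum (\<eta> q 1) (pi * kap q / a (Suc q)) B \<le> ennreal (enn2real (both_waves q B))"
      unfolding both[symmetric] unfolding both_waves_def zeta_def by (simp add: le_iff_add)
    have W2: "wave_sum (\<lambda>r. \<eta> q 1 (1 - r)) (pi * kap q / a (Suc q)) B \<le> ennreal (enn2real (both_waves q B))"
      unfolding both[symmetric] unfolding both_waves_def zeta_def by (subst add.commute) (simp add: le_iff_add)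
    have one: "(1::nat) \<in> {1,2,3}" by simp
    have revi: "integrable lborel (\<lambda>r. \<eta> q 1 (1 - r))"
      using lborel_integrable_real_affine[OF eta_props(5)[OF one, of q], of "-1" 1] by simp
    have t01: "0 \<le> tau q 0" "tau q 1 < 1/2" "0 < tau q 0"
      using tau_01[of 0 q] tau_01[of 1 q] tq0 by (auto simp: tau_ends)
    have "near (Cb j2 * (Cf j2 * (kap q * K) + 2 * A q + 5 * a (Suc q) + kap q * K) + kap q * K) (X (kap q) 1) (ret q p0 0)"
    proof (rule endpoint)
      show "good j p0" if "j2 \<le> j" "j < q" for j by (rule good) (use that in \<open>simp add: j2_def\<close>)
      show "3 * a (Suc (Suc j)) \<le> lq (Suc j)" if "j2 \<le> j" for j by (rule j1) (use that in \<open>simp add: j2_def\<close>)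
      show "Cf j2 * (kap q * K) + 2 * A q + 5 * a (Suc q) + kap q * K < 3 * lq q"
        using Eq by (simp add: pos_divide_less_eq E_def)
      fix c assume c: "\<And>t. t \<in> {0..1} \<Longrightarrow> \<bar>c + kap q * w t $ 2 - snd (fwd q p0)\<bar> + lq (Suc q) < 5 * lq q"
      have "\<bar>integral {tau q 0..tau q 1} (\<lambda>r. \<eta> q 1 r * g1 q (c + kap q * w r $ 2))\<bar> \<le> A q"
        unfolding A_def
      proof (rule averaged_shear[where B=B and w="\<lambda>t. w t $ 2", OF off c eta_props(5)[OF one] _ _ B W1 Z0])
        show "t \<in> {tau q 0..tau q 1}" if "\<eta> q 1 t \<noteq> 0" for t
          using eta_props(2)[OF one that] unfolding J_tau by simp
        show "{tau q 0..tau q 1} \<subseteq> {0..<1}" using t01 by auto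
      qed
      moreover have "\<bar>integral {1 - tau q 1..1 - tau q 0} (\<lambda>r. \<eta> q 1 (1 - r) * g1 q (c + kap q * w r $ 2))\<bar> \<le> A q"
        unfolding A_def
      proof (rule averaged_shear[where B=B and w="\<lambda>t. w t $ 2", OF off c revi _ _ B W2 Z0])
        show "t \<in> {1 - tau q 1..1 - tau q 0}" if "\<eta> q 1 (1 - t) \<noteq> 0" for t
          using eta_props(2)[OF one that] unfolding J_tau by simp
        show "{1 - tau q 1..1 - tau q 0} \<subseteq> {0..<1}" using t01 by auto
      qed
      ultimately show "\<bar>integral {tau q 0..tau q 1} (\<lambda>r. \<eta> q 1 r * g1 q (c + kap q * w r $ 2))\<bar> \<le> A q \<and>
        \<bar>integral {1 - tau q 1..1 - tau q 0} (\<lambda>r. \<eta> q 1 (1 - r) * g1 q (c + kap q * w r $ 2))\<bar> \<le> A q" by (rule conjI)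
    qed (rule q(1) A0)+
    then have n: "\<bar>X (kap q) 1 $ 1 - fst (ret q p0 0)\<bar> \<le> G q" "\<bar>X (kap q) 1 $ 2 - snd (ret q p0 0)\<bar> \<le> G q"
      by (simp_all add: near_def G_def E_def)
    show ?thesis using exhaust_2[of i] n by auto
  qed
  have "eventually (\<lambda>q. E q / lq q < 3) sequentially" by (rule order_tendstoD(2)[OF E_ell]) simp
  then have ev: "eventually (\<lambda>q. \<forall>i. \<bar>(X (kap q) 1 - vec2 (ret q (x $ 1, x $ 2) 0)) $ i\<bar> \<le> G q) sequentially"
    using eventually_gt_at_top[of j2] eventually_ge_at_top[of q1]
  proof eventually_elim
    case (elim q)
    then show ?case using near[of q] by blast
  qed
  show ?thesis
  proof (rule vec_tendstoI)
    fix i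
    have "(\<lambda>q. (X (kap q) 1 - vec2 (ret q (x $ 1, x $ 2) 0)) $ i) \<longlonglongrightarrow> 0"
    proof (rule Lim_null_comparison[OF _ G0])
      show "eventually (\<lambda>q. norm ((X (kap q) 1 - vec2 (ret q (x $ 1, x $ 2) 0)) $ i) \<le> G q) sequentially"
        using ev by eventually_elim simp
    qed
    then show "(\<lambda>q. (X (kap q) 1 - vec2 (ret q (x $ 1, x $ 2) 0)) $ i) \<longlonglongrightarrow> (0::real^2) $ i" by simp
  qed
qed

end

section \<open>Convergence of the variance for almost every starting point\<close>

theorem corollary6p2:
  fixes M :: "'w measure" and W :: "real \<Rightarrow> 'w \<Rightarrow> real^2" and N :: noise
    and \<alpha> \<gamma> :: real and \<rho> :: "real \<Rightarrow> real" and \<eta> :: "nat \<Rightarrow> nat \<Rightarrow> real \<Rightarrow> real"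
  assumes "prob_space M"
    and "valid_noise N" and "is_noise M N W"
    and "alpha_W N < \<alpha>" and "\<alpha> < 1"
    and "admissible_gamma N \<gamma>"
    and "mollifier \<rho>" and "time_cutoffs \<eta>"
  shows "\<exists>\<delta>0>0. \<forall>\<delta>. 0 < \<delta> \<and> \<delta> < \<delta>0 \<and> \<delta> < 1/100 \<longrightarrow>
    (\<exists>a_max>0. \<forall>(a :: nat \<Rightarrow> real) (\<phi> :: nat \<Rightarrow> real \<Rightarrow> real) (u :: real \<Rightarrow> real^2 \<Rightarrow> real^2)
        (X :: real \<Rightarrow> real \<Rightarrow> real^2 \<Rightarrow> 'w \<Rightarrow> real^2) (f :: real^2 \<Rightarrow> real).
      a 0 < a_max \<and> scale_sequence \<delta> \<gamma> a \<and>
      (\<forall>q. zigzag (a q) (a (Suc q)) (\<phi> (Suc q))) \<and>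
      u = velocity \<gamma> \<rho> \<eta> a \<phi> \<and> holder_field \<alpha> u \<and>
      (\<forall>\<kappa>>0. stochastic_flow M W u \<kappa> (X \<kappa>)) \<and>
      continuous_on UNIV f \<and> torus_periodic f
      \<longrightarrow> (AE x in lborel. x \<in> cbox 0 1 \<longrightarrow>
            (\<lambda>q. prob_space.variance M (\<lambda>\<omega>. f (X (kappa a q) 1 x \<omega>))) \<longlonglongrightarrow> 0))"
proof -
  interpret prob_space M by (rule assms(1))
  obtain \<theta> K c where c: "0 < c" and \<theta>: "4 * (1 - \<gamma>) < \<theta>"
    and char: "\<forall>s\<in>{1/4..1}. \<forall>t\<in>{1/4..1}. \<forall>\<xi>\<ge>1.
      norm (\<integral>\<omega>. cis (\<xi> * (W t \<omega> $ 2 - W s \<omega> $ 2)) \<partial>M) \<le> K * exp (- c * \<xi> powr \<theta> * \<bar>t - s\<bar>)"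
    using noise_increment_char[OF assms(2,3,6)] by (elim exE conjE)
  have "1/2 < \<gamma> \<and> \<gamma> < 1"
  proof (cases N)
    case (FBM H)
    show ?thesis using assms(6) unfolding FBM admissible_gamma.simps max_less_iff_conj by (simp only: split: if_splits)
  next
    case (Stable \<beta>)
    show ?thesis using assms(6) unfolding Stable admissible_gamma.simps by simp
  qed
  then have \<gamma>: "1/2 < \<gamma>" "\<gamma> < 1" by (rule conjunct1, rule conjunct2)
  note Wm = noise_paths(1)[OF assms(3)]
  note paths = noise_paths(2)[OF assms(3)]
  have rc: "AE \<omega> in M. \<forall>t\<in>{0..<1}. continuous (at_right t) (\<lambda>s. W s \<omega> $ 2)"
    using paths by eventually_elim (rule conjunct2)
  have "\<exists>B. (\<lambda>p. B (fst p) (snd p)) \<in> borel_measurable (lborel \<Otimes>\<^sub>M M) \<and>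
      (AE \<omega> in M. \<forall>t\<in>{0..<1}. B t \<omega> = W t \<omega> $ 2)"
    by (rule jointly_measurable_version[OF Wm rc])
  then obtain B where Bm: "(\<lambda>p. B (fst p) (snd p)) \<in> borel_measurable (lborel \<Otimes>\<^sub>M M)"
    and BW: "AE \<omega> in M. \<forall>t\<in>{0..<1}. B t \<omega> = W t \<omega> $ 2"
    by (elim exE conjE)
  have Bt: "B t \<in> borel_measurable M" for t
    using measurable_compose[OF measurable_Pair1'[of t lborel M] Bm] by simp
  \<comment> \<open>The decay passes to the version \<open>B\<close>, which equals the noise for
    times below 1. The absolute value of K meets the sign condition of
    \<open>waves_negligible\<close>.\<close>
  have charB: "norm (\<integral>\<omega>. cis (\<xi> * (B t \<omega> - B s \<omega>)) \<partial>M) \<le> \<bar>K\<bar> * exp (- c * \<xi> powr \<theta> * \<bar>t - s\<bar>)"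
    if st: "s \<in> {1/4..<1}" "t \<in> {1/4..<1}" and \<xi>: "1 \<le> \<xi>" for s t \<xi> :: real
  proof -
    have [measurable]: "B t \<in> borel_measurable M" "B s \<in> borel_measurable M"
      "(\<lambda>\<omega>. W t \<omega> $ 2) \<in> borel_measurable M" "(\<lambda>\<omega>. W s \<omega> $ 2) \<in> borel_measurable M"
      using Bt Wm[of t] Wm[of s] st by auto
    have "(\<integral>\<omega>. cis (\<xi> * (B t \<omega> - B s \<omega>)) \<partial>M) = (\<integral>\<omega>. cis (\<xi> * (W t \<omega> $ 2 - W s \<omega> $ 2)) \<partial>M)"
    proof (rule integral_cong_AE)
      show "(\<lambda>\<omega>. cis (\<xi> * (B t \<omega> - B s \<omega>))) \<in> borel_measurable M"
        "(\<lambda>\<omega>. cis (\<xi> * (W t \<omega> $ 2 - W s \<omega> $ 2))) \<in> borel_measurable M"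
        by (rule measurable_compose[OF _ borel_measurable_cis], measurable)+
      show "AE \<omega> in M. cis (\<xi> * (B t \<omega> - B s \<omega>)) = cis (\<xi> * (W t \<omega> $ 2 - W s \<omega> $ 2))"
        using BW
      proof eventually_elim
        case (elim \<omega>)
        then have "B t \<omega> = W t \<omega> $ 2" "B s \<omega> = W s \<omega> $ 2" using st by auto
        then show ?case by simp
      qed
    qed
    then have "norm (\<integral>\<omega>. cis (\<xi> * (B t \<omega> - B s \<omega>)) \<partial>M) \<le> K * exp (- c * \<xi> powr \<theta> * \<bar>t - s\<bar>)"
      using char st \<xi> by simp
    also have "\<dots> \<le> \<bar>K\<bar> * exp (- c * \<xi> powr \<theta> * \<bar>t - s\<bar>)" by (rule mult_right_mono) simp_all
    finally show ?thesis .
  qed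
  have main: "AE x in lborel. x \<in> cbox 0 1 \<longrightarrow> (\<lambda>q. variance (\<lambda>\<omega>. f (X (kappa a q) 1 x \<omega>))) \<longlonglongrightarrow> 0"
    if \<delta>: "0 < \<delta>" and scale: "scale_sequence \<delta> \<gamma> a" and zz: "\<forall>q. zigzag (a q) (a (Suc q)) (\<phi> (Suc q))"
      and flow: "\<forall>\<kappa>>0. stochastic_flow M W (velocity \<gamma> \<rho> \<eta> a \<phi>) \<kappa> (X \<kappa>)"
      and f: "continuous_on UNIV f" "torus_periodic f"
    for \<delta> a \<phi> X and f :: "real^2 \<Rightarrow> real"
  proof -
    interpret cascade \<delta> \<gamma> \<rho> \<eta> a \<phi>
      by unfold_locales (use \<delta> \<gamma> scale assms(7,8) zz in auto)
    \<comment> \<open>This null set does not depend on the starting point, while the set of good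
      starting points does not depend on the noise.\<close>
    have waves: "AE \<omega> in M. (\<lambda>q. a q / lq q * enn2real (both_waves q (\<lambda>t. B t \<omega>))) \<longlonglongrightarrow> 0 \<and>
        (\<exists>q1. \<forall>q\<ge>q1. both_waves q (\<lambda>t. B t \<omega>) \<noteq> top)"
      by (rule waves_negligible[OF assms(1) Bm charB c \<theta>]) simp_all
    note flow_q = flow[rule_format, OF kap_pos, unfolded stochastic_flow_def]
    have Xm: "X (kap q) 1 x \<in> borel_measurable M" for q x
      using conjunct1[OF flow_q[of q]] by simp
    have flow_AE: "AE \<omega> in M. \<forall>q. \<forall>t\<in>{0..1}. \<forall>x. set_integrable lborel {0..t} (\<lambda>r. u r (X (kap q) r x \<omega>)) \<and>
        X (kap q) t x \<omega> = x + (LINT r:{0..t}|lborel. u r (X (kap q) r x \<omega>)) + kap q *\<^sub>R W t \<omega>"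
    \<comment> \<open>Only the countably many intensities \<open>kap q\<close> occur, so one null
      set serves them all.\<close>
    proof (subst AE_all_countable, rule allI)
      fix q
      show "AE \<omega> in M. \<forall>t\<in>{0..1}. \<forall>x. set_integrable lborel {0..t} (\<lambda>r. u r (X (kap q) r x \<omega>)) \<and>
        X (kap q) t x \<omega> = x + (LINT r:{0..t}|lborel. u r (X (kap q) r x \<omega>)) + kap q *\<^sub>R W t \<omega>"
        using conjunct2[OF flow_q[of q]] by eventually_elim blast
    qed
    obtain b where b: "\<And>x. \<bar>f x\<bar> \<le> b" using torus_continuous(1)[OF f] by blast
    have uc: "uniformly_continuous_on UNIV f" by (rule torus_continuous(2)[OF f])
    have fm: "f \<in> borel_measurable borel" by (rule borel_measurable_continuous_onI[OF f(1)])
    have concl: "(\<lambda>q. variance (\<lambda>\<omega>. f (X (kap q) 1 x \<omega>))) \<longlonglongrightarrow> 0"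
      if good: "\<And>j. j0 \<le> j \<Longrightarrow> good j (x $ 1, x $ 2)" for x j0
    proof (rule variance_tendsto_0[where c="\<lambda>q. f (vec2 (ret q (x $ 1, x $ 2) 0))"])
      show "(\<lambda>\<omega>. f (X (kap q) 1 x \<omega>)) \<in> borel_measurable M" for q by (rule measurable_compose[OF Xm fm])
      show "AE \<omega> in M. (\<lambda>q. f (X (kap q) 1 x \<omega>) - f (vec2 (ret q (x $ 1, x $ 2) 0))) \<longlonglongrightarrow> 0"
        using waves flow_AE paths BW AE_space
      proof eventually_elim
        case (elim \<omega>)
        obtain K where K: "\<And>t. t \<in> {0..1} \<Longrightarrow> norm (W t \<omega>) \<le> K" using elim(3) by blast
        obtain q1 where q1: "\<And>q. q1 \<le> q \<Longrightarrow> both_waves q (\<lambda>t. B t \<omega>) \<noteq> top" using elim(1) by blast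
        have "(\<lambda>q. X (kap q) 1 x \<omega> - vec2 (ret q (x $ 1, x $ 2) 0)) \<longlonglongrightarrow> 0"
        proof (rule endpoint_limit[where w="\<lambda>t. W t \<omega>" and B="\<lambda>t. B t \<omega>" and X="\<lambda>\<kappa> t. X \<kappa> t x \<omega>", OF good])
          show "set_integrable lborel {0..t} (\<lambda>r. u r (X (kap q) r x \<omega>))"
            "X (kap q) t x \<omega> = x + (LINT r:{0..t}|lborel. u r (X (kap q) r x \<omega>)) + kap q *\<^sub>R W t \<omega>"
            if "t \<in> {0..1}" for q t
            using elim(2)[rule_format, OF that] by blast+
          show "(\<lambda>t. B t \<omega>) \<in> borel_measurable borel"
            using measurable_compose[OF measurable_Pair2'[OF elim(5)] Bm] by simp
        qed (use K q1 elim in auto)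
        \<comment> \<open>The endpoints of the return orbits may move with \<open>q\<close> without
          converging, so continuity of \<open>f\<close> at one point is not enough; uniform
          continuity compares the values along both sequences.\<close>
        then have "(\<lambda>q. dist (X (kap q) 1 x \<omega>) (vec2 (ret q (x $ 1, x $ 2) 0))) \<longlonglongrightarrow> 0"
          unfolding dist_norm by (rule tendsto_norm_zero)
        then have "(\<lambda>q. dist (f (X (kap q) 1 x \<omega>)) (f (vec2 (ret q (x $ 1, x $ 2) 0)))) \<longlonglongrightarrow> 0"
          using uc unfolding uniformly_continuous_on_sequentially by simp
        then show ?case unfolding dist_norm by (rule tendsto_norm_zero_cancel)
      qed
    qed (rule b)+
    show ?thesis
      using ae_good
    proof eventually_elim
      case (elim x)
      then show ?case using concl by blast
    qed
  qed
  show ?thesis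
    \<comment> \<open>The quantitative smallness used by the argument is contained in
      \<open>scale_sequence\<close>, so 1 serves as both thresholds.\<close>
    by (rule exI[of _ 1], rule conjI, simp, intro allI impI, rule exI[of _ 1], rule conjI, simp, intro allI impI)
      (elim conjE, hypsubst, rule main)
qed

end
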